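(* Let $\lambda,T>0$ and let $\mu$ be a symmetric minimizer of $\mathcal{E}_{\lambda,T}$, i.e. a minimizer with $\mu_{-t}=\mu_t$ for $t\in[0,T]$. If $\beta\in(0,1)$ is such that \[ \limsup_{\varepsilon\to0^+}\frac{I(\mu,\varepsilon)}{\varepsilon^\beta}<\infty, \] then \[ \frac{1+3\beta}{1+\beta}\le \underline{\dim}\,\mu_T\le\overline{\dim}\,\mu_T\le\frac{4(1-\beta)}{1+\beta}. \]
   Context: Let $Q=(\mathbb{R}/\mathbb{Z})^2$ and $Q_T=(-T,T)\times Q$. Let $\mathcal{A}_T^*$ be the set of finite positive measures $\mu$ on $Q_T$ of the form $\mu=dt\otimes\mu_t$ such that for a.e. $t\in(-T,T)$, $\mu_t=\sum_i\phi_i\delta_{X_i}$ (at most countable sum, $\phi_i>0$, $X_i\in Q$ distinct), and for which there is a finite $\mathbb{R}^2$-valued measure $m\ll\mu$ on $Q_T$ with $\partial_t\mu+\nabla\cdot m=0$ in the sense of distributions ($\nabla$ acts on the $Q$ variable). For $-T\le a<b\le T$ set \[ I(\mu,(a,b))=\min_m\Big\{\int_a^b\sum_{x\in Q}\mu_t(\{x\})^{1/2}\,dt+\int_{(a,b)\times Q}\Big|\frac{dm}{d\mu}\Big|^2d\mu\Big\}, \] the minimum being over all such $m$; $I(\mu)=I(\mu,(-T,T))$ and $I(\mu,\varepsilon)=I(\mu,(T-\varepsilon,T))$ for $\varepsilon\in(0,T)$. If $I(\mu)<\infty$, $t\mapsto\mu_t$ is $1/2$-Hölder continuous in the Wasserstein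 distance, so the traces $\mu_{\pm T}$ are well defined. For a measure $\sigma$ on $Q$ with Fourier coefficients $\widehat\sigma_k$, $k\in\mathbb{Z}^2$, and $\gamma>0$: $\|\sigma\|_{H^{-\gamma}}^2=\sum_{k}|k|^{-2\gamma}|\widehat\sigma_k|^2$ (finiteness forces $\widehat\sigma_0=\sigma(Q)=0$). The energy is $\mathcal{E}_{\lambda,T}(\mu)=I(\mu)+\lambda\|\mu_{-T}-1\|_{H^{-1/2}}^2+\lambda\|\mu_T-1\|_{H^{-1/2}}^2$ for $\mu\in\mathcal{A}_T^*$ with $\mu_t(Q)=1$, where $1$ denotes Lebesgue measure on $Q$. Dimensions of a positive measure $\sigma$ on $Q$: $\underline{\dim}\,\sigma=\inf\{\dim A:\sigma(A)>0\}$ and $\overline{\dim}\,\sigma=\inf\{\dim A:\sigma(Q\setminus A)=0\}$, where $A$ ranges over (Borel) subsets of $Q$ and $\dim A$ is the Hausdorff dimension. *)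

theory Defs
  imports "HOL-Analysis.Analysis"
begin

section \<open>The flat torus\<close>

quotient_type torus = "real^2" / "\<lambda>x y. \<forall>i. x $ i - y $ i \<in> \<int>"
proof (rule equivpI)
  show "reflp (\<lambda>x y::real^2. \<forall>i. x $ i - y $ i \<in> \<int>)"
    by (simp add: reflp_def)
  show "symp (\<lambda>x y::real^2. \<forall>i. x $ i - y $ i \<in> \<int>)"
    by (rule sympI) (metis Ints_minus minus_diff_eq)
  show "transp (\<lambda>x y::real^2. \<forall>i. x $ i - y $ i \<in> \<int>)"
  proof (rule transpI, intro allI)
    fix x y z :: "real^2" and i
    assume "\<forall>i. x $ i - y $ i \<in> \<int>" "\<forall>i. y $ i - z $ i \<in> \<int>"
    then have "(x $ i - y $ i) + (y $ i - z $ i) \<in> \<int>" by (meson Ints_add)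
    then show "x $ i - z $ i \<in> \<int>" by simp
  qed
qed

definition torus_coset :: "torus \<Rightarrow> (real^2) set"
  where "torus_coset p = {x. abs_torus x = p}"

lemma abs_torus_eq_iff: "abs_torus x = abs_torus y \<longleftrightarrow> (\<forall>i. x $ i - y $ i \<in> \<int>)"
  by (simp add: torus.abs_eq_iff)

lemma abs_torus_rep: "abs_torus (rep_torus p) = p"
  by (rule Quotient_abs_rep[OF Quotient_torus])

lemma torus_coset_nonempty: "torus_coset p \<noteq> {}"
  using abs_torus_rep[of p] by (auto simp: torus_coset_def)

lemma closed_torus_coset: "closed (torus_coset p)"
proof -
  have "torus_coset p = (\<Inter>i. (\<lambda>x. x $ i - rep_torus p $ i) -` \<int>)"
    using abs_torus_eq_iff[of _ "rep_torus p"] by (auto simp: torus_coset_def abs_torus_rep)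
  also have "closed \<dots>"
    by (intro closed_INT ballI closed_vimage closed_Ints continuous_intros)
  finally show ?thesis .
qed

text \<open>The distance is the quotient distance, i.e. the minimal Euclidean distance of representatives.\<close>

instantiation torus :: metric_space
begin

definition dist_torus :: "torus \<Rightarrow> torus \<Rightarrow> real"
  where "dist_torus p q = setdist (torus_coset p) (torus_coset q)"

definition uniformity_torus :: "(torus \<times> torus) filter"
  where "uniformity_torus = (INF e\<in>{0<..}. principal {(x, y). dist x y < e})"

definition open_torus :: "torus set \<Rightarrow> bool"
  where "open_torus U \<longleftrightarrow>
    (\<forall>x\<in>U. eventually (\<lambda>(x', y). x' = x \<longrightarrow> y \<in> U) uniformity)"

lemma dist_torus_infdist:
  assumes "x \<in> torus_coset p"
  shows "dist p q = infdist x (torus_coset q)"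
proof (rule antisym)
  show "dist p q \<le> infdist x (torus_coset q)"
    unfolding dist_torus_def infdist_eq_setdist
    using assms by (intro setdist_subset_left) auto
  show "infdist x (torus_coset q) \<le> dist p q"
    unfolding dist_torus_def
  proof (rule le_setdistI)
    show "torus_coset p \<noteq> {}" "torus_coset q \<noteq> {}" by (rule torus_coset_nonempty)+
    fix y z assume yz: "y \<in> torus_coset p" "z \<in> torus_coset q"
    have "\<forall>i. (z + (x - y)) $ i - z $ i \<in> \<int>"
      using yz assms abs_torus_eq_iff[of x y] by (simp add: torus_coset_def)
    then have "z + (x - y) \<in> torus_coset q"
      using yz abs_torus_eq_iff[of "z + (x - y)" z] by (simp add: torus_coset_def)
    then have "infdist x (torus_coset q) \<le> dist x (z + (x - y))" by (rule infdist_le)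
    also have "\<dots> = dist y z" by (simp add: dist_norm)
    finally show "infdist x (torus_coset q) \<le> dist y z" .
  qed
qed

instance
proof
  fix p q r :: torus
  obtain x where x: "x \<in> torus_coset p" using torus_coset_nonempty by blast
  have "dist p q = 0 \<longleftrightarrow> x \<in> torus_coset q"
    using in_closed_iff_infdist_zero[OF closed_torus_coset torus_coset_nonempty]
    by (simp add: dist_torus_infdist[OF x])
  also have "\<dots> \<longleftrightarrow> p = q" using x by (auto simp: torus_coset_def)
  finally show "dist p q = 0 \<longleftrightarrow> p = q" .
  have *: "dist p q - dist r q \<le> dist x y" if "y \<in> torus_coset r" for y
    using infdist_triangle[of x "torus_coset q" y]
    by (simp add: dist_torus_infdist[OF x] dist_torus_infdist[OF that])
  have "dist p q - dist r q \<le> infdist x (torus_coset r)"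
    unfolding infdist_notempty[OF torus_coset_nonempty]
    by (intro cINF_greatest torus_coset_nonempty *)
  then have "dist p q \<le> dist p r + dist r q"
    by (simp add: dist_torus_infdist[OF x])
  also have "dist r q = dist q r" by (simp add: dist_torus_def setdist_sym)
  finally show "dist p q \<le> dist p r + dist q r" .
qed (simp_all add: uniformity_torus_def open_torus_def)

end

definition torus_lebesgue :: "torus measure"
  where "torus_lebesgue = distr (restrict_space lborel (cbox 0 1)) borel abs_torus"


section \<open>Hausdorff dimension\<close>

text \<open>Only covers by bounded sets are admitted because \<open>diameter\<close> is meaningless on unbounded
  sets. The case distinction implements the convention that in dimension zero every nonempty set
  has weight one (note that \<open>0 powr 0 = 0\<close>). The usual normalising constant is omitted.\<close>

definition diam_weight :: "real \<Rightarrow> 'a::metric_space set \<Rightarrow> ennreal"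
  where "diam_weight s U =
    (if U = {} then 0 else if s = 0 then 1 else ennreal (diameter U powr s))"

definition hausdorff_premeasure :: "real \<Rightarrow> real \<Rightarrow> 'a::metric_space set \<Rightarrow> ennreal"
  where "hausdorff_premeasure s \<delta> A =
    (INF U\<in>{U :: nat \<Rightarrow> 'a set. A \<subseteq> (\<Union>i. U i) \<and> (\<forall>i. bounded (U i) \<and> diameter (U i) \<le> \<delta>)}.
       \<Sum>i. diam_weight s (U i))"

definition hausdorff_measure :: "real \<Rightarrow> 'a::metric_space set \<Rightarrow> ennreal"
  where "hausdorff_measure s A = (SUP \<delta>\<in>{0<..}. hausdorff_premeasure s \<delta> A)"

definition hausdorff_dim :: "'a::metric_space set \<Rightarrow> ereal"
  where "hausdorff_dim A = Inf {ereal s |s. 0 \<le> s \<and> hausdorff_measure s A = 0}"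

definition lower_dim :: "'a::metric_space measure \<Rightarrow> ereal"
  where "lower_dim \<sigma> = (INF A\<in>{A \<in> sets borel. emeasure \<sigma> A > 0}. hausdorff_dim A)"

definition upper_dim :: "'a::metric_space measure \<Rightarrow> ereal"
  where "upper_dim \<sigma> = (INF A\<in>{A \<in> sets borel. emeasure \<sigma> (UNIV - A) = 0}. hausdorff_dim A)"


section \<open>Smooth test functions on \<open>(-T, T) \<times> Q\<close>\<close>

primrec continuously_differentiable :: "nat \<Rightarrow> ('a::euclidean_space \<Rightarrow> real) \<Rightarrow> bool"
  where
    "continuously_differentiable 0 f \<longleftrightarrow> continuous_on UNIV f"
  | "continuously_differentiable (Suc n) f \<longleftrightarrow>
      (\<forall>x. f differentiable at x) \<and>
      (\<forall>b\<in>Basis. continuously_differentiable n (\<lambda>x. frechet_derivative f (at x) b))"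

definition smooth :: "('a::euclidean_space \<Rightarrow> real) \<Rightarrow> bool"
  where "smooth f \<longleftrightarrow> (\<forall>n. continuously_differentiable n f)"

definition QT :: "real \<Rightarrow> (real \<times> torus) set"
  where "QT T = {-T<..<T} \<times> UNIV"

definition lift_fun :: "(real \<times> torus \<Rightarrow> real) \<Rightarrow> real \<times> (real^2) \<Rightarrow> real"
  where "lift_fun \<phi> = (\<lambda>(t, x). \<phi> (t, abs_torus x))"

definition test_function :: "real \<Rightarrow> (real \<times> torus \<Rightarrow> real) \<Rightarrow> bool"
  where "test_function T \<phi> \<longleftrightarrow>
    smooth (lift_fun \<phi>) \<and> (\<exists>K. compact K \<and> K \<subseteq> QT T \<and> (\<forall>z. z \<notin> K \<longrightarrow> \<phi> z = 0))"

text \<open>Derivatives of a lifted function are periodic in space, so the choice of representative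
  below is immaterial.\<close>

definition time_deriv :: "(real \<times> torus \<Rightarrow> real) \<Rightarrow> real \<times> torus \<Rightarrow> real"
  where "time_deriv \<phi> = (\<lambda>(t, p). frechet_derivative (lift_fun \<phi>) (at (t, rep_torus p)) (1, 0))"

definition space_grad :: "(real \<times> torus \<Rightarrow> real) \<Rightarrow> real \<times> torus \<Rightarrow> real^2"
  where "space_grad \<phi> = (\<lambda>(t, p).
    \<chi> i. frechet_derivative (lift_fun \<phi>) (at (t, rep_torus p)) (0, axis i 1))"


section \<open>Vector measures\<close>

text \<open>A vector measure is a countably additive set function on the measurable sets of \<open>M\<close>;
  its values elsewhere are irrelevant.\<close>

definition vector_measure :: "'a measure \<Rightarrow> ('a set \<Rightarrow> 'b::real_normed_vector) \<Rightarrow> bool"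
  where "vector_measure M m \<longleftrightarrow>
    (\<forall>A::nat \<Rightarrow> 'a set. range A \<subseteq> sets M \<longrightarrow> disjoint_family A \<longrightarrow>
      (\<lambda>i. m (A i)) sums m (\<Union>i. A i))"

definition abs_cont :: "('a set \<Rightarrow> 'b::real_normed_vector) \<Rightarrow> 'a measure \<Rightarrow> bool"
  where "abs_cont m M \<longleftrightarrow> (\<forall>A\<in>sets M. emeasure M A = 0 \<longrightarrow> m A = 0)"

definition vector_RN_deriv ::
    "'a measure \<Rightarrow> ('a set \<Rightarrow> 'b::{banach, second_countable_topology}) \<Rightarrow> 'a \<Rightarrow> 'b"
  where "vector_RN_deriv M m =
    (SOME v. integrable M v \<and> (\<forall>A\<in>sets M. m A = (LINT x:A|M. v x)))"


section \<open>Admissible measures and the internal energy\<close>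

definition finite_borel :: "torus measure \<Rightarrow> bool"
  where "finite_borel \<sigma> \<longleftrightarrow> sets \<sigma> = sets borel \<and> finite_measure \<sigma>"

text \<open>\<open>\<mu> = dt \<otimes> \<sigma>\<^sub>t\<close> on \<open>(-T, T) \<times> Q\<close>.\<close>

definition is_disintegration ::
    "real \<Rightarrow> (real \<times> torus) measure \<Rightarrow> (real \<Rightarrow> torus measure) \<Rightarrow> bool"
  where "is_disintegration T \<mu> \<sigma> \<longleftrightarrow>
    (\<forall>t\<in>{-T<..<T}. finite_borel (\<sigma> t)) \<and>
    (\<forall>B\<in>sets borel. (\<lambda>t. emeasure (\<sigma> t) B) \<in> borel_measurable (restrict_space borel {-T<..<T})) \<and>
    (\<forall>A\<in>sets \<mu>. emeasure \<mu> A = (\<integral>\<^sup>+ t\<in>{-T<..<T}. emeasure (\<sigma> t) (Pair t -` A) \<partial>lborel))"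

text \<open>The disintegration is unique up to a null set of times.\<close>

definition disintegration :: "real \<Rightarrow> (real \<times> torus) measure \<Rightarrow> real \<Rightarrow> torus measure"
  where "disintegration T \<mu> = (SOME \<sigma>. is_disintegration T \<mu> \<sigma>)"

definition purely_atomic :: "torus measure \<Rightarrow> bool"
  where "purely_atomic \<sigma> \<longleftrightarrow>
    (\<exists>X \<phi>. countable X \<and> (\<forall>x\<in>X. \<phi> x > (0::real)) \<and>
      (\<forall>A\<in>sets borel. emeasure \<sigma> A = (\<Sum>\<^sub>\<infinity>x\<in>X \<inter> A. ennreal (\<phi> x))))"

text \<open>The finite vector measures \<open>m \<lless> \<mu>\<close> with \<open>\<partial>\<^sub>t \<mu> + \<nabla>\<cdot>m = 0\<close> in the sense of distributions;
  integration against \<open>m\<close> is integration of the density against \<open>\<mu>\<close>.\<close>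

definition fluxes :: "real \<Rightarrow> (real \<times> torus) measure \<Rightarrow> ((real \<times> torus) set \<Rightarrow> real^2) set"
  where "fluxes T \<mu> = {m. vector_measure \<mu> m \<and> abs_cont m \<mu> \<and>
    (\<forall>\<phi>. test_function T \<phi> \<longrightarrow>
      (LINT z|\<mu>. time_deriv \<phi> z) + (LINT z|\<mu>. space_grad \<phi> z \<bullet> vector_RN_deriv \<mu> m z) = 0)}"

definition admissible :: "real \<Rightarrow> (real \<times> torus) measure set"
  where "admissible T = {\<mu>. sets \<mu> = sets (restrict_space borel (QT T)) \<and> finite_measure \<mu> \<and>
    (\<exists>\<sigma>. is_disintegration T \<mu> \<sigma> \<and> (AE t in lborel. t \<in> {-T<..<T} \<longrightarrow> purely_atomic (\<sigma> t))) \<and>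
    fluxes T \<mu> \<noteq> {}}"

definition irrigation_energy :: "real \<Rightarrow> (real \<times> torus) measure \<Rightarrow> real \<Rightarrow> real \<Rightarrow> ennreal"
  where "irrigation_energy T \<mu> a b =
    (INF m\<in>fluxes T \<mu>.
      (\<integral>\<^sup>+ t\<in>{a<..<b}. (\<Sum>\<^sub>\<infinity>x\<in>UNIV. ennreal (sqrt (measure (disintegration T \<mu> t) {x}))) \<partial>lborel) +
      (\<integral>\<^sup>+ z\<in>{a<..<b} \<times> UNIV. ennreal ((norm (vector_RN_deriv \<mu> m z))\<^sup>2) \<partial>\<mu>))"


section \<open>Wasserstein distance and the continuous representative\<close>

definition couplings :: "torus measure \<Rightarrow> torus measure \<Rightarrow> (torus \<times> torus) measure set"
  where "couplings \<sigma> \<rho> =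
    {\<pi>. sets \<pi> = sets borel \<and> finite_measure \<pi> \<and> distr \<pi> borel fst = \<sigma> \<and> distr \<pi> borel snd = \<rho>}"

text \<open>The quadratic Wasserstein distance; it is infinite if the masses differ.\<close>

definition wasserstein :: "torus measure \<Rightarrow> torus measure \<Rightarrow> ennreal"
  where "wasserstein \<sigma> \<rho> =
    (INF \<pi>\<in>couplings \<sigma> \<rho>. ennreal (sqrt (LINT z|\<pi>. (dist (fst z) (snd z))\<^sup>2)))"

definition is_continuous_representative ::
    "real \<Rightarrow> (real \<times> torus) measure \<Rightarrow> (real \<Rightarrow> torus measure) \<Rightarrow> bool"
  where "is_continuous_representative T \<mu> \<sigma> \<longleftrightarrow>
    is_disintegration T \<mu> \<sigma> \<and> (\<forall>t\<in>{-T..T}. finite_borel (\<sigma> t)) \<and>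
    (\<forall>t\<in>{-T..T}. ((\<lambda>s. wasserstein (\<sigma> s) (\<sigma> t)) \<longlongrightarrow> 0) (at t within {-T..T}))"

text \<open>\<open>slice T \<mu> t\<close> is \<open>\<mu>\<^sub>t\<close> for every \<open>t \<in> [-T, T]\<close>, in particular the trace at \<open>t = \<plusminus>T\<close>. The
  continuous representative is unique on \<open>[-T, T]\<close> and exists for admissible \<open>\<mu>\<close> of finite energy.\<close>

definition slice :: "real \<Rightarrow> (real \<times> torus) measure \<Rightarrow> real \<Rightarrow> torus measure"
  where "slice T \<mu> = (SOME \<sigma>. is_continuous_representative T \<mu> \<sigma>)"


section \<open>Negative Sobolev norm and the full energy\<close>

definition int_vec :: "int^2 \<Rightarrow> real^2"
  where "int_vec k = (\<chi> i. of_int (k $ i))"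

definition fourier :: "torus measure \<Rightarrow> int^2 \<Rightarrow> complex"
  where "fourier \<sigma> k = (LINT p|\<sigma>. cis (- 2 * pi * (int_vec k \<bullet> rep_torus p)))"

text \<open>The squared \<open>H\<^sup>-\<^sup>\<gamma>\<close> norm of the signed measure \<open>\<sigma> - \<rho>\<close>. The weight at frequency zero is
  infinite and \<open>\<infinity> * 0 = 0\<close>, so finiteness forces \<open>\<sigma>\<close> and \<open>\<rho>\<close> to have the same mass.\<close>

definition sobolev_neg_diff_sq :: "real \<Rightarrow> torus measure \<Rightarrow> torus measure \<Rightarrow> ennreal"
  where "sobolev_neg_diff_sq \<gamma> \<sigma> \<rho> =
    (\<Sum>\<^sub>\<infinity>k\<in>UNIV. (if k = 0 then \<infinity> else ennreal (norm (int_vec k) powr (- 2 * \<gamma>))) *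
       ennreal ((cmod (fourier \<sigma> k - fourier \<rho> k))\<^sup>2))"

definition energy :: "real \<Rightarrow> real \<Rightarrow> (real \<times> torus) measure \<Rightarrow> ennreal"
  where "energy lam T \<mu> = irrigation_energy T \<mu> (-T) T
    + ennreal lam * sobolev_neg_diff_sq (1/2) (slice T \<mu> (-T)) torus_lebesgue
    + ennreal lam * sobolev_neg_diff_sq (1/2) (slice T \<mu> T) torus_lebesgue"

definition competitors :: "real \<Rightarrow> (real \<times> torus) measure set"
  where "competitors T = {\<mu> \<in> admissible T.
    AE t in lborel. t \<in> {-T<..<T} \<longrightarrow> emeasure (disintegration T \<mu> t) UNIV = 1}"

definition is_minimizer :: "real \<Rightarrow> real \<Rightarrow> (real \<times> torus) measure \<Rightarrow> bool"
  where "is_minimizer lam T \<mu> \<longleftrightarrow>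
    \<mu> \<in> competitors T \<and> (\<forall>\<nu>\<in>competitors T. energy lam T \<mu> \<le> energy lam T \<nu>)"

definition is_symmetric :: "real \<Rightarrow> (real \<times> torus) measure \<Rightarrow> bool"
  where "is_symmetric T \<mu> \<longleftrightarrow> (\<forall>t\<in>{0..T}. slice T \<mu> (-t) = slice T \<mu> t)"

end

theory Submission
  imports Defs "HOL-Probability.Probability" "HOL-Real_Asymp.Real_Asymp"
begin

text \<open>The lower bound uses minimality. Near the final time the minimiser is replaced by the average of
  its two translates by \<open>\<plusminus>\<rho>e\<close>, switched on during \<open>(T - \<epsilon>, T)\<close>. This costs at most
  \<open>I(\<mu>, \<epsilon>) + C\<rho>\<^sup>2/\<epsilon>\<close> and multiplies the \<open>k\<close>-th Fourier coefficient of the trace \<open>\<nu>\<close> by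
  \<open>cos (2\<pi>\<rho>k \<bullet> e)\<close>. With \<open>\<epsilon> = \<rho>^(2/(1+\<beta>))\<close> the sum of \<open>sin\<^sup>2 (2\<pi>\<rho>k \<bullet> e) |\<nu>\<^sub>k|\<^sup>2 / |k|\<close> is
  \<open>O(\<rho>^\<alpha>)\<close>, \<open>\<alpha> = 2\<beta>/(1+\<beta>)\<close>, so the sum of \<open>|\<nu>\<^sub>k|\<^sup>2\<close> over \<open>|k| < N\<close> is \<open>O(N^(1-\<alpha>))\<close>. Testing \<open>\<nu>\<close>
  against squared Dirichlet kernels turns this into \<open>\<nu>(B(y, r)) \<le> C r^s\<close> at almost every \<open>y\<close>, for
  each \<open>s < 1 + \<alpha>\<close>. Here the minimiser has finite energy because a dyadic branching tree joins
  Lebesgue measure to itself.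

  The upper bound only uses the energy. At some time in \<open>(T - \<epsilon>, T)\<close> the perimeter is
  \<open>O(\<epsilon>^(\<beta>-1))\<close>, so most of the mass sits in about \<open>\<epsilon>^(-2(1-\<beta>))\<close> atoms, and by Cauchy--Schwarz
  it moves by about \<open>\<epsilon>^((1+\<beta>)/2)\<close> up to time \<open>T\<close>. Hence \<open>\<nu>\<close> is concentrated on the limit superior
  of unions of that many balls of that radius.\<close>

section \<open>Topology of the torus\<close>

text \<open>A single translate would leave every \<open>|\<nu>\<^sub>k|\<close> unchanged; averaging
  both signs makes the phase a real factor, so the norm loses exactly the \<open>sin\<^sup>2\<close>
  part, and in the kinetic energy the terms linear in the extra velocity cancel. The choice of
  \<open>\<epsilon>\<close> equates \<open>\<epsilon>^\<beta>\<close> with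
  \<open>\<rho>^2 / \<epsilon>\<close>. Finite energy matters because the common part of the two
  energies has to be cancelled. The main technical obstacle is that slices, traces and densities are
  picked by choice operators. Existence of a Wasserstein-continuous representative must therefore be
  proved for every competitor, starting from an integrable flux only, and uniqueness must identify
  it with each explicit construction. Competitors are built as images of moving particles, so that
  one push-forward result yields both the continuity equation and the energy bound. For the upper
  bound the mass near many atoms is tested with a cutoff whose gradient must not depend on their
  number; the condition \<open>|\<nabla>f| \<le> L f\<close> survives summation and is used for this
  reason. The two exponents are \<open>1 + \<alpha>\<close> and the ratio of
  \<open>2 (1 - \<beta>)\<close> to \<open>(1 + \<beta>) / 2\<close>.\<close>

lemma dist_abs_torus_le: "dist (abs_torus x) (abs_torus y) \<le> dist x y"
 unfolding dist_torus_def by (rule setdist_le_dist) (auto simp: torus_coset_def)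

text \<open>Cosets are closed, so the quotient distance is attained even with one lift prescribed.
  Distance estimates on the torus can thus be read off in the plane.\<close>

lemma torus_lift_near: "\<exists>y. abs_torus y = q \<and> dist x y = dist (abs_torus x) q"
proof -
 have "x \<in> torus_coset (abs_torus x)" by (simp add: torus_coset_def)
 from dist_torus_infdist[OF this, of q]
 moreover obtain y where "y \<in> torus_coset q" "infdist x (torus_coset q) = dist x y"
  using infdist_attains_inf[OF closed_torus_coset torus_coset_nonempty] by blast
 ultimately show ?thesis by (auto simp: torus_coset_def)
qed

lemma surj_abs_torus: "surj abs_torus"
 by (metis abs_torus_rep surjI)

lemma continuous_abs_torus: "continuous_on A abs_torus"
 unfolding continuous_on_iff using dist_abs_torus_le by (meson order_le_less_trans)

lemma open_abs_torus: "open U ==> open (abs_torus ` U)"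
 unfolding open_dist
proof (intro ballI)
 fix p assume U: "\<forall>x\<in>U. \<exists>e>0. \<forall>y. dist y x < e \<longrightarrow> y \<in> U" and "p \<in> abs_torus ` U"
 then obtain x e where x: "x \<in> U" "p = abs_torus x" "e > 0" "\<And>y. dist y x < e ==> y \<in> U" by blast
 show "\<exists>e>0. \<forall>q. dist q p < e \<longrightarrow> q \<in> abs_torus ` U"
 proof (intro exI[of _ e] conjI allI impI)
  fix q assume "dist q p < e"
  then show "q \<in> abs_torus ` U"
   using torus_lift_near[of q x] x by (metis dist_commute imageI)
 qed (use x in simp)
qed

text \<open>A product of quotient maps need not be a quotient map, but a product of open maps is
  open. Continuity on time-space can therefore be tested on lifts.\<close>

lemma open_map_prod_abs_torus:
 fixes U :: "('a::topological_space \<times> (real^2)) set"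
 assumes "open U"
 shows "open (map_prod id abs_torus ` U)"
 unfolding open_subopen[of "map_prod id abs_torus ` U"]
proof
 fix z assume "z \<in> map_prod id abs_torus ` U"
 then obtain t x where tx: "(t, x) \<in> U" "z = (t, abs_torus x)" by auto
 then obtain A B where AB: "open A" "open B" "t \<in> A" "x \<in> B" "A \<times> B \<subseteq> U"
  using assms by (metis open_prod_def mem_Sigma_iff)
 have "A \<times> abs_torus ` B = map_prod id abs_torus ` (A \<times> B)" by force
 then have "A \<times> abs_torus ` B \<subseteq> map_prod id abs_torus ` U" using AB(5) by (simp add: image_mono)
 moreover have "open (A \<times> abs_torus ` B)" using open_abs_torus[OF AB(2)] AB(1) by (rule open_Times[rotated])
 moreover have "z \<in> A \<times> abs_torus ` B" using AB tx by simp
 ultimately show "\<exists>T. open T \<and> z \<in> T \<and> T \<subseteq> map_prod id abs_torus ` U" by blast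
qed

lemma continuous_on_quotient:
 assumes "surj q" "\<And>U. open U ==> open (q ` U)" "continuous_on UNIV (%x. f (q x))"
 shows "continuous_on UNIV f"
proof -
 have "open (f -` B)" if "open B" for B
 proof -
  have "f -` B = q ` ((%x. f (q x)) -` B)" using surj_image_vimage_eq[OF assms(1), of "f -` B"] by (simp add: vimage_def)
  moreover have "open ((%x. f (q x)) -` B)" using open_vimage[OF that assms(3)] .
  ultimately show ?thesis using assms(2) by simp
 qed
 then show ?thesis by (simp add: continuous_on_open_vimage)
qed

lemma continuous_torusI: "continuous_on UNIV (%x. f (abs_torus x)) ==> continuous_on UNIV f"
 by (rule continuous_on_quotient[OF surj_abs_torus open_abs_torus])

lemma surj_map_prod_abs_torus: "surj (map_prod id abs_torus)"
 by (metis surj_abs_torus map_prod_surj surj_id)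

lemma continuous_prod_torusI:
 assumes "continuous_on UNIV (%(t, x). f (t, abs_torus x))"
 shows "continuous_on UNIV f"
 using assms
 by (intro continuous_on_quotient[OF surj_map_prod_abs_torus open_map_prod_abs_torus])
  (auto simp: split_def map_prod_def)

lemma abs_torus_frac: "\<exists>y\<in>cbox 0 1. abs_torus y = abs_torus x"
proof
 have "x $ i - frac (x $ i) \<in> \<int>" for i by (simp add: frac_def)
 then have "frac (x $ i) - x $ i \<in> \<int>" for i by (metis Ints_minus minus_diff_eq)
 then show "abs_torus (\<chi> i. frac (x $ i)) = abs_torus x"
  by (subst abs_torus_eq_iff) simp
 show "(\<chi> i. frac (x $ i)) \<in> cbox 0 1"
  by (simp add: mem_box_cart less_imp_le[OF frac_lt_1])
qed

lemma compact_torus: "compact (UNIV :: torus set)"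
proof -
 have "UNIV = abs_torus ` cbox 0 1"
 proof (rule antisym)
  show "UNIV \<subseteq> abs_torus ` cbox 0 1"
   using abs_torus_frac[of "rep_torus _"] unfolding abs_torus_rep by (metis image_eqI subsetI)
 qed simp
 then show ?thesis by (metis compact_cbox compact_continuous_image continuous_abs_torus)
qed

text \<open>An open continuous surjection carries a countable basis to a countable basis. The
  instance makes the Borel sets of products with the torus agree with the product
  sigma-algebra.\<close>

instance torus :: second_countable_topology
proof
 obtain B :: "(real^2) set set" where B: "countable B" "topological_basis B"
  using ex_countable_basis by blast
 have "topological_basis ((`) abs_torus ` B)"
  unfolding topological_basis_def
 proof safe
  show "open (abs_torus ` b)" if "b \<in> B" for b
   using B(2) that open_abs_torus topological_basis_open by blast
  fix U :: "torus set" assume "open U"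
  then have "open (abs_torus -` U)"
   by (rule open_vimage) (rule continuous_abs_torus)
  then obtain B' where B': "B' \<subseteq> B" "\<Union>B' = abs_torus -` U" using B(2) unfolding topological_basis_def by metis
  have "\<Union>((`) abs_torus ` B') = abs_torus ` (\<Union>B')" by blast
  also have "... = U" unfolding B'(2) using surj_abs_torus by (simp add: surj_image_vimage_eq)
  finally show "\<exists>B'\<subseteq>(`) abs_torus ` B. \<Union>B' = U" using B'(1) by (intro exI[of _ "(`) abs_torus ` B'"]) blast
 qed
 then show "\<exists>B::torus set set. countable B \<and> open = generate_topology B"
  using B(1) topological_basis_imp_subbasis by blast
qed

lemma torus_induct: "(\<And>x. P (abs_torus x)) ==> P p"
 by (metis abs_torus_rep)

section \<open>Translations of the torus\<close>

definition tshift :: "torus => real^2 => torus"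
 where "tshift p v = abs_torus (rep_torus p + v)"

lemma tshift_abs: "tshift (abs_torus x) v = abs_torus (x + v)"
proof -
 have "abs_torus (rep_torus (abs_torus x)) = abs_torus x" by (rule abs_torus_rep)
 then show ?thesis unfolding tshift_def abs_torus_eq_iff by simp
qed

lemma tshift_0 [simp]: "tshift p 0 = p"
 by (induction p rule: torus_induct) (simp add: tshift_abs)

lemma tshift_tshift: "tshift (tshift p v) w = tshift p (v + w)"
 by (induction p rule: torus_induct) (simp add: tshift_abs add.assoc)

lemma dist_tshift: "dist (tshift p v) (tshift q w) \<le> dist p q + norm (v - w)"
proof (induction p rule: torus_induct)
 case (1 x)
 obtain y where y: "q = abs_torus y" "dist x y = dist (abs_torus x) q" using torus_lift_near by metis
 have "dist (x + v) (y + w) \<le> dist x y + norm (v - w)"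
  by (metis add_diff_add dist_norm norm_triangle_ineq)
 then show ?case using dist_abs_torus_le[of "x + v" "y + w"] y by (simp add: tshift_abs)
qed

lemma continuous_tshift [continuous_intros]:
 fixes f :: "'a::topological_space => torus"
 assumes "continuous_on A f" "continuous_on A g"
 shows "continuous_on A (%z. tshift (f z) (g z))"
proof -
 have "continuous_on UNIV (%z. tshift (fst z) (snd z))"
  unfolding continuous_on_iff
 proof safe
  fix p v and e :: real assume "e > 0"
  moreover have "dist (tshift (fst (q, w)) (snd (q, w))) (tshift (fst (p, v)) (snd (p, v))) < e"
   if "dist (q, w) (p, v) < e / 2" for q w
  proof -
   have "dist q p < e / 2" "dist w v < e / 2"
    using that dist_fst_le[of "(q, w)" "(p, v)"] dist_snd_le[of "(q, w)" "(p, v)"] by auto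
   then show ?thesis using dist_tshift[of q w p v] by (simp add: dist_norm)
  qed
  ultimately show "\<exists>d>0. \<forall>x'\<in>UNIV. dist x' (p, v) < d \<longrightarrow>
    dist (tshift (fst x') (snd x')) (tshift (fst (p, v)) (snd (p, v))) < e"
   by (intro exI[of _ "e / 2"]) auto
 qed
 from continuous_on_compose2[OF this continuous_on_Pair[OF assms]] show ?thesis by simp
qed

section \<open>Smooth functions\<close>

abbreviation "cdiff \<equiv> continuously_differentiable"

text \<open>\<open>continuously_differentiable\<close> is phrased with
  \<open>frechet_derivative\<close>; by uniqueness any explicit derivative may be supplied
  instead.\<close>

lemma cdiff_SucI:
 assumes "\<And>x. (f has_derivative f' x) (at x)" "\<And>b. b \<in> Basis ==> cdiff n (%x. f' x b)"
 shows "cdiff (Suc n) f"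
proof -
 have "frechet_derivative f (at x) = f' x" for x
  using frechet_derivative_at[OF assms(1)] by metis
 then show ?thesis using assms by (auto simp: differentiable_def)
qed

lemma cdiff_has_derivative:
 "cdiff (Suc n) f ==> (f has_derivative frechet_derivative f (at x)) (at x)"
 using frechet_derivative_works by auto

lemma cdiff_continuous: "cdiff n f ==> continuous_on UNIV f"
proof (cases n)
 case (Suc m)
 assume "cdiff n f"
 then have "f differentiable (at x)" for x using Suc by simp
 then show ?thesis
  by (intro continuous_at_imp_continuous_on ballI differentiable_imp_continuous_within) auto
qed auto

lemma cdiff_Suc_imp: "cdiff (Suc n) f ==> cdiff n f"
proof (induction n arbitrary: f)
 case 0
 then show ?case using cdiff_continuous[OF 0] by simp
next
 case (Suc n)
 from Suc.prems have "\<And>x. f differentiable at x"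
  "\<And>b. b \<in> Basis ==> cdiff (Suc n) (%x. frechet_derivative f (at x) b)" by simp_all
 then show ?case using Suc.IH by simp
qed

lemma cdiff_const [simp]: "cdiff n (%x. c)"
proof (induction n arbitrary: c)
 case (Suc n)
 show ?case by (rule cdiff_SucI[where f'="%x h. 0"]) (use Suc in auto)
qed auto

lemma cdiff_add: "cdiff n f ==> cdiff n g ==> cdiff n (%x. f x + g x)"
proof (induction n arbitrary: f g)
 case (Suc n)
 show ?case
  by (rule cdiff_SucI[where f'="%x h. frechet_derivative f (at x) h + frechet_derivative g (at x) h"])
   (use Suc in \<open>auto intro!: has_derivative_add cdiff_has_derivative[of n]\<close>)
qed (auto intro: continuous_intros)

lemma cdiff_mult: "cdiff n f ==> cdiff n g ==> cdiff n (%x. f x * g x)"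
proof (induction n arbitrary: f g)
 case (Suc n)
 show ?case
  by (rule cdiff_SucI[where f'="%x h. f x * frechet_derivative g (at x) h + frechet_derivative f (at x) h * g x"])
   (use Suc.prems in \<open>auto intro!: has_derivative_mult cdiff_has_derivative[of n] cdiff_add Suc.IH
    intro: cdiff_Suc_imp\<close>)
qed (auto intro: continuous_intros)

lemma cdiff_sum: "(\<And>i. i \<in> A ==> cdiff n (f i)) ==> cdiff n (%x. \<Sum>i\<in>A. f i x)"
 by (induction A rule: infinite_finite_induct) (auto intro!: cdiff_add)

lemma cdiff_bounded_linear: "bounded_linear f ==> cdiff n f"
proof (cases n)
 case (Suc m)
 assume "bounded_linear f"
 then show ?thesis unfolding Suc
  by (intro cdiff_SucI[where f'="%x. f"]) (auto intro: bounded_linear_imp_has_derivative)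
qed (auto simp: linear_continuous_on)

text \<open>A family of outer functions closed under differentiation replaces a formula for higher
  derivatives of a composition: one derivative gives a member of the family times a derivative of
  \<open>g\<close>, and the induction runs with \<open>F\<close> arbitrary.\<close>

lemma cdiff_chain:
 fixes \<F> :: "(real => real) set"
 assumes closed: "\<And>F. F \<in> \<F> ==> \<exists>F'\<in>\<F>. \<forall>y\<in>S. (F has_real_derivative F' y) (at y)"
  and g: "\<And>x. g x \<in> S"
 shows "cdiff n g ==> F \<in> \<F> ==> cdiff n (%x. F (g x))"
proof (induction n arbitrary: F)
 case 0
 then obtain F' where "\<And>y. y \<in> S ==> (F has_real_derivative F' y) (at y)" using closed by metis
 then have "continuous_on S F" by (metis DERIV_isCont continuous_at_imp_continuous_on)
 then show ?case using 0(1) g by (auto intro: continuous_on_compose2)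
next
 case (Suc n)
 then obtain F' where F': "F' \<in> \<F>" "\<And>y. y \<in> S ==> (F has_real_derivative F' y) (at y)" using closed by metis
 show ?case
 proof (rule cdiff_SucI[where f'="%x h. F' (g x) * frechet_derivative g (at x) h"])
  show "((%x. F (g x)) has_derivative (%h. F' (g x) * frechet_derivative g (at x) h)) (at x)" for x
  proof -
   have "(F has_derivative (*) (F' (g x))) (at (g x))"
    using F'(2)[OF g] by (simp add: has_field_derivative_def)
   from has_derivative_compose[OF cdiff_has_derivative[OF Suc.prems(1)] this]
   show ?thesis by simp
  qed
  show "cdiff n (%x. F' (g x) * frechet_derivative g (at x) b)" if "b \<in> Basis" for b
   using Suc.prems Suc.IH[OF cdiff_Suc_imp[OF Suc.prems(1)] F'(1)] that
   by (intro cdiff_mult) auto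
 qed
qed

lemma smooth_const [simp]: "smooth (%x. c)"
 and smooth_add: "smooth f ==> smooth g ==> smooth (%x. f x + g x)"
 and smooth_mult: "smooth f ==> smooth g ==> smooth (%x. f x * g x)"
 and smooth_bounded_linear: "bounded_linear f ==> smooth f"
 by (simp_all add: smooth_def cdiff_add cdiff_mult cdiff_bounded_linear)

lemma smooth_sum: "(\<And>i. i \<in> A ==> smooth (f i)) ==> smooth (%x. \<Sum>i\<in>A. f i x)"
 by (simp add: smooth_def cdiff_sum)

lemma smooth_minus: "smooth f ==> smooth (%x. - f x)"
 using smooth_mult[of "%x. -1" f] by simp

lemma smooth_diff: "smooth f ==> smooth g ==> smooth (%x. f x - g x)"
 using smooth_add[of f "%x. - g x"] smooth_minus[of g] by simp

lemma smooth_chain: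
 assumes "\<And>F. F \<in> \<F> ==> \<exists>F'\<in>\<F>. \<forall>y\<in>S. (F has_real_derivative F' y) (at y)"
  and "\<And>x. g x \<in> S" "smooth g" "F \<in> \<F>"
 shows "smooth (%x. F (g x))"
 unfolding smooth_def
proof
 fix n
 have "cdiff n g" using assms(3) by (simp add: smooth_def)
 from cdiff_chain[of \<F> S g n F, OF assms(1,2) this assms(4)] show "cdiff n (%x. F (g x))" .
qed

lemma smooth_power: "smooth f ==> smooth (%x. f x ^ k)"
 by (induction k) (auto intro!: smooth_mult)

lemma smooth_inverse:
 assumes "smooth f" "\<And>x. f x > 0"
 shows "smooth (%x. inverse (f x))"
proof (rule smooth_chain[where F=inverse and g=f and S="{0<..}" and \<F>="range (%(c, k) y. c * inverse y ^ k)"])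
 fix F :: "real => real" assume "F \<in> range (%(c, k) y. c * inverse y ^ k)"
 then obtain c k where F: "F = (%y. c * inverse y ^ k)" by auto
 have "(F has_real_derivative (- (c * real k)) * inverse y ^ (Suc k)) (at y)" if "y > 0" for y
 proof -
  have "((%y. inverse y ^ k) has_real_derivative real k * inverse y ^ (k - 1) * - (inverse y * inverse y)) (at y)"
   using that by (auto intro!: derivative_eq_intros)
  from DERIV_cmult[OF this, of c] show ?thesis
   unfolding F by (cases k) (auto simp: algebra_simps)
 qed
 then show "\<exists>F'\<in>range (%(c, k) y. c * inverse y ^ k). \<forall>y\<in>{0<..}. (F has_real_derivative F' y) (at y)"
  by (intro bexI[of _ "%y. (- (c * real k)) * inverse y ^ (Suc k)"])
   (auto intro!: image_eqI[of _ _ "(- (c * real k), Suc k)"])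
next
 have "(inverse :: real => real) = (%y. 1 * inverse y ^ 1)" by auto
 then show "(inverse :: real => real) \<in> range (%(c, k::nat) y. c * inverse y ^ k)"
  by (intro image_eqI[of _ _ "(1::real, 1::nat)"]) auto
qed (use assms in auto)

lemma smooth_sin: "smooth f ==> smooth (%x. sin (f x))"
 and smooth_cos: "smooth f ==> smooth (%x. cos (f x))"
proof -
 let ?F = "range (%(a, b) y. a * sin y + b * cos y :: real)"
 have closed: "\<exists>F'\<in>?F. \<forall>y\<in>UNIV. (F has_real_derivative F' y) (at y)" if "F \<in> ?F" for F
 proof -
  from that obtain a b where F: "F = (%y. a * sin y + b * cos y)" by auto
  show ?thesis
   by (rule bexI[of _ "%y. (- b) * sin y + a * cos y"])
    (auto simp: F intro!: derivative_eq_intros image_eqI[of _ _ "(- b, a)"])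
 qed
 assume f: "smooth f"
 show "smooth (%x. sin (f x))"
  by (rule smooth_chain[OF closed _ f]) (auto intro!: image_eqI[of _ _ "(1, 0)"])
 show "smooth (%x. cos (f x))"
  by (rule smooth_chain[OF closed _ f]) (auto intro!: image_eqI[of _ _ "(0, 1)"])
qed

text \<open>Letting \<open>P\<close> vary makes the family closed under differentiation.\<close>

definition flat :: "real poly => real => real"
 where "flat P x = (if x > 0 then poly P (1 / x) * exp (- (1 / x)) else 0)"

lemma flat_tendsto_0: "(flat P \<longlongrightarrow> 0) (at 0)"
proof -
 have "((%y. poly P y * exp (- y)) \<longlongrightarrow> 0) at_top"
 proof (induction P)
  case (pCons a P)
  have *: "((%y. y ^ k / exp y) \<longlongrightarrow> (0::real)) at_top" for k by (rule tendsto_power_div_exp_0)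
  have "((%y. \<Sum>i\<le>degree (pCons a P). coeff (pCons a P) i * (y ^ i / exp y)) \<longlongrightarrow> (\<Sum>i\<le>degree (pCons a P). coeff (pCons a P) i * 0)) at_top"
   by (intro tendsto_sum tendsto_mult tendsto_const *)
  then show ?case
   by (simp add: poly_altdef exp_minus sum_distrib_right divide_inverse mult.assoc del: degree_pCons_eq_if)
 qed simp
 from filterlim_compose[OF this filterlim_inverse_at_top_right]
 have "((%x. poly P (inverse x) * exp (- inverse x)) \<longlongrightarrow> 0) (at_right 0)" .
 then have "(flat P \<longlongrightarrow> 0) (at_right 0)"
  by (rule Lim_transform_eventually) (auto simp: eventually_at_filter flat_def inverse_eq_divide)
 moreover have "(flat P \<longlongrightarrow> 0) (at_left 0)"
  by (rule Lim_transform_eventually[OF tendsto_const]) (auto simp: eventually_at_filter flat_def)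
 ultimately show ?thesis by (simp add: filterlim_split_at)
qed

text \<open>With \<open>y = 1 / x\<close> one has \<open>d/dx = - y^2 d/dy\<close>, and the
  \<open>y\<close>-derivative of \<open>P(y) exp (- y)\<close> is \<open>(P' - P) exp (- y)\<close>.
  This produces the polynomial \<open>y^2 (P - P')\<close>.\<close>

lemma flat_deriv: "(flat P has_real_derivative flat (monom 1 2 * (P - pderiv P)) x) (at x)"
proof -
 consider "x > 0" | "x < 0" | "x = 0" by linarith
 then show ?thesis
 proof cases
  case 1
  have "((%x. poly P (1 / x) * exp (- (1 / x))) has_real_derivative flat (monom 1 2 * (P - pderiv P)) x) (at x)"
   using 1 by (auto intro!: derivative_eq_intros DERIV_chain'[OF _ poly_DERIV]
     simp: flat_def poly_monom field_simps power2_eq_square)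
  then show ?thesis
   by (rule DERIV_cong_ev[THEN iffD1, OF refl _ refl, rotated])
    (use 1 in \<open>auto simp: flat_def eventually_nhds intro!: exI[of _ "{0<..}"]\<close>)
 next
  case 2
  have "((%x. 0) has_real_derivative flat (monom 1 2 * (P - pderiv P)) x) (at x)"
   using 2 by (simp add: flat_def)
  then show ?thesis
   by (rule DERIV_cong_ev[THEN iffD1, OF refl _ refl, rotated])
    (use 2 in \<open>auto simp: flat_def eventually_nhds intro!: exI[of _ "{..<0}"]\<close>)
 next
  case 3
  \<comment> \<open>The division by \<open>h\<close> is absorbed into the polynomial as one more
    factor \<open>1 / h\<close>, so the limit at zero is already known.\<close>
  have "((%h. (flat P (0 + h) - flat P 0) / h) \<longlongrightarrow> 0) (at 0)"
   by (rule Lim_transform_eventually[OF flat_tendsto_0[of "monom 1 1 * P"]])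
    (auto simp: flat_def poly_monom eventually_at_filter)
  then show ?thesis using 3 by (simp add: DERIV_def flat_def)
 qed
qed

lemma smooth_flat: "smooth g ==> smooth (%x. flat P (g x))"
 by (rule smooth_chain[where S=UNIV and \<F>="range flat"]) (auto intro!: flat_deriv)

lemma flat_1: "flat 1 x = (if x > 0 then exp (- (1 / x)) else 0)"
 by (simp add: flat_def)

section \<open>Densities of vector measures\<close>

lemma vector_measure_empty: "vector_measure M f ==> f {} = 0"
proof -
 assume "vector_measure M f"
 then have "(%i::nat. f {}) sums f (\<Union>i::nat. {})"
  unfolding vector_measure_def by (drule_tac x="%_. {}" in spec) (auto simp: disjoint_family_on_def)
 then have "(%i::nat. f {}) \<longlonglongrightarrow> 0" by (intro summable_LIMSEQ_zero sums_summable)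
 then show ?thesis by (simp add: LIMSEQ_const_iff)
qed

lemma vector_measure_sums:
 "vector_measure M f ==> (\<And>i. A i \<in> sets M) ==> disjoint_family A ==> (%i::nat. f (A i)) sums f (\<Union>i. A i)"
 by (auto simp: vector_measure_def)

lemma vector_measure_Un:
 assumes f: "vector_measure M f" and AB: "A \<in> sets M" "B \<in> sets M" "A \<inter> B = {}"
 shows "f (A \<union> B) = f A + f B"
proof -
 have "(%i. f (binaryset A B i)) sums f (\<Union>i. binaryset A B i)"
  using AB by (intro vector_measure_sums[OF f])
   (auto simp: binaryset_def disjoint_family_on_def split: nat.splits if_splits)
 then show ?thesis
  using binaryset_sums[of f A B, OF vector_measure_empty[OF f]] by (simp add: UN_binaryset_eq sums_unique2)
qed

lemma vector_measure_Int_Diff: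
 assumes "vector_measure M f" "A \<in> sets M" "B \<in> sets M"
 shows "f B = f (B \<inter> A) + f (B - A)"
 using vector_measure_Un[OF assms(1), of "B \<inter> A" "B - A"] assms
 by (metis Diff_disjoint Int_Diff_Un Int_Diff_disjoint sets.Diff sets.Int)

text \<open>The positive part in the Jordan decomposition. The truncation of negative values by
  \<open>ennreal\<close> is harmless here, since the empty set always competes with value
  zero.\<close>

definition upper_variation :: "'a measure => ('a set => real) => 'a set => ennreal"
 where "upper_variation M f A = (SUP B\<in>{B \<in> sets M. B \<subseteq> A}. ennreal (f B))"

lemma upper_variation_ge: "B \<in> sets M ==> B \<subseteq> A ==> ennreal (f B) \<le> upper_variation M f A"
 unfolding upper_variation_def by (rule SUP_upper) auto

lemma ennreal_sum_le: "ennreal (\<Sum>i\<in>I. f i) \<le> (\<Sum>i\<in>I. ennreal (f i))"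
proof -
 have "ennreal (\<Sum>i\<in>I. f i) \<le> ennreal (\<Sum>i\<in>I. max 0 (f i))" by (intro ennreal_leI sum_mono) auto
 also have "... = (\<Sum>i\<in>I. ennreal (max 0 (f i)))" by (rule sum_ennreal[symmetric]) auto
 finally show ?thesis by (simp add: ennreal_max_0)
qed

lemma upper_variation_subadd:
 assumes f: "vector_measure M f" and A: "\<And>i::nat. A i \<in> sets M" "disjoint_family A"
 shows "upper_variation M f (\<Union>i. A i) \<le> (\<Sum>i. upper_variation M f (A i))"
 unfolding upper_variation_def[of M f "\<Union>i. A i"]
proof (rule SUP_least, safe)
 fix B assume B: "B \<in> sets M" "B \<subseteq> (\<Union>i. A i)"
 have "(%i. f (B \<inter> A i)) sums f (\<Union>i. B \<inter> A i)"
  by (rule vector_measure_sums[OF f]) (use A B in \<open>auto simp: disjoint_family_on_def\<close>)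
 moreover have "(\<Union>i. B \<inter> A i) = B" using B by auto
 ultimately have "(%n. \<Sum>i<n. f (B \<inter> A i)) \<longlonglongrightarrow> f B" by (simp add: sums_def)
 then have "(%n. ennreal (\<Sum>i<n. f (B \<inter> A i))) \<longlonglongrightarrow> ennreal (f B)" by (rule tendsto_ennrealI)
 then show "ennreal (f B) \<le> (\<Sum>i. upper_variation M f (A i))"
 proof (rule LIMSEQ_le_const2, intro exI allI impI)
  fix n
  have "ennreal (\<Sum>i<n. f (B \<inter> A i)) \<le> (\<Sum>i<n. ennreal (f (B \<inter> A i)))" by (rule ennreal_sum_le)
  also have "... \<le> (\<Sum>i<n. upper_variation M f (A i))"
   using A B by (intro sum_mono upper_variation_ge) auto
  also have "... \<le> (\<Sum>i. upper_variation M f (A i))" by (rule sum_le_suminf) auto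
  finally show "ennreal (\<Sum>i<n. f (B \<inter> A i)) \<le> (\<Sum>i. upper_variation M f (A i))" .
 qed
qed

lemma upper_variation_superadd:
 assumes f: "vector_measure M f" and A: "A \<in> sets M" "B \<in> sets M" "A \<inter> B = {}"
 shows "upper_variation M f A + upper_variation M f B \<le> upper_variation M f (A \<union> B)"
proof -
 let ?S = "%A. {B \<in> sets M. B \<subseteq> A}"
 have ne: "?S A \<noteq> {}" for A by (auto intro!: exI[of _ "{}"])
 have "upper_variation M f A + upper_variation M f B = (SUP C\<in>?S A. ennreal (f C) + upper_variation M f B)"
  unfolding upper_variation_def[of M f A] by (rule ennreal_SUP_add_left[symmetric, OF ne])
 also have "... = (SUP C\<in>?S A. SUP D\<in>?S B. ennreal (f C) + ennreal (f D))"
  unfolding upper_variation_def[of M f B] by (simp add: ennreal_SUP_add_right[OF ne])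
 also have "... \<le> upper_variation M f (A \<union> B)"
 proof (intro SUP_least, safe)
  fix C D assume *: "C \<in> sets M" "D \<in> sets M" "C \<subseteq> A" "D \<subseteq> B"
  \<comment> \<open>Sets of negative value are replaced by the empty set; after that
    \<open>ennreal\<close> is additive on the two values.\<close>
  define C' where "C' = (if f C \<ge> 0 then C else {})"
  define D' where "D' = (if f D \<ge> 0 then D else {})"
  have 1: "f C' \<ge> 0" "ennreal (f C') = ennreal (f C)" "f D' \<ge> 0" "ennreal (f D') = ennreal (f D)"
   using vector_measure_empty[OF f] by (auto simp: C'_def D'_def ennreal_neg)
  have 2: "C' \<in> sets M" "D' \<in> sets M" "C' \<inter> D' = {}" "C' \<union> D' \<subseteq> A \<union> B"
   using * A(3) by (auto simp: C'_def D'_def)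
  have "ennreal (f C) + ennreal (f D) = ennreal (f (C' \<union> D'))"
   using 1 vector_measure_Un[OF f 2(1-3)] by (metis ennreal_plus)
  also have "... \<le> upper_variation M f (A \<union> B)" using 2 by (intro upper_variation_ge) auto
  finally show "ennreal (f C) + ennreal (f D) \<le> upper_variation M f (A \<union> B)" .
 qed
 finally show ?thesis .
qed

lemma upper_variation_empty: "vector_measure M f ==> upper_variation M f {} = 0"
 unfolding upper_variation_def using vector_measure_empty[of M f]
 by (intro antisym SUP_least) auto

lemma upper_variation_mono: "A \<subseteq> B ==> upper_variation M f A \<le> upper_variation M f B"
 unfolding upper_variation_def by (rule SUP_subset_mono) auto

lemma upper_variation_add:
 assumes f: "vector_measure M f" and A: "\<And>i::nat. A i \<in> sets M" "disjoint_family A"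
 shows "(\<Sum>i. upper_variation M f (A i)) = upper_variation M f (\<Union>i. A i)"
proof (rule antisym[OF _ upper_variation_subadd[OF assms]])
 have "(\<Sum>i<n. upper_variation M f (A i)) \<le> upper_variation M f (\<Union>i<n. A i)" for n
 proof (induction n)
  case (Suc n)
  have "(\<Sum>i<Suc n. upper_variation M f (A i)) \<le> upper_variation M f (\<Union>i<n. A i) + upper_variation M f (A n)"
   using Suc by (simp add: add_right_mono)
  also have "... \<le> upper_variation M f ((\<Union>i<n. A i) \<union> A n)"
  proof (intro upper_variation_superadd f)
   show "(\<Union>i<n. A i) \<inter> A n = {}"
    using A(2) unfolding disjoint_family_on_def by (auto simp: disjoint_iff) (metis less_irrefl)
  qed (use A(1) in auto)
  also have "(\<Union>i<n. A i) \<union> A n = (\<Union>i<Suc n. A i)" by (auto simp: less_Suc_eq)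
  finally show ?case .
 qed (simp add: upper_variation_empty[OF f])
 then have "(\<Sum>i<n. upper_variation M f (A i)) \<le> upper_variation M f (\<Union>i. A i)" for n
  by (rule order_trans) (rule upper_variation_mono, auto)
 then show "(\<Sum>i. upper_variation M f (A i)) \<le> upper_variation M f (\<Union>i. A i)"
  by (simp add: suminf_eq_SUP SUP_least)
qed

text \<open>A set of infinite variation could be split forever into a piece of infinite variation and a
 piece on which \<open>\<bar>f\<bar> \<ge> 1\<close>; the values on the latter would not be summable.\<close>

lemma upper_variation_finite:
 assumes f: "vector_measure M f"
 shows "upper_variation M f (space M) < \<infinity>"
proof (rule ccontr)
 assume "\<not> upper_variation M f (space M) < \<infinity>"
 then have inf: "upper_variation M f (space M) = \<infinity>" by (simp add: less_top[symmetric])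
 have split: "\<exists>E'. (E' \<in> sets M \<and> upper_variation M f E' = \<infinity>) \<and> E' \<subseteq> E \<and> \<bar>f (E - E')\<bar> \<ge> 1"
  if E: "E \<in> sets M \<and> upper_variation M f E = \<infinity>" for E
 proof -
  have "\<exists>A\<in>{B \<in> sets M. B \<subseteq> E}. ennreal (\<bar>f E\<bar> + 1) < ennreal (f A)"
   unfolding less_SUP_iff[symmetric] upper_variation_def[symmetric] using E by (simp add: less_top[symmetric])
  then obtain A where A: "A \<in> sets M" "A \<subseteq> E" "ennreal (\<bar>f E\<bar> + 1) < ennreal (f A)" by blast
  from A(3) have fA: "\<bar>f E\<bar> + 1 < f A" by (meson ennreal_leI not_le)
  have eq: "f E = f A + f (E - A)"
   using vector_measure_Int_Diff[OF f A(1), of E] E A(2) by (simp add: Int_absorb1)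
  have "upper_variation M f E \<le> upper_variation M f A + upper_variation M f (E - A)"
   unfolding upper_variation_def[of M f E]
  proof (rule SUP_least, safe)
   fix B assume B: "B \<in> sets M" "B \<subseteq> E"
   have "ennreal (f B) = ennreal (f (B \<inter> A) + f (B - A))" using vector_measure_Int_Diff[OF f A(1) B(1)] by simp
   also have "... \<le> ennreal (f (B \<inter> A)) + ennreal (f (B - A))"
    using ennreal_sum_le[of "%b. if b then f (B \<inter> A) else f (B - A)" UNIV] by (simp add: UNIV_bool add.commute)
   also have "... \<le> upper_variation M f A + upper_variation M f (E - A)"
    using A B by (intro add_mono upper_variation_ge) auto
   finally show "ennreal (f B) \<le> upper_variation M f A + upper_variation M f (E - A)" .
  qed
  then have "upper_variation M f A = \<infinity> \<or> upper_variation M f (E - A) = \<infinity>"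
   using E by (auto simp: top_unique)
  then show ?thesis
  proof
   assume "upper_variation M f A = \<infinity>"
   then show ?thesis using A fA eq by (intro exI[of _ A]) auto
  next
   assume "upper_variation M f (E - A) = \<infinity>"
   moreover have "E - (E - A) = A" using A by auto
   ultimately show ?thesis using A fA E by (intro exI[of _ "E - A"]) auto
  qed
 qed
 obtain E where E: "\<And>n::nat. E n \<in> sets M \<and> upper_variation M f (E n) = \<infinity>"
  "\<And>n. E (Suc n) \<subseteq> E n \<and> \<bar>f (E n - E (Suc n))\<bar> \<ge> 1"
  using dependent_nat_choice[of "%_ E. E \<in> sets M \<and> upper_variation M f E = \<infinity>"
    "%_ E E'. E' \<subseteq> E \<and> \<bar>f (E - E')\<bar> \<ge> 1"] inf split by (metis sets.top)
 have dec: "E m \<subseteq> E n" if "n \<le> m" for n m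
  using lift_Suc_antimono_le[of E, OF _ that] E(2) by blast
 have "disjoint_family (%n. E n - E (Suc n))"
  unfolding disjoint_family_on_def
 proof (intro ballI impI)
  fix m n :: nat assume "m \<noteq> n"
  then consider "Suc m \<le> n" | "Suc n \<le> m" by linarith
  then show "(E m - E (Suc m)) \<inter> (E n - E (Suc n)) = {}" by cases (use dec in blast)+
 qed
 then have "(%n. f (E n - E (Suc n))) \<longlonglongrightarrow> 0"
  using E(1) by (intro summable_LIMSEQ_zero sums_summable[OF vector_measure_sums[OF f]]) auto
 then have "\<forall>\<^sub>F n in sequentially. \<bar>f (E n - E (Suc n))\<bar> < 1"
  using tendsto_rabs_zero order_tendstoD(2)[of _ 0 _ 1] by force
 then obtain n where "\<bar>f (E n - E (Suc n))\<bar> < 1" by (auto simp: eventually_sequentially)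
 then show False using E(2)[of n] by linarith
qed

lemma nonneg_set_function_density:
 assumes "finite_measure M" and f: "vector_measure M f" "abs_cont f M" and pos: "\<And>A. A \<in> sets M ==> f A \<ge> (0::real)"
 shows "\<exists>v. integrable M v \<and> (\<forall>A\<in>sets M. f A = (LINT x:A|M. v x))"
proof -
 interpret finite_measure M by fact
 define N where "N = measure_of (space M) (sets M) (%A. ennreal (f A))"
 have emN: "emeasure N A = ennreal (f A)" if "A \<in> sets M" for A
  unfolding N_def
 proof (rule emeasure_measure_of_sigma[OF _ _ _ that])
  show "sigma_algebra (space M) (sets M)" ..
  show "positive (sets M) (%A. ennreal (f A))" by (simp add: positive_def vector_measure_empty[OF f(1)])
  show "countably_additive (sets M) (%A. ennreal (f A))"
   unfolding countably_additive_def
  proof (intro allI impI)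
   fix A :: "nat => 'a set" assume "range A \<subseteq> sets M" "disjoint_family A" "\<Union> (range A) \<in> sets M"
   then show "(\<Sum>i. ennreal (f (A i))) = ennreal (f (\<Union> (range A)))"
    using pos vector_measure_sums[OF f(1), of A] by (intro suminf_ennreal_eq) auto
  qed
 qed
 have sN: "sets N = sets M" "space N = space M" by (simp_all add: N_def)
 have "absolutely_continuous M N"
  using f(2) emN by (auto simp: absolutely_continuous_def abs_cont_def null_sets_def sN)
 from Radon_Nikodym[OF this sN(1)] obtain h where h: "h \<in> borel_measurable M" "density M h = N" by blast
 have eq: "(\<integral>\<^sup>+x\<in>A. h x \<partial>M) = ennreal (f A)" if "A \<in> sets M" for A
  using emeasure_density[OF h(1) that] h(2) emN[OF that] by simp
 have "(\<integral>\<^sup>+x. h x \<partial>M) = (\<integral>\<^sup>+x\<in>space M. h x \<partial>M)" by (intro nn_integral_cong) auto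
 also have "... = ennreal (f (space M))" by (rule eq) simp
 finally have fin: "(\<integral>\<^sup>+x. h x \<partial>M) \<noteq> \<infinity>" by simp
 then have AE: "AE x in M. h x \<noteq> \<infinity>" by (intro nn_integral_PInf_AE h)
 have "(\<integral>\<^sup>+x. ennreal (enn2real (h x)) \<partial>M) = (\<integral>\<^sup>+x. h x \<partial>M)"
  using AE by (intro nn_integral_cong_AE) (auto simp: less_top)
 then have int: "integrable M (%x. enn2real (h x))"
  using fin h(1) by (intro integrableI_nonneg) (auto simp: less_top)
 have "f A = (LINT x:A|M. enn2real (h x))" if A: "A \<in> sets M" for A
 proof -
  have "(\<integral>\<^sup>+x. ennreal (indicator A x *\<^sub>R enn2real (h x)) \<partial>M) = (\<integral>\<^sup>+x\<in>A. h x \<partial>M)"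
   using AE by (intro nn_integral_cong_AE) (auto simp: less_top indicator_def)
  also have "... = ennreal (f A)" by (rule eq[OF A])
  finally have "(\<integral>\<^sup>+x. ennreal (indicator A x *\<^sub>R enn2real (h x)) \<partial>M) = ennreal (f A)" .
  moreover have "integrable M (%x. indicator A x *\<^sub>R enn2real (h x))"
   by (rule integrable_mult_indicator[OF A int])
  ultimately show ?thesis
   unfolding set_lebesgue_integral_def
   by (subst integral_eq_nn_integral) (use pos[OF A] in auto)
 qed
 then show ?thesis using int by blast
qed

text \<open>The Jordan decomposition \<open>f = U - (U - f)\<close>, where \<open>U\<close> is the
  upper variation: both parts are nonnegative, countably additive and absolutely continuous, and
  finiteness of the variation makes the difference meaningful.\<close>

lemma real_set_function_density:
 assumes "finite_measure M" and f: "vector_measure M f" "abs_cont f M"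
 shows "\<exists>v. integrable M v \<and> (\<forall>A\<in>sets M. f A = (LINT x:A|M. v x :: real))"
proof -
 let ?U = "%A. enn2real (upper_variation M f A)"
 have fin: "upper_variation M f A < \<infinity>" if "A \<in> sets M" for A
  using upper_variation_finite[OF f(1)] upper_variation_mono[OF sets.sets_into_space[OF that], of M f]
  by (metis order_le_less_trans)
 have U: "vector_measure M ?U"
  unfolding vector_measure_def
 proof safe
  fix A :: "nat => _" assume A: "range A \<subseteq> sets M" "disjoint_family A"
  have s: "(\<Sum>i. upper_variation M f (A i)) = upper_variation M f (\<Union>i. A i)"
   using A by (intro upper_variation_add f) auto
  have e: "ennreal (?U (A i)) = upper_variation M f (A i)" for i
   using fin[of "A i"] A by auto
  have "(\<Sum>i. ennreal (?U (A i))) \<noteq> \<infinity>" unfolding e s using fin[of "\<Union>i. A i"] A by auto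
  then have sm: "summable (%i. ?U (A i))" by (intro summable_suminf_not_top) auto
  have "ennreal (\<Sum>i. ?U (A i)) = upper_variation M f (\<Union>i. A i)"
   using suminf_ennreal2[OF _ sm] unfolding e s by auto
  then have "(\<Sum>i. ?U (A i)) = ?U (\<Union>i. A i)"
   by (metis enn2real_ennreal suminf_nonneg sm enn2real_nonneg)
  then show "(%i. ?U (A i)) sums ?U (\<Union>i. A i)" using sm by (metis summable_sums)
 qed
 have ac: "abs_cont ?U M"
  unfolding abs_cont_def
 proof safe
  fix A assume A: "A \<in> sets M" "emeasure M A = 0"
  have "f B = 0" if "B \<in> sets M" "B \<subseteq> A" for B
   using f(2) that A emeasure_mono[OF that(2) A(1)] by (auto simp: abs_cont_def)
  then have "upper_variation M f A = 0" unfolding upper_variation_def by (intro antisym SUP_least) auto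
  then show "?U A = 0" by simp
 qed
 obtain u where u: "integrable M u" "\<And>A. A \<in> sets M ==> ?U A = (LINT x:A|M. u x)"
  using nonneg_set_function_density[OF assms(1) U ac] by auto
 have V: "vector_measure M (%A. ?U A - f A)" "abs_cont (%A. ?U A - f A) M"
 proof -
  show "vector_measure M (%A. ?U A - f A)"
   unfolding vector_measure_def
  proof (intro allI impI)
   fix A :: "nat => 'a set" assume "range A \<subseteq> sets M" "disjoint_family A"
   then show "(%i. ?U (A i) - f (A i)) sums (?U (\<Union> (range A)) - f (\<Union> (range A)))"
    by (intro sums_diff vector_measure_sums[OF U] vector_measure_sums[OF f(1)]) auto
  qed
  show "abs_cont (%A. ?U A - f A) M" using ac f(2) by (simp add: abs_cont_def)
 qed
 have "?U A - f A \<ge> 0" if "A \<in> sets M" for A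
  using upper_variation_ge[OF that order_refl, of f] fin[OF that]
  by (metis diff_ge_0_iff_ge enn2real_mono enn2real_nonneg enn2real_ennreal ennreal_neg infinity_ennreal_def linorder_le_cases order_trans)
 then obtain v where v: "integrable M v" "\<And>A. A \<in> sets M ==> ?U A - f A = (LINT x:A|M. v x)"
  using nonneg_set_function_density[OF assms(1) V] by auto
 have "f A = (LINT x:A|M. u x - v x)" if A: "A \<in> sets M" for A
 proof -
  have "set_integrable M A u" "set_integrable M A v"
   using integrable_mult_indicator[OF A u(1)] integrable_mult_indicator[OF A v(1)]
   by (simp_all add: set_integrable_def)
  from set_integral_diff(2)[OF this] show ?thesis using u(2)[OF A] v(2)[OF A] by linarith
 qed
 then show ?thesis using u v by (intro exI[of _ "%x. u x - v x"]) auto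
qed

text \<open>Guarantees that the choice in the definition of \<open>vector_RN_deriv\<close> really
  picks a density. The density is assembled from its coordinates.\<close>

lemma vector_RN_deriv:
 fixes m :: "'a set => real^2"
 assumes "finite_measure M" and m: "vector_measure M m" "abs_cont m M"
 shows "integrable M (vector_RN_deriv M m)"
  and "\<And>A. A \<in> sets M ==> m A = (LINT x:A|M. vector_RN_deriv M m x)"
proof -
 have "\<exists>v. integrable M v \<and> (\<forall>A\<in>sets M. m A $ i = (LINT x:A|M. v x))" for i
 proof (rule real_set_function_density[OF assms(1)])
  show "vector_measure M (%A. m A $ i)"
   using m(1) unfolding vector_measure_def by (auto intro: bounded_linear.sums[OF bounded_linear_vec_nth])
  show "abs_cont (%A. m A $ i) M" using m(2) by (auto simp: abs_cont_def)
 qed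
 then obtain v where v: "\<And>i. integrable M (v i)" "\<And>i A. A \<in> sets M ==> m A $ i = (LINT x:A|M. v i x)" by metis
 let ?w = "%x. \<Sum>i\<in>UNIV. v i x *\<^sub>R axis i 1 :: real^2"
 have w: "integrable M ?w" using v(1) by (intro Bochner_Integration.integrable_sum integrable_scaleR_left) auto
 have "m A = (LINT x:A|M. ?w x)" if A: "A \<in> sets M" for A
 proof -
  have "(LINT x:A|M. ?w x) = (LINT x|M. (\<Sum>i\<in>UNIV. (indicator A x *\<^sub>R v i x) *\<^sub>R axis i 1))"
   unfolding set_lebesgue_integral_def by (simp add: scaleR_sum_right)
  also have "... = (\<Sum>i\<in>UNIV. (LINT x|M. indicator A x *\<^sub>R v i x) *\<^sub>R axis i 1)"
   using integrable_mult_indicator[OF A v(1)]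
   by (subst Bochner_Integration.integral_sum) auto
  also have "... = (\<Sum>i\<in>UNIV. m A $ i *\<^sub>R axis i 1)"
   using v(2)[OF A] by (simp add: set_lebesgue_integral_def)
  also have "... = m A" by (simp add: vec_eq_iff sum.delta axis_def if_distrib[of "%x. _ * x"] cong: if_cong)
  finally show ?thesis by simp
 qed
 then have "\<exists>v. integrable M v \<and> (\<forall>A\<in>sets M. m A = (LINT x:A|M. v x))" using w by blast
 from someI_ex[OF this] show "integrable M (vector_RN_deriv M m)"
  "\<And>A. A \<in> sets M ==> m A = (LINT x:A|M. vector_RN_deriv M m x)"
  unfolding vector_RN_deriv_def by blast+
qed

section \<open>Test functions\<close>

text \<open>The lift is invariant under the lattice vector \<open>x - y\<close>, hence so is its
  derivative. This permits any representative in place of \<open>rep_torus\<close> in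
  \<open>time_deriv\<close> and \<open>space_grad\<close>.\<close>

lemma lift_fun_derivative_periodic:
 assumes "smooth (lift_fun \<phi>)" "abs_torus x = abs_torus y"
 shows "frechet_derivative (lift_fun \<phi>) (at (t, x)) = frechet_derivative (lift_fun \<phi>) (at (t, y))"
proof -
 let ?f = "lift_fun \<phi>"
 have d: "(?f has_derivative frechet_derivative ?f (at z)) (at z)" for z
  using assms(1) by (auto simp: smooth_def intro: cdiff_has_derivative[of 0] spec[of _ "Suc 0"])
 have "?f (z + (0, x - y)) = ?f z" for z
 proof (cases z)
  case (Pair s w)
  have "abs_torus (w + (x - y)) = abs_torus w" using assms(2) by (simp add: abs_torus_eq_iff)
  then show ?thesis by (simp add: Pair lift_fun_def)
 qed
 then have eq: "(%z. ?f (z + (0, x - y))) = ?f" by auto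
 have "((%z. ?f (z + (0, x - y))) has_derivative (%h. frechet_derivative ?f (at ((t, y) + (0, x - y))) h)) (at (t, y))"
  by (rule has_derivative_compose[OF _ d]) (auto intro!: derivative_eq_intros)
 then have "(?f has_derivative frechet_derivative ?f (at (t, x))) (at (t, y))" unfolding eq by simp
 from frechet_derivative_at[OF this] show ?thesis .
qed

lemma time_deriv_abs:
 "smooth (lift_fun \<phi>) ==> time_deriv \<phi> (t, abs_torus x) = frechet_derivative (lift_fun \<phi>) (at (t, x)) (1, 0)"
 unfolding time_deriv_def using lift_fun_derivative_periodic[of \<phi> x "rep_torus (abs_torus x)"]
 by (simp add: abs_torus_rep)

lemma space_grad_abs:
 "smooth (lift_fun \<phi>) ==> space_grad \<phi> (t, abs_torus x) $ i = frechet_derivative (lift_fun \<phi>) (at (t, x)) (0, axis i 1)"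
 unfolding space_grad_def using lift_fun_derivative_periodic[of \<phi> x "rep_torus (abs_torus x)"]
 by (simp add: abs_torus_rep)

lemma Basis_time: "(1, 0) \<in> (Basis :: (real \<times> (real^2)) set)"
 and Basis_space: "(0, axis i 1) \<in> (Basis :: (real \<times> (real^2)) set)"
 by (auto simp: Basis_prod_def axis_in_Basis_iff)

lemma continuous_time_deriv: "smooth (lift_fun \<phi>) ==> continuous_on UNIV (time_deriv \<phi>)"
proof (rule continuous_prod_torusI)
 assume s: "smooth (lift_fun \<phi>)"
 then have "cdiff (Suc 0) (lift_fun \<phi>)" unfolding smooth_def by blast
 then have "continuous_on UNIV (%z. frechet_derivative (lift_fun \<phi>) (at z) (1, 0))"
  using Basis_time by simp
 then show "continuous_on UNIV (%(t, x). time_deriv \<phi> (t, abs_torus x))"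
  by (simp add: time_deriv_abs[OF s] case_prod_unfold)
qed

lemma continuous_space_grad: "smooth (lift_fun \<phi>) ==> continuous_on UNIV (space_grad \<phi>)"
proof (rule continuous_prod_torusI)
 assume s: "smooth (lift_fun \<phi>)"
 then have "cdiff (Suc 0) (lift_fun \<phi>)" unfolding smooth_def by blast
 then have "continuous_on UNIV (%z. frechet_derivative (lift_fun \<phi>) (at z) (0, axis i 1))" for i
  using Basis_space by simp
 then have "continuous_on UNIV (%z. \<chi> i. frechet_derivative (lift_fun \<phi>) (at z) (0, axis i 1))"
  by (intro continuous_on_vec_lambda) auto
 moreover have "space_grad \<phi> (t, abs_torus x) = (\<chi> i. frechet_derivative (lift_fun \<phi>) (at (t, x)) (0, axis i 1))" for t x
  by (simp add: vec_eq_iff space_grad_abs[OF s])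
 ultimately show "continuous_on UNIV (%(t, x). space_grad \<phi> (t, abs_torus x))"
  by (simp add: case_prod_unfold)
qed

lemma continuous_bounded_QT:
 fixes f :: "real \<times> torus => 'b::real_normed_vector"
 assumes "continuous_on UNIV f"
 shows "\<exists>B. \<forall>z\<in>QT T. norm (f z) \<le> B"
proof -
 have "compact ({-T..T} \<times> (UNIV :: torus set))" by (intro compact_Times compact_torus compact_Icc)
 then have "bounded (f ` ({-T..T} \<times> UNIV))"
  using assms by (intro compact_imp_bounded compact_continuous_image) (auto intro: continuous_on_subset)
 then obtain B where "\<And>z. z \<in> {-T..T} \<times> UNIV ==> norm (f z) \<le> B" by (auto simp: bounded_iff)
 then show ?thesis by (intro exI[of _ B]) (auto simp: QT_def)
qed

section \<open>Push-forward of fluxes\<close>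

text \<open>The hypothesis on sets says that \<open>u\<close>, composed with \<open>P\<close>, is
  the conditional expectation of \<open>v\<close> given \<open>P\<close>. The conclusion is its
  defining property against functions of \<open>P\<close>, first for simple ones.\<close>

lemma simple_function_push:
 fixes F u v :: "_ => real"
 assumes F: "simple_function N F" and P: "P \<in> measurable M N" "N = distr M N P"
  and u: "integrable N u" and v: "integrable M v"
  and eq: "\<And>A. A \<in> sets N ==> (LINT x:A|N. u x) = (LINT z:P -` A \<inter> space M|M. v z)"
 shows "(LINT x|N. F x * u x) = (LINT z|M. F (P z) * v z)"
proof -
 let ?A = "%y. F -` {y} \<inter> space N"
 have fin: "finite (F ` space N)" and A: "?A y \<in> sets N" for y
  using F by (auto simp: simple_functionD)
 have rep: "F x = (\<Sum>y\<in>F ` space N. indicator (?A y) x * y)" if "x \<in> space N" for x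
  using simple_function_indicator_representation_banach[OF F that] unfolding real_scaleR_def .
 have "(LINT x|N. F x * u x) = (LINT x|N. (\<Sum>y\<in>F ` space N. y * (indicator (?A y) x *\<^sub>R u x)))"
 proof (rule Bochner_Integration.integral_cong[OF refl])
  fix x assume "x \<in> space N"
  then show "F x * u x = (\<Sum>y\<in>F ` space N. y * (indicator (?A y) x *\<^sub>R u x))"
   unfolding rep[OF \<open>x \<in> space N\<close>] by (simp add: sum_distrib_left sum_distrib_right mult_ac)
 qed
 also have "... = (\<Sum>y\<in>F ` space N. y * (LINT x:?A y|N. u x))"
  unfolding set_lebesgue_integral_def
  using integrable_mult_indicator[OF A u] by (subst Bochner_Integration.integral_sum) auto
 also have "... = (\<Sum>y\<in>F ` space N. y * (LINT z:P -` ?A y \<inter> space M|M. v z))"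
  using eq[OF A] by simp
 also have "... = (LINT z|M. (\<Sum>y\<in>F ` space N. y * (indicator (P -` ?A y \<inter> space M) z *\<^sub>R v z)))"
  unfolding set_lebesgue_integral_def
  using integrable_mult_indicator[OF measurable_sets[OF P(1) A] v] by (subst Bochner_Integration.integral_sum) auto
 also have "... = (LINT z|M. F (P z) * v z)"
 proof (rule Bochner_Integration.integral_cong[OF refl])
  fix z assume z: "z \<in> space M"
  have Pz: "P z \<in> space N" using measurable_space[OF P(1) z] .
  show "(\<Sum>y\<in>F ` space N. y * (indicator (P -` ?A y \<inter> space M) z *\<^sub>R v z)) = F (P z) * v z"
   unfolding rep[OF Pz] sum_distrib_right using z by (intro sum.cong refl) (simp add: indicator_def)
 qed
 finally show ?thesis .
qed

lemma bounded_function_push: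
 fixes g u v :: "_ => real"
 assumes g: "g \<in> borel_measurable N" "\<And>x. x \<in> space N ==> \<bar>g x\<bar> \<le> B" and P: "P \<in> measurable M N" "N = distr M N P"
  and u: "integrable N u" and v: "integrable M v"
  and eq: "\<And>A. A \<in> sets N ==> (LINT x:A|N. u x) = (LINT z:P -` A \<inter> space M|M. v z)"
 shows "(LINT x|N. g x * u x) = (LINT z|M. g (P z) * v z)"
proof -
 obtain F where F: "\<And>i. simple_function N (F i)" "\<And>x. x \<in> space N ==> (%i. F i x) \<longlonglongrightarrow> g x"
  "\<And>i x. x \<in> space N ==> dist (F i x) 0 \<le> 2 * dist (g x) 0"
  using borel_measurable_implies_sequence_metric[OF g(1), of 0] by metis
 have bd: "\<bar>F i x\<bar> \<le> 2 * B" if "x \<in> space N" for i x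
  using F(3)[OF that, of i] g(2)[OF that] by simp
 have Fm: "F i \<in> borel_measurable N" for i using F(1) by (rule borel_measurable_simple_function)
 have "(%i. LINT x|N. F i x * u x) \<longlonglongrightarrow> (LINT x|N. g x * u x)"
 proof (rule integral_dominated_convergence[where w="%x. 2 * B * \<bar>u x\<bar>"])
  show "AE x in N. norm (F i x * u x) \<le> 2 * B * \<bar>u x\<bar>" for i
   using bd by (auto simp: abs_mult intro!: mult_right_mono)
 qed (use g u Fm F(2) in \<open>auto intro!: tendsto_mult\<close>)
 moreover have "(%i. LINT z|M. F i (P z) * v z) \<longlonglongrightarrow> (LINT z|M. g (P z) * v z)"
 proof (rule integral_dominated_convergence[where w="%z. 2 * B * \<bar>v z\<bar>"])
  show "AE z in M. norm (F i (P z) * v z) \<le> 2 * B * \<bar>v z\<bar>" for i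
   using bd measurable_space[OF P(1)] by (auto simp: abs_mult intro!: mult_right_mono)
 qed (use v F(2) measurable_space[OF P(1)] measurable_compose[OF P(1) g(1)] measurable_compose[OF P(1) Fm]
   in \<open>auto intro!: tendsto_mult\<close>)
 moreover have "(LINT x|N. F i x * u x) = (LINT z|M. F i (P z) * v z)" for i
  by (rule simple_function_push[OF F(1) P u v eq])
 ultimately show ?thesis using LIMSEQ_unique by simp
qed

abbreviation borel_QT :: "real => (real \<times> torus) measure"
 where "borel_QT T \<equiv> restrict_space borel (QT T)"

lemma open_QT: "open (QT T)"
 unfolding QT_def by (intro open_Times) auto

lemma sets_borel_QT: "A \<in> sets (borel_QT T) \<longleftrightarrow> A \<in> sets borel \<and> A \<subseteq> QT T"
 using open_QT[of T] by (auto simp: sets_restrict_space_iff)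

lemma space_borel_QT [simp]: "space (borel_QT T) = QT T"
 by (simp add: space_restrict_space)

lemma continuous_measurable_QT:
 "continuous_on UNIV f ==> f \<in> borel_measurable (borel_QT T)"
 by (intro measurable_restrict_space1 borel_measurable_continuous_onI)

text \<open>Competitors arise as images of moving particles: \<open>P\<close> is the position in
  space-time and \<open>w\<close> the spatial velocity. The flux is the push-forward of
  \<open>w M\<close>, so its density is the conditional expectation of \<open>w\<close> given
  \<open>P\<close>; the energy inequality is Jensen's inequality for it.\<close>

lemma flux_push_forward:
 fixes w :: "'a => real^2"
 assumes M: "finite_measure M" and P: "P \<in> measurable M (borel_QT T)" and w: "integrable M w"
  and weak: "\<And>\<phi>. test_function T \<phi> ==>
   (LINT z|M. time_deriv \<phi> (P z)) + (LINT z|M. space_grad \<phi> (P z) \<bullet> w z) = 0"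
 shows "\<exists>m\<in>fluxes T (distr M (borel_QT T) P). \<forall>A\<in>sets (borel_QT T).
   (\<integral>\<^sup>+ x\<in>A. ennreal ((norm (vector_RN_deriv (distr M (borel_QT T) P) m x))\<^sup>2) \<partial>distr M (borel_QT T) P)
    \<le> (\<integral>\<^sup>+ z\<in>P -` A. ennreal ((norm (w z))\<^sup>2) \<partial>M)"
proof -
 interpret M: finite_measure M by fact
 define N where "N = distr M (borel_QT T) P"
 have sN: "sets N = sets (borel_QT T)" "space N = QT T" by (simp_all add: N_def)
 interpret N: finite_measure N unfolding N_def by (rule M.finite_measure_distr[OF P])
 have PN: "P \<in> measurable M N" "N = distr M N P"
  using P by (simp_all add: N_def cong: measurable_cong_sets distr_cong)
 define m where "m A = (LINT z:P -` A \<inter> space M|M. w z)" for A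
 have setP: "P -` A \<inter> space M \<in> sets M" if "A \<in> sets N" for A
  using measurable_sets[OF PN(1) that] .
 have int: "set_integrable M (P -` A \<inter> space M) w" if "A \<in> sets N" for A
  unfolding set_integrable_def by (rule integrable_mult_indicator[OF setP[OF that] w])
 have vm: "vector_measure N m"
  unfolding vector_measure_def
 proof (intro allI impI)
  fix A :: "nat => (real \<times> torus) set" assume A: "range A \<subseteq> sets N" "disjoint_family A"
  let ?B = "%i. P -` A i \<inter> space M"
  have A': "A i \<in> sets N" for i using A(1) by auto
  have "(%n. LINT z:(\<Union>i<n. ?B i)|M. w z) \<longlonglongrightarrow> (LINT z:(\<Union>n. \<Union>i<n. ?B i)|M. w z)"
  proof (rule set_integral_cont_up)
   show "(\<Union>i<n. ?B i) \<in> sets M" for n using setP[OF A'] by (intro sets.finite_UN) auto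
   then show "set_integrable M (\<Union>n. \<Union>i<n. ?B i) w"
    unfolding set_integrable_def by (intro integrable_mult_indicator w sets.countable_UN) auto
   show "incseq (%n. \<Union>i<n. ?B i)" by (fastforce simp: incseq_def)
  qed
  also have "(%n. LINT z:(\<Union>i<n. ?B i)|M. w z) = (%n. \<Sum>i<n. m (A i))"
  proof -
   have "disjoint_family_on ?B {..<n}" for n
    using A(2) unfolding disjoint_family_on_def by blast
   then show ?thesis
    unfolding m_def using int[OF A'] setP[OF A'] by (intro ext set_integral_finite_Union) auto
  qed
  also have "(LINT z:(\<Union>n. \<Union>i<n. ?B i)|M. w z) = m (\<Union>i. A i)"
   unfolding m_def by (rule arg_cong[where f="%B. LINT z:B|M. w z"]) auto
  finally show "(%i. m (A i)) sums m (\<Union>i. A i)" by (simp add: sums_def)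
 qed
 have ac: "abs_cont m N"
  unfolding abs_cont_def
 proof (intro ballI impI)
  fix A assume A: "A \<in> sets N" "emeasure N A = 0"
  then have "P -` A \<inter> space M \<in> null_sets M"
   using setP[OF A(1)] by (metis PN emeasure_distr null_setsI)
  then have "AE z in M. z \<notin> P -` A \<inter> space M" by (rule AE_not_in)
  then show "m A = 0"
   unfolding m_def set_lebesgue_integral_def by (intro integral_eq_zero_AE) (auto elim!: eventually_mono)
 qed
 define v where "v = vector_RN_deriv N m"
 have v: "integrable N v" "\<And>A. A \<in> sets N ==> m A = (LINT x:A|N. v x)"
  using vector_RN_deriv[OF N.finite_measure_axioms vm ac] by (auto simp: v_def)
 have vi: "integrable N (%x. v x $ i)" and wi: "integrable M (%x. w x $ i)" for i
  using v(1) w by (auto intro: integrable_bounded_linear[OF bounded_linear_vec_nth])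
 have push: "(LINT x|N. g x * v x $ i) = (LINT z|M. g (P z) * w z $ i)"
  if g: "g \<in> borel_measurable N" "\<And>x. x \<in> QT T ==> \<bar>g x\<bar> \<le> B" for g :: "_ => real" and B i
 proof (rule bounded_function_push[OF g(1) _ PN vi wi])
  fix A assume A: "A \<in> sets N"
  have "(LINT x:A|N. v x $ i) = (LINT x:A|N. v x) $ i"
   unfolding set_lebesgue_integral_def
   using integral_bounded_linear[OF bounded_linear_vec_nth integrable_mult_indicator[OF A v(1)], of i] by simp
  also have "... = (LINT z:P -` A \<inter> space M|M. w z) $ i" using v(2)[OF A] by (simp add: m_def)
  also have "... = (LINT z:P -` A \<inter> space M|M. w z $ i)"
   unfolding set_lebesgue_integral_def
   using integral_bounded_linear[OF bounded_linear_vec_nth integrable_mult_indicator[OF setP[OF A] w], of i] by simp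
  finally show "(LINT x:A|N. v x $ i) = (LINT z:P -` A \<inter> space M|M. w z $ i)" .
 qed (use g sN in auto)
 have push2: "(LINT x|N. g x \<bullet> v x) = (LINT z|M. g (P z) \<bullet> w z)"
   "integrable N (%x. g x \<bullet> v x)" "integrable M (%z. g (P z) \<bullet> w z)"
  if g: "g \<in> borel_measurable N" "\<And>x. x \<in> QT T ==> norm (g x) \<le> B" for g :: "_ => real^2" and B
 proof -
  have gi: "(%x. g x $ i) \<in> borel_measurable N" for i
   by (rule measurable_compose[OF g(1)]) (intro borel_measurable_continuous_onI continuous_intros)
  have gb: "\<bar>g x $ i\<bar> \<le> B" if "x \<in> QT T" for x i
   using g(2)[OF that] component_le_norm_cart[of "g x" i] by linarith
  have i1: "integrable N (%x. g x $ i * v x $ i)" for i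
   by (rule Bochner_Integration.integrable_bound[OF integrable_mult_right[OF vi[of i], of B]])
    (use gi gb borel_measurable_integrable[OF vi] sN in \<open>auto simp: abs_mult intro!: mult_mono order_trans[OF gb]\<close>)
  have i2: "integrable M (%z. g (P z) $ i * w z $ i)" for i
   by (rule Bochner_Integration.integrable_bound[OF integrable_mult_right[OF wi[of i], of B]])
    (use measurable_compose[OF PN(1) gi] gb borel_measurable_integrable[OF wi] measurable_space[OF PN(1)] sN
      in \<open>auto simp: abs_mult intro!: mult_mono order_trans[OF gb]\<close>)
  show "integrable N (%x. g x \<bullet> v x)" "integrable M (%z. g (P z) \<bullet> w z)"
   unfolding inner_vec_def inner_real_def by (intro Bochner_Integration.integrable_sum i1 i2)+
  show "(LINT x|N. g x \<bullet> v x) = (LINT z|M. g (P z) \<bullet> w z)"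
   unfolding inner_vec_def inner_real_def
   using push[OF gi gb] i1 i2 by (subst (1 2) Bochner_Integration.integral_sum) auto
 qed
 have "m \<in> fluxes T N"
  unfolding fluxes_def
 proof (intro CollectI conjI allI impI vm ac)
  fix \<phi> assume \<phi>: "test_function T \<phi>"
  then have s: "smooth (lift_fun \<phi>)" by (simp add: test_function_def)
  have "(LINT x|N. time_deriv \<phi> x) = (LINT z|M. time_deriv \<phi> (P z))"
   unfolding N_def by (rule integral_distr[OF P]) (rule continuous_measurable_QT[OF continuous_time_deriv[OF s]])
  moreover obtain B where "\<And>x. x \<in> QT T ==> norm (space_grad \<phi> x) \<le> B"
   using continuous_bounded_QT[OF continuous_space_grad[OF s]] by blast
  then have "(LINT x|N. space_grad \<phi> x \<bullet> v x) = (LINT z|M. space_grad \<phi> (P z) \<bullet> w z)"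
   using continuous_measurable_QT[OF continuous_space_grad[OF s], of T] sN(1)
   by (intro push2) (auto cong: measurable_cong_sets)
  ultimately show "(LINT z|N. time_deriv \<phi> z) + (LINT z|N. space_grad \<phi> z \<bullet> vector_RN_deriv N m z) = 0"
   using weak[OF \<phi>] by (simp add: v_def)
 qed
 moreover have "(\<integral>\<^sup>+ x\<in>A. ennreal ((norm (v x))\<^sup>2) \<partial>N) \<le> (\<integral>\<^sup>+ z\<in>P -` A. ennreal ((norm (w z))\<^sup>2) \<partial>M)"
  if A: "A \<in> sets N" for A
 proof (cases "(\<integral>\<^sup>+ z\<in>P -` A. ennreal ((norm (w z))\<^sup>2) \<partial>M) = \<infinity>")
  case False
  have [measurable]: "v \<in> borel_measurable N" "w \<in> borel_measurable M"
   using v(1) w by auto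
  have [measurable]: "A \<in> sets N" "P \<in> measurable M N" by fact+
  have eqP: "(\<integral>\<^sup>+ z\<in>P -` A. ennreal ((norm (w z))\<^sup>2) \<partial>M) = (\<integral>\<^sup>+ z. ennreal (indicator (P -` A \<inter> space M) z * (norm (w z))\<^sup>2) \<partial>M)"
   by (intro nn_integral_cong) (auto simp: indicator_def)
  have intw: "integrable M (%z. indicator (P -` A \<inter> space M) z * (norm (w z))\<^sup>2)"
   using False unfolding eqP by (intro integrableI_nonneg) (auto simp: less_top)
  \<comment> \<open>The density \<open>v\<close> is so far only integrable, so it is truncated at
    norm \<open>n\<close>. The truncation \<open>g\<close> is a legitimate bounded test field, and
    \<open>g \<bullet> v = |g|^2\<close>.\<close>
  have le: "(\<integral>\<^sup>+ x\<in>A \<inter> {x \<in> space N. norm (v x) \<le> real n}. ennreal ((norm (v x))\<^sup>2) \<partial>N)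
    \<le> (\<integral>\<^sup>+ z\<in>P -` A. ennreal ((norm (w z))\<^sup>2) \<partial>M)" (is "?l \<le> _") for n
  proof -
   let ?A = "A \<inter> {x \<in> space N. norm (v x) \<le> real n}"
   define g where "g x = indicator ?A x *\<^sub>R v x" for x
   have gm: "g \<in> borel_measurable N" unfolding g_def by measurable
   have gb: "norm (g x) \<le> real n" for x by (simp add: g_def indicator_def)
   have gg: "g x \<bullet> v x = (norm (g x))\<^sup>2" for x
    by (simp add: g_def indicator_def power2_norm_eq_inner)
   note p = push2[OF gm gb]
   have "integrable M (%z. (norm (g (P z)))\<^sup>2)"
    by (rule M.integrable_const_bound[where B="(real n)\<^sup>2"])
     (use gb measurable_compose[OF PN(1) gm] in \<open>auto intro!: power_mono\<close>)
   note ig = this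
   have "(LINT x|N. (norm (g x))\<^sup>2) = (LINT z|M. (norm (g (P z)))\<^sup>2)"
    by (subst PN(2), rule integral_distr[OF PN(1)]) (use gm in measurable)
   moreover have "(LINT x|N. (norm (g x))\<^sup>2) = (LINT z|M. g (P z) \<bullet> w z)"
    using p(1) by (simp add: gg)
   \<comment> \<open>The integrals of \<open>g(P) \<bullet> w\<close> and of \<open>|g(P)|^2\<close>
     coincide, so the left side equals the integral of \<open>|g|^2\<close>; the pointwise bound is
     the nonnegativity of \<open>|g(P) - w|^2\<close>.\<close>
   moreover have "(LINT z|M. 2 * (g (P z) \<bullet> w z) - (norm (g (P z)))\<^sup>2)
     \<le> (LINT z|M. indicator (P -` A \<inter> space M) z * (norm (w z))\<^sup>2)"
   proof (rule integral_mono)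
    show "2 * (g (P z) \<bullet> w z) - (norm (g (P z)))\<^sup>2 \<le> indicator (P -` A \<inter> space M) z * (norm (w z))\<^sup>2"
     if "z \<in> space M" for z
    proof (cases "P z \<in> A")
     case True
     have "0 \<le> (norm (g (P z) - w z))\<^sup>2" by simp
     then show ?thesis using True that
      by (simp add: power2_norm_eq_inner inner_diff_left inner_diff_right inner_commute)
    next
     case False
     then show ?thesis by (simp add: g_def)
    qed
   qed (use intw ig p(3) in auto)
   ultimately have "(LINT x|N. (norm (g x))\<^sup>2) \<le> (LINT z|M. indicator (P -` A \<inter> space M) z * (norm (w z))\<^sup>2)"
    using p(3) ig by (simp add: Bochner_Integration.integral_diff)
   then have "ennreal (LINT x|N. (norm (g x))\<^sup>2) \<le> ennreal (LINT z|M. indicator (P -` A \<inter> space M) z * (norm (w z))\<^sup>2)"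
    by (rule ennreal_leI)
   also have "... = (\<integral>\<^sup>+ z. ennreal (indicator (P -` A \<inter> space M) z * (norm (w z))\<^sup>2) \<partial>M)"
    by (rule nn_integral_eq_integral[symmetric, OF intw]) auto
   also have "ennreal (LINT x|N. (norm (g x))\<^sup>2) = (\<integral>\<^sup>+ x. ennreal ((norm (g x))\<^sup>2) \<partial>N)"
   proof (rule nn_integral_eq_integral[symmetric])
    show "integrable N (%x. (norm (g x))\<^sup>2)"
     by (rule N.integrable_const_bound[where B="(real n)\<^sup>2"]) (use gb gm in \<open>auto intro!: power_mono\<close>)
   qed auto
   also have "... = ?l"
    by (intro nn_integral_cong) (auto simp: g_def indicator_def)
   finally show ?thesis unfolding eqP .
  qed
  let ?D = "density N (%x. ennreal ((norm (v x))\<^sup>2))"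
  have "(\<integral>\<^sup>+ x\<in>A. ennreal ((norm (v x))\<^sup>2) \<partial>N) = emeasure ?D A"
   by (simp add: emeasure_density)
  also have "... = emeasure ?D (\<Union>n. A \<inter> {x \<in> space N. norm (v x) \<le> real n})"
  proof (rule arg_cong[where f="emeasure ?D"])
   show "A = (\<Union>n. A \<inter> {x \<in> space N. norm (v x) \<le> real n})"
    using sets.sets_into_space[OF A] real_arch_simple by blast
  qed
  also have "... = (SUP n. emeasure ?D (A \<inter> {x \<in> space N. norm (v x) \<le> real n}))"
   by (rule SUP_emeasure_incseq[symmetric]) (auto simp: incseq_def)
  also have "... \<le> (\<integral>\<^sup>+ z\<in>P -` A. ennreal ((norm (w z))\<^sup>2) \<partial>M)"
   using le by (intro SUP_least) (simp add: emeasure_density)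
  finally show ?thesis .
 qed auto
 ultimately show ?thesis using sN unfolding N_def v_def by blast
qed

section \<open>Disintegrations\<close>

lemma kernel_measurable:
 assumes \<sigma>: "\<And>t. t \<in> space M ==> finite_borel (\<sigma> t)"
  "\<And>B. B \<in> sets borel ==> (%t. emeasure (\<sigma> t) B) \<in> borel_measurable M"
 shows "A \<in> sets (M \<Otimes>\<^sub>M borel) ==> (%t. emeasure (\<sigma> t) (Pair t -` A)) \<in> borel_measurable M"
proof -
 note fb = \<sigma>(1)[unfolded finite_borel_def]
 have space\<sigma>: "space (\<sigma> t) = UNIV" if "t \<in> space M" for t
  using fb[OF that] sets_eq_imp_space_eq[of "\<sigma> t" borel] by simp
 assume A: "A \<in> sets (M \<Otimes>\<^sub>M borel)"
 have "Int_stable {a \<times> b | a b. a \<in> sets M \<and> b \<in> sets (borel :: torus measure)}"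
  by (rule Int_stable_pair_measure_generator)
 moreover have "{a \<times> b | a b. a \<in> sets M \<and> b \<in> sets (borel :: torus measure)} \<subseteq> Pow (space M \<times> space borel)"
  by (rule pair_measure_closed)
 moreover have "A \<in> sigma_sets (space M \<times> space borel) {a \<times> b | a b. a \<in> sets M \<and> b \<in> sets (borel :: torus measure)}"
  using A unfolding sets_pair_measure .
 ultimately show ?thesis
 proof (induction rule: sigma_sets_induct_disjoint)
  case (basic A)
  then obtain a b where ab: "A = a \<times> b" "a \<in> sets M" "b \<in> sets borel" by auto
  have "(%t. emeasure (\<sigma> t) (Pair t -` A)) \<in> borel_measurable M
    \<longleftrightarrow> (%t. indicator a t * emeasure (\<sigma> t) b) \<in> borel_measurable M"
   by (intro measurable_cong) (auto simp: ab indicator_def vimage_def)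
  then show ?case using ab \<sigma>(2)[OF ab(3)] by simp
 next
  case empty
  then show ?case by simp
 next
  case (compl A)
  have A: "Pair t -` A \<in> sets borel" if "t \<in> space M" for t
   using compl(1) that unfolding sets_pair_measure[symmetric] by (intro sets_Pair1)
  have "(%t. emeasure (\<sigma> t) (Pair t -` (space M \<times> space borel - A))) \<in> borel_measurable M
    \<longleftrightarrow> (%t. emeasure (\<sigma> t) UNIV - emeasure (\<sigma> t) (Pair t -` A)) \<in> borel_measurable M"
  proof (rule measurable_cong)
   fix t assume t: "t \<in> space M"
   interpret finite_measure "\<sigma> t" using fb[OF t] by simp
   have "Pair t -` (space M \<times> space borel - A) = UNIV - Pair t -` A" using t by auto
   then show "emeasure (\<sigma> t) (Pair t -` (space M \<times> space borel - A)) = emeasure (\<sigma> t) UNIV - emeasure (\<sigma> t) (Pair t -` A)"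
    using emeasure_compl[of "Pair t -` A" "\<sigma> t"] A[OF t] fb[OF t] space\<sigma>[OF t] by simp
  qed
  moreover have "(%t. emeasure (\<sigma> t) UNIV - emeasure (\<sigma> t) (Pair t -` A)) \<in> borel_measurable M"
   using \<sigma>(2)[of UNIV] compl(2) by measurable
  ultimately show ?case by simp
 next
  case (union A)
  have A: "Pair t -` A i \<in> sets borel" if "t \<in> space M" for t i
   using union(2) that unfolding sets_pair_measure[symmetric] by (intro sets_Pair1) auto
  have "(%t. emeasure (\<sigma> t) (Pair t -` (\<Union>i. A i))) \<in> borel_measurable M
    \<longleftrightarrow> (%t. \<Sum>i. emeasure (\<sigma> t) (Pair t -` A i)) \<in> borel_measurable M"
  proof (rule measurable_cong)
   fix t assume t: "t \<in> space M"
   have "disjoint_family (%i. Pair t -` A i)" using union(1) by (auto simp: disjoint_family_on_def)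
   then show "emeasure (\<sigma> t) (Pair t -` (\<Union>i. A i)) = (\<Sum>i. emeasure (\<sigma> t) (Pair t -` A i))"
    using suminf_emeasure[of "%i. Pair t -` A i" "\<sigma> t"] A[OF t] fb[OF t] by (simp add: vimage_UN image_subset_iff)
  qed
  moreover have "(%t. \<Sum>i. emeasure (\<sigma> t) (Pair t -` A i)) \<in> borel_measurable M"
   using union(3) by measurable
  ultimately show ?case by simp
 qed
qed

abbreviation lborel_I :: "real => real measure"
 where "lborel_I T \<equiv> restrict_space lborel {-T<..<T}"

lemma space_lborel_I [simp]: "space (lborel_I T) = {-T<..<T}"
 by (simp add: space_restrict_space)

lemma measurable_lborel_I_iff: "f \<in> borel_measurable (restrict_space borel {-T<..<T}) \<longleftrightarrow> f \<in> borel_measurable (lborel_I T)"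
 by (intro measurable_cong_sets[THEN eqset_imp_iff] sets_restrict_space_cong) auto

lemma AE_lborel_I: "(AE t in lborel_I T. P t) \<longleftrightarrow> (AE t in lborel. t \<in> {-T<..<T} \<longrightarrow> P t)"
 by (intro AE_restrict_space_iff) auto

lemma sets_borel_QT_pair:
 assumes "A \<in> sets (borel_QT T)"
 shows "A \<in> sets (restrict_space borel {-T<..<T} \<Otimes>\<^sub>M (borel :: torus measure))" (is "_ \<in> sets ?M")
proof -
 have "(%z. (fst z, snd z)) \<in> measurable ?M (borel \<Otimes>\<^sub>M borel)"
  by (intro measurable_Pair measurable_compose[OF measurable_fst] measurable_snd measurable_restrict_space1) auto
 then have "(%z. (fst z, snd z)) \<in> measurable ?M borel" by (simp add: borel_prod)
 from measurable_sets[OF this, of A] assms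
 have "(%z. (fst z, snd z)) -` A \<inter> space ?M \<in> sets ?M" by (simp add: sets_borel_QT)
 moreover have "(%z. (fst z, snd z)) -` A \<inter> space ?M = A"
  using assms unfolding sets_borel_QT by (auto simp: QT_def space_pair_measure space_restrict_space)
 ultimately show ?thesis by simp
qed

lemma measurable_slice_QT:
 assumes "f \<in> borel_measurable (borel_QT T)" "t \<in> {-T<..<T}"
 shows "(%p. f (t, p)) \<in> borel_measurable borel"
proof (rule measurable_compose[OF _ assms(1)])
 show "Pair t \<in> measurable borel (borel_QT T)"
  using assms(2) by (intro measurable_restrict_space2) (auto simp: QT_def intro!: borel_measurable_continuous_onI continuous_intros)
qed

lemma disintegrationD:
 assumes "is_disintegration T \<mu> \<sigma>" "t \<in> {-T<..<T}"
 shows "sets (\<sigma> t) = sets borel" "space (\<sigma> t) = UNIV" "finite_measure (\<sigma> t)"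
 using assms sets_eq_imp_space_eq[of "\<sigma> t" borel] by (auto simp: is_disintegration_def finite_borel_def)

lemma disintegration_emeasure:
 assumes "is_disintegration T \<mu> \<sigma>" "sets \<mu> = sets (borel_QT T)" "A \<in> sets (borel_QT T)"
 shows "emeasure \<mu> A = (\<integral>\<^sup>+ t. emeasure (\<sigma> t) (Pair t -` A) \<partial>lborel_I T)"
 using assms by (simp add: is_disintegration_def nn_integral_restrict_space)

lemma disintegration_nn_integral_cong:
 assumes "\<And>t. t \<in> {-T<..<T} ==> (\<integral>\<^sup>+p. f (t, p) \<partial>\<sigma> t) = g t" "g \<in> borel_measurable (lborel_I T)" "X = (\<integral>\<^sup>+t. g t \<partial>lborel_I T)"
 shows "(%t. \<integral>\<^sup>+p. f (t, p) \<partial>\<sigma> t) \<in> borel_measurable (lborel_I T) \<and> X = (\<integral>\<^sup>+t. \<integral>\<^sup>+p. f (t, p) \<partial>\<sigma> t \<partial>lborel_I T)"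
proof -
 have e: "(\<integral>\<^sup>+p. f (t, p) \<partial>\<sigma> t) = g t" if "t \<in> space (lborel_I T)" for t using assms(1) that by simp
 have "(%t. \<integral>\<^sup>+p. f (t, p) \<partial>\<sigma> t) \<in> borel_measurable (lborel_I T) \<longleftrightarrow> g \<in> borel_measurable (lborel_I T)"
  by (intro measurable_cong e)
 moreover have "(\<integral>\<^sup>+t. \<integral>\<^sup>+p. f (t, p) \<partial>\<sigma> t \<partial>lborel_I T) = (\<integral>\<^sup>+t. g t \<partial>lborel_I T)" by (intro nn_integral_cong e)
 ultimately show ?thesis using assms(2,3) by simp
qed

lemma disintegration_nn_integral:
 assumes \<sigma>: "is_disintegration T \<mu> \<sigma>" and \<mu>: "sets \<mu> = sets (borel_QT T)"
  and f: "f \<in> borel_measurable (borel_QT T)"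
 shows "(%t. \<integral>\<^sup>+p. f (t, p) \<partial>\<sigma> t) \<in> borel_measurable (lborel_I T) \<and>
  (\<integral>\<^sup>+z. f z \<partial>\<mu>) = (\<integral>\<^sup>+t. \<integral>\<^sup>+p. f (t, p) \<partial>\<sigma> t \<partial>lborel_I T)"
 using f
proof (induction rule: borel_measurable_induct)
 case (cong f g)
 have "(\<integral>\<^sup>+z. f z \<partial>\<mu>) = (\<integral>\<^sup>+z. g z \<partial>\<mu>)"
  using cong(3) sets_eq_imp_space_eq[OF \<mu>] by (intro nn_integral_cong) auto
 moreover have "(\<integral>\<^sup>+p. f (t, p) \<partial>\<sigma> t) = (\<integral>\<^sup>+p. g (t, p) \<partial>\<sigma> t)" if "t \<in> {-T<..<T}" for t
  using cong(3)[of "(t, _)"] that unfolding space_borel_QT by (intro nn_integral_cong) (auto simp: QT_def)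
 ultimately show ?case using cong(4) by (intro disintegration_nn_integral_cong) auto
next
 case (set A)
 have 1: "(\<integral>\<^sup>+p. indicator A (t, p) \<partial>\<sigma> t) = emeasure (\<sigma> t) (Pair t -` A)" if "t \<in> {-T<..<T}" for t
 proof -
  have "Pair t -` A \<in> sets (\<sigma> t)"
   using measurable_sets[OF measurable_slice_QT[OF borel_measurable_indicator[OF set] that], of "{1::ennreal}"]
    disintegrationD(1)[OF \<sigma> that] by (simp add: vimage_def indicator_def)
  then have "emeasure (\<sigma> t) (Pair t -` A) = (\<integral>\<^sup>+p. indicator (Pair t -` A) p \<partial>\<sigma> t)" by simp
  then show ?thesis by (simp add: indicator_def)
 qed
 have "(%t. emeasure (\<sigma> t) (Pair t -` A)) \<in> borel_measurable (lborel_I T)"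
  using \<sigma> sets_borel_QT_pair[OF set] unfolding measurable_lborel_I_iff[symmetric]
  by (intro kernel_measurable[where M="restrict_space borel {-T<..<T}"]) (auto simp: is_disintegration_def space_restrict_space)
 from disintegration_nn_integral_cong[OF 1 this] show ?case using disintegration_emeasure[OF \<sigma> \<mu> set] set \<mu> by simp
next
 case (mult u c)
 have "(\<integral>\<^sup>+p. c * u (t, p) \<partial>\<sigma> t) = c * (\<integral>\<^sup>+p. u (t, p) \<partial>\<sigma> t)" if "t \<in> {-T<..<T}" for t
  using measurable_slice_QT[OF mult(2) that] disintegrationD(1)[OF \<sigma> that]
  by (intro nn_integral_cmult) (auto cong: measurable_cong_sets)
 moreover have "(\<integral>\<^sup>+z. c * u z \<partial>\<mu>) = c * (\<integral>\<^sup>+z. u z \<partial>\<mu>)"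
  using mult(2) \<mu> by (intro nn_integral_cmult) (auto cong: measurable_cong_sets)
 ultimately show ?case using mult(4)
  by (intro disintegration_nn_integral_cong[where g = "%t. c * (\<integral>\<^sup>+p. u (t, p) \<partial>\<sigma> t)"]) (auto simp: nn_integral_cmult)
next
 case (add u v)
 have "(\<integral>\<^sup>+p. v (t, p) + u (t, p) \<partial>\<sigma> t) = (\<integral>\<^sup>+p. v (t, p) \<partial>\<sigma> t) + (\<integral>\<^sup>+p. u (t, p) \<partial>\<sigma> t)" if "t \<in> {-T<..<T}" for t
  using measurable_slice_QT[OF add(1) that] measurable_slice_QT[OF add(3) that] disintegrationD(1)[OF \<sigma> that]
  by (intro nn_integral_add) (auto cong: measurable_cong_sets)
 moreover have "(\<integral>\<^sup>+z. v z + u z \<partial>\<mu>) = (\<integral>\<^sup>+z. v z \<partial>\<mu>) + (\<integral>\<^sup>+z. u z \<partial>\<mu>)"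
  using add(1,3) \<mu> by (intro nn_integral_add) (auto cong: measurable_cong_sets)
 ultimately show ?case using add.IH
  by (intro disintegration_nn_integral_cong[where g = "%t. (\<integral>\<^sup>+p. v (t, p) \<partial>\<sigma> t) + (\<integral>\<^sup>+p. u (t, p) \<partial>\<sigma> t)"]) (auto simp: nn_integral_add)
next
 case (seq U)
 have inc: "incseq U" and Um: "U i \<in> borel_measurable (borel_QT T)" for i using seq by blast+
 have IH: "(%t. \<integral>\<^sup>+p. U i (t, p) \<partial>\<sigma> t) \<in> borel_measurable (lborel_I T)"
  "(\<integral>\<^sup>+z. U i z \<partial>\<mu>) = (\<integral>\<^sup>+t. \<integral>\<^sup>+p. U i (t, p) \<partial>\<sigma> t \<partial>lborel_I T)" for i using seq.IH by blast+
 show ?case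
 proof (rule disintegration_nn_integral_cong)
  show "(\<integral>\<^sup>+p. (SUP i. U i) (t, p) \<partial>\<sigma> t) = (SUP i. \<integral>\<^sup>+p. U i (t, p) \<partial>\<sigma> t)" if "t \<in> {-T<..<T}" for t
   using measurable_slice_QT[OF Um that] disintegrationD(1)[OF \<sigma> that] inc unfolding SUP_apply
   by (intro nn_integral_monotone_convergence_SUP) (auto cong: measurable_cong_sets simp: incseq_def le_fun_def)
  show "(%t. SUP i. \<integral>\<^sup>+p. U i (t, p) \<partial>\<sigma> t) \<in> borel_measurable (lborel_I T)"
   using IH(1) by (intro borel_measurable_SUP) auto
  have "(\<integral>\<^sup>+z. (SUP i. U i) z \<partial>\<mu>) = (SUP i. \<integral>\<^sup>+z. U i z \<partial>\<mu>)"
   using Um inc \<mu> unfolding SUP_apply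
   by (intro nn_integral_monotone_convergence_SUP) (auto cong: measurable_cong_sets)
  also have "... = (\<integral>\<^sup>+t. (SUP i. \<integral>\<^sup>+p. U i (t, p) \<partial>\<sigma> t) \<partial>lborel_I T)"
   unfolding IH(2) using IH inc
   by (intro nn_integral_monotone_convergence_SUP[symmetric]) (auto simp: incseq_def le_fun_def intro!: nn_integral_mono)
  finally show "(\<integral>\<^sup>+z. (SUP i. U i) z \<partial>\<mu>) = (\<integral>\<^sup>+t. (SUP i. \<integral>\<^sup>+p. U i (t, p) \<partial>\<sigma> t) \<partial>lborel_I T)" .
 qed
qed

lemma disintegration_integral_nonneg:
 fixes h :: "_ => real"
 assumes \<sigma>: "is_disintegration T \<mu> \<sigma>" and \<mu>: "sets \<mu> = sets (borel_QT T)" "finite_measure \<mu>"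
  and h: "h \<in> borel_measurable (borel_QT T)" "\<And>z. z \<in> QT T ==> 0 \<le> h z" "\<And>z. z \<in> QT T ==> h z \<le> B"
 shows "integrable (lborel_I T) (%t. LINT p|\<sigma> t. h (t, p))"
  and "(LINT z|\<mu>. h z) = (LINT t|lborel_I T. LINT p|\<sigma> t. h (t, p))"
proof -
 interpret finite_measure \<mu> by fact
 have sp: "space \<mu> = QT T" using sets_eq_imp_space_eq[OF \<mu>(1)] by simp
 have hm: "h \<in> borel_measurable \<mu>" using h(1) \<mu>(1) by (simp cong: measurable_cong_sets)
 have 1: "(\<integral>\<^sup>+p. ennreal (h (t, p)) \<partial>\<sigma> t) = ennreal (LINT p|\<sigma> t. h (t, p))" if t: "t \<in> {-T<..<T}" for t
 proof (rule nn_integral_eq_integral)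
  interpret \<sigma>: finite_measure "\<sigma> t" by (rule disintegrationD(3)[OF \<sigma> t])
  show "integrable (\<sigma> t) (%p. h (t, p))"
   using measurable_slice_QT[OF h(1) t] disintegrationD[OF \<sigma> t] h(2,3) t
   by (intro \<sigma>.integrable_const_bound[where B=B]) (auto cong: measurable_cong_sets simp: QT_def)
  show "AE p in \<sigma> t. 0 \<le> h (t, p)" using h(2) t by (simp add: QT_def)
 qed
 have h': "(%z. ennreal (h z)) \<in> borel_measurable (borel_QT T)" using h(1) by measurable
 note d = disintegration_nn_integral[OF \<sigma> \<mu>(1) h']
 have c: "(%t. \<integral>\<^sup>+p. ennreal (h (t, p)) \<partial>\<sigma> t) \<in> borel_measurable (lborel_I T) \<longleftrightarrow> (%t. ennreal (LINT p|\<sigma> t. h (t, p))) \<in> borel_measurable (lborel_I T)"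
  using 1 by (intro measurable_cong) auto
 have e: "(\<integral>\<^sup>+z. ennreal (h z) \<partial>\<mu>) = (\<integral>\<^sup>+t. ennreal (LINT p|\<sigma> t. h (t, p)) \<partial>lborel_I T)"
  unfolding d[THEN conjunct2] using 1 by (intro nn_integral_cong) auto
 have nn: "0 \<le> (LINT p|\<sigma> t. h (t, p))" if "t \<in> {-T<..<T}" for t
  using that h(2) by (intro Bochner_Integration.integral_nonneg) (simp add: QT_def)
 have m: "(%t. LINT p|\<sigma> t. h (t, p)) \<in> borel_measurable (lborel_I T)"
 proof -
  have "(%t. enn2real (ennreal (LINT p|\<sigma> t. h (t, p)))) \<in> borel_measurable (lborel_I T)"
   using c d by (intro borel_measurable_enn2real) auto
  then show ?thesis by (rule measurable_cong[THEN iffD1, rotated]) (use nn in auto)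
 qed
 have ih: "integrable \<mu> h"
  using h(2,3) sp by (intro integrable_const_bound[where B=B] hm) auto
 have "(\<integral>\<^sup>+z. ennreal (h z) \<partial>\<mu>) = ennreal (LINT z|\<mu>. h z)"
  using h(2) sp by (intro nn_integral_eq_integral ih) auto
 then show i: "integrable (lborel_I T) (%t. LINT p|\<sigma> t. h (t, p))"
  using e nn m by (intro integrableI_nonneg) auto
 have "ennreal (LINT z|\<mu>. h z) = ennreal (LINT t|lborel_I T. LINT p|\<sigma> t. h (t, p))"
  using \<open>(\<integral>\<^sup>+z. ennreal (h z) \<partial>\<mu>) = ennreal (LINT z|\<mu>. h z)\<close> e nn_integral_eq_integral[OF i AE_I2] nn by simp
 moreover have "0 \<le> (LINT z|\<mu>. h z)" using h(2) sp by (intro integral_nonneg_AE) auto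
 moreover have "0 \<le> (LINT t|lborel_I T. LINT p|\<sigma> t. h (t, p))" using nn by (intro integral_nonneg_AE) auto
 ultimately show "(LINT z|\<mu>. h z) = (LINT t|lborel_I T. LINT p|\<sigma> t. h (t, p))"
  by (simp add: ennreal_inj)
qed

text \<open>Adding the constant \<open>B'\<close> makes the integrand nonnegative; the constant is
  then subtracted again, which is possible because all slices and \<open>\<mu>\<close> are finite
  measures.\<close>

lemma disintegration_integral:
 fixes h :: "_ => real"
 assumes \<sigma>: "is_disintegration T \<mu> \<sigma>" and \<mu>: "sets \<mu> = sets (borel_QT T)" "finite_measure \<mu>"
  and h: "h \<in> borel_measurable (borel_QT T)" "\<And>z. z \<in> QT T ==> \<bar>h z\<bar> \<le> B"
 shows "integrable (lborel_I T) (%t. LINT p|\<sigma> t. h (t, p))"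
  and "(LINT z|\<mu>. h z) = (LINT t|lborel_I T. LINT p|\<sigma> t. h (t, p))"
proof -
 interpret finite_measure \<mu> by fact
 have sp: "space \<mu> = QT T" using sets_eq_imp_space_eq[OF \<mu>(1)] by simp
 define B' where "B' = \<bar>B\<bar>"
 have hB: "\<bar>h z\<bar> \<le> B'" if "z \<in> QT T" for z using h(2)[OF that] by (simp add: B'_def)
 have 1: "(%z. h z + B') \<in> borel_measurable (borel_QT T)" using h(1) by measurable
 have 2: "0 \<le> h z + B'" "h z + B' \<le> 2 * B'" if "z \<in> QT T" for z
  using hB[OF that] by auto
 have 3: "0 \<le> B'" by (simp add: B'_def)
 note a = disintegration_integral_nonneg[OF \<sigma> \<mu> 1 2]
 note b = disintegration_integral_nonneg[OF \<sigma> \<mu>, of "%_. B'" B', OF _ 3]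
 have eq: "(LINT p|\<sigma> t. h (t, p)) = (LINT p|\<sigma> t. h (t, p) + B') - (LINT p|\<sigma> t. B')" if t: "t \<in> {-T<..<T}" for t
 proof -
  interpret \<sigma>: finite_measure "\<sigma> t" by (rule disintegrationD(3)[OF \<sigma> t])
  have "integrable (\<sigma> t) (%p. h (t, p))"
   using measurable_slice_QT[OF h(1) t] disintegrationD[OF \<sigma> t] hB t
   by (intro \<sigma>.integrable_const_bound[where B=B']) (auto cong: measurable_cong_sets simp: QT_def)
  then show ?thesis by simp
 qed
 have "integrable (lborel_I T) (%t. (LINT p|\<sigma> t. h (t, p) + B') - (LINT p|\<sigma> t. B'))"
  using a(1) b(1) by (intro Bochner_Integration.integrable_diff) auto
 then show "integrable (lborel_I T) (%t. LINT p|\<sigma> t. h (t, p))"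
  by (rule Bochner_Integration.integrable_cong[OF refl, THEN iffD1, rotated]) (use eq in auto)
 have "integrable \<mu> h"
  using h(1) hB sp \<mu>(1) by (intro integrable_const_bound[where B=B']) (auto cong: measurable_cong_sets)
 then have "(LINT z|\<mu>. h z) = (LINT z|\<mu>. h z + B') - (LINT z|\<mu>. B')" by simp
 also have "... = (LINT t|lborel_I T. (LINT p|\<sigma> t. h (t, p) + B') - (LINT p|\<sigma> t. B'))"
  using a b by (subst Bochner_Integration.integral_diff) auto
 also have "... = (LINT t|lborel_I T. LINT p|\<sigma> t. h (t, p))"
  using eq by (intro Bochner_Integration.integral_cong) auto
 finally show "(LINT z|\<mu>. h z) = (LINT t|lborel_I T. LINT p|\<sigma> t. h (t, p))" .
qed

lemma countable_generator_torus:
 obtains \<C> :: "torus set set"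
 where "countable \<C>" "Int_stable \<C>" "UNIV \<in> \<C>" "\<C> \<subseteq> sets borel" "sets borel = sigma_sets UNIV \<C>"
proof -
 obtain B :: "torus set set" where B: "countable B" "topological_basis B" using ex_countable_basis by blast
 define \<C> where "\<C> = Inter ` {F. F \<subseteq> B \<and> finite F}"
 have c: "countable \<C>" unfolding \<C>_def
  using countable_Collect_finite_subset[OF B(1)] by (intro countable_image) (simp add: conj_commute)
 have i: "Int_stable \<C>"
  unfolding Int_stable_def \<C>_def
 proof safe
  fix F G assume "F \<subseteq> B" "finite F" "G \<subseteq> B" "finite G"
  then show "\<Inter>F \<inter> \<Inter>G \<in> Inter ` {F. F \<subseteq> B \<and> finite F}"
   by (intro image_eqI[of _ _ "F \<union> G"]) auto
 qed
 have o: "open U" if "U \<in> \<C>" for U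
  using that topological_basis_open[OF B(2)] unfolding \<C>_def by (auto intro!: open_Inter)
 have "B \<subseteq> \<C>" unfolding \<C>_def by (auto intro!: image_eqI[of _ _ "{_}"])
 have s: "sets borel = sigma_sets UNIV \<C>"
 proof (rule antisym)
  have "sets borel = sigma_sets UNIV B"
   using borel_eq_countable_basis[OF B] by (metis sets_measure_of subset_UNIV Pow_UNIV top_greatest)
  then show "sets borel \<subseteq> sigma_sets UNIV \<C>" using \<open>B \<subseteq> \<C>\<close> sigma_sets_mono' by blast
  show "sigma_sets UNIV \<C> \<subseteq> sets borel"
   using o by (intro sets.sigma_sets_subset[where M=borel, simplified]) auto
 qed
 have "UNIV \<in> \<C>" unfolding \<C>_def by (auto intro!: image_eqI[of _ _ "{}"])
 then show thesis using that c i s o by blast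
qed

text \<open>For one Borel set the two slice masses are densities of the same measure in time, hence
  equal almost everywhere. A countable intersection-stable generator leaves only countably many
  exceptional null sets.\<close>

lemma disintegration_unique:
 assumes \<sigma>: "is_disintegration T \<mu> \<sigma>" "is_disintegration T \<mu> \<sigma>'"
  and \<mu>: "sets \<mu> = sets (borel_QT T)" "finite_measure \<mu>"
 shows "AE t in lborel_I T. \<sigma> t = \<sigma>' t"
proof -
 obtain \<C> :: "torus set set" where C: "countable \<C>" "Int_stable \<C>" "UNIV \<in> \<C>" "\<C> \<subseteq> sets borel" "sets borel = sigma_sets UNIV \<C>"
  using countable_generator_torus .
 have "AE t in lborel_I T. emeasure (\<sigma> t) B = emeasure (\<sigma>' t) B" if B: "B \<in> sets borel" for B
 proof -
  have m: "(%t. emeasure (\<rho> t) B) \<in> borel_measurable (lborel_I T)" if "is_disintegration T \<mu> \<rho>" for \<rho>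
   using that B by (simp add: is_disintegration_def measurable_lborel_I_iff)
  have e: "emeasure (density (lborel_I T) (%t. emeasure (\<rho> t) B)) A = emeasure \<mu> (A \<times> B)"
   if "is_disintegration T \<mu> \<rho>" "A \<in> sets (lborel_I T)" for \<rho> A
  proof -
   have A: "A \<in> sets borel" "A \<subseteq> {-T<..<T}" using that(2) by (auto simp: sets_restrict_space_iff)
   have AB: "A \<times> B \<in> sets (borel_QT T)"
    using pair_measureI[OF A(1) B] A(2) unfolding sets_borel_QT borel_prod by (auto simp: QT_def)
   have "emeasure (density (lborel_I T) (%t. emeasure (\<rho> t) B)) A = (\<integral>\<^sup>+t. emeasure (\<rho> t) B * indicator A t \<partial>lborel_I T)"
    by (rule emeasure_density[OF m[OF that(1)] that(2)])
   also have "... = (\<integral>\<^sup>+t. emeasure (\<rho> t) (Pair t -` (A \<times> B)) \<partial>lborel_I T)"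
    by (intro nn_integral_cong) (auto simp: indicator_def vimage_def)
   finally show ?thesis using disintegration_emeasure[OF that(1) \<mu>(1) AB] by simp
  qed
  have "density (lborel_I T) (%t. emeasure (\<sigma> t) B) = density (lborel_I T) (%t. emeasure (\<sigma>' t) B)"
   by (rule measure_eqI) (auto simp: e[OF \<sigma>(1)] e[OF \<sigma>(2)])
  moreover have "(\<integral>\<^sup>+t. emeasure (\<sigma> t) B \<partial>lborel_I T) \<noteq> \<infinity>"
  proof -
   have "(\<integral>\<^sup>+t. emeasure (\<sigma> t) B \<partial>lborel_I T) = emeasure (density (lborel_I T) (%t. emeasure (\<sigma> t) B)) {-T<..<T}"
    using m[OF \<sigma>(1)] by (subst emeasure_density) (auto intro!: nn_integral_cong simp: sets_restrict_space_iff)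
   also have "... = emeasure \<mu> ({-T<..<T} \<times> B)" by (rule e[OF \<sigma>(1)]) (auto simp: sets_restrict_space_iff)
   finally show ?thesis using finite_measure.emeasure_finite[OF \<mu>(2)] by simp
  qed
  ultimately show ?thesis using finite_density_unique[OF m[OF \<sigma>(1)] m[OF \<sigma>(2)]] by simp
 qed
 then have "AE t in lborel_I T. \<forall>B\<in>\<C>. emeasure (\<sigma> t) B = emeasure (\<sigma>' t) B"
  using C(1,4) by (subst AE_ball_countable) auto
 then show ?thesis
 proof (rule AE_mp, intro AE_I2 impI)
  fix t assume t: "t \<in> space (lborel_I T)" and eq: "\<forall>B\<in>\<C>. emeasure (\<sigma> t) B = emeasure (\<sigma>' t) B"
  then have t': "t \<in> {-T<..<T}" by simp
  interpret f: finite_measure "\<sigma> t" by (rule disintegrationD(3)[OF \<sigma>(1) t'])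
  show "\<sigma> t = \<sigma>' t"
   by (rule measure_eqI_generator_eq[where E=\<C> and \<Omega>=UNIV and A="%_. UNIV"])
    (use C eq disintegrationD[OF \<sigma>(1) t'] disintegrationD[OF \<sigma>(2) t'] f.emeasure_finite in auto)
 qed
qed

lemma disintegration_some:
 assumes "is_disintegration T \<mu> \<sigma>"
 shows "is_disintegration T \<mu> (disintegration T \<mu>)"
 unfolding disintegration_def by (rule someI[of _ \<sigma>]) (rule assms)

section \<open>The transport equation along time\<close>

text \<open>Stated on time-space so that products with lifted functions of space remain within one
  calculus of smooth functions.\<close>

definition smooth_time :: "(real => real) => bool"
 where "smooth_time \<eta> \<longleftrightarrow> smooth (%z::real \<times> (real^2). \<eta> (fst z))"

definition smooth_space :: "(torus => real) => bool"
 where "smooth_space f \<longleftrightarrow> smooth (lift_fun (%z. f (snd z)))"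

text \<open>The function being lifted is constant in time, so evaluation at time 0 is
  arbitrary.\<close>

definition tgrad :: "(torus => real) => torus => real^2"
 where "tgrad f p = space_grad (%z. f (snd z)) (0, p)"

lemma cdiff_has_derivative': "smooth f ==> (f has_derivative frechet_derivative f (at x)) (at x)"
 unfolding smooth_def by (rule cdiff_has_derivative[of 0]) blast

lemma space_grad_I:
 assumes "smooth (lift_fun \<phi>)" "(lift_fun \<phi> has_derivative D) (at (t, x))"
 shows "space_grad \<phi> (t, abs_torus x) = (\<chi> i. D (0, axis i 1))"
  and "time_deriv \<phi> (t, abs_torus x) = D (1, 0)"
 using frechet_derivative_at[OF assms(2)]
 by (simp_all add: vec_eq_iff space_grad_abs[OF assms(1)] time_deriv_abs[OF assms(1)])

lemma continuous_smooth_space: "smooth_space f ==> continuous_on UNIV f"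
proof (rule continuous_torusI)
 assume "smooth_space f"
 then have "cdiff 0 (lift_fun (%z. f (snd z)))" unfolding smooth_space_def smooth_def by blast
 then have "continuous_on UNIV (%z::real \<times> (real^2). f (abs_torus (snd z)))"
  by (simp add: lift_fun_def case_prod_unfold)
 from continuous_on_compose2[OF this, of UNIV "%x. (0, x)"]
 show "continuous_on UNIV (%x. f (abs_torus x))" by (simp add: continuous_on_Pair)
qed

lemma continuous_tgrad: "smooth_space f ==> continuous_on UNIV (tgrad f)"
 unfolding tgrad_def smooth_space_def
 by (rule continuous_on_compose2[OF continuous_space_grad]) (auto intro!: continuous_intros)

lemma bounded_continuous_torus:
 fixes f :: "torus => 'b::real_normed_vector"
 assumes "continuous_on UNIV f"
 obtains B where "B > 0" "\<And>p. norm (f p) \<le> B"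
proof -
 have "bounded (range f)" using assms compact_torus by (intro compact_imp_bounded compact_continuous_image)
 then obtain B where "B > 0" "\<And>p. norm (f p) \<le> B" by (auto simp: bounded_pos)
 then show thesis using that by blast
qed

lemma smooth_time_antiderivative:
 assumes "\<And>t. (\<eta> has_real_derivative \<psi> t) (at t)" "smooth_time \<psi>"
 shows "smooth_time \<eta>"
 unfolding smooth_time_def smooth_def
proof
 fix n
 have d: "((%z::real \<times> (real^2). \<eta> (fst z)) has_derivative (%h. \<psi> (fst z) * fst h)) (at z)" for z
  using has_derivative_compose[OF has_derivative_fst[OF has_derivative_ident], of \<eta> "(*) (\<psi> (fst z))" z] assms(1)[of "fst z"]
  by (simp add: has_field_derivative_def)
 show "cdiff n (%z::real \<times> (real^2). \<eta> (fst z))"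
 proof (cases n)
  case 0
  then show ?thesis
   using d by (auto intro!: continuous_at_imp_continuous_on has_derivative_continuous)
 next
  case (Suc k)
  show ?thesis unfolding Suc
  proof (rule cdiff_SucI[OF d])
   fix b :: "real \<times> (real^2)"
   have "cdiff k (%z::real \<times> (real^2). \<psi> (fst z))" using assms(2) by (simp add: smooth_time_def smooth_def)
   then show "cdiff k (%z::real \<times> (real^2). \<psi> (fst z) * fst b)" by (intro cdiff_mult) auto
  qed
 qed
qed

lemma smooth_time_flat: "smooth_time (%t. flat 1 (a * t + b))"
 unfolding smooth_time_def
 by (intro smooth_flat smooth_add smooth_mult smooth_const smooth_bounded_linear bounded_linear_fst)

lemma smooth_time_mult: "smooth_time f ==> smooth_time g ==> smooth_time (%t. f t * g t)"
 and smooth_time_diff: "smooth_time f ==> smooth_time g ==> smooth_time (%t. f t - g t)"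
 and smooth_time_const: "smooth_time (%t. c)"
 by (auto simp: smooth_time_def intro: smooth_mult smooth_diff)

lemma continuous_smooth_time: "smooth_time \<psi> ==> continuous_on UNIV \<psi>"
proof -
 assume "smooth_time \<psi>"
 then have "cdiff 0 (%z::real \<times> (real^2). \<psi> (fst z))" unfolding smooth_time_def smooth_def by blast
 then have "continuous_on UNIV (%z::real \<times> (real^2). \<psi> (fst z))" by simp
 from continuous_on_compose2[OF this, of UNIV "%x. (x, 0)"]
 show ?thesis by (simp add: continuous_on_Pair)
qed

lemma test_function_product:
 assumes \<eta>: "smooth_time \<eta>" "\<And>t. (\<eta> has_real_derivative \<eta>' t) (at t)"
  and supp: "-T < a" "b < T" "\<And>t. t \<notin> {a..b} ==> \<eta> t = 0" and f: "smooth_space f"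
 defines "\<phi> \<equiv> %z. \<eta> (fst z) * f (snd z)"
 shows "test_function T \<phi>" "time_deriv \<phi> z = \<eta>' (fst z) * f (snd z)"
  "space_grad \<phi> z = \<eta> (fst z) *\<^sub>R tgrad f (snd z)"
proof -
 let ?f = "lift_fun (%z. f (snd z))"
 have lift: "lift_fun \<phi> = (%z. \<eta> (fst z) * ?f z)"
  by (auto simp: lift_fun_def \<phi>_def)
 have s: "smooth (lift_fun \<phi>)"
  unfolding lift using \<eta>(1) f by (intro smooth_mult) (auto simp: smooth_time_def smooth_space_def)
 have "compact ({a..b} \<times> (UNIV :: torus set))" by (intro compact_Times compact_torus) auto
 then show "test_function T \<phi>"
  unfolding test_function_def using s supp
  by (intro conjI exI[of _ "{a..b} \<times> UNIV"]) (auto simp: QT_def \<phi>_def)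
 obtain t p where z: "z = (t, p)" by force
 obtain x where x: "p = abs_torus x" by (metis abs_torus_rep)
 define D where "D = frechet_derivative ?f (at (t, x))"
 have D: "(?f has_derivative D) (at (t, x))"
  unfolding D_def using f by (intro cdiff_has_derivative') (simp add: smooth_space_def)
 have d: "((%z::real \<times> (real^2). \<eta> (fst z)) has_derivative (%h. \<eta>' t * fst h)) (at (t, x))"
  using has_derivative_compose[OF has_derivative_fst[OF has_derivative_ident], of \<eta> "(*) (\<eta>' t)" "(t, x)"] \<eta>(2)[of t]
  by (simp add: has_field_derivative_def)
 have "(lift_fun \<phi> has_derivative (%h. \<eta> t * D h + \<eta>' t * fst h * ?f (t, x))) (at (t, x))"
  unfolding lift using has_derivative_mult[OF d D] by simp
 note g = space_grad_I[OF s this]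
 \<comment> \<open>The lift of \<open>f\<close> does not depend on time, so the derivative has no
   component in the time direction.\<close>
 have "((%s. ?f (s, x)) has_derivative (%h. D (h, 0))) (at t)"
  by (rule has_derivative_compose[where f="%s. (s, x)" and f'="%h. (h, 0)", OF _ D]) (auto intro!: derivative_eq_intros)
 moreover have "(%s. ?f (s, x)) = (%s. f p)" by (auto simp: lift_fun_def x)
 ultimately have "(%h. D (h, 0)) = (%h. 0)"
  using has_derivative_unique[of "%s. f p" "%h. D (h, 0)" t "%h. 0"] by simp
 then have D0: "D (1, 0) = 0" by meson
 show "time_deriv \<phi> z = \<eta>' (fst z) * f (snd z)"
  using g(2) by (simp add: z x D0 lift_fun_def)
 have "((%z. ?f (z + (t, 0))) has_derivative D) (at (0, x))"
  by (rule has_derivative_compose[where f="%z. z + (t, 0)" and f'="%h. h"]) (use D in \<open>auto intro!: derivative_eq_intros\<close>)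
 moreover have "(%z. ?f (z + (t, 0))) = ?f" by (auto simp: lift_fun_def)
 ultimately have "(?f has_derivative D) (at (0, x))" by simp
 then have "tgrad f p = (\<chi> i. D (0, axis i 1))"
  unfolding tgrad_def x using f by (intro space_grad_I(1)) (auto simp: smooth_space_def)
 then show "space_grad \<phi> z = \<eta> (fst z) *\<^sub>R tgrad f (snd z)"
  using g(1) by (simp add: z x[symmetric] vec_eq_iff)
qed

text \<open>The primitive started to the left of the support vanishes to its right exactly because
  the mean is zero. It is then compactly supported and can be used in a test function.\<close>

lemma primitive_of_mean_zero:
 assumes \<psi>: "continuous_on UNIV \<psi>" and supp: "-T < a" "b < T" "\<And>t. t \<notin> {a..b} ==> \<psi> t = 0"
  and zero: "(LINT t|lborel_I T. \<psi> t) = 0"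
 shows "\<exists>\<eta>. (\<forall>t. (\<eta> has_real_derivative \<psi> t) (at t)) \<and> (\<forall>t. t \<notin> {a..b} \<longrightarrow> \<eta> t = 0)"
proof -
 define L where "L = -T - 1"
 define \<eta> where "\<eta> t = integral {L..t} \<psi>" for t
 have int: "\<psi> integrable_on {c..d}" for c d
  by (intro integrable_continuous_interval continuous_on_subset[OF \<psi>]) auto
 have left: "\<eta> t = 0" if "t < a" for t
  unfolding \<eta>_def by (rule integral_unique[OF has_integral_is_0]) (use that supp in auto)
 have tot: "integral {L..t} \<psi> = 0" if "t > b" for t
 proof -
  let ?t = "max t T"
  have "integral {L..?t} \<psi> = (LINT s:{L..?t}|lborel. \<psi> s)"
   by (rule set_borel_integral_eq_integral(2)[symmetric])
    (intro borel_integrable_atLeastAtMost' continuous_on_subset[OF \<psi>], simp)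
  also have "... = (LINT s:{-T<..<T}|lborel. \<psi> s)"
   unfolding set_lebesgue_integral_def
   by (intro Bochner_Integration.integral_cong) (use supp in \<open>auto simp: indicator_def L_def\<close>)
  also have "... = 0" using zero by (subst (asm) integral_restrict_space) (auto simp: set_lebesgue_integral_def)
  finally have 1: "integral {L..?t} \<psi> = 0" .
  show ?thesis
  proof (cases "L \<le> t")
   case True
   have "integral {L..t} \<psi> + integral {t..?t} \<psi> = integral {L..?t} \<psi>"
    by (rule Henstock_Kurzweil_Integration.integral_combine) (use True int in auto)
   moreover have "integral {t..?t} \<psi> = 0"
    by (rule integral_unique[OF has_integral_is_0]) (use that supp in auto)
   ultimately show ?thesis using 1 by simp
  next
   case False
   then show ?thesis by simp
  qed
 qed
 have "(\<eta> has_real_derivative \<psi> t) (at t)" for t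
 proof (cases "t < a")
  case True
  have "((%_. 0) has_real_derivative \<psi> t) (at t)" using True supp(3) by simp
  then show ?thesis
   by (rule DERIV_cong_ev[THEN iffD1, OF refl _ refl, rotated])
    (use True left in \<open>auto simp: eventually_nhds intro!: exI[of _ "{..<a}"]\<close>)
 next
  case False
  then have "L < t" using supp by (simp add: L_def)
  have "(\<eta> has_real_derivative \<psi> t) (at t within {L..t + 1})"
   unfolding \<eta>_def using \<open>L < t\<close> by (intro integral_has_real_derivative continuous_on_subset[OF \<psi>]) auto
  then show ?thesis using \<open>L < t\<close> by (simp add: at_within_Icc_at)
 qed
 moreover have "\<eta> t = 0" if "t \<notin> {a..b}" for t
  using that left[of t] tot[of t] by (auto simp: \<eta>_def not_le)
 ultimately show ?thesis by blast
qed

lemma integrable_lborel_I_iff: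
 fixes f :: "real => real"
 shows "integrable (lborel_I T) f \<longleftrightarrow> integrable lborel (%t. indicator {-T<..<T} t *\<^sub>R f t)"
  and "(LINT t|lborel_I T. f t) = (LINT t|lborel. indicator {-T<..<T} t *\<^sub>R f t)"
 by (auto simp: integrable_restrict_space integral_restrict_space)

lemma finite_lborel_I: "finite_measure (lborel_I T)"
 using emeasure_bounded_finite[of "{-T<..<T}"] by (intro finite_measureI) (simp add: emeasure_restrict_space less_top)

text \<open>Smooth compactly supported approximations of the indicator of the interval from
  \<open>x\<close> to \<open>T\<close>. Each factor vanishes within distance
  \<open>1 / (n + 1)\<close> of its endpoint, and tends to one inside because \<open>flat 1\<close>
  tends to one at infinity.\<close>

lemma plateau:
 fixes x T :: real
 assumes "-T \<le> x"
 defines "\<psi> \<equiv> %n t. flat 1 (real (Suc n) * (t - x) - 1) * flat 1 (real (Suc n) * (T - t) - 1)"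
 shows "smooth_time (\<psi> n)" "\<exists>a b. -T < a \<and> b < T \<and> (\<forall>t. t \<notin> {a..b} \<longrightarrow> \<psi> n t = 0)"
  "\<bar>\<psi> n t\<bar> \<le> 1" "(%n. \<psi> n t) \<longlonglongrightarrow> indicator {x<..<T} t"
proof -
 have *: "\<psi> n = (%t. flat 1 (real (Suc n) * t + (- (real (Suc n) * x) - 1)) * flat 1 (- real (Suc n) * t + (real (Suc n) * T - 1)))"
  unfolding \<psi>_def by (intro ext) (simp add: algebra_simps)
 show "smooth_time (\<psi> n)" unfolding * by (intro smooth_time_mult smooth_time_flat)
 show "\<exists>a b. -T < a \<and> b < T \<and> (\<forall>t. t \<notin> {a..b} \<longrightarrow> \<psi> n t = 0)"
 proof (intro exI conjI allI impI)
  let ?h = "1 / real (Suc n)"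
  show "-T < x + ?h" using assms(1) by (smt (verit) divide_pos_pos of_nat_0_less_iff zero_less_Suc)
  show "T - ?h < T" by simp
  fix t assume "t \<notin> {x + ?h..T - ?h}"
  then consider "t - x < ?h" | "T - t < ?h" by force
  then show "\<psi> n t = 0"
  proof cases
   case 1
   then have "real (Suc n) * (t - x) < 1" by (simp add: field_simps)
   then show ?thesis by (simp add: \<psi>_def flat_1)
  next
   case 2
   then have "real (Suc n) * (T - t) < 1" by (simp add: field_simps)
   then show ?thesis by (simp add: \<psi>_def flat_1)
  qed
 qed
 have f1: "0 \<le> flat 1 s" "flat 1 s \<le> 1" for s by (auto simp: flat_1)
 show "\<bar>\<psi> n t\<bar> \<le> 1" unfolding \<psi>_def using f1 by (simp add: abs_mult mult_le_one)
 have lim: "(%n. flat 1 (real (Suc n) * d - 1)) \<longlonglongrightarrow> (if d > 0 then 1 else 0)" for d :: real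
 proof (cases "d > 0")
  case True
  have "filterlim (%n. real (Suc n) * d - 1) at_top sequentially" using True by real_asymp
  moreover have "((%s::real. exp (- (1 / s))) \<longlongrightarrow> 1) at_top" by real_asymp
  then have "(flat 1 \<longlongrightarrow> 1) at_top"
   by (rule Lim_transform_eventually) (use eventually_gt_at_top[of 0] in eventually_elim, simp add: flat_1)
  ultimately show ?thesis using True by (auto intro: filterlim_compose)
 next
  case False
  then have "real (Suc n) * d - 1 \<le> 0" for n by (smt (verit) mult_nonneg_nonpos of_nat_0_le_iff)
  then have "flat 1 (real (Suc n) * d - 1) = 0" for n unfolding flat_1 by (simp add: not_less)
  then show ?thesis using False by simp
 qed
 have "(%n. \<psi> n t) \<longlonglongrightarrow> (if t - x > 0 then 1 else 0) * (if T - t > 0 then 1 else 0)"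
  unfolding \<psi>_def by (intro tendsto_mult lim)
 then show "(%n. \<psi> n t) \<longlonglongrightarrow> indicator {x<..<T} t"
  by (cases "x < t"; cases "t < T") (simp_all add: indicator_def)
qed

text \<open>The positive and the negative part of \<open>K\<close> define finite measures that agree
  on all half-lines, hence are equal, and so are their densities.\<close>

lemma AE_zero_if_integrals_zero:
 fixes K :: "real => real"
 assumes K: "integrable lborel K" and zero: "\<And>x. (LINT t:{x<..}|lborel. K t) = 0"
 shows "AE t in lborel. K t = 0"
proof -
 let ?p = "%t. ennreal (max 0 (K t))" and ?n = "%t. ennreal (max 0 (- K t))"
 have [measurable]: "K \<in> borel_measurable borel" using K by simp
 have ip: "integrable lborel (%t. indicator {x<..} t * max 0 (K t))"
  and "in": "integrable lborel (%t. indicator {x<..} t * max 0 (- K t))" for x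
  by (rule Bochner_Integration.integrable_bound[OF K]; force simp: indicator_def)+
 have ep: "emeasure (density lborel ?p) {x<..} = ennreal (LINT t|lborel. indicator {x<..} t * max 0 (K t))"
  and en: "emeasure (density lborel ?n) {x<..} = ennreal (LINT t|lborel. indicator {x<..} t * max 0 (- K t))" for x
  by (auto simp: emeasure_density nn_integral_eq_integral[OF ip, symmetric] nn_integral_eq_integral[OF "in", symmetric]
    intro!: nn_integral_cong split: split_indicator)
 have eq: "(LINT t|lborel. indicator {x<..} t * max 0 (K t)) = (LINT t|lborel. indicator {x<..} t * max 0 (- K t))" for x
 proof -
  have "(LINT t|lborel. indicator {x<..} t * max 0 (K t)) - (LINT t|lborel. indicator {x<..} t * max 0 (- K t))
   = (LINT t|lborel. indicator {x<..} t * max 0 (K t) - indicator {x<..} t * max 0 (- K t))"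
   by (rule Bochner_Integration.integral_diff[symmetric, OF ip "in"])
  also have "... = (LINT t:{x<..}|lborel. K t)"
   unfolding set_lebesgue_integral_def by (intro Bochner_Integration.integral_cong) (auto simp: indicator_def)
  finally show ?thesis using zero by simp
 qed
 have "density lborel ?p = density lborel ?n"
 proof (rule measure_eqI_lessThan)
  show "emeasure (density lborel ?p) {x<..} < \<infinity>" for x unfolding ep by simp
  show "emeasure (density lborel ?p) {x<..} = emeasure (density lborel ?n) {x<..}" for x unfolding ep en eq ..
 qed simp_all
 moreover have "(\<integral>\<^sup>+ t. ?p t \<partial>lborel) \<noteq> \<infinity>"
 proof -
  have "(\<integral>\<^sup>+ t. ?p t \<partial>lborel) \<le> (\<integral>\<^sup>+ t. ennreal (norm (K t)) \<partial>lborel)"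
   by (intro nn_integral_mono ennreal_leI) auto
  then show ?thesis using K by (auto simp: integrable_iff_bounded top_unique)
 qed
 ultimately have "AE t in lborel. ?p t = ?n t"
  by (subst (asm) finite_density_unique) auto
 then show ?thesis by eventually_elim (auto simp: max_def split: if_splits)
qed

text \<open>The weak equation tests \<open>H\<close> against all smooth compactly supported
  functions of mean zero. Correcting a plateau by a fixed bump to mean zero shows that integrals of
  \<open>H\<close> over intervals ending at \<open>T\<close> are those of a constant.\<close>

lemma du_Bois_Reymond:
 assumes H: "integrable (lborel_I T) H" and "T > 0"
  and weak: "\<And>\<eta> \<eta>' a b. smooth_time \<eta> ==> (\<And>t. (\<eta> has_real_derivative \<eta>' t) (at t)) ==> -T < a ==> b < T ==>
   (\<And>t. t \<notin> {a..b} ==> \<eta> t = 0) ==> continuous_on UNIV \<eta>' ==> (LINT t|lborel_I T. \<eta>' t * H t) = 0"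
 shows "\<exists>c. AE t in lborel_I T. H t = c"
proof -
 interpret I: finite_measure "lborel_I T" by (rule finite_lborel_I)
 have meas: "\<psi> \<in> borel_measurable (lborel_I T)" if "continuous_on UNIV \<psi>" for \<psi> :: "real => real"
  using borel_measurable_continuous_onI[OF that] by (simp add: measurable_restrict_space1)
 have ind: "(indicator {x<..<T} :: real => real) \<in> borel_measurable (lborel_I T)" for x
  by (intro measurable_restrict_space1) auto
 have mean0: "(LINT t|lborel_I T. \<psi> t * H t) = 0"
  if "smooth_time \<psi>" "-T < a" "b < T" "\<And>t. t \<notin> {a..b} ==> \<psi> t = 0" "(LINT t|lborel_I T. \<psi> t) = 0" for \<psi> a b
 proof -
  note c = continuous_smooth_time[OF that(1)] and that' = that
  obtain \<eta> where \<eta>: "\<And>t. (\<eta> has_real_derivative \<psi> t) (at t)" "\<And>t. t \<notin> {a..b} ==> \<eta> t = 0"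
   using primitive_of_mean_zero[OF c that'(2-5)] by blast
  show ?thesis by (rule weak[OF smooth_time_antiderivative[OF \<eta>(1) that(1)] \<eta>(1) that(2,3) \<eta>(2) c])
 qed
 define \<psi> where "\<psi> x n t = flat 1 (real (Suc n) * (t - x) - 1) * flat 1 (real (Suc n) * (T - t) - 1)" for x n t
 note pl = plateau[where T=T, folded \<psi>_def]
 have lim1: "(%n. LINT t|lborel_I T. \<psi> x n t) \<longlonglongrightarrow> (LINT t|lborel_I T. indicator {x<..<T} t)" if "-T \<le> x" for x
  by (rule integral_dominated_convergence[where w="%_. 1"])
   (use pl[OF that] ind meas[OF continuous_smooth_time[OF pl(1)[OF that]]] in auto)
 have limH: "(%n. LINT t|lborel_I T. \<psi> x n t * H t) \<longlonglongrightarrow> (LINT t|lborel_I T. indicator {x<..<T} t * H t)" if "-T \<le> x" for x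
 proof (rule integral_dominated_convergence[where w="%t. \<bar>H t\<bar>"])
  show "AE t in lborel_I T. norm (\<psi> x n t * H t) \<le> \<bar>H t\<bar>" for n
   using pl(3)[OF that, of n] by (auto simp: abs_mult intro!: mult_left_le_one_le)
  show "AE t in lborel_I T. (%n. \<psi> x n t * H t) \<longlonglongrightarrow> indicator {x<..<T} t * H t"
   by (intro AE_I2 tendsto_mult pl(4)[OF that] tendsto_const)
 qed (use H ind meas[OF continuous_smooth_time[OF pl(1)[OF that]]] in \<open>auto intro!: borel_measurable_times\<close>)
 have vol: "(LINT t|lborel_I T. indicator {x<..<T} t) = T - x" if "-T \<le> x" "x \<le> T" for x :: real
 proof -
  have "(LINT t|lborel_I T. indicator {x<..<T} t) = (LINT t|lborel. indicator {x<..<T} t :: real)"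
   unfolding integrable_lborel_I_iff using that by (intro Bochner_Integration.integral_cong) (auto simp: indicator_def)
  then show ?thesis using that by simp
 qed
 have i\<psi>: "integrable (lborel_I T) (\<psi> x n)" "integrable (lborel_I T) (%t. \<psi> x n t * H t)" if "-T \<le> x" for x n
 proof -
  show "integrable (lborel_I T) (\<psi> x n)"
   by (rule I.integrable_const_bound[where B=1]) (use pl(3)[OF that] meas[OF continuous_smooth_time[OF pl(1)[OF that]]] in auto)
  show "integrable (lborel_I T) (%t. \<psi> x n t * H t)"
  proof (rule Bochner_Integration.integrable_bound[OF H])
   show "AE t in lborel_I T. norm (\<psi> x n t * H t) \<le> norm (H t)"
    using pl(3)[OF that, of n] by (auto simp: abs_mult intro!: mult_left_le_one_le)
  qed (use H meas[OF continuous_smooth_time[OF pl(1)[OF that]]] in \<open>auto intro!: borel_measurable_times\<close>)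
 qed
 \<comment> \<open>The integrals of the plateaus started at \<open>-T\<close> tend to
   \<open>2 * T > 0\<close>; this supplies a bump with nonzero integral.\<close>
 have "(%n. LINT t|lborel_I T. \<psi> (-T) n t) \<longlonglongrightarrow> 2 * T"
  using lim1[of "-T"] vol[of "-T"] \<open>T > 0\<close> by simp
 from order_tendstoD(1)[OF this, of 0] have "\<forall>\<^sub>F n in sequentially. (LINT t|lborel_I T. \<psi> (-T) n t) > 0"
  using \<open>T > 0\<close> by simp
 then obtain k where k: "(LINT t|lborel_I T. \<psi> (-T) k t) > 0" by (auto simp: eventually_sequentially)
 define A where "A = (LINT t|lborel_I T. \<psi> (-T) k t)"
 define c where "c = (LINT t|lborel_I T. \<psi> (-T) k t * H t) / A"
 have main: "(LINT t|lborel_I T. \<psi> x n t * H t) = c * (LINT t|lborel_I T. \<psi> x n t)" if x: "-T \<le> x" for x n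
 proof -
  \<comment> \<open>Subtracting \<open>r\<close> times the fixed bump gives mean zero, so the
    difference has a compactly supported primitive.\<close>
  define r where "r = (LINT t|lborel_I T. \<psi> x n t) / A"
  obtain a b where ab: "-T < a" "b < T" "\<And>t. t \<notin> {a..b} ==> \<psi> x n t = 0" using pl(2)[OF x, of n] by blast
  obtain a' b' where ab': "-T < a'" "b' < T" "\<And>t. t \<notin> {a'..b'} ==> \<psi> (-T) k t = 0" using pl(2)[of "-T" k] by auto
  have "(LINT t|lborel_I T. (\<psi> x n t - r * \<psi> (-T) k t) * H t) = 0"
  proof (rule mean0[where a="min a a'" and b="max b b'"])
   show "smooth_time (%t. \<psi> x n t - r * \<psi> (-T) k t)"
    using pl(1)[OF x] pl(1)[of "-T"] by (intro smooth_time_diff smooth_time_mult smooth_time_const) auto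
   show "(LINT t|lborel_I T. \<psi> x n t - r * \<psi> (-T) k t) = 0"
    using i\<psi>(1)[OF x] i\<psi>(1)[of "-T"] k by (simp add: r_def A_def)
   show "\<psi> x n t - r * \<psi> (-T) k t = 0" if t: "t \<notin> {min a a'..max b b'}" for t
   proof -
    have "t \<notin> {a..b}" "t \<notin> {a'..b'}" using t by auto
    then show ?thesis using ab(3) ab'(3) by simp
   qed
  qed (use ab(1,2) ab'(1,2) in auto)
  moreover have "(LINT t|lborel_I T. (\<psi> x n t - r * \<psi> (-T) k t) * H t)
    = (LINT t|lborel_I T. \<psi> x n t * H t) - r * (LINT t|lborel_I T. \<psi> (-T) k t * H t)"
   using i\<psi>(2)[OF x] i\<psi>(2)[of "-T" k] by (simp add: left_diff_distrib mult.assoc)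
  ultimately show ?thesis by (simp add: r_def c_def)
 qed
 have key: "(LINT t|lborel_I T. indicator {x<..<T} t * H t) = c * (LINT t|lborel_I T. indicator {x<..<T} t)" if x: "-T \<le> x" for x
  using LIMSEQ_unique[OF limH[OF x]] tendsto_mult[OF tendsto_const lim1[OF x], of c] unfolding main[OF x] by blast
 define K where "K t = indicator {-T<..<T} t * (H t - c)" for t
 have iK: "integrable (lborel_I T) (%t. H t - c)" using H by auto
 then have K: "integrable lborel K" unfolding integrable_lborel_I_iff K_def by simp
 have "(LINT t:{x<..}|lborel. K t) = 0" for x
 proof -
  define y where "y = max x (-T)"
  have y: "-T \<le> y" by (simp add: y_def)
  have "(LINT t:{x<..}|lborel. K t) = (LINT t|lborel_I T. indicator {y<..<T} t * H t - c * indicator {y<..<T} t)"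
   unfolding integrable_lborel_I_iff set_lebesgue_integral_def K_def
   by (intro Bochner_Integration.integral_cong) (auto simp: indicator_def y_def)
  also have "... = (LINT t|lborel_I T. indicator {y<..<T} t * H t) - (LINT t|lborel_I T. c * indicator {y<..<T} t)"
  proof (rule Bochner_Integration.integral_diff)
   show "integrable (lborel_I T) (%t. indicator {y<..<T} t * H t)"
   proof (rule Bochner_Integration.integrable_bound[OF H])
    show "(%t. indicator {y<..<T} t * H t) \<in> borel_measurable (lborel_I T)"
     using H ind by (intro borel_measurable_times) auto
   qed (auto simp: indicator_def)
   show "integrable (lborel_I T) (%t. c * indicator {y<..<T} t)"
   proof (rule I.integrable_const_bound[where B="\<bar>c\<bar>"])
    show "(%t. c * indicator {y<..<T} t) \<in> borel_measurable (lborel_I T)"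
     using ind by (intro borel_measurable_times) auto
   qed (auto simp: indicator_def)
  qed
  finally show ?thesis using key[OF y] by simp
 qed
 from AE_zero_if_integrals_zero[OF K this] have "AE t in lborel_I T. H t = c"
  unfolding AE_lborel_I by eventually_elim (auto simp: K_def)
 then show ?thesis by blast
qed

text \<open>The action of the flux on \<open>f\<close> accumulated up to time \<open>t\<close>. Up
  to a constant it is the continuous version of the integral of \<open>f\<close> against the slice
  at time \<open>t\<close>.\<close>

definition flow :: "real => (real \<times> torus) measure => ((real \<times> torus) set => real^2) => (torus => real) => real => real"
 where "flow T \<mu> m f t = (LINT z|\<mu>. indicator {z. fst z \<le> t} z * (tgrad f (snd z) \<bullet> vector_RN_deriv \<mu> m z))"

lemma flux_integrable:
 assumes "m \<in> fluxes T \<mu>" "finite_measure \<mu>"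
 shows "integrable \<mu> (vector_RN_deriv \<mu> m)"
 using vector_RN_deriv(1)[OF assms(2)] assms(1) by (auto simp: fluxes_def)

lemma integrable_tgrad_flux:
 assumes "m \<in> fluxes T \<mu>" "finite_measure \<mu>" "sets \<mu> = sets (borel_QT T)" "smooth_space f"
 shows "integrable \<mu> (%z. tgrad f (snd z) \<bullet> vector_RN_deriv \<mu> m z)"
proof -
 obtain B where B: "B > 0" "\<And>p. norm (tgrad f p) \<le> B" using bounded_continuous_torus[OF continuous_tgrad[OF assms(4)]] by blast
 note v = flux_integrable[OF assms(1,2)]
 have "(%z. tgrad f (snd z)) \<in> borel_measurable (borel_QT T)"
  by (rule continuous_measurable_QT) (auto intro!: continuous_on_compose2[OF continuous_tgrad[OF assms(4)]] continuous_intros)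
 then have m: "(%z. tgrad f (snd z)) \<in> borel_measurable \<mu>" using assms(3) by (simp cong: measurable_cong_sets)
 show ?thesis
 proof (rule Bochner_Integration.integrable_bound)
  show "integrable \<mu> (%z. B * norm (vector_RN_deriv \<mu> m z))" using v by auto
  show "(%z. tgrad f (snd z) \<bullet> vector_RN_deriv \<mu> m z) \<in> borel_measurable \<mu>" using m v by auto
  show "AE z in \<mu>. norm (tgrad f (snd z) \<bullet> vector_RN_deriv \<mu> m z) \<le> norm (B * norm (vector_RN_deriv \<mu> m z))"
  proof (intro AE_I2)
   fix z
   have "\<bar>tgrad f (snd z) \<bullet> vector_RN_deriv \<mu> m z\<bar> \<le> norm (tgrad f (snd z)) * norm (vector_RN_deriv \<mu> m z)"
    by (rule Cauchy_Schwarz_ineq2)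
   also have "... \<le> B * norm (vector_RN_deriv \<mu> m z)" by (intro mult_right_mono B) auto
   finally show "norm (tgrad f (snd z) \<bullet> vector_RN_deriv \<mu> m z) \<le> norm (B * norm (vector_RN_deriv \<mu> m z))"
    using B by simp
  qed
 qed
qed

text \<open>A disintegrated measure does not charge a single time. This is what makes
  \<open>flow\<close> continuous in its last argument.\<close>

lemma AE_time_neq:
 assumes "is_disintegration T \<mu> \<sigma>" "sets \<mu> = sets (borel_QT T)"
 shows "AE z in \<mu>. fst z \<noteq> t"
proof (rule AE_I)
 have sp: "space \<mu> = QT T" using sets_eq_imp_space_eq[OF assms(2)] by simp
 have A: "({t} \<times> UNIV) \<inter> QT T \<in> sets (borel_QT T)"
  unfolding sets_borel_QT by (intro conjI sets.Int borel_closed[OF closed_Times] borel_open[OF open_QT]) auto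
 show "{z \<in> space \<mu>. \<not> fst z \<noteq> t} \<subseteq> ({t} \<times> UNIV) \<inter> QT T" using sp by auto
 show "({t} \<times> UNIV) \<inter> QT T \<in> sets \<mu>" using A assms(2) by simp
 have "emeasure \<mu> (({t} \<times> UNIV) \<inter> QT T) = (\<integral>\<^sup>+ s. emeasure (\<sigma> s) (Pair s -` (({t} \<times> UNIV) \<inter> QT T)) \<partial>lborel_I T)"
  by (rule disintegration_emeasure[OF assms A])
 also have "... = (\<integral>\<^sup>+ s. 0 \<partial>lborel_I T)"
 proof (rule nn_integral_cong_AE)
  have "AE s in lborel. s \<noteq> t" by (rule AE_lborel_singleton)
  then show "AE s in lborel_I T. emeasure (\<sigma> s) (Pair s -` (({t} \<times> UNIV) \<inter> QT T)) = 0"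
   unfolding AE_lborel_I by eventually_elim (auto simp: vimage_def)
 qed
 finally show "emeasure \<mu> (({t} \<times> UNIV) \<inter> QT T) = 0" by simp
qed

lemma continuous_flow:
 assumes "m \<in> fluxes T \<mu>" "finite_measure \<mu>" "sets \<mu> = sets (borel_QT T)" "smooth_space f" "is_disintegration T \<mu> \<sigma>"
 shows "continuous_on UNIV (flow T \<mu> m f)"
proof (rule continuous_at_imp_continuous_on, intro ballI, unfold continuous_at_sequentially comp_def, intro allI impI)
 fix t and u :: "nat => real" assume u: "u \<longlonglongrightarrow> t"
 let ?g = "%z. tgrad f (snd z) \<bullet> vector_RN_deriv \<mu> m z"
 note g = integrable_tgrad_flux[OF assms(1-4)]
 have S: "{z. fst z \<le> s} \<inter> space \<mu> \<in> sets \<mu>" for s :: real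
 proof -
  have "closed {z::real \<times> torus. fst z \<le> s}" by (intro closed_Collect_le continuous_intros)
  then have "{z. fst z \<le> s} \<inter> QT T \<in> sets (borel_QT T)"
   unfolding sets_borel_QT using open_QT[of T] by (auto intro!: sets.Int borel_closed)
  then show ?thesis using assms(3) sets_eq_imp_space_eq[OF assms(3)] by simp
 qed
 have m: "(%z. indicator {z. fst z \<le> s} z * ?g z) \<in> borel_measurable \<mu>" for s
  using g S by (intro borel_measurable_times borel_measurable_indicator') (auto simp: vimage_def Int_def conj_commute)
 show "(%n. flow T \<mu> m f (u n)) \<longlonglongrightarrow> flow T \<mu> m f t"
  unfolding flow_def
 proof (rule integral_dominated_convergence[where w="%z. \<bar>?g z\<bar>"])
  show "AE z in \<mu>. (%n. indicator {z. fst z \<le> u n} z * ?g z) \<longlonglongrightarrow> indicator {z. fst z \<le> t} z * ?g z"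
   using AE_time_neq[OF assms(5,3), of t]
  proof eventually_elim
   fix z :: "real \<times> torus" assume "fst z \<noteq> t"
   then consider "fst z < t" | "t < fst z" by linarith
   then have "\<forall>\<^sub>F n in sequentially. indicator {z. fst z \<le> t} z = (indicator {z. fst z \<le> u n} z :: real)"
   proof cases
    case 1
    then show ?thesis using order_tendstoD(1)[OF u 1] by (auto elim!: eventually_mono)
   next
    case 2
    then show ?thesis using order_tendstoD(2)[OF u 2] by (auto elim!: eventually_mono)
   qed
   then have "(%n. indicator {z. fst z \<le> u n} z :: real) \<longlonglongrightarrow> indicator {z. fst z \<le> t} z"
    by (rule Lim_transform_eventually[OF tendsto_const])
   then show "(%n. indicator {z. fst z \<le> u n} z * ?g z) \<longlonglongrightarrow> indicator {z. fst z \<le> t} z * ?g z"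
    by (intro tendsto_mult tendsto_const)
  qed
 qed (use g m in \<open>auto simp: indicator_def\<close>)
qed

text \<open>Test functions of product form turn the continuity equation into an equation in time
  alone: by Fubini the difference of the slice integral and \<open>flow\<close> has zero weak
  derivative, and \<open>du_Bois_Reymond\<close> applies.\<close>

lemma flux_transport:
 assumes m: "m \<in> fluxes T \<mu>" and \<mu>: "finite_measure \<mu>" "sets \<mu> = sets (borel_QT T)"
  and f: "smooth_space f" and \<sigma>: "is_disintegration T \<mu> \<sigma>" and "T > 0"
 shows "\<exists>c. AE t in lborel_I T. (LINT p|\<sigma> t. f p) = c + flow T \<mu> m f t"
proof -
 interpret \<mu>: finite_measure \<mu> by fact
 interpret I: finite_measure "lborel_I T" by (rule finite_lborel_I)
 interpret pair_sigma_finite \<mu> "lborel_I T" ..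
 let ?F = "%t. LINT p|\<sigma> t. f p" and ?G = "flow T \<mu> m f"
 let ?g = "%z. tgrad f (snd z) \<bullet> vector_RN_deriv \<mu> m z"
 note g = integrable_tgrad_flux[OF m \<mu> f]
 have sp: "space \<mu> = QT T" using sets_eq_imp_space_eq[OF \<mu>(2)] by simp
 obtain B where B: "B > 0" "\<And>p. norm (f p) \<le> B" using bounded_continuous_torus[OF continuous_smooth_space[OF f]] by blast
 have contf: "continuous_on UNIV (%z::real \<times> torus. f (snd z))"
  by (auto intro!: continuous_on_compose2[OF continuous_smooth_space[OF f]] continuous_intros)
 have F: "integrable (lborel_I T) ?F"
  using disintegration_integral(1)[OF \<sigma> \<mu>(2,1), of "%z. f (snd z)" B] B(2) continuous_measurable_QT[OF contf] by simp
 have Gm: "?G \<in> borel_measurable (lborel_I T)"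
  using borel_measurable_continuous_onI[OF continuous_flow[OF m \<mu> f \<sigma>]] by (simp add: measurable_restrict_space1)
 have Gb: "\<bar>?G t\<bar> \<le> (LINT z|\<mu>. \<bar>?g z\<bar>)" for t
 proof -
  have "\<bar>?G t\<bar> \<le> (LINT z|\<mu>. \<bar>indicator {z. fst z \<le> t} z * ?g z\<bar>)"
   unfolding flow_def using integral_norm_bound[of \<mu> "%z. indicator {z. fst z \<le> t} z * ?g z"] by simp
  also have "... \<le> (LINT z|\<mu>. \<bar>?g z\<bar>)"
   by (rule integral_mono') (use g in \<open>auto simp: indicator_def\<close>)
  finally show ?thesis .
 qed
 have G: "integrable (lborel_I T) ?G"
  by (rule I.integrable_const_bound[where B="LINT z|\<mu>. \<bar>?g z\<bar>"]) (use Gb Gm in auto)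
 have "\<exists>c. AE t in lborel_I T. ?F t - ?G t = c"
 proof (rule du_Bois_Reymond)
  show "integrable (lborel_I T) (%t. ?F t - ?G t)" using F G by auto
  fix \<eta> \<eta>' a b assume \<eta>: "smooth_time \<eta>" "\<And>t. (\<eta> has_real_derivative \<eta>' t) (at t)" "-T < a" "b < T"
   "\<And>t. t \<notin> {a..b} ==> \<eta> t = 0" and cont: "continuous_on UNIV \<eta>'"
  let ?\<phi> = "%z. \<eta> (fst z) * f (snd z)"
  have tf: "test_function T ?\<phi>" "time_deriv ?\<phi> z = \<eta>' (fst z) * f (snd z)"
    "space_grad ?\<phi> z = \<eta> (fst z) *\<^sub>R tgrad f (snd z)" for z
   by (rule test_function_product[OF \<eta>(1-4) _ f]; use \<eta>(5) in blast)+
  have "bounded (\<eta>' ` {-T..T})"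
   by (intro compact_imp_bounded compact_continuous_image continuous_on_subset[OF cont]) auto
  then obtain C where C: "C > 0" "\<And>t. t \<in> {-T<..<T} ==> \<bar>\<eta>' t\<bar> \<le> C" by (auto simp: bounded_pos)
  have \<eta>'m: "\<eta>' \<in> borel_measurable (lborel_I T)" using borel_measurable_continuous_onI[OF cont] by (simp add: measurable_restrict_space1)
  have contf': "continuous_on UNIV (%z::real \<times> torus. \<eta>' (fst z) * f (snd z))"
   by (intro continuous_intros contf continuous_on_compose2[OF cont]) (auto intro!: continuous_intros)
  have 1: "(LINT z|\<mu>. \<eta>' (fst z) * f (snd z)) = (LINT t|lborel_I T. \<eta>' t * ?F t)"
  proof -
   have "(LINT z|\<mu>. \<eta>' (fst z) * f (snd z)) = (LINT t|lborel_I T. LINT p|\<sigma> t. \<eta>' t * f p)"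
   proof (subst disintegration_integral(2)[OF \<sigma> \<mu>(2,1) continuous_measurable_QT[OF contf'], of "C * B"])
    show "\<bar>\<eta>' (fst z) * f (snd z)\<bar> \<le> C * B" if "z \<in> QT T" for z
     using B(2)[of "snd z"] C(2)[of "fst z"] C(1) that by (auto simp: QT_def abs_mult intro!: mult_mono)
   qed simp
   then show ?thesis by simp
  qed
  have [measurable]: "\<eta>' \<in> borel_measurable borel" by (rule borel_measurable_continuous_onI[OF cont])
  \<comment> \<open>Since \<open>\<eta>\<close> vanishes at \<open>T\<close>, it is minus the
    integral of \<open>\<eta>'\<close> over the remaining time. Exchanging the integrals then
    produces \<open>flow\<close>, because \<open>t\<close> lies after the time of \<open>z\<close>
    exactly when \<open>z\<close> counts in \<open>flow\<close> at \<open>t\<close>.\<close>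
  have \<eta>_eq: "\<eta> s = - (LINT t|lborel_I T. \<eta>' t * indicator {s..} t)" if s: "s \<in> {-T<..<T}" for s
  proof -
   have "(LINT t|lborel. indicator {s..T} t *\<^sub>R \<eta>' t) = \<eta> T - \<eta> s"
    using s \<eta>(2) by (intro integral_FTC_Icc) (auto intro: has_vector_derivative_at_within
     continuous_on_subset[OF cont] simp: has_real_derivative_iff_has_vector_derivative)
   moreover have "\<eta> T = 0" using \<eta>(4,5) by simp
   moreover have "(LINT t|lborel. indicator {s..T} t *\<^sub>R \<eta>' t) = (LINT t|lborel. indicator {-T<..<T} t *\<^sub>R (\<eta>' t * indicator {s..} t))"
   proof (rule integral_cong_AE)
    have "AE t in lborel. t \<noteq> T" by (rule AE_lborel_singleton)
    then show "AE t in lborel. indicator {s..T} t *\<^sub>R \<eta>' t = indicator {-T<..<T} t *\<^sub>R (\<eta>' t * indicator {s..} t)"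
     by eventually_elim (use s in \<open>auto simp: indicator_def\<close>)
   qed measurable
   ultimately show ?thesis unfolding integrable_lborel_I_iff by simp
  qed
  have mp: "(%(z, t). (\<eta>' t * indicator {fst z..} t) * ?g z) \<in> borel_measurable (\<mu> \<Otimes>\<^sub>M lborel_I T)"
  proof -
   have [measurable]: "\<eta>' \<in> borel_measurable (lborel_I T)" by fact
   have gm: "?g \<in> borel_measurable \<mu>" using g by simp
   have "continuous_on UNIV (%z::real \<times> torus. fst z)" by (intro continuous_intros)
   then have [measurable]: "fst \<in> borel_measurable \<mu>"
    using continuous_measurable_QT[of fst T] \<mu>(2) by (simp cong: measurable_cong_sets)
   have [measurable]: "(%t. t) \<in> borel_measurable (lborel_I T)" by (simp add: measurable_restrict_space1)
   have ms: "(%w. snd w) \<in> borel_measurable (\<mu> \<Otimes>\<^sub>M lborel_I T)"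
    by (rule measurable_compose[OF measurable_snd]) measurable
   have mf: "(%w. fst (fst w)) \<in> borel_measurable (\<mu> \<Otimes>\<^sub>M lborel_I T)"
    by (rule measurable_compose[OF measurable_fst]) measurable
   have "{w \<in> space (\<mu> \<Otimes>\<^sub>M lborel_I T). fst (fst w) \<le> snd w} \<in> sets (\<mu> \<Otimes>\<^sub>M lborel_I T)"
    by (rule borel_measurable_le[OF mf ms])
   then have "(%w. indicator {w. fst (fst w) \<le> snd w} w :: real) \<in> borel_measurable (\<mu> \<Otimes>\<^sub>M lborel_I T)"
    by (intro borel_measurable_indicator') (simp add: Collect_conj_eq Int_commute)
   moreover have "(%w. \<eta>' (snd w)) \<in> borel_measurable (\<mu> \<Otimes>\<^sub>M lborel_I T)" "(%w. ?g (fst w)) \<in> borel_measurable (\<mu> \<Otimes>\<^sub>M lborel_I T)"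
    using measurable_compose[OF measurable_snd \<eta>'m, of \<mu>] measurable_compose[OF measurable_fst gm] by auto
   ultimately have "(%w. (\<eta>' (snd w) * indicator {w. fst (fst w) \<le> snd w} w) * ?g (fst w)) \<in> borel_measurable (\<mu> \<Otimes>\<^sub>M lborel_I T)"
    by (intro borel_measurable_times)
   then show ?thesis by (simp add: case_prod_unfold indicator_def)
  qed
  have bd: "norm ((\<eta>' t * indicator {fst z..} t) * ?g z) \<le> C * \<bar>?g z\<bar>" if "t \<in> {-T<..<T}" for z t
   using C(2)[OF that] by (auto simp: abs_mult indicator_def intro!: mult_right_mono)
  have iz: "integrable (lborel_I T) (%t. (\<eta>' t * indicator {fst z..} t) * ?g z)" if "z \<in> space \<mu>" for z
   using bd[of _ z] measurable_Pair2[OF mp that] by (intro I.integrable_const_bound[where B="C * \<bar>?g z\<bar>"]) auto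
  have ip: "integrable (\<mu> \<Otimes>\<^sub>M lborel_I T) (%(z, t). (\<eta>' t * indicator {fst z..} t) * ?g z)"
  proof (rule Fubini_integrable[OF mp])
   have nm: "(%z. LINT t|lborel_I T. norm ((\<eta>' t * indicator {fst z..} t) * ?g z)) \<in> borel_measurable \<mu>"
    using measurable_compose[OF mp borel_measurable_norm] by (intro I.borel_measurable_lebesgue_integral) (simp add: case_prod_unfold)
   show "integrable \<mu> (%z. LINT t|lborel_I T. norm (case (z, t) of (z, t) => (\<eta>' t * indicator {fst z..} t) * ?g z))"
   proof (rule Bochner_Integration.integrable_bound)
    show "integrable \<mu> (%z. measure (lborel_I T) (space (lborel_I T)) * (C * \<bar>?g z\<bar>))"
     using g by (intro integrable_mult_right integrable_abs)
    show "AE z in \<mu>. norm (LINT t|lborel_I T. norm (case (z, t) of (z, t) => (\<eta>' t * indicator {fst z..} t) * ?g z))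
      \<le> norm (measure (lborel_I T) (space (lborel_I T)) * (C * \<bar>?g z\<bar>))"
    proof (rule AE_I2)
     fix z assume z: "z \<in> space \<mu>"
     have "(LINT t|lborel_I T. norm ((\<eta>' t * indicator {fst z..} t) * ?g z)) \<le> (LINT t|lborel_I T. C * \<bar>?g z\<bar>)"
      using bd[of _ z] iz[OF z] by (intro integral_mono) auto
     then show "norm (LINT t|lborel_I T. norm (case (z, t) of (z, t) => (\<eta>' t * indicator {fst z..} t) * ?g z))
      \<le> norm (measure (lborel_I T) (space (lborel_I T)) * (C * \<bar>?g z\<bar>))"
      using C(1) by simp
    qed
   qed (use nm in simp)
  qed (use iz in auto)
  have "(LINT z|\<mu>. \<eta> (fst z) * ?g z) = (LINT z|\<mu>. - (LINT t|lborel_I T. (\<eta>' t * indicator {fst z..} t) * ?g z))"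
   using \<eta>_eq sp by (intro Bochner_Integration.integral_cong) (auto simp: QT_def)
  also have "... = - (LINT t|lborel_I T. LINT z|\<mu>. (\<eta>' t * indicator {fst z..} t) * ?g z)"
   using Fubini_integral[OF ip] by simp
  also have "... = - (LINT t|lborel_I T. \<eta>' t * ?G t)"
   by (simp add: flow_def mult.assoc indicator_def)
  finally have 2: "(LINT z|\<mu>. \<eta> (fst z) * ?g z) = - (LINT t|lborel_I T. \<eta>' t * ?G t)" .
  have "(LINT z|\<mu>. time_deriv ?\<phi> z) = (LINT z|\<mu>. \<eta>' (fst z) * f (snd z))"
   by (intro Bochner_Integration.integral_cong refl tf(2))
  moreover have "(LINT z|\<mu>. space_grad ?\<phi> z \<bullet> vector_RN_deriv \<mu> m z) = (LINT z|\<mu>. \<eta> (fst z) * ?g z)"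
   unfolding tf(3) by simp
  moreover have "(LINT z|\<mu>. time_deriv ?\<phi> z) + (LINT z|\<mu>. space_grad ?\<phi> z \<bullet> vector_RN_deriv \<mu> m z) = 0"
   using m tf(1) unfolding fluxes_def by blast
  ultimately have "(LINT z|\<mu>. \<eta>' (fst z) * f (snd z)) + (LINT z|\<mu>. \<eta> (fst z) * ?g z) = 0" by simp
  then have "(LINT t|lborel_I T. \<eta>' t * ?F t) - (LINT t|lborel_I T. \<eta>' t * ?G t) = 0" using 1 2 by simp
  moreover have "integrable (lborel_I T) (%t. \<eta>' t * h t)" if "integrable (lborel_I T) h" for h
  proof (rule Bochner_Integration.integrable_bound[OF integrable_mult_right[OF that, of C]])
   show "AE t in lborel_I T. norm (\<eta>' t * h t) \<le> norm (C * h t)"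
    using C by (intro AE_I2) (auto simp: abs_mult intro!: mult_right_mono)
  qed (use that \<eta>'m in auto)
  ultimately show "(LINT t|lborel_I T. \<eta>' t * (?F t - ?G t)) = 0"
   using F G by (simp add: right_diff_distrib)
 qed (use \<open>T > 0\<close> in auto)
 then obtain c where "AE t in lborel_I T. ?F t - ?G t = c" by blast
 then show ?thesis by (intro exI[of _ c]) (auto elim!: eventually_mono)
qed

section \<open>Couplings\<close>

lemma finite_borelD:
 assumes "finite_borel \<sigma>"
 shows "sets \<sigma> = sets borel" "space \<sigma> = UNIV" "finite_measure \<sigma>"
 using assms sets_eq_imp_space_eq[of \<sigma> borel] by (auto simp: finite_borel_def)

lemma measurable_finite_borel:
 assumes "finite_borel \<sigma>" "f \<in> measurable borel N"
 shows "f \<in> measurable \<sigma> N"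
 using assms finite_borelD(1)[OF assms(1)] by (simp cong: measurable_cong_sets)

lemma integrable_continuous_torus:
 fixes f :: "torus => 'b::{banach, second_countable_topology}"
 assumes "finite_borel \<sigma>" "continuous_on UNIV f"
 shows "integrable \<sigma> f"
proof -
 interpret finite_measure \<sigma> by (rule finite_borelD[OF assms(1)])
 obtain B where "\<And>p. norm (f p) \<le> B" using bounded_continuous_torus[OF assms(2)] by blast
 then show ?thesis
  by (intro integrable_const_bound[where B=B] measurable_finite_borel[OF assms(1)] borel_measurable_continuous_onI[OF assms(2)]) auto
qed

lemma continuous_prod_integrable:
 fixes f :: "torus \<times> torus => real"
 assumes "sets \<pi> = sets borel" "finite_measure \<pi>" "continuous_on UNIV f"
 shows "integrable \<pi> f"
proof -
 interpret finite_measure \<pi> by fact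
 have "compact (UNIV \<times> UNIV :: (torus \<times> torus) set)" by (intro compact_Times compact_torus)
 then have "bounded (range f)" using assms(3) by (intro compact_imp_bounded compact_continuous_image) auto
 then obtain B where "\<And>z. norm (f z) \<le> B" by (auto simp: bounded_iff)
 moreover have "f \<in> borel_measurable \<pi>"
  using borel_measurable_continuous_onI[OF assms(3)] assms(1) by (simp cong: measurable_cong_sets)
 ultimately show ?thesis by (intro integrable_const_bound[where B=B]) auto
qed

definition lipschitz_fun :: "real => ('a::metric_space => real) => bool"
 where "lipschitz_fun L f \<longleftrightarrow> (\<forall>x y. \<bar>f x - f y\<bar> \<le> L * dist x y)"

lemma lipschitz_fun_continuous: "lipschitz_fun L f ==> continuous_on UNIV f"
 unfolding continuous_on_iff
proof safe
 fix x and e :: real assume L: "lipschitz_fun L f" and e: "e > 0"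
 show "\<exists>d>0. \<forall>x'\<in>UNIV. dist x' x < d \<longrightarrow> dist (f x') (f x) < e"
 proof (intro exI[of _ "e / (\<bar>L\<bar> + 1)"] conjI ballI impI)
  fix y assume d: "dist y x < e / (\<bar>L\<bar> + 1)"
  have "dist (f y) (f x) \<le> L * dist y x" using L by (simp add: lipschitz_fun_def dist_real_def)
  also have "... \<le> (\<bar>L\<bar> + 1) * dist y x" by (intro mult_right_mono) auto
  also have "... < e" using d by (simp add: field_simps)
  finally show "dist (f y) (f x) < e" .
 qed (use e in auto)
qed

lemma coupling_mass:
 assumes "\<pi> \<in> couplings \<sigma> \<rho>"
 shows "measure \<pi> UNIV = measure \<sigma> UNIV" "measure \<pi> UNIV = measure \<rho> UNIV"
proof -
 have \<pi>: "sets \<pi> = sets borel" "distr \<pi> borel fst = \<sigma>" "distr \<pi> borel snd = \<rho>"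
  using assms by (auto simp: couplings_def)
 have sp: "space \<pi> = UNIV" using sets_eq_imp_space_eq[OF \<pi>(1)] by simp
 have "fst \<in> measurable \<pi> borel" "snd \<in> measurable \<pi> borel"
  using \<pi>(1) by (auto simp: borel_prod[symmetric] cong: measurable_cong_sets)
 then show "measure \<pi> UNIV = measure \<sigma> UNIV" "measure \<pi> UNIV = measure \<rho> UNIV"
  using \<pi>(2,3) sp by (auto simp: measure_distr)
qed

text \<open>The easy half of the duality between couplings and Lipschitz functions. The passage from
  the quadratic to the linear cost is the pointwise bound \<open>d \<le> w + d^2 / w\<close>, which
  explains the factor mass plus one.\<close>

lemma wasserstein_lessD:
 assumes "wasserstein \<sigma> \<rho> < ennreal w" "lipschitz_fun L f" "L \<ge> 0"
 shows "\<bar>(LINT p|\<sigma>. f p) - (LINT p|\<rho>. f p)\<bar> \<le> L * (measure \<rho> UNIV + 1) * w"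
proof -
 have w: "w > 0" using assms(1) by (metis ennreal_neg linorder_not_less not_less_zero order_le_less)
 obtain \<pi> where p: "\<pi> \<in> couplings \<sigma> \<rho>" and less: "ennreal (sqrt (LINT z|\<pi>. (dist (fst z) (snd z))\<^sup>2)) < ennreal w"
  using assms(1) unfolding wasserstein_def INF_less_iff by blast
 have \<pi>: "sets \<pi> = sets borel" "finite_measure \<pi>" "distr \<pi> borel fst = \<sigma>" "distr \<pi> borel snd = \<rho>"
  using p by (auto simp: couplings_def)
 interpret finite_measure \<pi> by fact
 have sp: "space \<pi> = UNIV" using sets_eq_imp_space_eq[OF \<pi>(1)] by simp
 let ?S = "LINT z|\<pi>. (dist (fst z) (snd z))\<^sup>2"
 have S0: "?S \<ge> 0" by simp
 have "sqrt ?S < w" using less w by (meson ennreal_leI not_le)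
 then have S: "?S \<le> w\<^sup>2" using S0 by (metis less_imp_le real_sqrt_le_iff real_sqrt_unique w)
 note cf = lipschitz_fun_continuous[OF assms(2)]
 have fm: "f \<in> borel_measurable borel" by (rule borel_measurable_continuous_onI[OF cf])
 have proj: "fst \<in> measurable \<pi> borel" "snd \<in> measurable \<pi> borel"
  using \<pi>(1) by (auto simp: borel_prod[symmetric] cong: measurable_cong_sets)
 have int: "integrable \<pi> g" if "continuous_on UNIV g" for g :: "_ => real"
  by (rule continuous_prod_integrable[OF \<pi>(1,2) that])
 have c: "continuous_on UNIV (%z::torus \<times> torus. dist (fst z) (snd z))" by (intro continuous_intros)
 have c1: "continuous_on UNIV (%z::torus \<times> torus. f (fst z))" "continuous_on UNIV (%z::torus \<times> torus. f (snd z))"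
  by (auto intro!: continuous_on_compose2[OF cf] continuous_intros)
 have "\<bar>(LINT p|\<sigma>. f p) - (LINT p|\<rho>. f p)\<bar> = \<bar>LINT z|\<pi>. f (fst z) - f (snd z)\<bar>"
  using integral_distr[OF proj(1) fm] integral_distr[OF proj(2) fm] int[OF c1(1)] int[OF c1(2)] \<pi>(3,4) by simp
 also have "... \<le> (LINT z|\<pi>. \<bar>f (fst z) - f (snd z)\<bar>)"
  using integral_norm_bound[of \<pi> "%z. f (fst z) - f (snd z)"] by simp
 also have "... \<le> (LINT z|\<pi>. L * (w + (dist (fst z) (snd z))\<^sup>2 / w))"
 proof (rule integral_mono)
  fix z :: "torus \<times> torus"
  let ?d = "dist (fst z) (snd z)"
  have "?d \<le> w + ?d\<^sup>2 / w"
  proof (cases "?d \<le> w")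
   case True
   then show ?thesis using w by (smt (verit) divide_nonneg_pos zero_le_power2)
  next
   case False
   then have "?d * w \<le> ?d\<^sup>2" using w by (simp add: power2_eq_square mult_left_mono)
   then have "?d \<le> ?d\<^sup>2 / w" using w by (simp add: pos_le_divide_eq)
   then show ?thesis using w by linarith
  qed
  then have "L * ?d \<le> L * (w + ?d\<^sup>2 / w)" using assms(3) by (rule mult_left_mono)
  then show "\<bar>f (fst z) - f (snd z)\<bar> \<le> L * (w + ?d\<^sup>2 / w)"
   using assms(2) unfolding lipschitz_fun_def by (meson order_trans)
 qed (auto intro!: int continuous_intros c1 simp: w less_imp_neq[OF w, symmetric])
 also have "... = L * (w * measure \<pi> UNIV + ?S / w)"
  using int[of "%z. (dist (fst z) (snd z))\<^sup>2"] sp by (simp add: continuous_intros)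
 also have "... \<le> L * (w * measure \<rho> UNIV + w)"
  using S w assms(3) coupling_mass(2)[OF p] by (intro mult_left_mono) (auto simp: pos_divide_le_eq power2_eq_square)
 finally show ?thesis by (simp add: algebra_simps)
qed

text \<open>These functions decrease to the indicator of a closed set, so integrals of Lipschitz
  functions determine the masses of closed sets and with them the whole measure.\<close>

lemma lipschitz_infdist: "lipschitz_fun (real n) (%p. max 0 (1 - real n * infdist p C))"
 unfolding lipschitz_fun_def
proof (intro allI)
 fix x y :: 'a
 have "\<bar>infdist x C - infdist y C\<bar> \<le> dist x y" using infdist_triangle[of x C y] infdist_triangle[of y C x] by (simp add: dist_commute)
 then have "real n * \<bar>infdist x C - infdist y C\<bar> \<le> real n * dist x y" by (rule mult_left_mono) simp
 moreover have "\<bar>max 0 (1 - real n * infdist x C) - max 0 (1 - real n * infdist y C)\<bar> \<le> \<bar>real n * infdist x C - real n * infdist y C\<bar>"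
  by (auto simp: max_def)
 moreover have "\<bar>real n * infdist x C - real n * infdist y C\<bar> = real n * \<bar>infdist x C - infdist y C\<bar>"
  by (simp add: right_diff_distrib[symmetric] abs_mult)
 ultimately show "\<bar>max 0 (1 - real n * infdist x C) - max 0 (1 - real n * infdist y C)\<bar> \<le> real n * dist x y" by linarith
qed

lemma closed_indicator_limit:
 fixes C :: "'a::metric_space set"
 assumes "closed C" "C \<noteq> {}"
 shows "(%n. max 0 (1 - real n * infdist p C)) \<longlonglongrightarrow> indicator C p"
proof (cases "p \<in> C")
 case True
 then show ?thesis by simp
next
 case False
 then have pos: "infdist p C > 0" using in_closed_iff_infdist_zero[OF assms, of p] infdist_nonneg[of p C] by (simp add: order_le_less)
 obtain N :: nat where N: "1 < real N * infdist p C" using ex_less_of_nat_mult[OF pos, of 1] by blast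
 have "\<forall>\<^sub>F n in sequentially. 0 = max 0 (1 - real n * infdist p C)"
  unfolding eventually_sequentially
 proof (intro exI[of _ N] allI impI)
  fix n assume "N \<le> n"
  then have "real N * infdist p C \<le> real n * infdist p C" using pos by (intro mult_right_mono) auto
  then show "0 = max 0 (1 - real n * infdist p C)" using N by simp
 qed
 then show ?thesis using False by (auto intro: Lim_transform_eventually[OF tendsto_const])
qed

lemma measure_closed_limit:
 fixes \<sigma> :: "torus measure"
 assumes "finite_borel \<sigma>" "closed C" "C \<noteq> {}"
 shows "(%n. LINT p|\<sigma>. max 0 (1 - real n * infdist p C)) \<longlonglongrightarrow> measure \<sigma> C"
proof -
 interpret finite_measure \<sigma> by (rule finite_borelD[OF assms(1)])
 have C: "C \<in> sets \<sigma>" using assms finite_borelD(1)[OF assms(1)] by auto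
 have "(%n. LINT p|\<sigma>. max 0 (1 - real n * infdist p C)) \<longlonglongrightarrow> (LINT p|\<sigma>. indicator C p)"
 proof (rule integral_dominated_convergence[where w="%_. 1"])
  show "(%p. max 0 (1 - real n * infdist p C)) \<in> borel_measurable \<sigma>" for n
   by (intro measurable_finite_borel[OF assms(1)] borel_measurable_continuous_onI lipschitz_fun_continuous[OF lipschitz_infdist])
  show "AE p in \<sigma>. (%n. max 0 (1 - real n * infdist p C)) \<longlonglongrightarrow> indicator C p"
   by (intro AE_I2 closed_indicator_limit assms)
  show "AE p in \<sigma>. norm (max 0 (1 - real n * infdist p C)) \<le> 1" for n
   by (intro AE_I2) (auto simp: infdist_nonneg)
 qed (use C in auto)
 then show ?thesis using C by simp
qed

lemma borel_measure_eqI_lipschitz: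
 assumes "finite_borel \<sigma>" "finite_borel \<rho>"
  and eq: "\<And>L f. L \<ge> 0 ==> lipschitz_fun L f ==> (LINT p|\<sigma>. f p) = (LINT p|\<rho>. f p)"
 shows "\<sigma> = \<rho>"
proof -
 interpret s: finite_measure \<sigma> by (rule finite_borelD[OF assms(1)])
 interpret r: finite_measure \<rho> by (rule finite_borelD[OF assms(2)])
 have cl: "emeasure \<sigma> C = emeasure \<rho> C" if "closed C" for C
 proof (cases "C = {}")
  case False
  have "measure \<sigma> C = measure \<rho> C"
   using measure_closed_limit[OF assms(1) that False] measure_closed_limit[OF assms(2) that False]
   unfolding eq[OF of_nat_0_le_iff lipschitz_infdist] by (rule LIMSEQ_unique)
  then show ?thesis by (simp add: s.emeasure_eq_measure r.emeasure_eq_measure)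
 qed simp
 show ?thesis
 proof (rule measure_eqI_generator_eq[where E="Collect closed" and \<Omega>=UNIV and A="%_. UNIV"])
  show "Int_stable (Collect closed :: torus set set)" by (auto simp: Int_stable_def)
  have "sets (borel :: torus measure) = sigma_sets UNIV (Collect closed)" by (simp add: borel_eq_closed)
  then show "sets \<sigma> = sigma_sets UNIV (Collect closed)" "sets \<rho> = sigma_sets UNIV (Collect closed)"
   using finite_borelD(1) assms(1,2) by auto
 qed (auto simp: cl)
qed

section \<open>A smooth substitute for the squared distance\<close>

text \<open>The squared distance is not smooth at the cut locus. Squared sines of period one are,
  and they dominate four times the squared distance.\<close>

definition tdist2 :: "torus => torus => real"
 where "tdist2 p q = (\<Sum>i\<in>UNIV. (sin (pi * (rep_torus p $ i - rep_torus q $ i)))\<^sup>2)"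

lemma sin_pi_add_Ints_sq: "k \<in> \<int> ==> (sin (pi * (x + k)))\<^sup>2 = (sin (pi * x))\<^sup>2"
proof -
 assume "k \<in> \<int>"
 then have "sin (pi * k) = 0" using sin_times_pi_eq_0[of k] by (simp add: mult.commute)
 then have "(cos (pi * k))\<^sup>2 = 1" using sin_cos_squared_add[of "pi * k"] by simp
 moreover have "sin (pi * (x + k)) = sin (pi * x) * cos (pi * k)"
  unfolding distrib_left sin_add \<open>sin (pi * k) = 0\<close> by simp
 ultimately show ?thesis by (simp only: power_mult_distrib mult_1_right)
qed

lemma tdist2_abs: "tdist2 (abs_torus x) (abs_torus y) = (\<Sum>i\<in>UNIV. (sin (pi * (x $ i - y $ i)))\<^sup>2)"
 unfolding tdist2_def
proof (rule sum.cong[OF refl])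
 fix i :: 2
 have "rep_torus (abs_torus z) $ i - z $ i \<in> \<int>" for z
  using abs_torus_eq_iff[of "rep_torus (abs_torus z)" z] abs_torus_rep[of "abs_torus z"] by simp
 from Ints_diff[OF this[of x] this[of y]]
 have "(rep_torus (abs_torus x) $ i - x $ i) - (rep_torus (abs_torus y) $ i - y $ i) \<in> \<int>" .
 from sin_pi_add_Ints_sq[OF this, of "x $ i - y $ i"]
 show "(sin (pi * (rep_torus (abs_torus x) $ i - rep_torus (abs_torus y) $ i)))\<^sup>2 = (sin (pi * (x $ i - y $ i)))\<^sup>2"
  by (simp add: algebra_simps)
qed

lemma tdist2_refl [simp]: "tdist2 p p = 0"
 by (simp add: tdist2_def)

lemma tdist2_nonneg [simp]: "0 \<le> tdist2 p q"
 by (simp add: tdist2_def sum_nonneg)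

lemma tdist2_le_2: "tdist2 p q \<le> 2"
proof -
 have "tdist2 p q \<le> (\<Sum>i\<in>(UNIV :: 2 set). 1)"
  unfolding tdist2_def by (intro sum_mono) (metis abs_sin_le_one abs_square_le_1)
 then show ?thesis by simp
qed

text \<open>Concavity puts the sine above its chord on \<open>[0, \<pi>/2]\<close>.\<close>

lemma sin_pi_ge: "\<bar>u\<bar> \<le> 1 / 2 ==> (2 * u)\<^sup>2 \<le> (sin (pi * u))\<^sup>2"
proof -
 assume u: "\<bar>u\<bar> \<le> 1 / 2"
 have *: "2 * v \<le> sin (pi * v)" if "0 \<le> v" "v \<le> 1 / 2" for v :: real
 proof -
  have "concave_on {0..pi} sin"
  proof (rule f''_le0_imp_concave[where f'=cos and f''="%x. - sin x"])
   show "- sin x \<le> 0" if "x \<in> {0..pi}" for x using that sin_ge_zero by auto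
  qed (auto intro!: derivative_eq_intros)
  from concave_onD[OF this, of "2 * v" 0 "pi / 2"] that show ?thesis by (simp add: algebra_simps)
 qed
 have "2 * \<bar>u\<bar> \<le> sin (pi * \<bar>u\<bar>)" using * u by simp
 then have "(2 * \<bar>u\<bar>)\<^sup>2 \<le> (sin (pi * \<bar>u\<bar>))\<^sup>2" by (intro power_mono) auto
 then show ?thesis by (cases "u \<ge> 0") auto
qed

lemma dist_le_tdist2: "4 * (dist p q)\<^sup>2 \<le> tdist2 p q"
proof -
 obtain x y where xy: "p = abs_torus x" "q = abs_torus y" by (metis abs_torus_rep)
 \<comment> \<open>Rounding picks the representative of \<open>q\<close> whose coordinates differ
   from those of \<open>x\<close> by at most one half, the range in which the chord bound for the
   sine holds.\<close>
 define y' :: "real^2" where "y' = (\<chi> i. y $ i + round (x $ i - y $ i))"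
 have y': "abs_torus y' = q" unfolding xy abs_torus_eq_iff by (simp add: y'_def)
 have "\<bar>x $ i - y' $ i\<bar> \<le> 1 / 2" for i
  using of_int_round_abs_le[of "x $ i - y $ i"] by (simp add: y'_def abs_minus_commute diff_diff_eq algebra_simps)
 then have "(\<Sum>i\<in>UNIV. (2 * (x $ i - y' $ i))\<^sup>2) \<le> tdist2 p q"
  unfolding xy(1) y'[symmetric] tdist2_abs by (intro sum_mono sin_pi_ge)
 moreover have "(\<Sum>i\<in>UNIV. (2 * (x $ i - y' $ i))\<^sup>2) = 4 * (dist x y')\<^sup>2"
 proof -
  have "(dist x y')\<^sup>2 = (\<Sum>i\<in>UNIV. (x $ i - y' $ i)\<^sup>2)" by (simp add: dist_norm norm_vec_def L2_set_def sum_nonneg)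
  then show ?thesis unfolding sum_distrib_left by (simp add: sum_distrib_left power2_eq_square algebra_simps)
 qed
 moreover have "(dist p q)\<^sup>2 \<le> (dist x y')\<^sup>2"
  using dist_abs_torus_le[of x y'] by (intro power_mono) (auto simp: xy(1) y')
 ultimately show ?thesis by linarith
qed

lemma dist_torus_le_1: "dist (p::torus) q \<le> 1"
proof (rule power2_le_imp_le)
 show "(dist p q)\<^sup>2 \<le> 1\<^sup>2" using dist_le_tdist2[of p q] tdist2_le_2[of p q] by simp
qed simp

lemma smooth_space_iff: "smooth_space f \<longleftrightarrow> smooth (%z::real \<times> (real^2). f (abs_torus (snd z)))"
 by (simp add: smooth_space_def lift_fun_def case_prod_unfold)

lemma smooth_space_intros:
 shows smooth_space_const: "smooth_space (%p. c)"
  and smooth_space_add: "smooth_space f ==> smooth_space g ==> smooth_space (%p. f p + g p)"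
  and smooth_space_mult: "smooth_space f ==> smooth_space g ==> smooth_space (%p. f p * g p)"
  and smooth_space_diff: "smooth_space f ==> smooth_space g ==> smooth_space (%p. f p - g p)"
  and smooth_space_power: "smooth_space f ==> smooth_space (%p. f p ^ k)"
  and smooth_space_flat: "smooth_space f ==> smooth_space (%p. flat P (f p))"
  and smooth_space_inverse: "smooth_space f ==> (\<And>p. f p > 0) ==> smooth_space (%p. inverse (f p))"
 unfolding smooth_space_iff
 by (intro smooth_const smooth_add smooth_mult smooth_diff smooth_power smooth_flat smooth_inverse; simp)+

lemma smooth_space_sum: "(\<And>i. i \<in> A ==> smooth_space (f i)) ==> smooth_space (%p. \<Sum>i\<in>A. f i p)"
 unfolding smooth_space_iff by (intro smooth_sum) auto

lemma smooth_space_tdist2: "smooth_space (%p. tdist2 p q)"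
proof -
 obtain y where y: "q = abs_torus y" by (metis abs_torus_rep)
 have "bounded_linear (%z::real \<times> (real^2). snd z $ i)" for i
  by (rule bounded_linear_compose[OF bounded_linear_vec_nth bounded_linear_snd])
 then show ?thesis
  unfolding smooth_space_iff y tdist2_abs
  by (intro smooth_sum smooth_power smooth_sin smooth_mult smooth_diff smooth_const smooth_bounded_linear)
qed

definition pou :: "real => torus set => (torus => torus => real) => bool"
 where "pou \<delta> C \<psi> \<longleftrightarrow> finite C \<and> (\<forall>c. smooth_space (\<psi> c)) \<and> (\<forall>c p. 0 \<le> \<psi> c p) \<and>
  (\<forall>p. (\<Sum>c\<in>C. \<psi> c p) = 1) \<and> (\<forall>c p. 0 < \<psi> c p \<longrightarrow> dist p c \<le> \<delta>)"

text \<open>Bumps \<open>flat 1 (\<delta>\<^sup>2 - tdist2 p c)\<close> at the centres of a finite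
  subcover, divided by their sum. Where a bump is positive, \<open>tdist2\<close> is below
  \<open>\<delta>\<^sup>2\<close>, and the comparison with the distance puts the point within
  \<open>\<delta>\<close> of the centre.\<close>

lemma smooth_partition_of_unity:
 assumes "\<delta> > 0"
 shows "\<exists>C \<psi>. pou \<delta> C \<psi>"
proof -
 define U where "U c = {p. tdist2 p c < \<delta>\<^sup>2}" for c
 have "open (U c)" for c unfolding U_def
  by (intro open_Collect_less continuous_smooth_space[OF smooth_space_tdist2] continuous_intros)
 moreover have "UNIV \<subseteq> (\<Union>c\<in>UNIV. U c)" using assms by (auto simp: U_def intro!: exI[of _ "_ :: torus"])
 ultimately obtain C where C: "C \<subseteq> UNIV" "finite C" "UNIV \<subseteq> (\<Union>c\<in>C. U c)"
  using compactE_image[OF compact_torus, of UNIV U] by blast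
 define b where "b c p = flat 1 (\<delta>\<^sup>2 - tdist2 p c)" for c p
 have b: "0 \<le> b c p" "b c p > 0 \<longleftrightarrow> p \<in> U c" for c p by (auto simp: b_def flat_1 U_def)
 have sb: "smooth_space (b c)" for c
  unfolding b_def by (intro smooth_space_flat smooth_space_diff smooth_space_const smooth_space_tdist2)
 have pos: "(\<Sum>c\<in>C. b c p) > 0" for p
 proof -
  obtain c where "c \<in> C" "b c p > 0" using C(3) b(2) by blast
  then show ?thesis using C(2) b(1) by (intro sum_pos2[of C c]) auto
 qed
 define \<psi> where "\<psi> c p = b c p * inverse (\<Sum>c\<in>C. b c p)" for c p
 have "smooth_space (\<psi> c)" for c
  unfolding \<psi>_def by (intro smooth_space_mult smooth_space_inverse smooth_space_sum sb pos)
 moreover have "0 \<le> \<psi> c p" for c p using b(1) by (simp add: \<psi>_def sum_nonneg)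
 moreover have "(\<Sum>c\<in>C. \<psi> c p) = 1" for p using pos[of p] by (simp add: \<psi>_def sum_distrib_right[symmetric])
 moreover have "dist p c \<le> \<delta>" if "0 < \<psi> c p" for c p
 proof -
  have "b c p > 0" using that pos[of p] b(1)[of c p] by (auto simp: \<psi>_def zero_less_mult_iff)
  then have "4 * (dist p c)\<^sup>2 < \<delta>\<^sup>2" using b(2) dist_le_tdist2[of p c] by (auto simp: U_def)
  then have "(dist p c)\<^sup>2 \<le> \<delta>\<^sup>2" using zero_le_power2[of "dist p c"] by linarith
  then show ?thesis by (rule power2_le_imp_le) (use assms in simp)
 qed
 ultimately show ?thesis using C(2) unfolding pou_def by blast
qed

text \<open>Finitely many smooth integrals recover every Lipschitz integral up to an error uniform
  in the measure. Statements known almost everywhere in time for each smooth function thereby pass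
  to all Lipschitz functions at once.\<close>

lemma pou_approx:
 assumes \<psi>: "pou \<delta> C \<psi>" and f: "L \<ge> 0" "lipschitz_fun L f" and \<nu>: "finite_borel \<nu>" "measure \<nu> UNIV = 1"
 shows "\<bar>(LINT p|\<nu>. f p) - (\<Sum>c\<in>C. f c * (LINT p|\<nu>. \<psi> c p))\<bar> \<le> L * \<delta>"
proof -
 interpret finite_measure \<nu> by (rule finite_borelD[OF \<nu>(1)])
 have i: "integrable \<nu> (\<psi> c)" for c
  using \<psi> by (intro integrable_continuous_torus[OF \<nu>(1)] continuous_smooth_space) (simp add: pou_def)
 have fi: "integrable \<nu> f" by (rule integrable_continuous_torus[OF \<nu>(1) lipschitz_fun_continuous[OF f(2)]])
 have si: "integrable \<nu> (%p. \<Sum>c\<in>C. f c * \<psi> c p)" using i by (intro Bochner_Integration.integrable_sum) simp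
 have pw: "\<bar>f p - (\<Sum>c\<in>C. f c * \<psi> c p)\<bar> \<le> L * \<delta>" for p
 proof -
  have s1: "(\<Sum>c\<in>C. \<psi> c p) = 1" using \<psi> by (simp add: pou_def)
  have "f p - (\<Sum>c\<in>C. f c * \<psi> c p) = (\<Sum>c\<in>C. (f p - f c) * \<psi> c p)"
   using s1 by (simp add: left_diff_distrib sum_subtractf sum_distrib_left[symmetric])
  also have "\<bar>...\<bar> \<le> (\<Sum>c\<in>C. L * \<delta> * \<psi> c p)"
  proof (rule order_trans[OF sum_abs sum_mono])
   fix c
   show "\<bar>(f p - f c) * \<psi> c p\<bar> \<le> L * \<delta> * \<psi> c p"
   proof (cases "\<psi> c p = 0")
    case False
    then have c: "0 < \<psi> c p" "dist p c \<le> \<delta>" using \<psi> by (auto simp: pou_def order_less_le)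
    have "\<bar>f p - f c\<bar> \<le> L * dist p c" using f(2) by (simp add: lipschitz_fun_def)
    also have "... \<le> L * \<delta>" using c f(1) by (intro mult_left_mono) auto
    finally show ?thesis using c by (simp add: abs_mult)
   qed simp
  qed
  also have "... = L * \<delta>" using s1 by (simp add: sum_distrib_left[symmetric])
  finally show ?thesis .
 qed
 have "(LINT p|\<nu>. f p) - (\<Sum>c\<in>C. f c * (LINT p|\<nu>. \<psi> c p)) = (LINT p|\<nu>. f p - (\<Sum>c\<in>C. f c * \<psi> c p))"
  using i fi si by (simp add: Bochner_Integration.integral_sum)
 also have "\<bar>...\<bar> \<le> (LINT p|\<nu>. \<bar>f p - (\<Sum>c\<in>C. f c * \<psi> c p)\<bar>)"
  using integral_norm_bound[of \<nu> "%p. f p - (\<Sum>c\<in>C. f c * \<psi> c p)"] by simp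
 also have "... \<le> (LINT p|\<nu>. L * \<delta>)" using fi si pw by (intro Bochner_Integration.integral_mono) auto
 also have "... = L * \<delta>" using \<nu>(2) finite_borelD(2)[OF \<nu>(1)] by simp
 finally show ?thesis .
qed

text \<open>Random variables on a common space provide a coupling; the cost is bounded because the
  torus has diameter at most one, so dominated convergence applies.\<close>

lemma wasserstein_pointwise:
 assumes \<Omega>: "finite_measure \<Omega>" and X: "\<And>n. X n \<in> borel_measurable \<Omega>" "Y \<in> borel_measurable \<Omega>"
  and lim: "\<And>w. w \<in> space \<Omega> ==> (%n. X n w) \<longlonglongrightarrow> Y w"
 shows "(%n. wasserstein (distr \<Omega> borel (X n)) (distr \<Omega> borel (Y :: _ => torus))) \<longlonglongrightarrow> 0"
proof -
 interpret finite_measure \<Omega> by (rule \<Omega>)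
 let ?d = "%z :: torus \<times> torus. (dist (fst z) (snd z))\<^sup>2"
 have fs: "(fst :: torus \<times> torus => torus) \<in> borel_measurable borel" "(snd :: torus \<times> torus => torus) \<in> borel_measurable borel"
  and d: "?d \<in> borel_measurable borel"
  by (intro borel_measurable_continuous_onI continuous_intros)+
 have f: "(%w. (X n w, Y w)) \<in> borel_measurable \<Omega>" for n
  unfolding borel_prod[symmetric] by (intro measurable_Pair X)
 have W: "wasserstein (distr \<Omega> borel (X n)) (distr \<Omega> borel Y) \<le> ennreal (sqrt (LINT w|\<Omega>. ?d (X n w, Y w)))" for n
 proof -
  have "distr \<Omega> borel (%w. (X n w, Y w)) \<in> couplings (distr \<Omega> borel (X n)) (distr \<Omega> borel Y)"
   unfolding couplings_def using finite_measure_distr[OF f, of n]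
   by (auto simp: distr_distr[OF fs(1) f] distr_distr[OF fs(2) f] o_def)
  from INF_lower[OF this, of "%\<pi>. ennreal (sqrt (LINT z|\<pi>. ?d z))"]
  show ?thesis unfolding wasserstein_def integral_distr[OF f d] .
 qed
 have "(%n. LINT w|\<Omega>. ?d (X n w, Y w)) \<longlonglongrightarrow> (LINT w|\<Omega>. 0)"
 proof (rule integral_dominated_convergence[where w = "%_. 1"])
  show "AE w in \<Omega>. (%n. ?d (X n w, Y w)) \<longlonglongrightarrow> 0"
  proof (rule AE_I2)
   fix w assume "w \<in> space \<Omega>"
   then have "(%n. (dist (X n w) (Y w))\<^sup>2) \<longlonglongrightarrow> (dist (Y w) (Y w))\<^sup>2" by (intro tendsto_intros lim)
   then show "(%n. ?d (X n w, Y w)) \<longlonglongrightarrow> 0" by simp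
  qed
  show "AE w in \<Omega>. norm (?d (X n w, Y w)) \<le> 1" for n using dist_torus_le_1 by (simp add: power_le_one)
 qed (use measurable_compose[OF f d] in auto)
 then have "(%n. ennreal (sqrt (LINT w|\<Omega>. ?d (X n w, Y w)))) \<longlonglongrightarrow> ennreal (sqrt 0)"
  by (intro tendsto_ennrealI tendsto_real_sqrt) simp
 then have "(%n. ennreal (sqrt (LINT w|\<Omega>. ?d (X n w, Y w)))) \<longlonglongrightarrow> 0" by simp
 from tendsto_sandwich[OF _ _ tendsto_const this] W show ?thesis by (simp add: always_eventually)
qed

lemma wasserstein_tendsto_integral:
 assumes W: "((%s. wasserstein (\<sigma> s) \<rho>) \<longlongrightarrow> 0) F" and f: "L \<ge> 0" "lipschitz_fun L f"
 shows "((%s. LINT p|\<sigma> s. f p) \<longlongrightarrow> (LINT p|\<rho>. f p)) F"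
proof (rule tendstoI)
 let ?K = "L * (measure \<rho> UNIV + 1)"
 have K: "?K \<ge> 0" using f(1) by simp
 fix e :: real assume e: "e > 0"
 define w where "w = e / (?K + 1)"
 have w: "w > 0" using e K by (simp add: w_def)
 have "\<forall>\<^sub>F s in F. wasserstein (\<sigma> s) \<rho> < ennreal w" using w by (intro order_tendstoD(2)[OF W]) simp
 then show "\<forall>\<^sub>F s in F. dist (LINT p|\<sigma> s. f p) (LINT p|\<rho>. f p) < e"
 proof eventually_elim
  fix s assume "wasserstein (\<sigma> s) \<rho> < ennreal w"
  from wasserstein_lessD[OF this f(2,1)]
  have "\<bar>(LINT p|\<sigma> s. f p) - (LINT p|\<rho>. f p)\<bar> \<le> ?K * w" by simp
  also have "... < (?K + 1) * w" using w by simp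
  also have "... = e" using K by (simp add: w_def)
  finally show "dist (LINT p|\<sigma> s. f p) (LINT p|\<rho>. f p) < e" by (simp add: dist_real_def)
 qed
qed

section \<open>A space-filling curve on the torus\<close>

definition dyadic :: "nat => real => real"
 where "dyadic n x = of_int \<lfloor>2 ^ n * x\<rfloor> / 2 ^ n"

definition digit :: "nat => real => real"
 where "digit n x = of_int (\<lfloor>2 ^ Suc n * x\<rfloor> - 2 * \<lfloor>2 ^ n * x\<rfloor>)"

lemma digit_cases: "digit n x = 0 \<or> digit n x = 1"
proof -
 define y where "y = 2 ^ n * x"
 have "digit n x = of_int (\<lfloor>2 * y\<rfloor> - 2 * \<lfloor>y\<rfloor>)"
  by (simp add: digit_def y_def mult.assoc)
 moreover have "\<lfloor>2 * y\<rfloor> = 2 * \<lfloor>y\<rfloor> \<or> \<lfloor>2 * y\<rfloor> = 2 * \<lfloor>y\<rfloor> + 1"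
  by linarith
 ultimately show ?thesis by auto
qed

lemma dyadic_Suc: "dyadic (Suc n) x = dyadic n x + digit n x / 2 ^ Suc n"
 by (simp add: dyadic_def digit_def field_simps)

lemma dyadic_bounds: "dyadic n x \<le> x" "x < dyadic n x + 1 / 2 ^ n"
proof -
 have "of_int \<lfloor>2 ^ n * x\<rfloor> \<le> 2 ^ n * x" "2 ^ n * x < of_int \<lfloor>2 ^ n * x\<rfloor> + 1" by linarith+
 then show "dyadic n x \<le> x" "x < dyadic n x + 1 / 2 ^ n"
  by (auto simp: dyadic_def field_simps)
qed

lemma dyadic_sum: "0 \<le> x ==> x < 1 ==> (\<Sum>i<n. digit i x / 2 ^ Suc i) = dyadic n x"
proof (induction n)
 case 0
 then have "\<lfloor>x\<rfloor> = 0" by (simp add: floor_eq_iff)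
 then show ?case by (simp add: dyadic_def)
qed (simp add: dyadic_Suc)

lemma digit_sums:
 assumes "0 \<le> x" "x < 1"
 shows "(%n. digit n x / 2 ^ Suc n) sums x"
 unfolding sums_def dyadic_sum[OF assms]
proof (rule tendsto_sandwich)
 have "x - 1 / 2 ^ n \<le> dyadic n x" "dyadic n x \<le> x" for n
  using dyadic_bounds[where n=n and x=x] by linarith+
 then show "\<forall>\<^sub>F n in sequentially. x - 1 / 2 ^ n \<le> dyadic n x" "\<forall>\<^sub>F n in sequentially. dyadic n x \<le> x"
  by (simp_all add: always_eventually)
 have "(%n. x - (1 / 2) ^ n) \<longlonglongrightarrow> x - 0" by (intro tendsto_intros) auto
 then show "(%n. x - 1 / 2 ^ n) \<longlonglongrightarrow> x" by (simp add: power_divide)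
qed simp

text \<open>Schoenberg's curve in base four: the plateau function reads off the \<open>k\<close>-th digit
 \<open>e \<in> {0, 1}\<close> of \<open>t = \<Sum>k. e\<^sub>k / (2 \<cdot> 4\<^sup>k)\<close> from \<open>4\<^sup>k t\<close>, because the
 fractional part of \<open>4\<^sup>k t\<close> lies within \<open>[e/2, e/2 + 1/6]\<close>.\<close>

definition read_digit :: "real => real"
 where "read_digit x = max 0 (min 1 (1 / 2 - cos (2 * pi * (x - 1 / 12))))"

definition schoenberg :: "nat => real => real"
 where "schoenberg j t = (\<Sum>n. read_digit (4 ^ (2 * n + j) * t) / 2 ^ Suc n)"

lemma read_digit_range: "0 \<le> read_digit x" "read_digit x \<le> 1"
 by (auto simp: read_digit_def)

lemma continuous_read_digit: "continuous_on UNIV read_digit"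
 unfolding read_digit_def by (intro continuous_intros)

lemma read_digit_eq:
 assumes "e = 0 \<or> e = 1" "0 \<le> s" "s \<le> 1 / 6"
 shows "read_digit (of_int m + e / 2 + s) = e"
proof -
 let ?y = "2 * pi * (s - 1 / 12)"
 have "\<bar>?y\<bar> \<le> pi / 6"
 proof -
  have "\<bar>s - 1 / 12\<bar> \<le> 1 / 12" using assms(2,3) by linarith
  then have "2 * pi * \<bar>s - 1 / 12\<bar> \<le> 2 * pi * (1 / 12)" by (intro mult_left_mono) auto
  then show ?thesis by (simp add: abs_mult)
 qed
 then have "cos (pi / 6) \<le> cos \<bar>?y\<bar>" by (intro cos_monotone_0_pi_le) auto
 then have c: "sqrt 3 / 2 \<le> cos ?y" by (simp add: cos_30)
 have "1 \<le> sqrt 3" by simp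
 then have c': "1 / 2 \<le> cos ?y" using c by linarith
 have eq: "2 * pi * (of_int m + e / 2 + s - 1 / 12) = (?y + pi * e) + of_int (2 * m) * pi"
  by (simp add: algebra_simps)
 have ci: "cos (of_int (2 * m) * pi) = 1" and si: "sin (of_int (2 * m) * pi) = 0"
  using cos_int_2pin[of m] sin_int_2pin[of m] by (simp_all add: mult_ac)
 have "cos ((?y + pi * e) + of_int (2 * m) * pi) = cos (?y + pi * e)"
  unfolding cos_add[of "?y + pi * e"] ci si by simp
 then have "cos (2 * pi * (of_int m + e / 2 + s - 1 / 12)) = cos (?y + pi * e)" unfolding eq .
 moreover have "cos (?y + pi) = - cos ?y" by (rule cos_periodic_pi)
 ultimately show ?thesis using assms(1) c' unfolding read_digit_def by auto
qed

lemma continuous_schoenberg: "continuous_on UNIV (schoenberg j)"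
proof -
 let ?f = "%n t. read_digit (4 ^ (2 * n + j) * t) / 2 ^ Suc n"
 have "uniform_limit UNIV (%n t. \<Sum>i<n. ?f i t) (%t. suminf (%i. ?f i t)) sequentially"
 proof (rule Weierstrass_m_test)
  show "norm (?f n t) \<le> (1 / 2) ^ Suc n" for n t
   using read_digit_range[of "4 ^ (2 * n + j) * t"] by (simp add: power_divide divide_right_mono)
  show "summable (%n. (1 / 2 :: real) ^ Suc n)" by (rule summable_Suc_iff[THEN iffD2, OF summable_geometric]) simp
 qed
 moreover have "continuous_on UNIV (%t. \<Sum>i<n. ?f i t)" for n
  by (intro continuous_intros continuous_on_compose2[OF continuous_read_digit]) auto
 ultimately show ?thesis
  unfolding schoenberg_def by (intro uniform_limit_theorem[OF always_eventually]) auto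
qed

lemma schoenberg_surj:
 assumes xy: "0 \<le> x" "x < 1" "0 \<le> y" "y < 1"
 obtains t where "t \<in> {0..1}" "schoenberg 0 t = x" "schoenberg 1 t = y"
proof -
 \<comment> \<open>The binary digits of \<open>x\<close> and \<open>y\<close> are interleaved, the
   even positions belonging to \<open>x\<close>.\<close>
 define e where "e k = (if even k then digit (k div 2) x else digit (k div 2) y)" for k
 have e: "e k = 0 \<or> e k = 1" for k using digit_cases by (simp add: e_def)
 have e01: "0 \<le> e k" "e k \<le> 1" for k using e[of k] by auto
 define g where "g k = e k / (2 * 4 ^ k)" for k
 have geo: "(%n. c * (1 / 4) ^ n) sums (c * (4 / 3))" for c :: real
  using sums_mult[OF geometric_sums[of "1 / 4 :: real"], of c] by simp
 have g_le: "norm (g k) \<le> (1 / 2) * (1 / 4) ^ k" for k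
  using e01[of k] by (simp add: g_def power_divide divide_simps)
 have sg: "summable g" by (rule summable_comparison_test'[OF sums_summable[OF geo[of "1 / 2"]] g_le])
 define t where "t = suminf g"
 have g0: "0 \<le> g k" for k using e01[of k] by (simp add: g_def)
 have t: "0 \<le> t" "t \<le> 2 / 3"
 proof -
  show "0 \<le> t" unfolding t_def by (intro suminf_nonneg sg g0)
  have "suminf g \<le> (\<Sum>k. (1 / 2) * (1 / 4) ^ k)"
   using g_le g0 by (intro suminf_le sg sums_summable[OF geo]) auto
  then show "t \<le> 2 / 3" using sums_unique[OF geo[of "1 / 2"]] by (simp add: t_def)
 qed
 have read: "read_digit (4 ^ k * t) = e k" for k
 proof -
  define s where "s = (\<Sum>i. 4 ^ k * g (i + Suc k))"
  have sg': "summable (%i. g (i + Suc k))" using summable_iff_shift[of g "Suc k"] sg by blast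
  have "t = (\<Sum>i. g (i + Suc k)) + (\<Sum>i<Suc k. g i)"
   unfolding t_def by (rule suminf_split_initial_segment[OF sg])
  then have "4 ^ k * t = 4 ^ k * (\<Sum>i. g (i + Suc k)) + 4 ^ k * (\<Sum>i<k. g i) + 4 ^ k * g k"
   by (simp add: distrib_left)
  also have "4 ^ k * (\<Sum>i. g (i + Suc k)) = s" unfolding s_def by (rule suminf_mult[OF sg', symmetric])
  also have "4 ^ k * g k = e k / 2" by (simp add: g_def)
  also have "\<exists>m. 4 ^ k * (\<Sum>i<k. g i) = of_int m"
  proof -
   have "4 ^ k * g i \<in> \<int>" if "i < k" for i
   proof -
    obtain d where d: "k = Suc (i + d)" using \<open>i < k\<close> by (metis less_iff_Suc_add)
    have "4 ^ k * g i = 2 * 4 ^ d * e i" unfolding d g_def by (simp add: power_add)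
    moreover have "e i \<in> \<int>" using e[of i] by auto
    ultimately show ?thesis by simp
   qed
   then have "(\<Sum>i<k. 4 ^ k * g i) \<in> \<int>" by (intro Ints_sum) auto
   then show ?thesis by (auto simp: sum_distrib_left elim: Ints_cases)
  qed
  then obtain m where "4 ^ k * (\<Sum>i<k. g i) = of_int m" by blast
  finally have eq: "4 ^ k * t = of_int m + e k / 2 + s" by (simp add: \<open>4 ^ k * (\<Sum>i<k. g i) = of_int m\<close>)
  \<comment> \<open>After scaling by \<open>4 ^ k\<close>, the digits behind position
    \<open>k\<close> add up to at most \<open>(1 / 8) * (4 / 3) = 1 / 6\<close>, which is the
    tolerance allowed by \<open>read_digit_eq\<close>.\<close>
  have s_le: "4 ^ k * g (i + Suc k) \<le> (1 / 8) * (1 / 4) ^ i" for i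
   using e01[of "i + Suc k"] by (simp add: g_def power_add power_divide divide_simps)
  have ss: "summable (%i. 4 ^ k * g (i + Suc k))" by (intro summable_mult sg')
  have "0 \<le> s" unfolding s_def using g0 by (intro suminf_nonneg ss) auto
  moreover have "s \<le> (\<Sum>i. (1 / 8) * (1 / 4) ^ i)"
   unfolding s_def using s_le by (intro suminf_le ss sums_summable[OF geo]) auto
  then have "s \<le> 1 / 6" using sums_unique[OF geo[of "1 / 8"]] by simp
  ultimately show ?thesis unfolding eq by (intro read_digit_eq e)
 qed
 have "schoenberg 0 t = x"
  unfolding schoenberg_def read using sums_unique[OF digit_sums[OF xy(1,2)]] by (simp add: e_def)
 moreover have "schoenberg 1 t = y"
  unfolding schoenberg_def read using sums_unique[OF digit_sums[OF xy(3,4)]] by (simp add: e_def)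
 ultimately show thesis using t that[of t] by simp
qed

definition torus_curve :: "real => torus"
 where "torus_curve t = abs_torus (\<chi> i. if i = 1 then schoenberg 0 t else schoenberg 1 t)"

lemma continuous_torus_curve: "continuous_on UNIV torus_curve"
proof -
 have "continuous_on UNIV (%t. (\<chi> i. if i = 1 then schoenberg 0 t else schoenberg 1 t) :: real^2)"
 proof (rule continuous_on_vec_lambda)
  show "continuous_on UNIV (%t. if i = 1 then schoenberg 0 t else schoenberg 1 t)" for i :: 2
   using continuous_schoenberg by (cases "i = 1") auto
 qed
 then show ?thesis
  unfolding torus_curve_def by (rule continuous_on_compose2[OF continuous_abs_torus]) auto
qed

lemma torus_curve_surj: "\<exists>t\<in>{0..1}. torus_curve t = p"
proof -
 obtain x where x: "p = abs_torus x" by (metis abs_torus_rep)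
 obtain t where t: "t \<in> {0..1}" "schoenberg 0 t = frac (x $ 1)" "schoenberg 1 t = frac (x $ 2)"
  using schoenberg_surj[of "frac (x $ 1)" "frac (x $ 2)"] by (auto simp: frac_ge_0 frac_lt_1)
 have fi: "frac (x $ i) - x $ i \<in> \<int>" for i by (simp add: frac_def)
 have "torus_curve t = p"
  unfolding torus_curve_def x abs_torus_eq_iff t forall_2 using fi[of 1] fi[of 2] by simp
 then show ?thesis using t(1) by blast
qed

text \<open>The first time at which the curve visits a point. Taking the first one gives a Borel
  right inverse of the curve: its sublevel sets are images of compact intervals.\<close>

definition curve_time :: "torus => real"
 where "curve_time p = Inf {t \<in> {0..1}. torus_curve t = p}"

lemma curve_time: "curve_time p \<in> {0..1}" "torus_curve (curve_time p) = p"
 and curve_time_le: "t \<in> {0..1} ==> torus_curve t = p ==> curve_time p \<le> t"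
proof -
 let ?S = "{t \<in> {0..1}. torus_curve t = p}"
 have "closed (torus_curve -` {p})" by (intro closed_vimage continuous_torus_curve closed_singleton)
 then have "closed ({0..1} \<inter> torus_curve -` {p})" by (intro closed_Int) auto
 moreover have S: "?S = {0..1} \<inter> torus_curve -` {p}" by auto
 ultimately have "closed ?S" by simp
 moreover have "?S \<noteq> {}" using torus_curve_surj[of p] by auto
 moreover have bb: "bdd_below ?S" by (intro bdd_belowI[of _ 0]) auto
 ultimately have "Inf ?S \<in> ?S" by (intro closed_contains_Inf)
 then show "curve_time p \<in> {0..1}" "torus_curve (curve_time p) = p" by (auto simp: curve_time_def)
 show "t \<in> {0..1} ==> torus_curve t = p ==> curve_time p \<le> t"
  unfolding curve_time_def by (intro cInf_lower bb) auto
qed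

lemma borel_measurable_curve_time: "curve_time \<in> borel_measurable borel"
proof (rule borel_measurable_iff_le[THEN iffD2], intro allI)
 fix a
 have "{p \<in> space borel. curve_time p \<le> a} = torus_curve ` ({0..1} \<inter> {..a})"
 proof (rule set_eqI, rule iffI)
  fix p assume "p \<in> {p \<in> space borel. curve_time p \<le> a}"
  then show "p \<in> torus_curve ` ({0..1} \<inter> {..a})" using curve_time[of p] by (intro image_eqI[of _ _ "curve_time p"]) auto
 next
  fix p assume "p \<in> torus_curve ` ({0..1} \<inter> {..a})"
  then obtain t where "t \<in> {0..1}" "t \<le> a" "torus_curve t = p" by auto
  then show "p \<in> {p \<in> space borel. curve_time p \<le> a}" using curve_time_le[of t p] by auto
 qed
 moreover have "compact ({0..1::real} \<inter> {..a})" by (intro compact_Int_closed) auto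
 then have "compact (torus_curve ` ({0..1} \<inter> {..a}))"
  by (intro compact_continuous_image continuous_on_subset[OF continuous_torus_curve]) auto
 ultimately show "{p \<in> space borel. curve_time p \<le> a} \<in> sets borel"
  by (simp add: compact_imp_closed borel_closed)
qed

text \<open>Transporting measures to the line along \<open>curve_time\<close> reduces compactness on the torus to
 Helly's selection theorem, and the Skorohod representation supplies the couplings.\<close>

lemma torus_measures_compact:
 fixes \<sigma> :: "nat => torus measure"
 assumes \<sigma>: "\<And>n. finite_borel (\<sigma> n)" "\<And>n. measure (\<sigma> n) UNIV = 1"
 obtains \<rho> and r :: "nat => nat" where "finite_borel \<rho>" "measure \<rho> UNIV = 1" "strict_mono r"
  "(%n. wasserstein (\<sigma> (r n)) \<rho>) \<longlonglongrightarrow> 0"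
proof -
 have cm: "curve_time \<in> measurable (\<sigma> n) borel" for n
  by (rule measurable_finite_borel[OF \<sigma>(1) borel_measurable_curve_time])
 define M where "M n = distr (\<sigma> n) borel curve_time" for n
 have sp: "sets (\<sigma> n) = sets borel" "space (\<sigma> n) = UNIV" for n by (rule finite_borelD[OF \<sigma>(1)])+
 have prob: "prob_space (\<sigma> n)" for n
 proof
  interpret finite_measure "\<sigma> n" by (rule finite_borelD(3)[OF \<sigma>(1)])
  show "emeasure (\<sigma> n) (space (\<sigma> n)) = 1" using \<sigma>(2)[of n] by (simp add: sp emeasure_eq_measure)
 qed
 have rd: "real_distribution (M n)" for n
  unfolding M_def by (rule prob_space.real_distribution_distr[OF prob cm])
 have "tight M"
  unfolding tight_def
 proof (intro conjI allI impI)
  fix \<epsilon> :: real assume "\<epsilon> > 0"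
  have "curve_time -` {-1<..1} = UNIV" using curve_time(1) by force
  then have "measure (M n) {-1<..1} = 1" for n
   unfolding M_def by (subst measure_distr[OF cm]) (simp_all add: sp \<sigma>(2))
  then show "\<exists>a b. a < b \<and> (\<forall>n. 1 - \<epsilon> < measure (M n) {a<..b})"
   using \<open>\<epsilon> > 0\<close> by (intro exI[of _ "-1"] exI[of _ 1]) simp
 qed (use rd in auto)
 from tight_imp_convergent_subsubsequence[OF this strict_mono_id]
 obtain r N where r: "strict_mono r" "real_distribution N" "weak_conv_m (%n. M (r n)) N" by (auto simp: comp_def)
 obtain \<Omega> :: "real measure" and Y and Z where Y: "prob_space \<Omega>" "\<And>n. Y n \<in> borel_measurable \<Omega>" "\<And>n. distr \<Omega> borel (Y n) = M (r n)"
   "Z \<in> measurable \<Omega> lborel" "\<And>x. x \<in> space \<Omega> ==> (%n. Y n x) \<longlonglongrightarrow> Z x"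
  using Skorohod[OF rd r(2,3)] by blast
 interpret prob_space \<Omega> by (rule Y(1))
 have c: "torus_curve \<in> borel_measurable borel" by (rule borel_measurable_continuous_onI[OF continuous_torus_curve])
 have m: "(%x. torus_curve (Y n x)) \<in> borel_measurable \<Omega>" "(%x. torus_curve (Z x)) \<in> borel_measurable \<Omega>" for n
  using measurable_compose[OF Y(2) c] measurable_compose[OF _ c, of Z \<Omega>] Y(4) by auto
 have e: "distr \<Omega> borel (%x. torus_curve (Y n x)) = \<sigma> (r n)" for n
 proof -
  have "distr \<Omega> borel (%x. torus_curve (Y n x)) = distr (M (r n)) borel torus_curve"
   unfolding Y(3)[symmetric] distr_distr[OF c Y(2)] by (simp add: comp_def)
  also have "... = distr (\<sigma> (r n)) borel (%p. p)"
   unfolding M_def distr_distr[OF c cm] by (simp add: comp_def curve_time(2))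
  also have "... = \<sigma> (r n)" by (rule distr_id2) (simp add: sp)
  finally show ?thesis .
 qed
 define \<rho> where "\<rho> = distr \<Omega> borel (%x. torus_curve (Z x))"
 interpret \<rho>: prob_space \<rho> unfolding \<rho>_def by (rule prob_space_distr[OF m(2)])
 have f\<rho>: "finite_borel \<rho>" unfolding finite_borel_def using \<rho>.finite_measure_axioms by (simp add: \<rho>_def)
 show thesis
 proof (rule that[OF f\<rho> _ r(1)])
  show "measure \<rho> UNIV = 1" using \<rho>.prob_space finite_borelD(2)[OF f\<rho>] by simp
  show "(%n. wasserstein (\<sigma> (r n)) \<rho>) \<longlonglongrightarrow> 0"
   unfolding e[symmetric] \<rho>_def
   by (rule wasserstein_pointwise[OF finite_measure_axioms m]) (rule continuous_on_tendsto_compose[OF continuous_torus_curve Y(5)], auto)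
 qed
qed

text \<open>If the distance stayed away from zero along a sequence, compactness would give a
  Wasserstein limit of a subsequence; its Lipschitz integrals are those of the slice at
  \<open>t\<close>, so it is that slice.\<close>

lemma weak_continuity_wasserstein:
 fixes \<sigma> :: "real => torus measure"
 assumes \<sigma>: "\<And>t. t \<in> A ==> finite_borel (\<sigma> t)" "\<And>t. t \<in> A ==> measure (\<sigma> t) UNIV = 1"
  and cont: "\<And>L f. L \<ge> 0 ==> lipschitz_fun L f ==> continuous_on A (%t. LINT p|\<sigma> t. f p)" and t: "t \<in> A"
 shows "((%s. wasserstein (\<sigma> s) (\<sigma> t)) \<longlongrightarrow> 0) (at t within A)"
 unfolding tendsto_at_iff_sequentially comp_def
proof (intro allI impI order_tendstoI)
 fix X and u :: ennreal assume X: "\<forall>i. X i \<in> A - {t}" "X \<longlonglongrightarrow> t" and u: "0 < u"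
 show "\<forall>\<^sub>F n in sequentially. wasserstein (\<sigma> (X n)) (\<sigma> t) < u"
 proof (rule ccontr)
  assume "\<not> ?thesis"
  then have "infinite {n. \<not> wasserstein (\<sigma> (X n)) (\<sigma> t) < u}"
   by (simp add: not_eventually frequently_cofinite flip: cofinite_eq_sequentially)
  then obtain r :: "nat => nat" where r: "strict_mono r" "\<And>n. \<not> wasserstein (\<sigma> (X (r n))) (\<sigma> t) < u"
   using infinite_enumerate by blast
  have XA: "X n \<in> A" for n using X(1) by simp
  obtain \<rho> and q :: "nat => nat" where \<rho>: "finite_borel \<rho>" "measure \<rho> UNIV = 1" "strict_mono q"
   "(%n. wasserstein (\<sigma> (X (r (q n)))) \<rho>) \<longlonglongrightarrow> 0"
   using torus_measures_compact[of "%n. \<sigma> (X (r n))", OF \<sigma>(1)[OF XA] \<sigma>(2)[OF XA]] by metis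
  have Xt: "(%n. X (r (q n))) \<longlonglongrightarrow> t"
   using LIMSEQ_subseq_LIMSEQ[OF LIMSEQ_subseq_LIMSEQ[OF X(2) r(1)] \<rho>(3)] by (simp add: comp_def)
  have "\<rho> = \<sigma> t"
  proof (rule borel_measure_eqI_lipschitz[OF \<rho>(1) \<sigma>(1)[OF t]])
   fix L and f :: "torus => real" assume f: "L \<ge> 0" "lipschitz_fun L f"
   have "(%n. LINT p|\<sigma> (X (r (q n))). f p) \<longlonglongrightarrow> (LINT p|\<sigma> t. f p)"
    using XA by (intro continuous_on_tendsto_compose[OF cont[OF f] Xt t]) auto
   with wasserstein_tendsto_integral[OF \<rho>(4) f] show "(LINT p|\<rho>. f p) = (LINT p|\<sigma> t. f p)" by (rule LIMSEQ_unique)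
  qed
  then have "\<forall>\<^sub>F n in sequentially. wasserstein (\<sigma> (X (r (q n)))) (\<sigma> t) < u" using order_tendstoD(2)[OF \<rho>(4) u] by simp
  then show False using r(2) by (simp add: eventually_sequentially)
 qed
qed simp

section \<open>Continuous representatives\<close>

lemma smooth_space_derivative:
 assumes "smooth_space f"
 shows "((%x. f (abs_torus x)) has_derivative (%h. tgrad f (abs_torus x) \<bullet> h)) (at x)"
proof -
 let ?f = "lift_fun (%z. f (snd z))"
 define D where "D = frechet_derivative ?f (at (0, x))"
 have D: "(?f has_derivative D) (at (0, x))"
  unfolding D_def using assms by (intro cdiff_has_derivative') (simp add: smooth_space_def)
 have g: "tgrad f (abs_torus x) = (\<chi> i. D (0, axis i 1))"
  unfolding tgrad_def using assms D by (intro space_grad_I(1)) (auto simp: smooth_space_def)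
 have "((%y. ?f (0, y)) has_derivative (%h. D (0, h))) (at x)"
  by (rule has_derivative_compose[where f="%y. (0, y)" and f'="%h. (0, h)", OF _ D]) (auto intro!: derivative_eq_intros)
 then have 1: "((%x. f (abs_torus x)) has_derivative (%h. D (0, h))) (at x)" by (simp add: lift_fun_def)
 then have lin: "linear (%h. D (0, h))" by (rule has_derivative_linear)
 have "D (0, h) = tgrad f (abs_torus x) \<bullet> h" for h
 proof -
  have "h = (\<Sum>i\<in>UNIV. h $ i *\<^sub>R axis i 1)"
   by (simp add: vec_eq_iff axis_def if_distrib[of "%x. _ * x"] cong: if_cong)
  then have "D (0, h) = D (0, \<Sum>i\<in>UNIV. h $ i *\<^sub>R axis i 1)" by simp
  also have "... = (\<Sum>i\<in>UNIV. D (0, h $ i *\<^sub>R axis i 1))" by (rule linear_sum[OF lin])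
  also have "... = (\<Sum>i\<in>UNIV. h $ i *\<^sub>R D (0, axis i 1))" by (intro sum.cong refl linear_scale[OF lin])
  also have "... = tgrad f (abs_torus x) \<bullet> h" by (simp add: g inner_vec_def mult.commute)
  finally show ?thesis .
 qed
 then show ?thesis using 1 by simp
qed

lemma smooth_space_lipschitz:
 assumes "smooth_space f"
 obtains L where "L \<ge> 0" "lipschitz_fun L f"
proof -
 obtain B where B: "B > 0" "\<And>p. norm (tgrad f p) \<le> B" using bounded_continuous_torus[OF continuous_tgrad[OF assms]] by blast
 have "\<bar>f p - f q\<bar> \<le> B * dist p q" for p q
 proof -
  obtain x where x: "p = abs_torus x" by (metis abs_torus_rep)
  obtain y where y: "q = abs_torus y" "dist x y = dist p q" using torus_lift_near[of q x] x by blast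
  have "norm (f (abs_torus x) - f (abs_torus y)) \<le> B * norm (x - y)"
  proof (rule differentiable_bound[of UNIV])
   show "((%x. f (abs_torus x)) has_derivative (%h. tgrad f (abs_torus z) \<bullet> h)) (at z within UNIV)" for z
    using smooth_space_derivative[OF assms] by simp
   show "onorm (%h. tgrad f (abs_torus z) \<bullet> h) \<le> B" for z
   proof (rule onorm_le)
    fix h :: "real^2"
    have "\<bar>tgrad f (abs_torus z) \<bullet> h\<bar> \<le> norm (tgrad f (abs_torus z)) * norm h" by (rule Cauchy_Schwarz_ineq2)
    also have "... \<le> B * norm h" by (intro mult_right_mono B) auto
    finally show "norm (tgrad f (abs_torus z) \<bullet> h) \<le> B * norm h" by simp
   qed
  qed auto
  then show ?thesis using y x by (simp add: dist_norm)
 qed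
 then show thesis using that[of B] B(1) by (simp add: lipschitz_fun_def)
qed

lemma representative_continuous:
 assumes "is_continuous_representative T \<mu> \<sigma>" "lipschitz_fun L f" "L \<ge> 0"
 shows "continuous_on {-T..T} (%t. LINT p|\<sigma> t. f p)"
 using assms unfolding continuous_on_def
 by (auto simp: is_continuous_representative_def intro!: wasserstein_tendsto_integral)

text \<open>A property valid at almost every time holds at times inside each nondegenerate interval.
  Continuity then spreads identities to all times, including the two end times.\<close>

lemma AE_dense_interval:
 assumes "AE t in lborel_I T. P t" "-T \<le> a" "a < b" "b \<le> T"
 obtains t where "a < t" "t < b" "P t"
proof -
 have "AE t in lborel. t \<in> {-T<..<T} \<longrightarrow> P t" using assms(1) by (simp add: AE_lborel_I)
 then obtain N where N: "N \<in> null_sets lborel" "{t. \<not> (t \<in> {-T<..<T} \<longrightarrow> P t)} \<subseteq> N"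
  by (auto simp: eventually_ae_filter)
 have "\<not> {a<..<b} \<subseteq> N"
 proof
  assume "{a<..<b} \<subseteq> N"
  then have "emeasure lborel {a<..<b} \<le> emeasure lborel N" using N(1) by (intro emeasure_mono) auto
  then show False using N(1) assms(3) by auto
 qed
 then obtain t where t: "t \<in> {a<..<b}" "t \<notin> N" by blast
 then have "t \<in> {-T<..<T}" using assms(2,4) by auto
 then have "P t" using t(2) N(2) by blast
 then show thesis using that t(1) by auto
qed

lemma continuous_AE_eq:
 fixes f g :: "real => real"
 assumes "AE t in lborel_I T. f t = g t" "continuous_on {-T..T} f" "continuous_on {-T..T} g" "T > 0" "t \<in> {-T..T}"
 shows "f t = g t"
proof (rule ccontr)
 assume ne: "f t \<noteq> g t"
 have "continuous_on {-T..T} (%t. \<bar>f t - g t\<bar>)" using assms by (intro continuous_intros)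
 then obtain d where d: "d > 0" "\<And>s. s \<in> {-T..T} ==> dist s t < d ==> dist \<bar>f s - g s\<bar> \<bar>f t - g t\<bar> < \<bar>f t - g t\<bar>"
  using assms(5) ne unfolding continuous_on_iff by (metis zero_less_abs_iff right_minus_eq)
 define a where "a = max (-T) (t - d)"
 define b where "b = min T (t + d)"
 have "a < b" "-T \<le> a" "b \<le> T" using assms(4,5) d(1) by (auto simp: a_def b_def)
 then obtain s where s: "a < s" "s < b" "f s = g s" using AE_dense_interval[OF assms(1)] by metis
 then have "s \<in> {-T..T}" "dist s t < d" by (auto simp: a_def b_def dist_real_def)
 from d(2)[OF this] s(3) show False by simp
qed

lemma representative_unique:
 assumes \<sigma>: "is_continuous_representative T \<mu> \<sigma>" "is_continuous_representative T \<mu> \<sigma>'"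
  and \<mu>: "sets \<mu> = sets (borel_QT T)" "finite_measure \<mu>" "T > 0" and t: "t \<in> {-T..T}"
 shows "\<sigma> t = \<sigma>' t"
proof (rule borel_measure_eqI_lipschitz)
 have d: "is_disintegration T \<mu> \<sigma>" "is_disintegration T \<mu> \<sigma>'" using \<sigma> by (auto simp: is_continuous_representative_def)
 show "finite_borel (\<sigma> t)" "finite_borel (\<sigma>' t)" using \<sigma> t by (auto simp: is_continuous_representative_def)
 fix L and f :: "torus => real" assume f: "L \<ge> 0" "lipschitz_fun L f"
 show "(LINT p|\<sigma> t. f p) = (LINT p|\<sigma>' t. f p)"
 proof (rule continuous_AE_eq[OF _ representative_continuous[OF \<sigma>(1) f(2,1)] representative_continuous[OF \<sigma>(2) f(2,1)] \<mu>(3) t])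
  show "AE t in lborel_I T. (LINT p|\<sigma> t. f p) = (LINT p|\<sigma>' t. f p)"
   using disintegration_unique[OF d \<mu>(1,2)] by eventually_elim simp
 qed
qed

lemma slice_representative:
 assumes "is_continuous_representative T \<mu> \<sigma>"
 shows "is_continuous_representative T \<mu> (slice T \<mu>)"
 unfolding slice_def by (rule someI[of _ \<sigma>]) (rule assms)

text \<open>On closed sets the mass is a limit of integrals of Lipschitz functions, each continuous
  in time; the pi-lambda theorem extends measurability to Borel sets.\<close>

lemma lipschitz_continuous_kernel_measurable:
 fixes \<sigma> :: "real => torus measure"
 assumes \<sigma>: "\<And>t. t \<in> {-T..T} ==> finite_borel (\<sigma> t)"
  and cont: "\<And>L f. L \<ge> 0 ==> lipschitz_fun L f ==> continuous_on {-T..T} (%t. LINT p|\<sigma> t. f p)"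
  and B: "B \<in> sets borel"
 shows "(%t. emeasure (\<sigma> t) B) \<in> borel_measurable (restrict_space borel {-T<..<T})"
proof -
 let ?M = "restrict_space borel {-T<..<T}"
 have em: "emeasure (\<sigma> t) S = ennreal (measure (\<sigma> t) S)" if "t \<in> {-T<..<T}" for t S
 proof -
  interpret finite_measure "\<sigma> t" using \<sigma>[of t] that by (intro finite_borelD) auto
  show ?thesis by (rule emeasure_eq_measure)
 qed
 have "Int_stable (Collect closed :: torus set set)" by (auto simp: Int_stable_def)
 moreover have "Collect closed \<subseteq> Pow (UNIV :: torus set)" by simp
 moreover have "B \<in> sigma_sets UNIV (Collect closed)" using B by (simp add: borel_eq_closed)
 ultimately have "(%t. measure (\<sigma> t) B) \<in> borel_measurable ?M"
 proof (induction rule: sigma_sets_induct_disjoint)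
  case (basic C)
  show ?case
  proof (cases "C = {}")
   case False
   show ?thesis
   proof (rule borel_measurable_LIMSEQ_real)
    fix n
    have "continuous_on {-T<..<T} (%t. LINT p|\<sigma> t. max 0 (1 - real n * infdist p C))"
     by (rule continuous_on_subset[OF cont[OF _ lipschitz_infdist]]) auto
    then show "(%t. LINT p|\<sigma> t. max 0 (1 - real n * infdist p C)) \<in> borel_measurable ?M"
     by (rule borel_measurable_continuous_on_restrict)
   next
    fix t assume "t \<in> space ?M"
    then show "(%n. LINT p|\<sigma> t. max 0 (1 - real n * infdist p C)) \<longlonglongrightarrow> measure (\<sigma> t) C"
     using basic False \<sigma>[of t] by (intro measure_closed_limit) (auto simp: space_restrict_space)
   qed
  qed simp
 next
  case (compl A)
  have "measure (\<sigma> t) (UNIV - A) = measure (\<sigma> t) UNIV - measure (\<sigma> t) A" if "t \<in> space ?M" for t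
  proof -
   have fb: "finite_borel (\<sigma> t)" using that \<sigma> by (simp add: space_restrict_space)
   interpret finite_measure "\<sigma> t" by (rule finite_borelD[OF fb])
   have "A \<in> sets (\<sigma> t)" using compl(1) finite_borelD(1)[OF fb] by (simp add: borel_eq_closed)
   then show ?thesis using finite_measure_compl[of A] finite_borelD(2)[OF fb] by simp
  qed
  moreover have "(%t. measure (\<sigma> t) UNIV) \<in> borel_measurable ?M"
  proof -
   have "continuous_on {-T<..<T} (%t. LINT p|\<sigma> t. 1 :: real)"
    by (rule continuous_on_subset[OF cont[of 0]]) (auto simp: lipschitz_fun_def)
   then have "(%t. LINT p|\<sigma> t. 1 :: real) \<in> borel_measurable ?M" by (rule borel_measurable_continuous_on_restrict)
   then show ?thesis
    by (rule measurable_cong[THEN iffD1, rotated]) (use \<sigma> finite_borelD(2) in \<open>auto simp: space_restrict_space\<close>)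
  qed
  ultimately have "(%t. measure (\<sigma> t) (UNIV - A)) \<in> borel_measurable ?M
    \<longleftrightarrow> (%t. measure (\<sigma> t) UNIV - measure (\<sigma> t) A) \<in> borel_measurable ?M"
   by (intro measurable_cong) auto
  then show ?case using compl \<open>(%t. measure (\<sigma> t) UNIV) \<in> borel_measurable ?M\<close> by simp
 next
  case (union A)
  show ?case
  proof (rule borel_measurable_LIMSEQ_real)
   show "(%t. \<Sum>i<n. measure (\<sigma> t) (A i)) \<in> borel_measurable ?M" for n using union(3) by measurable
   fix t assume "t \<in> space ?M"
   then have fb: "finite_borel (\<sigma> t)" using \<sigma> by (simp add: space_restrict_space)
   interpret finite_measure "\<sigma> t" by (rule finite_borelD[OF fb])
   have "range A \<subseteq> sets (\<sigma> t)" using union(2) finite_borelD(1)[OF fb] by (auto simp: borel_eq_closed)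
   then show "(%n. \<Sum>i<n. measure (\<sigma> t) (A i)) \<longlonglongrightarrow> measure (\<sigma> t) (\<Union>i. A i)"
    using finite_measure_UNION[OF _ union(1)] by (simp add: sums_def)
  qed
 qed simp
 then have "(%t. ennreal (measure (\<sigma> t) B)) \<in> borel_measurable ?M" by measurable
 then show ?thesis
  by (rule measurable_cong[THEN iffD1, rotated]) (use em in \<open>auto simp: space_restrict_space\<close>)
qed

lemma representativeI:
 assumes \<sigma>: "\<And>t. t \<in> {-T..T} ==> finite_borel (\<sigma> t)" "\<And>t. t \<in> {-T..T} ==> measure (\<sigma> t) UNIV = 1"
  and cont: "\<And>L f. L \<ge> 0 ==> lipschitz_fun L f ==> continuous_on {-T..T} (%t. LINT p|\<sigma> t. f p)"
  and \<mu>: "sets \<mu> = sets (borel_QT T)"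
  and eq: "\<And>A. A \<in> sets (borel_QT T) ==> emeasure \<mu> A = (\<integral>\<^sup>+ t. emeasure (\<sigma> t) (Pair t -` A) \<partial>lborel_I T)"
 shows "is_continuous_representative T \<mu> \<sigma>"
 unfolding is_continuous_representative_def is_disintegration_def
 using \<sigma> eq lipschitz_continuous_kernel_measurable[OF \<sigma>(1) cont] weak_continuity_wasserstein[OF \<sigma> cont]
 by (auto simp: \<mu> nn_integral_restrict_space)

text \<open>Both \<open>slice\<close> and \<open>disintegration\<close> are selected by choice. For
  a measure constructed with explicit continuous slices, uniqueness identifies the former with these
  slices at every time and the latter at almost every time.\<close>

lemma competitorI:
 assumes \<sigma>: "\<And>t. t \<in> {-T..T} ==> finite_borel (\<sigma> t)" "\<And>t. t \<in> {-T..T} ==> measure (\<sigma> t) UNIV = 1"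
  and cont: "\<And>L f. L \<ge> 0 ==> lipschitz_fun L f ==> continuous_on {-T..T} (%t. LINT p|\<sigma> t. f p)"
  and \<mu>: "sets \<mu> = sets (borel_QT T)" "finite_measure \<mu>" "m \<in> fluxes T \<mu>" "T > 0"
  and eq: "\<And>A. A \<in> sets (borel_QT T) ==> emeasure \<mu> A = (\<integral>\<^sup>+ t. emeasure (\<sigma> t) (Pair t -` A) \<partial>lborel_I T)"
  and atomic: "AE t in lborel_I T. purely_atomic (\<sigma> t)"
 shows "\<mu> \<in> competitors T" "\<And>t. t \<in> {-T..T} ==> slice T \<mu> t = \<sigma> t" "AE t in lborel_I T. disintegration T \<mu> t = \<sigma> t"
proof -
 have rep: "is_continuous_representative T \<mu> \<sigma>" using \<sigma> cont \<mu>(1) eq by (rule representativeI)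
 then have d: "is_disintegration T \<mu> \<sigma>" by (simp add: is_continuous_representative_def)
 show eqd: "AE t in lborel_I T. disintegration T \<mu> t = \<sigma> t"
  by (rule disintegration_unique[OF disintegration_some[OF d] d \<mu>(1,2)])
 show "slice T \<mu> t = \<sigma> t" if "t \<in> {-T..T}" for t
  by (rule representative_unique[OF slice_representative[OF rep] rep \<mu>(1,2,4) that])
 have "AE t in lborel_I T. emeasure (disintegration T \<mu> t) UNIV = 1"
  using eqd AE_space
 proof eventually_elim
  fix t assume t: "disintegration T \<mu> t = \<sigma> t" "t \<in> space (lborel_I T)"
  then have t': "t \<in> {-T..T}" by auto
  interpret finite_measure "\<sigma> t" by (rule finite_borelD[OF \<sigma>(1)[OF t']])
  show "emeasure (disintegration T \<mu> t) UNIV = 1" using \<sigma>(2)[OF t'] by (simp add: t(1) emeasure_eq_measure)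
 qed
 then show "\<mu> \<in> competitors T"
  using \<mu> d atomic unfolding competitors_def admissible_def AE_lborel_I by blast
qed

text \<open>The integrals of countably many partition functions agree almost everywhere with the
  continuous functions \<open>\<Phi>\<close>. At an arbitrary time a limit of slices at nearby good
  times has the integrals prescribed by \<open>\<Phi>\<close>, and these determine all Lipschitz
  integrals with a uniform error. This gives continuity in time as well as agreement with the given
  slices almost everywhere.\<close>

lemma continuous_representative_exists:
 assumes m: "m \<in> fluxes T \<mu>" and \<mu>: "finite_measure \<mu>" "sets \<mu> = sets (borel_QT T)"
  and \<sigma>: "is_disintegration T \<mu> \<sigma>" and mass: "AE t in lborel_I T. measure (\<sigma> t) UNIV = 1" and "T > 0"
 obtains \<rho> where "is_continuous_representative T \<mu> \<rho>" "\<And>t. t \<in> {-T..T} ==> measure (\<rho> t) UNIV = 1"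
proof -
 define \<delta> where "\<delta> n = 1 / real (Suc n)" for n
 have "\<forall>n. \<exists>C \<psi>. pou (\<delta> n) C \<psi>" by (intro allI smooth_partition_of_unity) (simp add: \<delta>_def)
 then obtain C \<psi> where pou: "\<And>n. pou (\<delta> n) (C n) (\<psi> n)" by metis
 then have fC: "finite (C n)" and sm: "smooth_space (\<psi> n c)" for n c by (auto simp: pou_def)
 define k where "k n c = (SOME k. AE t in lborel_I T. (LINT p|\<sigma> t. \<psi> n c p) = k + flow T \<mu> m (\<psi> n c) t)" for n c
 define \<Phi> where "\<Phi> n c t = k n c + flow T \<mu> m (\<psi> n c) t" for n c t
 have k: "AE t in lborel_I T. (LINT p|\<sigma> t. \<psi> n c p) = \<Phi> n c t" for n c
  unfolding k_def \<Phi>_def by (rule someI_ex) (rule flux_transport[OF m \<mu> sm \<sigma> \<open>T > 0\<close>])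
 have c\<Phi>: "continuous_on A (\<Phi> n c)" for A n c
  unfolding \<Phi>_def by (rule continuous_on_subset[of UNIV]) (auto intro!: continuous_intros continuous_flow[OF m \<mu> sm \<sigma>])
 have "AE t in lborel_I T. \<forall>n. \<forall>c\<in>C n. (LINT p|\<sigma> t. \<psi> n c p) = \<Phi> n c t"
  unfolding AE_all_countable using k by (intro allI AE_finite_allI fC) auto
 then have good: "AE t in lborel_I T. measure (\<sigma> t) UNIV = 1 \<and> (\<forall>n. \<forall>c\<in>C n. (LINT p|\<sigma> t. \<psi> n c p) = \<Phi> n c t)"
  using mass by eventually_elim auto
 have "\<exists>\<rho>. finite_borel \<rho> \<and> measure \<rho> UNIV = 1 \<and> (\<forall>n. \<forall>c\<in>C n. (LINT p|\<rho>. \<psi> n c p) = \<Phi> n c t)" if t: "t \<in> {-T..T}" for t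
 proof -
  \<comment> \<open>Good times have full measure, so they accumulate at every point of the closed
    interval, in particular at the end times where no slice is given.\<close>
  have "\<exists>s. s \<in> {-T<..<T} \<and> \<bar>s - t\<bar> < 1 / Suc j \<and> measure (\<sigma> s) UNIV = 1 \<and> (\<forall>n. \<forall>c\<in>C n. (LINT p|\<sigma> s. \<psi> n c p) = \<Phi> n c s)" for j
  proof -
   define h where "h = 1 / real (Suc j)"
   have h: "0 < h" by (simp add: h_def)
   define a where "a = max (-T) (t - h)"
   define b where "b = min T (t + h)"
   have "a < b" "-T \<le> a" "b \<le> T" using t h \<open>T > 0\<close> by (auto simp: a_def b_def)
   then obtain s where s: "a < s" "s < b" "measure (\<sigma> s) UNIV = 1 \<and> (\<forall>n. \<forall>c\<in>C n. (LINT p|\<sigma> s. \<psi> n c p) = \<Phi> n c s)"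
    using AE_dense_interval[OF good] by metis
   then have "s \<in> {-T<..<T}" "\<bar>s - t\<bar> < 1 / Suc j" by (auto simp: a_def b_def h_def)
   then show ?thesis using s(3) by blast
  qed
  then obtain s where s: "\<And>j. s j \<in> {-T<..<T}" "\<And>j. \<bar>s j - t\<bar> < 1 / Suc j" "\<And>j. measure (\<sigma> (s j)) UNIV = 1"
   "\<And>j n c. c \<in> C n ==> (LINT p|\<sigma> (s j). \<psi> n c p) = \<Phi> n c (s j)" by metis
  have fb: "finite_borel (\<sigma> (s j))" for j using \<sigma> s(1) by (simp add: is_disintegration_def)
  obtain \<rho> and r :: "nat => nat" where \<rho>: "finite_borel \<rho>" "measure \<rho> UNIV = 1" "strict_mono r"
   "(%n. wasserstein (\<sigma> (s (r n))) \<rho>) \<longlonglongrightarrow> 0"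
   using torus_measures_compact[of "%j. \<sigma> (s j)", OF fb s(3)] by metis
  have "(%j. s j - t) \<longlonglongrightarrow> 0"
   by (rule Lim_null_comparison[OF _ LIMSEQ_Suc[OF lim_1_over_n]]) (use s(2) in \<open>auto intro!: always_eventually less_imp_le\<close>)
  then have sr: "(%n. s (r n)) \<longlonglongrightarrow> t" using LIMSEQ_subseq_LIMSEQ[OF _ \<rho>(3)] by (auto simp: comp_def LIM_zero_iff)
  have "(LINT p|\<rho>. \<psi> n c p) = \<Phi> n c t" if c: "c \<in> C n" for n c
  proof (rule LIMSEQ_unique)
   obtain L where L: "L \<ge> 0" "lipschitz_fun L (\<psi> n c)" using smooth_space_lipschitz[OF sm] by blast
   show "(%j. LINT p|\<sigma> (s (r j)). \<psi> n c p) \<longlonglongrightarrow> (LINT p|\<rho>. \<psi> n c p)"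
    by (rule wasserstein_tendsto_integral[OF \<rho>(4) L])
   have "(%j. \<Phi> n c (s (r j))) \<longlonglongrightarrow> \<Phi> n c t"
    by (rule continuous_on_tendsto_compose[OF c\<Phi>[of UNIV] sr]) auto
   then show "(%j. LINT p|\<sigma> (s (r j)). \<psi> n c p) \<longlonglongrightarrow> \<Phi> n c t" unfolding s(4)[OF c] .
  qed
  then show ?thesis using \<rho>(1,2) by blast
 qed
 then obtain \<rho> where \<rho>: "\<And>t. t \<in> {-T..T} ==> finite_borel (\<rho> t)" "\<And>t. t \<in> {-T..T} ==> measure (\<rho> t) UNIV = 1"
  "\<And>t n c. t \<in> {-T..T} ==> c \<in> C n ==> (LINT p|\<rho> t. \<psi> n c p) = \<Phi> n c t" by metis
 define g where "g f n t = (\<Sum>c\<in>C n. f c * \<Phi> n c t)" for f n t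
 have ap: "\<bar>(LINT p|\<nu>. f p) - g f n t\<bar> \<le> L * \<delta> n"
  if "L \<ge> 0" "lipschitz_fun L f" "finite_borel \<nu>" "measure \<nu> UNIV = 1" "\<And>c. c \<in> C n ==> (LINT p|\<nu>. \<psi> n c p) = \<Phi> n c t" for L f \<nu> n t
  using pou_approx[OF pou[of n] that(1-4)] that(5) by (simp add: g_def)
 have lim: "(%n. L * \<delta> n) \<longlonglongrightarrow> 0" for L
  using tendsto_mult_right_zero[OF LIMSEQ_Suc[OF lim_1_over_n]] unfolding \<delta>_def by blast
 \<comment> \<open>The finite sums \<open>g f n\<close> are continuous in time and approximate the
   integral of \<open>f\<close> within \<open>L * \<delta> n\<close> at every time, so the limit is
   uniform.\<close>
 have cont: "continuous_on {-T..T} (%t. LINT p|\<rho> t. f p)" if f: "L \<ge> 0" "lipschitz_fun L f" for L f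
 proof (rule uniform_limit_theorem[of _ "g f"])
  show "\<forall>\<^sub>F n in sequentially. continuous_on {-T..T} (g f n)"
   unfolding g_def by (intro always_eventually allI continuous_intros c\<Phi>)
  show "uniform_limit {-T..T} (g f) (%t. LINT p|\<rho> t. f p) sequentially"
  proof (rule uniform_limitI)
   fix e :: real assume "e > 0"
   then have "\<forall>\<^sub>F n in sequentially. L * \<delta> n < e" by (intro order_tendstoD(2)[OF lim])
   then show "\<forall>\<^sub>F n in sequentially. \<forall>t\<in>{-T..T}. dist (g f n t) (LINT p|\<rho> t. f p) < e"
   proof eventually_elim
    case (elim n)
    have "\<bar>(LINT p|\<rho> t. f p) - g f n t\<bar> \<le> L * \<delta> n" if "t \<in> {-T..T}" for t
     by (rule ap[OF f \<rho>(1,2,3)]) (use that in auto)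
    then show ?case using elim by (fastforce simp: dist_real_def abs_minus_commute)
   qed
  qed
 qed simp
 have eq: "AE t in lborel_I T. \<rho> t = \<sigma> t"
  using good AE_space
 proof eventually_elim
  fix t assume gd: "measure (\<sigma> t) UNIV = 1 \<and> (\<forall>n. \<forall>c\<in>C n. (LINT p|\<sigma> t. \<psi> n c p) = \<Phi> n c t)" and "t \<in> space (lborel_I T)"
  then have t: "t \<in> {-T<..<T}" "t \<in> {-T..T}" by auto
  have fb: "finite_borel (\<sigma> t)" using \<sigma> t by (simp add: is_disintegration_def)
  show "\<rho> t = \<sigma> t"
  proof (rule borel_measure_eqI_lipschitz[OF \<rho>(1)[OF t(2)] fb])
   fix L and f :: "torus => real" assume f: "L \<ge> 0" "lipschitz_fun L f"
   have ab: "\<bar>(LINT p|\<rho> t. f p) - (LINT p|\<sigma> t. f p)\<bar> \<le> 2 * L * \<delta> n" for n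
   proof -
    have "\<bar>(LINT p|\<sigma> t. f p) - g f n t\<bar> \<le> L * \<delta> n" using gd by (intro ap[OF f fb]) auto
    then show ?thesis using ap[OF f \<rho>(1)[OF t(2)] \<rho>(2)[OF t(2)] \<rho>(3)[OF t(2)], of n] by linarith
   qed
   have "\<bar>(LINT p|\<rho> t. f p) - (LINT p|\<sigma> t. f p)\<bar> \<le> 0"
    by (intro LIMSEQ_le_const[OF lim[of "2 * L"]] exI[of _ 0] allI impI ab)
   then show "(LINT p|\<rho> t. f p) = (LINT p|\<sigma> t. f p)" by simp
  qed
 qed
 have em: "emeasure \<mu> A = (\<integral>\<^sup>+ t. emeasure (\<rho> t) (Pair t -` A) \<partial>lborel_I T)" if "A \<in> sets (borel_QT T)" for A
  unfolding disintegration_emeasure[OF \<sigma> \<mu>(2) that] by (rule nn_integral_cong_AE) (use eq in eventually_elim, simp)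
 show thesis by (rule that[OF representativeI[OF \<rho>(1,2) cont \<mu>(2) em] \<rho>(2)])
qed

lemma competitor_slice:
 assumes "\<mu> \<in> competitors T" "T > 0"
 shows "sets \<mu> = sets (borel_QT T)" "finite_measure \<mu>" "fluxes T \<mu> \<noteq> {}"
  "is_disintegration T \<mu> (disintegration T \<mu>)"
  "is_continuous_representative T \<mu> (slice T \<mu>)" "is_disintegration T \<mu> (slice T \<mu>)"
  "\<And>t. t \<in> {-T..T} ==> finite_borel (slice T \<mu> t)"
  "\<And>t. t \<in> {-T..T} ==> measure (slice T \<mu> t) UNIV = 1"
  "AE t in lborel_I T. disintegration T \<mu> t = slice T \<mu> t"
  "AE t in lborel_I T. purely_atomic (slice T \<mu> t)"
proof -
 show \<mu>: "sets \<mu> = sets (borel_QT T)" "finite_measure \<mu>" and fl: "fluxes T \<mu> \<noteq> {}"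
  using assms(1) by (auto simp: competitors_def admissible_def)
 obtain \<sigma> where \<sigma>: "is_disintegration T \<mu> \<sigma>" "AE t in lborel_I T. purely_atomic (\<sigma> t)"
  using assms(1) unfolding AE_lborel_I competitors_def admissible_def by blast
 show d: "is_disintegration T \<mu> (disintegration T \<mu>)" by (rule disintegration_some[OF \<sigma>(1)])
 have "AE t in lborel_I T. emeasure (disintegration T \<mu> t) UNIV = 1"
  using assms(1) by (simp add: competitors_def AE_lborel_I)
 then have mass: "AE t in lborel_I T. measure (disintegration T \<mu> t) UNIV = 1"
  by eventually_elim (simp add: measure_def)
 obtain m where m: "m \<in> fluxes T \<mu>" using fl by blast
 obtain \<rho> where \<rho>: "is_continuous_representative T \<mu> \<rho>" "\<And>t. t \<in> {-T..T} ==> measure (\<rho> t) UNIV = 1"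
  using continuous_representative_exists[OF m \<mu>(2,1) d mass assms(2)] by metis
 show r: "is_continuous_representative T \<mu> (slice T \<mu>)" by (rule slice_representative[OF \<rho>(1)])
 then show d': "is_disintegration T \<mu> (slice T \<mu>)" "\<And>t. t \<in> {-T..T} ==> finite_borel (slice T \<mu> t)"
  by (auto simp: is_continuous_representative_def)
 show "measure (slice T \<mu> t) UNIV = 1" if "t \<in> {-T..T}" for t
  using representative_unique[OF r \<rho>(1) \<mu> assms(2) that] \<rho>(2)[OF that] by simp
 show "AE t in lborel_I T. disintegration T \<mu> t = slice T \<mu> t"
  by (rule disintegration_unique[OF d d'(1) \<mu>])
 show "AE t in lborel_I T. purely_atomic (slice T \<mu> t)"
  using disintegration_unique[OF \<sigma>(1) d'(1) \<mu>] \<sigma>(2) by eventually_elim simp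
qed

text \<open>The transport identity holds almost everywhere up to a constant; both sides are
  continuous, so it holds at all times up to and including \<open>T\<close>.\<close>

lemma slice_transport:
 assumes "\<mu> \<in> competitors T" "T > 0" "m \<in> fluxes T \<mu>" "smooth_space f" "s \<in> {-T..T}" "t \<in> {-T..T}"
 shows "(LINT p|slice T \<mu> t. f p) - (LINT p|slice T \<mu> s. f p) = flow T \<mu> m f t - flow T \<mu> m f s"
proof -
 note c = competitor_slice[OF assms(1,2)]
 obtain k where k: "AE t in lborel_I T. (LINT p|slice T \<mu> t. f p) = k + flow T \<mu> m f t"
  using flux_transport[OF assms(3) c(2,1) assms(4) c(6) assms(2)] by blast
 obtain L where L: "L \<ge> 0" "lipschitz_fun L f" using smooth_space_lipschitz[OF assms(4)] .
 have "(LINT p|slice T \<mu> t. f p) = k + flow T \<mu> m f t" if "t \<in> {-T..T}" for t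
  by (rule continuous_AE_eq[OF k representative_continuous[OF c(5) L(2,1)] _ assms(2) that])
   (intro continuous_intros continuous_on_subset[OF continuous_flow[OF assms(3) c(2,1) assms(4) c(6)]], auto)
 from this[OF assms(5)] this[OF assms(6)] show ?thesis by simp
qed

section \<open>Atomic measures\<close>

text \<open>Rewrites unordered sums over arbitrary index sets as integrals for counting measure, so
  that integration theorems become available for the perimeter and the Sobolev norm.\<close>

lemma infsum_nn_integral:
 fixes f :: "'a => ennreal"
 shows "infsum f A = (\<integral>\<^sup>+x. f x \<partial>count_space A)"
proof (rule antisym)
 show "infsum f A \<le> (\<integral>\<^sup>+x. f x \<partial>count_space A)"
  unfolding nonneg_infsum_complete[of A f, simplified]
 proof (rule SUP_least)
  fix F assume F: "F \<in> {F. finite F \<and> F \<subseteq> A}"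
  then have "sum f F = (\<integral>\<^sup>+x. f x * indicator F x \<partial>count_space A)"
   by (subst nn_integral_count_space'[of F]) (auto intro!: sum.cong)
  also have "... \<le> (\<integral>\<^sup>+x. f x \<partial>count_space A)"
   by (intro nn_integral_mono) (auto simp: indicator_def)
  finally show "sum f F \<le> (\<integral>\<^sup>+x. f x \<partial>count_space A)" .
 qed
next
 show "(\<integral>\<^sup>+x. f x \<partial>count_space A) \<le> infsum f A"
  unfolding nn_integral_def
 proof (rule SUP_least, safe)
  fix g assume g: "simple_function (count_space A) g" "g \<le> f"
  have gf: "g x \<le> f x" for x using g(2) by (simp add: le_fun_def)
  show "integral\<^sup>S (count_space A) g \<le> infsum f A"
  proof (cases "finite {a \<in> A. 0 < g a}")
   case True
   have "integral\<^sup>S (count_space A) g = (\<Sum>a|a \<in> A \<and> 0 < g a. g a)"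
    using nn_integral_eq_simple_integral[OF g(1)] nn_integral_count_space[OF True] by simp
   also have "... \<le> (\<Sum>a|a \<in> A \<and> 0 < g a. f a)" by (intro sum_mono gf)
   also have "... \<le> infsum f A"
    unfolding nonneg_infsum_complete[of A f, simplified] using True by (intro SUP_upper) auto
   finally show ?thesis .
  next
   case False
   \<comment> \<open>A simple function with infinite support takes some positive value infinitely
     often, which already makes the sum infinite.\<close>
   have "finite (g ` A)" using g(1) by (simp add: simple_function_def)
   moreover have "{a \<in> A. 0 < g a} = (\<Union>y\<in>g ` A - {0}. {a \<in> A. g a = y})" by (auto simp: zero_less_iff_neq_zero)
   ultimately obtain y where y: "y \<in> g ` A - {0}" "infinite {a \<in> A. g a = y}" using False by auto
   have "infsum f {a \<in> A. g a = y} = \<infinity>"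
    by (rule infsum_superconst_infinite_ennreal[of _ y]) (use y gf in \<open>auto simp: zero_less_iff_neq_zero\<close>)
   moreover have "infsum f {a \<in> A. g a = y} \<le> infsum f A"
    unfolding nonneg_infsum_complete[of _ f, simplified] by (rule SUP_subset_mono) auto
   ultimately show ?thesis by (simp add: top_unique)
  qed
 qed
qed

definition perimeter :: "torus measure => ennreal"
 where "perimeter \<sigma> = (\<Sum>\<^sub>\<infinity>x\<in>UNIV. ennreal (sqrt (measure \<sigma> {x})))"

lemma perimeter_nn_integral: "perimeter \<sigma> = (\<integral>\<^sup>+x. ennreal (sqrt (measure \<sigma> {x})) \<partial>count_space UNIV)"
 unfolding perimeter_def by (rule infsum_nn_integral)

text \<open>Being carried by a countable set is the form that passes easily to averages of
  translates. In the converse direction only points of positive mass are kept as atoms.\<close>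

lemma purely_atomic_iff:
 assumes "finite_borel \<sigma>"
 shows "purely_atomic \<sigma> \<longleftrightarrow> (\<exists>X. countable X \<and> emeasure \<sigma> (UNIV - X) = 0)"
proof
 assume "purely_atomic \<sigma>"
 then obtain X \<phi> where X: "countable X" "\<And>A. A \<in> sets borel ==> emeasure \<sigma> A = (\<Sum>\<^sub>\<infinity>x\<in>X \<inter> A. ennreal (\<phi> x))"
  unfolding purely_atomic_def by blast
 have "X \<in> sets borel" by (rule sets.countable[OF _ X(1)]) simp
 then have "UNIV - X \<in> sets borel" by auto
 from X(2)[OF this] have "emeasure \<sigma> (UNIV - X) = 0" by simp
 then show "\<exists>X. countable X \<and> emeasure \<sigma> (UNIV - X) = 0" using X(1) by blast
next
 assume "\<exists>X. countable X \<and> emeasure \<sigma> (UNIV - X) = 0"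
 then obtain X where X: "countable X" "emeasure \<sigma> (UNIV - X) = 0" by blast
 interpret finite_measure \<sigma> by (rule finite_borelD[OF assms])
 note s = finite_borelD(1,2)[OF assms]
 define Y where "Y = {x \<in> X. measure \<sigma> {x} > 0}"
 have cX: "C \<in> sets \<sigma>" if "countable C" for C unfolding s(1) by (rule sets.countable[OF _ that]) simp
 have Y: "countable Y" using X(1) by (auto simp: Y_def intro: countable_subset)
 have "emeasure \<sigma> A = (\<Sum>\<^sub>\<infinity>x\<in>Y \<inter> A. ennreal (measure \<sigma> {x}))" if A: "A \<in> sets borel" for A
 proof -
  have A': "A \<in> sets \<sigma>" using A s by simp
  have "emeasure \<sigma> A = emeasure \<sigma> (A \<inter> X)"
  proof (rule emeasure_eq_AE)
   have "UNIV - X \<in> null_sets \<sigma>" using X cX[OF X(1)] s by (intro null_setsI) auto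
   then have "AE x in \<sigma>. x \<notin> UNIV - X" by (rule AE_not_in)
   then show "AE x in \<sigma>. x \<in> A \<longleftrightarrow> x \<in> A \<inter> X" by eventually_elim auto
  qed (use A' cX[OF X(1)] in auto)
  also have "... = (\<integral>\<^sup>+x. emeasure \<sigma> {x} \<partial>count_space (A \<inter> X))"
   using X(1) s by (intro emeasure_countable_singleton) (auto intro: countable_subset)
  also have "... = (\<Sum>\<^sub>\<infinity>x\<in>A \<inter> X. ennreal (measure \<sigma> {x}))"
   by (simp add: infsum_nn_integral emeasure_eq_measure)
  also have "... = (\<Sum>\<^sub>\<infinity>x\<in>Y \<inter> A. ennreal (measure \<sigma> {x}))"
   by (rule infsum_cong_neutral) (auto simp: Y_def not_less measure_le_0_iff)
  finally show ?thesis .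
 qed
 then show "purely_atomic \<sigma>"
  unfolding purely_atomic_def using Y by (intro exI[of _ Y] exI[of _ "%x. measure \<sigma> {x}"]) (auto simp: Y_def)
qed

section \<open>Symmetrized translates\<close>

text \<open>A fair choice of sign. Both translates are then one image of the product with this coin,
  so a single push-forward provides measure, flux and energy bound.\<close>

definition signs :: "real measure"
 where "signs = uniform_count_measure {-1, 1}"

lemma space_signs [simp]: "space signs = {-1, 1}"
 and sets_signs [measurable_cong]: "sets signs = sets (count_space {-1, 1})"
 by (simp_all add: signs_def space_uniform_count_measure sets_uniform_count_measure)

lemma inverse_2_ennreal: "inverse (2::ennreal) = ennreal (1 / 2)"
 by (metis ennreal_numeral inverse_ennreal inverse_eq_divide zero_less_numeral)

lemma ennreal_half_less_top: "x < top ==> y < top ==> (x + y) / 2 < (top :: ennreal)"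
proof -
 have "inverse 2 < (top :: ennreal)" unfolding inverse_2_ennreal by (rule ennreal_less_top)
 then show "x < top ==> y < top ==> (x + y) / 2 < (top :: ennreal)"
  unfolding divide_ennreal_def by (simp add: ennreal_mult_less_top)
qed

lemma ennreal_half_add:
 assumes "0 \<le> a" "0 \<le> b"
 shows "(ennreal a + ennreal b) / 2 = ennreal ((a + b) / 2)"
proof -
 have "(ennreal a + ennreal b) / 2 = ennreal (a + b) * ennreal (1 / 2)"
  unfolding divide_ennreal_def inverse_2_ennreal using assms by simp
 also have "... = ennreal ((a + b) * (1 / 2))" using assms by (intro ennreal_mult[symmetric]) auto
 finally show ?thesis by simp
qed

lemma nn_integral_signs: "(\<integral>\<^sup>+s. f s \<partial>signs) = (f (-1) + f 1) / 2"
proof -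
 have "(\<integral>\<^sup>+s. f s \<partial>signs) = ennreal (1 / 2) * f (-1) + ennreal (1 / 2) * f 1"
  unfolding signs_def uniform_count_measure_def by (subst nn_integral_point_measure_finite) simp_all
 then show ?thesis unfolding divide_ennreal_def distrib_right inverse_2_ennreal by (simp only: mult.commute)
qed

lemma prob_signs: "prob_space signs"
proof
 show "emeasure signs (space signs) = 1"
  unfolding signs_def by (simp add: space_uniform_count_measure emeasure_uniform_count_measure)
qed

lemma signs_pair_measurable:
 "(\<And>s. s = -1 \<or> s = 1 ==> (%x. f (s, x)) \<in> measurable N K) ==> f \<in> measurable (signs \<Otimes>\<^sub>M N) K"
proof -
 assume *: "\<And>s. s = -1 \<or> s = 1 ==> (%x. f (s, x)) \<in> measurable N K"
 have "f \<in> measurable (count_space {-1, 1} \<Otimes>\<^sub>M N) K"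
  by (rule measurable_pair_measure_countable1) (use * in auto)
 then show ?thesis by (simp cong: measurable_cong_sets sets_pair_measure_cong add: sets_signs)
qed

lemma signs_pair_nn_integral:
 assumes "finite_measure N" "f \<in> borel_measurable (signs \<Otimes>\<^sub>M N)"
 shows "(\<integral>\<^sup>+w. f w \<partial>(signs \<Otimes>\<^sub>M N)) = ((\<integral>\<^sup>+x. f (-1, x) \<partial>N) + (\<integral>\<^sup>+x. f (1, x) \<partial>N)) / 2"
proof -
 interpret finite_measure N by fact
 show ?thesis using nn_integral_fst[OF assms(2)] by (simp add: nn_integral_signs)
qed

lemma finite_signs_pair: "finite_measure N ==> finite_measure (signs \<Otimes>\<^sub>M N)"
 by (rule finite_measure_pair_measure) (auto intro: prob_signs prob_space.finite_measure)

lemma signs_pair_integral: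
 fixes f :: "real \<times> 'a => 'b::{banach, second_countable_topology}"
 assumes N: "finite_measure N" and f: "\<And>s. s = -1 \<or> s = 1 ==> integrable N (%x. f (s, x))"
 shows "integrable (signs \<Otimes>\<^sub>M N) f"
  and "(LINT w|(signs \<Otimes>\<^sub>M N). f w) = (1 / 2) *\<^sub>R ((LINT x|N. f (-1, x)) + (LINT x|N. f (1, x)))"
proof -
 interpret N: finite_measure N by fact
 interpret S: prob_space signs by (rule prob_signs)
 interpret pair_sigma_finite signs N ..
 have m: "f \<in> borel_measurable (signs \<Otimes>\<^sub>M N)" by (rule signs_pair_measurable) (use f in auto)
 have fin: "(\<integral>\<^sup>+x. ennreal (norm (f (s, x))) \<partial>N) < \<infinity>" if "s = -1 \<or> s = 1" for s
  using f[OF that] by (simp add: integrable_iff_bounded)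
 show i: "integrable (signs \<Otimes>\<^sub>M N) f"
 proof (rule integrableI_bounded[OF m])
  have "(\<integral>\<^sup>+w. ennreal (norm (f w)) \<partial>(signs \<Otimes>\<^sub>M N)) = ((\<integral>\<^sup>+x. ennreal (norm (f (-1, x))) \<partial>N) + (\<integral>\<^sup>+x. ennreal (norm (f (1, x))) \<partial>N)) / 2"
   using m by (intro signs_pair_nn_integral N) auto
  then show "(\<integral>\<^sup>+w. ennreal (norm (f w)) \<partial>(signs \<Otimes>\<^sub>M N)) < \<infinity>"
   using fin[of "-1"] fin[of 1] by (simp only: ennreal_half_less_top infinity_ennreal_def simp_thms)
 qed
 have "(LINT w|(signs \<Otimes>\<^sub>M N). f w) = (LINT s|signs. LINT x|N. f (s, x))"
  by (rule integral_fst'[OF i, symmetric])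
 also have "... = (\<Sum>s\<in>{-1, 1}. (1 / 2) *\<^sub>R (LINT x|N. f (s, x)))"
  unfolding signs_def uniform_count_measure_def by (subst lebesgue_integral_point_measure_finite) auto
 finally show "(LINT w|(signs \<Otimes>\<^sub>M N). f w) = (1 / 2) *\<^sub>R ((LINT x|N. f (-1, x)) + (LINT x|N. f (1, x)))"
  by (simp add: scaleR_add_right)
qed

lemma signs_pair_emeasure_distr:
 assumes "finite_measure N" "\<And>s. s = -1 \<or> s = 1 ==> (%x. f (s, x)) \<in> measurable N K" "B \<in> sets K"
 shows "emeasure (distr (signs \<Otimes>\<^sub>M N) K f) B =
  (emeasure N ((%x. f (-1, x)) -` B \<inter> space N) + emeasure N ((%x. f (1, x)) -` B \<inter> space N)) / 2"
proof -
 have m: "f \<in> measurable (signs \<Otimes>\<^sub>M N) K" by (rule signs_pair_measurable) (rule assms(2))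
 have "emeasure (distr (signs \<Otimes>\<^sub>M N) K f) B = (\<integral>\<^sup>+w. indicator B (f w) \<partial>(signs \<Otimes>\<^sub>M N))"
  using m assms(3) by (simp add: emeasure_distr nn_integral_distr[symmetric] flip: nn_integral_indicator)
 also have "... = ((\<integral>\<^sup>+x. indicator B (f (-1, x)) \<partial>N) + (\<integral>\<^sup>+x. indicator B (f (1, x)) \<partial>N)) / 2"
  by (intro signs_pair_nn_integral assms(1) measurable_compose[OF m] borel_measurable_indicator assms(3))
 finally have 1: "emeasure (distr (signs \<Otimes>\<^sub>M N) K f) B = ((\<integral>\<^sup>+x. indicator B (f (-1, x)) \<partial>N) + (\<integral>\<^sup>+x. indicator B (f (1, x)) \<partial>N)) / 2" .
 have "(\<integral>\<^sup>+x. indicator B (f (s, x)) \<partial>N) = emeasure N ((%x. f (s, x)) -` B \<inter> space N)" if "s = -1 \<or> s = 1" for s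
 proof -
  have "(\<integral>\<^sup>+x. indicator B (f (s, x)) \<partial>N) = (\<integral>\<^sup>+x. indicator ((%x. f (s, x)) -` B \<inter> space N) x \<partial>N)"
   by (intro nn_integral_cong) (auto simp: indicator_def)
  then show ?thesis using measurable_sets[OF assms(2)[OF that] assms(3)] by simp
 qed
 then show ?thesis using 1 by simp
qed

definition avg2 :: "torus measure => real^2 => torus measure"
 where "avg2 \<sigma> v = distr (signs \<Otimes>\<^sub>M \<sigma>) borel (%w. tshift (snd w) (fst w *\<^sub>R v))"

lemma measurable_tshift: "finite_borel \<sigma> ==> (%p. tshift p v) \<in> measurable \<sigma> borel"
 by (rule measurable_finite_borel) (assumption, intro borel_measurable_continuous_onI continuous_intros)

lemma half_double_ennreal: "(x + x) / 2 = (x::ennreal)"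
 using mult_divide_eq_ennreal[of 2 x] by (simp add: mult_2_right)

lemma finite_borel_avg2:
 assumes "finite_borel \<sigma>"
 shows "finite_borel (avg2 \<sigma> v)"
  and "B \<in> sets borel ==> emeasure (avg2 \<sigma> v) B = (emeasure \<sigma> {p. tshift p (- v) \<in> B} + emeasure \<sigma> {p. tshift p v \<in> B}) / 2"
proof -
 note fm = finite_borelD[OF assms]
 have m: "(%w. tshift (snd w) (fst w *\<^sub>R v)) \<in> measurable (signs \<Otimes>\<^sub>M \<sigma>) borel"
  by (rule signs_pair_measurable) (simp add: measurable_tshift[OF assms])
 show "finite_borel (avg2 \<sigma> v)"
  unfolding finite_borel_def avg2_def
  using finite_measure.finite_measure_distr[OF finite_signs_pair[OF fm(3)] m] by simp
 show "emeasure (avg2 \<sigma> v) B = (emeasure \<sigma> {p. tshift p (- v) \<in> B} + emeasure \<sigma> {p. tshift p v \<in> B}) / 2" if "B \<in> sets borel"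
  unfolding avg2_def using signs_pair_emeasure_distr[OF fm(3), of "%w. tshift (snd w) (fst w *\<^sub>R v)" borel B] that
  by (simp add: measurable_tshift[OF assms] fm(2) vimage_def)
qed

lemma measure_avg2:
 assumes "finite_borel \<sigma>" "B \<in> sets borel"
 shows "measure (avg2 \<sigma> v) B = (measure \<sigma> {p. tshift p (- v) \<in> B} + measure \<sigma> {p. tshift p v \<in> B}) / 2"
proof -
 interpret s: finite_measure \<sigma> by (rule finite_borelD[OF assms(1)])
 interpret a: finite_measure "avg2 \<sigma> v" by (rule finite_borelD[OF finite_borel_avg2(1)[OF assms(1)]])
 have "ennreal (measure (avg2 \<sigma> v) B) = ennreal ((measure \<sigma> {p. tshift p (- v) \<in> B} + measure \<sigma> {p. tshift p v \<in> B}) / 2)"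
  using finite_borel_avg2(2)[OF assms, of v]
  unfolding a.emeasure_eq_measure s.emeasure_eq_measure by (simp only: ennreal_half_add measure_nonneg)
 then show ?thesis by (subst (asm) ennreal_inj) auto
qed

lemma integral_avg2:
 fixes f :: "torus => 'b::{banach, second_countable_topology}"
 assumes "finite_borel \<sigma>" "continuous_on UNIV f"
 shows "(LINT p|avg2 \<sigma> v. f p) = (1 / 2) *\<^sub>R ((LINT p|\<sigma>. f (tshift p (- v))) + (LINT p|\<sigma>. f (tshift p v)))"
proof -
 have m: "(%w. tshift (snd w) (fst w *\<^sub>R v)) \<in> measurable (signs \<Otimes>\<^sub>M \<sigma>) borel"
  by (rule signs_pair_measurable) (simp add: measurable_tshift[OF assms(1)])
 have "(LINT p|avg2 \<sigma> v. f p) = (LINT w|(signs \<Otimes>\<^sub>M \<sigma>). f (tshift (snd w) (fst w *\<^sub>R v)))"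
  unfolding avg2_def by (rule integral_distr[OF m borel_measurable_continuous_onI[OF assms(2)]])
 moreover have "integrable \<sigma> (%p. f (tshift p u))" for u
  by (intro integrable_continuous_torus[OF assms(1)] continuous_on_compose2[OF assms(2)] continuous_intros) auto
 ultimately show ?thesis
  using signs_pair_integral(2)[OF finite_borelD(3)[OF assms(1)], of "%w. f (tshift (snd w) (fst w *\<^sub>R v))"] by auto
qed

lemma tshift_inverse: "tshift (tshift p v) (- v) = p" "tshift (tshift p (- v)) v = p"
 by (simp_all add: tshift_tshift)

lemma purely_atomic_avg2:
 assumes "finite_borel \<sigma>" "purely_atomic \<sigma>"
 shows "purely_atomic (avg2 \<sigma> v)"
proof -
 obtain X where X: "countable X" "emeasure \<sigma> (UNIV - X) = 0" using assms purely_atomic_iff by blast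
 define Y where "Y = (%p. tshift p v) ` X \<union> (%p. tshift p (- v)) ` X"
 have Y: "countable Y" using X(1) by (simp add: Y_def)
 have "Y \<in> sets borel" by (rule sets.countable[OF _ Y]) simp
 then have B: "UNIV - Y \<in> sets borel" by auto
 have Xs: "UNIV - X \<in> sets \<sigma>"
  using sets.countable[OF _ X(1), of borel] finite_borelD(1)[OF assms(1)] by auto
 have z: "emeasure \<sigma> {p. tshift p u \<in> UNIV - Y} = 0" if "u = v \<or> u = - v" for u
 proof -
  have "emeasure \<sigma> {p. tshift p u \<in> UNIV - Y} \<le> emeasure \<sigma> (UNIV - X)"
   using that by (intro emeasure_mono Xs) (auto simp: Y_def)
  then show ?thesis using X(2) by simp
 qed
 have "emeasure (avg2 \<sigma> v) (UNIV - Y) = 0"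
  unfolding finite_borel_avg2(2)[OF assms(1) B] z[of v, OF disjI1[OF refl]] z[of "- v", OF disjI2[OF refl]] by simp
 then show ?thesis using purely_atomic_iff[OF finite_borel_avg2(1)[OF assms(1)]] Y by blast
qed

lemma perimeter_shift: "(\<integral>\<^sup>+x. ennreal (sqrt (measure \<sigma> {tshift x v})) \<partial>count_space UNIV) = perimeter \<sigma>"
proof -
 have "bij (%x. tshift x v)"
  by (rule o_bij[of "%x. tshift x (- v)"]) (auto simp: tshift_inverse)
 from nn_integral_bij_count_space[OF this, of "%y. ennreal (sqrt (measure \<sigma> {y}))"]
 show ?thesis by (simp add: perimeter_nn_integral)
qed

text \<open>Subadditivity of the square root costs a factor two, while the zero shift costs nothing.
  The loss is therefore confined to the times at which the shift is active.\<close>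

lemma perimeter_avg2:
 assumes "finite_borel \<sigma>"
 shows "perimeter (avg2 \<sigma> v) \<le> 2 * perimeter \<sigma>" "perimeter (avg2 \<sigma> 0) = perimeter \<sigma>"
proof -
 have pt: "{p. tshift p u \<in> {x}} = {tshift x (- u)}" for u x
  using tshift_inverse[of _ u] by auto
 have m: "measure (avg2 \<sigma> w) {x} = (measure \<sigma> {tshift x w} + measure \<sigma> {tshift x (- w)}) / 2" for w x
  using measure_avg2[OF assms, of "{x}" w] pt[of "- w" x] pt[of w x] by simp
 have "perimeter (avg2 \<sigma> v) \<le> (\<integral>\<^sup>+x. ennreal (sqrt (measure \<sigma> {tshift x v})) + ennreal (sqrt (measure \<sigma> {tshift x (- v)})) \<partial>count_space UNIV)"
  unfolding perimeter_nn_integral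
 proof (rule nn_integral_mono)
  fix x
  let ?a = "measure \<sigma> {tshift x v}" and ?b = "measure \<sigma> {tshift x (- v)}"
  have "sqrt ((?a + ?b) / 2) \<le> sqrt (?a + ?b)" by simp
  also have "... \<le> sqrt ?a + sqrt ?b" by (rule sqrt_add_le_add_sqrt) auto
  finally show "ennreal (sqrt (measure (avg2 \<sigma> v) {x})) \<le> ennreal (sqrt ?a) + ennreal (sqrt ?b)"
   unfolding m by (simp add: ennreal_plus[symmetric] ennreal_leI del: ennreal_plus)
 qed
 also have "... = perimeter \<sigma> + perimeter \<sigma>"
  by (subst nn_integral_add) (auto simp: perimeter_shift)
 finally show "perimeter (avg2 \<sigma> v) \<le> 2 * perimeter \<sigma>" by (simp add: mult_2)
 show "perimeter (avg2 \<sigma> 0) = perimeter \<sigma>"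
  unfolding perimeter_nn_integral m by simp
qed

text \<open>Changing the shift from \<open>h t\<close> to \<open>h s\<close> alters the integral by
  at most \<open>L * norm (h s - h t)\<close>, whatever the probability measure. It remains to
  integrate one fixed Lipschitz function against varying slices.\<close>

lemma avg2_continuous:
 assumes \<sigma>: "\<And>t. t \<in> A ==> finite_borel (\<sigma> t)" "\<And>t. t \<in> A ==> measure (\<sigma> t) UNIV = 1"
  and cont: "\<And>L f. L \<ge> 0 ==> lipschitz_fun L f ==> continuous_on A (%t. LINT p|\<sigma> t. f p)"
  and h: "continuous_on A h" and f: "L \<ge> 0" "lipschitz_fun L f"
 shows "continuous_on A (%t. LINT p|avg2 (\<sigma> t) (h t). f p)"
proof -
 note cf = lipschitz_fun_continuous[OF f(2)]
 have sh: "\<bar>f (tshift p v) - f (tshift q w)\<bar> \<le> L * (dist p q + norm (v - w))" for p q v w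
  using f(2) order_trans[OF _ mult_left_mono[OF dist_tshift f(1)]] unfolding lipschitz_fun_def by blast
 have c: "continuous_on A (%t. LINT p|\<sigma> t. f (tshift p (h t)))" if h: "continuous_on A h" for h
  unfolding continuous_on_def
 proof
  fix t assume t: "t \<in> A"
  let ?g = "%p. f (tshift p (h t))"
  have g: "lipschitz_fun L ?g" unfolding lipschitz_fun_def using sh[of _ "h t" _ "h t"] by simp
  have "norm ((LINT p|\<sigma> s. f (tshift p (h s))) - (LINT p|\<sigma> s. ?g p)) \<le> L * norm (h s - h t)" if s: "s \<in> A" for s
  proof -
   interpret finite_measure "\<sigma> s" by (rule finite_borelD[OF \<sigma>(1)[OF s]])
   have i: "integrable (\<sigma> s) (%p. f (tshift p v))" for v
    by (rule integrable_continuous_torus[OF \<sigma>(1)[OF s]]) (intro continuous_on_compose2[OF cf] continuous_intros, auto)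
   have "norm ((LINT p|\<sigma> s. f (tshift p (h s))) - (LINT p|\<sigma> s. ?g p)) \<le> (LINT p|\<sigma> s. norm (f (tshift p (h s)) - ?g p))"
    using i integral_norm_bound[of "\<sigma> s" "%p. f (tshift p (h s)) - ?g p"] by simp
   also have "... \<le> (LINT p|\<sigma> s. L * norm (h s - h t))"
    using i sh[of _ "h s" _ "h t"] by (intro Bochner_Integration.integral_mono) (auto intro: order_trans[OF sh])
   finally show ?thesis using \<sigma>(2)[OF s] finite_borelD(2)[OF \<sigma>(1)[OF s]] by simp
  qed
  then have e: "\<forall>\<^sub>F s in at t within A. norm ((LINT p|\<sigma> s. f (tshift p (h s))) - (LINT p|\<sigma> s. ?g p)) \<le> L * norm (h s - h t)"
   by (simp add: eventually_at_filter)
  have "((%s. L * norm (h s - h t)) \<longlongrightarrow> L * norm (h t - h t)) (at t within A)"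
   using h t by (intro tendsto_intros) (auto simp: continuous_on_def)
  then have "((%s. L * norm (h s - h t)) \<longlongrightarrow> 0) (at t within A)" by simp
  from tendsto_add[OF Lim_null_comparison[OF e this], of "%s. LINT p|\<sigma> s. ?g p"]
  show "((%s. LINT p|\<sigma> s. f (tshift p (h s))) \<longlongrightarrow> (LINT p|\<sigma> t. ?g p)) (at t within A)"
   using cont[OF f(1) g] t by (auto simp: continuous_on_def)
 qed
 have "continuous_on A (%t. (1 / 2) *\<^sub>R ((LINT p|\<sigma> t. f (tshift p (- h t))) + (LINT p|\<sigma> t. f (tshift p (h t)))))"
  using h by (intro continuous_intros c)
 then show ?thesis by (rule continuous_on_cong[THEN iffD1, rotated 2]) (simp_all add: integral_avg2[OF \<sigma>(1) cf])
qed

section \<open>Splitting a competitor near the final time\<close>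

text \<open>Composition with \<open>(t, x) \<mapsto> (t, x + h(t) e)\<close>. A time derivative
  produces an extra factor \<open>h'\<close> times a space derivative of \<open>\<psi>\<close> at
  the sheared point, to which the induction hypothesis for arbitrary \<open>\<psi>\<close>
  applies.\<close>

lemma cdiff_shear:
 fixes \<psi> :: "real \<times> (real^2) => real"
 assumes h: "smooth_time h" "smooth_time h'" "\<And>t. (h has_real_derivative h' t) (at t)"
 shows "cdiff n \<psi> ==> cdiff n (%z. \<psi> (fst z, snd z + h (fst z) *\<^sub>R axis i 1))"
proof (induction n arbitrary: \<psi>)
 case 0
 have "continuous_on UNIV (%z::real \<times> (real^2). h (fst z))"
  by (rule continuous_on_compose2[OF continuous_smooth_time[OF h(1)]]) (auto intro!: continuous_intros)
 then show ?case
  using 0 by (auto intro!: continuous_on_compose2[of UNIV \<psi>] continuous_intros)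
next
 case (Suc n)
 let ?A = "%z::real \<times> (real^2). (fst z, snd z + h (fst z) *\<^sub>R axis i 1)"
 let ?D = "%z. frechet_derivative \<psi> (at (?A z))"
 have hd: "((%z::real \<times> (real^2). h (fst z)) has_derivative (%k. h' (fst z) * fst k)) (at z)" for z
  using has_derivative_compose[OF has_derivative_fst[OF has_derivative_ident], of h "(*) (h' (fst z))" z] h(3)[of "fst z"]
  by (simp add: has_field_derivative_def)
 have D: "(\<psi> has_derivative ?D z) (at (?A z))" for z by (rule cdiff_has_derivative[OF Suc.prems])
 have lin: "linear (?D z)" for z by (rule has_derivative_linear[OF D])
 have IH: "cdiff n (%z. ?D z b)" if "b \<in> Basis" for b
  using Suc.IH[of "%z. frechet_derivative \<psi> (at z) b"] Suc.prems that by simp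
 show ?case
 proof (rule cdiff_SucI[where f'="%z k. ?D z (fst k, snd k + (h' (fst z) * fst k) *\<^sub>R axis i 1)"])
  show "((%z. \<psi> (?A z)) has_derivative (%k. ?D z (fst k, snd k + (h' (fst z) * fst k) *\<^sub>R axis i 1))) (at z)" for z
   by (rule has_derivative_compose[where f="?A" and x=z, OF _ D]) (auto intro!: derivative_eq_intros hd)
  fix b :: "real \<times> (real^2)" assume "b \<in> Basis"
  then consider "b = (1, 0)" | u where "u \<in> Basis" "b = (0, u)" by (auto simp: Basis_prod_def)
  then show "cdiff n (%z. ?D z (fst b, snd b + (h' (fst z) * fst b) *\<^sub>R axis i 1))"
  proof cases
   case 1
   have "?D z (1, h' (fst z) *\<^sub>R axis i 1) = ?D z (1, 0) + h' (fst z) * ?D z (0, axis i 1)" for z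
    using linear_add[OF lin, of z "(1, 0)" "h' (fst z) *\<^sub>R (0, axis i 1)"]
     linear_scale[OF lin, of z "h' (fst z)" "(0, axis i 1)"] by simp
   then show ?thesis
    using IH[OF Basis_time] IH[OF Basis_space[of i]] h(2) unfolding 1 smooth_time_def smooth_def
    by (auto intro!: cdiff_add cdiff_mult)
  next
   case 2
   then show ?thesis using IH[of b] 2 by (simp add: Basis_prod_def)
  qed
 qed
qed

text \<open>Testing the equation of \<open>\<mu>\<close> with the sheared function yields the
  equation of the shifted measure; the additional term in the time derivative is the contribution of
  the velocity \<open>h' e\<close>.\<close>

lemma test_function_shift:
 fixes i :: 2
 assumes \<phi>: "test_function T \<phi>" and h: "smooth_time h" "smooth_time h'" "\<And>t. (h has_real_derivative h' t) (at t)"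
 defines "S \<equiv> %z. (fst z, tshift (snd z) (h (fst z) *\<^sub>R axis i 1))"
 shows "test_function T (%z. \<phi> (S z))"
  "time_deriv (%z. \<phi> (S z)) z = time_deriv \<phi> (S z) + h' (fst z) * space_grad \<phi> (S z) $ i"
  "space_grad (%z. \<phi> (S z)) z = space_grad \<phi> (S z)"
proof -
 let ?A = "%z::real \<times> (real^2). (fst z, snd z + h (fst z) *\<^sub>R axis i 1)"
 have s: "smooth (lift_fun \<phi>)" using \<phi> by (simp add: test_function_def)
 have lift: "lift_fun (%z. \<phi> (S z)) = (%z. lift_fun \<phi> (?A z))"
  by (auto simp: lift_fun_def S_def tshift_abs)
 have s': "smooth (lift_fun (%z. \<phi> (S z)))"
  unfolding lift smooth_def using s cdiff_shear[OF h] by (auto simp: smooth_def)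
 have "continuous_on UNIV (%z::real \<times> torus. h (fst z))"
  by (rule continuous_on_compose2[OF continuous_smooth_time[OF h(1)]]) (auto intro!: continuous_intros)
 then have cS: "continuous_on UNIV S" unfolding S_def by (intro continuous_intros)
 obtain K where K: "compact K" "K \<subseteq> QT T" "\<And>z. z \<notin> K ==> \<phi> z = 0" using \<phi> by (auto simp: test_function_def)
 \<comment> \<open>The shear keeps the time coordinate, so the preimage of \<open>K\<close> lies
   over the compact time projection of \<open>K\<close>; the torus is compact, and continuity makes
   the preimage closed.\<close>
 have "compact ((fst ` K \<times> UNIV) \<inter> S -` K)"
  using K(1) by (intro compact_Int_closed compact_Times compact_torus closed_vimage cS compact_imp_closed
    compact_continuous_image continuous_intros)
 moreover have "(fst ` K \<times> UNIV) \<inter> S -` K \<subseteq> QT T" using K(2) by (auto simp: QT_def)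
 moreover have "\<phi> (S z) = 0" if "z \<notin> (fst ` K \<times> UNIV) \<inter> S -` K" for z
 proof -
  have "S z \<notin> K"
  proof
   assume "S z \<in> K"
   then have "fst (S z) \<in> fst ` K" by simp
   then show False using that \<open>S z \<in> K\<close> by (cases z) (auto simp: S_def)
  qed
  then show ?thesis by (rule K(3))
 qed
 ultimately show "test_function T (%z. \<phi> (S z))" using s' unfolding test_function_def by blast
 obtain t p where z: "z = (t, p)" by force
 obtain x where x: "p = abs_torus x" by (metis abs_torus_rep)
 define D where "D = frechet_derivative (lift_fun \<phi>) (at (?A (t, x)))"
 have D: "(lift_fun \<phi> has_derivative D) (at (?A (t, x)))" unfolding D_def by (rule cdiff_has_derivative'[OF s])
 have hd: "((%z::real \<times> (real^2). h (fst z)) has_derivative (%k. h' t * fst k)) (at (t, x))"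
  using has_derivative_compose[OF has_derivative_fst[OF has_derivative_ident], of h "(*) (h' t)" "(t, x)"] h(3)[of t]
  by (simp add: has_field_derivative_def)
 have "(lift_fun (%z. \<phi> (S z)) has_derivative (%k. D (fst k, snd k + (h' t * fst k) *\<^sub>R axis i 1))) (at (t, x))"
  unfolding lift by (rule has_derivative_compose[where f="?A" and x="(t, x)", OF _ D]) (auto intro!: derivative_eq_intros hd)
 note g = space_grad_I[OF s' this]
 have D': "(lift_fun \<phi> has_derivative D) (at (t, x + h t *\<^sub>R axis i 1))" using D by simp
 note g' = space_grad_I[OF s D']
 have Sz: "S z = (t, abs_torus (x + h t *\<^sub>R axis i 1))" by (simp add: S_def z x tshift_abs)
 have lin: "linear D" by (rule has_derivative_linear[OF D])
 have "D (1, h' t *\<^sub>R axis i 1) = D (1, 0) + h' t * D (0, axis i 1)"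
  using linear_add[OF lin, of "(1, 0)" "h' t *\<^sub>R (0, axis i 1)"] linear_scale[OF lin, of "h' t" "(0, axis i 1)"] by simp
 then show "time_deriv (%z. \<phi> (S z)) z = time_deriv \<phi> (S z) + h' (fst z) * space_grad \<phi> (S z) $ i"
  using g(2) g' unfolding Sz by (simp add: z x)
 show "space_grad (%z. \<phi> (S z)) z = space_grad \<phi> (S z)"
  using g(1) g'(1) unfolding Sz by (simp add: z x)
qed

text \<open>The shift at time \<open>t\<close>: it vanishes up to \<open>T - \<epsilon>\<close> and
  equals \<open>r / e\<close> at \<open>T\<close>. Later the amplitude is multiplied by
  \<open>exp 1\<close> to undo this factor.\<close>

definition hump :: "real => real => real => real => real"
 where "hump \<epsilon> T r t = r * flat 1 (1 / \<epsilon> * t + (\<epsilon> - T) / \<epsilon>)"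

definition hump' :: "real => real => real => real => real"
 where "hump' \<epsilon> T r t = r / \<epsilon> * flat (monom 1 2) (1 / \<epsilon> * t + (\<epsilon> - T) / \<epsilon>)"

lemma hump:
 assumes "\<epsilon> > 0" "r \<ge> 0"
 shows "smooth_time (%t. s * hump \<epsilon> T r t)" "smooth_time (%t. s * hump' \<epsilon> T r t)"
  "((%t. s * hump \<epsilon> T r t) has_real_derivative s * hump' \<epsilon> T r t) (at t)"
  "t \<le> T - \<epsilon> ==> hump \<epsilon> T r t = 0" "t \<le> T - \<epsilon> ==> hump' \<epsilon> T r t = 0"
  "\<bar>hump' \<epsilon> T r t\<bar> \<le> 4 * r / \<epsilon>" "hump \<epsilon> T r T = r * exp (-1)"
proof -
 let ?l = "%t. 1 / \<epsilon> * t + (\<epsilon> - T) / \<epsilon>"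
 have sm: "smooth_time (%t. flat P (a * t + b))" for P a b
  unfolding smooth_time_def by (intro smooth_flat smooth_add smooth_mult smooth_const smooth_bounded_linear bounded_linear_fst)
 show "smooth_time (%t. s * hump \<epsilon> T r t)" "smooth_time (%t. s * hump' \<epsilon> T r t)"
  unfolding hump_def hump'_def by (intro smooth_time_mult smooth_time_const sm)+
 have "(flat 1 has_real_derivative flat (monom 1 2) (?l t)) (at (?l t))"
  using flat_deriv[of 1 "?l t"] by (simp add: pderiv_1)
 moreover have "(?l has_real_derivative 1 / \<epsilon>) (at t)" using assms(1) by (auto intro!: derivative_eq_intros)
 ultimately
 have "((%t. flat 1 (?l t)) has_real_derivative flat (monom 1 2) (?l t) * (1 / \<epsilon>)) (at t)"
  by (rule DERIV_chain2)
 from DERIV_cmult[OF this, of "s * r"]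
 show "((%t. s * hump \<epsilon> T r t) has_real_derivative s * hump' \<epsilon> T r t) (at t)"
  unfolding hump_def hump'_def by (simp add: mult_ac)
 have l: "?l t = (t - (T - \<epsilon>)) / \<epsilon>" for t using assms(1) by (simp add: field_simps)
 show "t \<le> T - \<epsilon> ==> hump \<epsilon> T r t = 0" "t \<le> T - \<epsilon> ==> hump' \<epsilon> T r t = 0"
  unfolding hump_def hump'_def flat_def l using assms(1) by (auto simp: zero_less_divide_iff)
 have b: "0 \<le> flat (monom 1 2) x \<and> flat (monom 1 2) x \<le> 4" for x
 proof (cases "x > 0")
  case True
  define y where "y = 1 / x"
  have y: "y > 0" using True by (simp add: y_def)
  \<comment> \<open>Squaring gives \<open>y\<^sup>2 exp (- y) \<le> 4\<close>, the origin of the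
    constant in the bound for \<open>hump'\<close>.\<close>
  have "y / 2 \<le> exp (y / 2)" using exp_ge_add_one_self[of "y / 2"] by linarith
  then have "(y / 2)\<^sup>2 \<le> (exp (y / 2))\<^sup>2" using y by (intro power_mono) auto
  then have "y\<^sup>2 \<le> 4 * exp y" by (simp add: power_divide exp_double[symmetric])
  then have "y\<^sup>2 * exp (- y) \<le> 4 * exp y * exp (- y)" by (intro mult_right_mono) auto
  also have "... = 4" by (simp add: exp_minus)
  finally show ?thesis using True by (simp add: flat_def poly_monom y_def[symmetric])
 qed (simp add: flat_def)
 show "\<bar>hump' \<epsilon> T r t\<bar> \<le> 4 * r / \<epsilon>"
  using b[of "?l t"] assms mult_left_mono[of "flat (monom 1 2) (?l t)" 4 "r / \<epsilon>"]
  by (simp add: hump'_def abs_mult mult.commute)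
 have "?l T = 1" using assms(1) by (simp add: field_simps)
 then show "hump \<epsilon> T r T = r * exp (-1)" by (simp add: hump_def flat_1)
qed

text \<open>\<open>g\<close> may be arbitrary: this is applied to the perimeter as a function of
  time, whose measurability has not been established, so additivity of the integral is not at
  hand.\<close>

lemma nn_integral_add_indicator_le:
 fixes g :: "'a => ennreal"
 assumes J: "J \<in> sets M"
 shows "(\<integral>\<^sup>+x. g x + g x * indicator J x \<partial>M) \<le> (\<integral>\<^sup>+x. g x \<partial>M) + (\<integral>\<^sup>+x. g x * indicator J x \<partial>M)"
 unfolding nn_integral_def[of M "%x. g x + g x * indicator J x"]
proof (rule SUP_least, safe)
 fix s assume s: "simple_function M s" "s \<le> (%x. g x + g x * indicator J x)"
 have sle: "s x \<le> g x + g x * indicator J x" for x using s(2) by (simp add: le_fun_def)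
 have [measurable]: "s \<in> borel_measurable M" using s(1) by (rule borel_measurable_simple_function)
 \<comment> \<open>A simple function below \<open>g + g 1\<^sub>J\<close> is at most
   \<open>2 g\<close> on \<open>J\<close>. Splitting it there into two halves gives measurable
   functions below \<open>g\<close> and below \<open>g 1\<^sub>J\<close>.\<close>
 note [measurable] = J
 let ?a = "%x. s x / 2 * indicator J x" and ?b = "%x. if x \<in> J then s x / 2 else s x"
 have half: "s x / 2 \<le> g x" if "x \<in> J" for x
  using divide_right_mono_ennreal[OF sle[of x], of 2] that by (simp add: half_double_ennreal)
 have "integral\<^sup>S M s = (\<integral>\<^sup>+x. s x \<partial>M)" by (rule nn_integral_eq_simple_integral[OF s(1), symmetric])
 also have "... = (\<integral>\<^sup>+x. ?b x + ?a x \<partial>M)"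
 proof (intro nn_integral_cong)
  fix x
  have "s x / 2 + s x / 2 = s x"
   using half_double_ennreal[of "s x"] unfolding divide_ennreal_def by (simp add: distrib_right)
  then show "s x = ?b x + ?a x" by (simp add: indicator_def)
 qed
 also have "... = (\<integral>\<^sup>+x. ?b x \<partial>M) + (\<integral>\<^sup>+x. ?a x \<partial>M)" by (intro nn_integral_add) measurable
 also have "... \<le> (\<integral>\<^sup>+x. g x \<partial>M) + (\<integral>\<^sup>+x. g x * indicator J x \<partial>M)"
 proof (intro add_mono nn_integral_mono)
  show "?b x \<le> g x" "?a x \<le> g x * indicator J x" for x
   using half[of x] sle[of x] by (cases "x \<in> J"; simp)+
 qed
 finally show "integral\<^sup>S M s \<le> (\<integral>\<^sup>+x. g x \<partial>M) + (\<integral>\<^sup>+x. g x * indicator J x \<partial>M)" .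
qed

section \<open>Perimeter part and kinetic part of the energy\<close>

definition perim_energy :: "real => (real \<times> torus) measure => real => real => ennreal"
 where "perim_energy T \<mu> a b = (\<integral>\<^sup>+ t\<in>{a<..<b}. perimeter (disintegration T \<mu> t) \<partial>lborel)"

definition kin_energy :: "(real \<times> torus) measure => ((real \<times> torus) set => real^2) => real => real => ennreal"
 where "kin_energy \<mu> m a b = (\<integral>\<^sup>+ z\<in>{a<..<b} \<times> UNIV. ennreal ((norm (vector_RN_deriv \<mu> m z))\<^sup>2) \<partial>\<mu>)"

lemma irrigation_energy_alt:
 "irrigation_energy T \<mu> a b = (INF m\<in>fluxes T \<mu>. perim_energy T \<mu> a b + kin_energy \<mu> m a b)"
 by (simp add: irrigation_energy_def perim_energy_def kin_energy_def perimeter_def)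

lemma perim_energy_le: "perim_energy T \<mu> a b \<le> irrigation_energy T \<mu> a b"
 unfolding irrigation_energy_alt by (rule INF_greatest) simp

lemma integrable_continuous_QT:
 fixes g :: "real \<times> torus => 'b::{banach, second_countable_topology}"
 assumes "sets \<mu> = sets (borel_QT T)" "finite_measure \<mu>" "continuous_on UNIV g"
 shows "integrable \<mu> g"
proof -
 interpret finite_measure \<mu> by fact
 obtain B where "\<And>z. z \<in> QT T ==> norm (g z) \<le> B" using continuous_bounded_QT[OF assms(3)] by blast
 then show ?thesis
  using continuous_measurable_QT[OF assms(3), of T] assms(1) sets_eq_imp_space_eq[OF assms(1)]
  by (intro integrable_const_bound[where B=B]) (auto cong: measurable_cong_sets)
qed

lemma integrable_inner_QT:
 fixes g v :: "real \<times> torus => real^2"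
 assumes "sets \<mu> = sets (borel_QT T)" "finite_measure \<mu>" "continuous_on UNIV g" "integrable \<mu> v"
 shows "integrable \<mu> (%z. g z \<bullet> v z)"
proof -
 obtain B where B: "\<And>z. z \<in> QT T ==> norm (g z) \<le> B" using continuous_bounded_QT[OF assms(3)] by blast
 have sp: "space \<mu> = QT T" using sets_eq_imp_space_eq[OF assms(1)] by simp
 show ?thesis
 proof (rule Bochner_Integration.integrable_bound)
  show "integrable \<mu> (%z. B * norm (v z))" using assms(4) by auto
  show "(%z. g z \<bullet> v z) \<in> borel_measurable \<mu>"
   using continuous_measurable_QT[OF assms(3), of T] assms(1,4) by (auto intro!: borel_measurable_inner cong: measurable_cong_sets)
  show "AE z in \<mu>. norm (g z \<bullet> v z) \<le> norm (B * norm (v z))"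
  proof (rule AE_I2)
   fix z assume "z \<in> space \<mu>"
   then have "norm (g z) \<le> B" using B sp by simp
   have "\<bar>g z \<bullet> v z\<bar> \<le> norm (g z) * norm (v z)" by (rule Cauchy_Schwarz_ineq2)
   also have "... \<le> B * norm (v z)" using \<open>norm (g z) \<le> B\<close> by (rule mult_right_mono) simp
   finally show "norm (g z \<bullet> v z) \<le> norm (B * norm (v z))" by simp
  qed
 qed
qed

lemma time_strip_mass:
 assumes "\<mu> \<in> competitors T" "T > 0" "0 < \<epsilon>" "\<epsilon> \<le> 2 * T"
 shows "emeasure \<mu> ({T - \<epsilon><..<T} \<times> UNIV) = ennreal \<epsilon>"
proof -
 note c = competitor_slice[OF assms(1,2)]
 let ?A = "{T - \<epsilon><..<T} \<times> (UNIV :: torus set)"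
 have A: "?A \<in> sets (borel_QT T)"
  unfolding sets_borel_QT using assms(4) by (auto simp: QT_def intro!: borel_open open_Times)
 have "emeasure \<mu> ?A = (\<integral>\<^sup>+ t. emeasure (slice T \<mu> t) (Pair t -` ?A) \<partial>lborel_I T)"
  by (rule disintegration_emeasure[OF c(6,1) A])
 also have "... = (\<integral>\<^sup>+ t. indicator {T - \<epsilon><..<T} t \<partial>lborel_I T)"
 proof (rule nn_integral_cong)
  fix t assume "t \<in> space (lborel_I T)"
  then have t: "t \<in> {-T..T}" by auto
  interpret finite_measure "slice T \<mu> t" by (rule finite_borelD[OF c(7)[OF t]])
  show "emeasure (slice T \<mu> t) (Pair t -` ?A) = indicator {T - \<epsilon><..<T} t"
   using c(8)[OF t] by (cases "t \<in> {T - \<epsilon><..<T}") (auto simp: emeasure_eq_measure vimage_def)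
 qed
 also have "... = emeasure (lborel_I T) {T - \<epsilon><..<T}"
  using assms(4) by (intro nn_integral_indicator) (auto simp: sets_restrict_space_iff)
 also have "... = ennreal \<epsilon>" using assms(3,4) by (subst emeasure_restrict_space) auto
 finally show ?thesis .
qed

text \<open>Inside the strip the perimeter at most doubles, which adds at most the energy of the
  strip. The velocities \<open>v + h' e\<close> and \<open>v - h' e\<close> have mean square
  \<open>|v|\<^sup>2 + h'\<^sup>2\<close>; with \<open>|h'| \<le> 4 r / \<epsilon>\<close> on a
  strip of mass \<open>\<epsilon>\<close> this adds
  \<open>16 r\<^sup>2 / \<epsilon>\<close>.\<close>

lemma shift_competitor:
 fixes i :: 2
 assumes \<mu>: "\<mu> \<in> competitors T" and T: "T > 0" "0 < \<epsilon>" "\<epsilon> \<le> T" "0 \<le> r"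
 obtains \<mu>' where "\<mu>' \<in> competitors T"
  "\<And>t. t \<in> {-T..T} ==> slice T \<mu>' t = avg2 (slice T \<mu> t) (hump \<epsilon> T r t *\<^sub>R axis i 1)"
  "irrigation_energy T \<mu>' (-T) T \<le> irrigation_energy T \<mu> (-T) T + irrigation_energy T \<mu> (T - \<epsilon>) T + ennreal (16 * r\<^sup>2 / \<epsilon>)"
proof -
 note c = competitor_slice[OF \<mu> T(1)]
 let ?h = "hump \<epsilon> T r" and ?h' = "hump' \<epsilon> T r" and ?e = "axis i 1 :: real^2"
 note hp = hump[OF T(2,4), where T=T]
 have sp: "space \<mu> = QT T" using sets_eq_imp_space_eq[OF c(1)] by simp
 define S where "S s z = (fst z, tshift (snd z) ((s * ?h (fst z)) *\<^sub>R ?e))" for s and z :: "real \<times> torus"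
 define P where "P w = S (fst w) (snd w)" for w
 have cont: "continuous_on UNIV ?h" "continuous_on UNIV ?h'"
  using continuous_smooth_time[OF hp(1)[of 1]] continuous_smooth_time[OF hp(2)[of 1]] by simp_all
 have ch: "continuous_on UNIV (%z::real \<times> torus. ?h (fst z))" "continuous_on UNIV (%z::real \<times> torus. ?h' (fst z))"
  by (auto intro!: continuous_on_compose2[OF cont(1)] continuous_on_compose2[OF cont(2)] continuous_intros)
 have cS: "continuous_on UNIV (S s)" for s unfolding S_def by (intro continuous_intros ch)
 have Sm: "S s \<in> measurable \<mu> (borel_QT T)" for s
 proof -
  have "S s \<in> measurable (borel_QT T) (borel_QT T)"
   by (intro measurable_restrict_space2 measurable_restrict_space1 borel_measurable_continuous_onI cS)
    (simp only: space_borel_QT, auto simp: S_def QT_def)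
  then show ?thesis using c(1) by (simp cong: measurable_cong_sets)
 qed
 have Ps: "(%z. P (s, z)) = S s" for s by (simp add: P_def)
 have Pm: "P \<in> measurable (signs \<Otimes>\<^sub>M \<mu>) (borel_QT T)" by (rule signs_pair_measurable) (simp only: Ps Sm)
 define \<mu>' where "\<mu>' = distr (signs \<Otimes>\<^sub>M \<mu>) (borel_QT T) P"
 have s\<mu>': "sets \<mu>' = sets (borel_QT T)" by (simp add: \<mu>'_def)
 have f\<mu>': "finite_measure \<mu>'"
  unfolding \<mu>'_def by (rule finite_measure.finite_measure_distr[OF finite_signs_pair[OF c(2)] Pm])
 have key: "\<exists>m'\<in>fluxes T \<mu>'. kin_energy \<mu>' m' (-T) T \<le> kin_energy \<mu> m (-T) T + ennreal (16 * r\<^sup>2 / \<epsilon>)"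
  if m: "m \<in> fluxes T \<mu>" for m
 proof -
  define v where "v = vector_RN_deriv \<mu> m"
  have v: "integrable \<mu> v" unfolding v_def by (rule flux_integrable[OF m c(2)])
  define w where "w y = v (snd y) + (fst y * ?h' (fst (snd y))) *\<^sub>R ?e" for y
  have iw: "integrable \<mu> (%z. w (s, z))" for s
  proof -
   have "continuous_on UNIV (%z::real \<times> torus. (s * ?h' (fst z)) *\<^sub>R ?e)" by (intro continuous_intros ch)
   from integrable_continuous_QT[OF c(1,2) this] show ?thesis unfolding w_def using v by simp
  qed
  have weak: "(LINT z|(signs \<Otimes>\<^sub>M \<mu>). time_deriv \<phi> (P z)) + (LINT z|(signs \<Otimes>\<^sub>M \<mu>). space_grad \<phi> (P z) \<bullet> w z) = 0"
   if \<phi>: "test_function T \<phi>" for \<phi>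
  proof -
   have sm: "smooth (lift_fun \<phi>)" using \<phi> by (simp add: test_function_def)
   have c1: "continuous_on UNIV (%z. time_deriv \<phi> (S s z))" and c2: "continuous_on UNIV (%z. space_grad \<phi> (S s z))" for s
    by (auto intro!: continuous_on_compose2[OF continuous_time_deriv[OF sm] cS] continuous_on_compose2[OF continuous_space_grad[OF sm] cS])
   have c3: "continuous_on UNIV (%z. (s * ?h' (fst z)) * space_grad \<phi> (S s z) $ i)" for s
    by (intro continuous_intros ch c2)
   note i1 = integrable_continuous_QT[OF c(1,2) c1] and i2 = integrable_inner_QT[OF c(1,2) c2 v]
    and i3 = integrable_continuous_QT[OF c(1,2) c3]
   have gw: "space_grad \<phi> (S s z) \<bullet> w (s, z) = space_grad \<phi> (S s z) \<bullet> v z + (s * ?h' (fst z)) * space_grad \<phi> (S s z) $ i" for s z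
    by (simp add: w_def inner_add_right inner_axis)
   have z: "(LINT z|\<mu>. time_deriv \<phi> (S s z)) + (LINT z|\<mu>. space_grad \<phi> (S s z) \<bullet> w (s, z)) = 0" for s
   proof -
    \<comment> \<open>The original flux is tested with \<open>\<phi>\<close> composed with the
      shear, which is again a test function.\<close>
    note ts = test_function_shift[OF \<phi> hp(1)[of s] hp(2)[of s] hp(3), of i, folded S_def]
    have "(LINT z|\<mu>. time_deriv (%z. \<phi> (S s z)) z) + (LINT z|\<mu>. space_grad (%z. \<phi> (S s z)) z \<bullet> v z) = 0"
     using m ts(1) unfolding fluxes_def v_def by blast
    then have "(LINT z|\<mu>. time_deriv \<phi> (S s z) + (s * ?h' (fst z)) * space_grad \<phi> (S s z) $ i) + (LINT z|\<mu>. space_grad \<phi> (S s z) \<bullet> v z) = 0"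
     unfolding ts(2,3) by (simp add: S_def)
    then show ?thesis unfolding gw using i1 i2 i3 by simp
   qed
   have "integrable \<mu> (%z. space_grad \<phi> (S s z) \<bullet> w (s, z))" for s unfolding gw using i2 i3 by auto
   then have "(LINT z|(signs \<Otimes>\<^sub>M \<mu>). space_grad \<phi> (P z) \<bullet> w z) =
     (1 / 2) *\<^sub>R ((LINT z|\<mu>. space_grad \<phi> (S (-1) z) \<bullet> w (-1, z)) + (LINT z|\<mu>. space_grad \<phi> (S 1 z) \<bullet> w (1, z)))"
    by (subst signs_pair_integral(2)[OF c(2)]) (auto simp: P_def)
   moreover have "(LINT z|(signs \<Otimes>\<^sub>M \<mu>). time_deriv \<phi> (P z)) =
     (1 / 2) *\<^sub>R ((LINT z|\<mu>. time_deriv \<phi> (S (-1) z)) + (LINT z|\<mu>. time_deriv \<phi> (S 1 z)))"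
    using i1 by (subst signs_pair_integral(2)[OF c(2)]) (auto simp: P_def)
   ultimately show ?thesis using z[of "-1"] z[of 1] by (simp add: field_simps)
  qed
  have iw': "integrable (signs \<Otimes>\<^sub>M \<mu>) w" by (rule signs_pair_integral(1)[OF c(2) iw])
  obtain m' where m': "m' \<in> fluxes T \<mu>'" and le: "\<And>A. A \<in> sets (borel_QT T) ==>
    (\<integral>\<^sup>+ x\<in>A. ennreal ((norm (vector_RN_deriv \<mu>' m' x))\<^sup>2) \<partial>\<mu>') \<le> (\<integral>\<^sup>+ z\<in>P -` A. ennreal ((norm (w z))\<^sup>2) \<partial>(signs \<Otimes>\<^sub>M \<mu>))"
   using flux_push_forward[OF finite_signs_pair[OF c(2)] Pm iw' weak] unfolding \<mu>'_def by blast
  let ?J = "{T - \<epsilon><..<T} \<times> (UNIV :: torus set)"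
  have Js: "?J \<in> sets \<mu>" using T unfolding c(1) sets_borel_QT by (auto simp: QT_def intro!: borel_open open_Times)
  have QTs: "{-T<..<T} \<times> (UNIV :: torus set) \<in> sets (borel_QT T)"
   unfolding sets_borel_QT using open_QT[of T] by (auto simp: QT_def)
  have vm: "(%z. ennreal ((norm (v z))\<^sup>2)) \<in> borel_measurable \<mu>" using v by auto
  have "kin_energy \<mu>' m' (-T) T \<le> (\<integral>\<^sup>+ z\<in>P -` ({-T<..<T} \<times> UNIV). ennreal ((norm (w z))\<^sup>2) \<partial>(signs \<Otimes>\<^sub>M \<mu>))"
   unfolding kin_energy_def by (rule le[OF QTs])
  also have "... \<le> (\<integral>\<^sup>+ z. ennreal ((norm (w z))\<^sup>2) \<partial>(signs \<Otimes>\<^sub>M \<mu>))"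
   by (intro nn_integral_mono) (auto simp: indicator_def)
  also have "... = ((\<integral>\<^sup>+ z. ennreal ((norm (w (-1, z)))\<^sup>2) \<partial>\<mu>) + (\<integral>\<^sup>+ z. ennreal ((norm (w (1, z)))\<^sup>2) \<partial>\<mu>)) / 2"
   using iw' by (intro signs_pair_nn_integral c(2)) auto
  also have "... = (\<integral>\<^sup>+ z. ennreal ((norm (w (-1, z)))\<^sup>2) + ennreal ((norm (w (1, z)))\<^sup>2) \<partial>\<mu>) / 2"
   using borel_measurable_integrable[OF iw[of "-1"]] borel_measurable_integrable[OF iw[of 1]] by (subst nn_integral_add) auto
  also have "... \<le> (\<integral>\<^sup>+ z. (ennreal ((norm (v z))\<^sup>2) + ennreal ((4 * r / \<epsilon>)\<^sup>2) * indicator ?J z) +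
    (ennreal ((norm (v z))\<^sup>2) + ennreal ((4 * r / \<epsilon>)\<^sup>2) * indicator ?J z) \<partial>\<mu>) / 2"
  proof (intro divide_right_mono_ennreal nn_integral_mono)
   fix z assume z: "z \<in> space \<mu>"
   \<comment> \<open>The parallelogram identity: the terms linear in \<open>h'\<close> cancel
     between the two signs.\<close>
   have "(norm (w (-1, z)))\<^sup>2 + (norm (w (1, z)))\<^sup>2 = 2 * ((norm (v z))\<^sup>2 + (?h' (fst z))\<^sup>2)"
   proof -
    have par: "(norm (a - b))\<^sup>2 + (norm (a + b))\<^sup>2 = 2 * ((norm a)\<^sup>2 + (norm b)\<^sup>2)" for a b :: "real^2"
     by (simp add: power2_norm_eq_inner inner_add_left inner_add_right inner_diff_left inner_diff_right inner_commute)
    show ?thesis using par[of "v z" "?h' (fst z) *\<^sub>R ?e"] by (simp add: w_def)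
   qed
   also have "... \<le> 2 * ((norm (v z))\<^sup>2 + (4 * r / \<epsilon>)\<^sup>2 * indicator ?J z)"
   proof -
    have "(?h' (fst z))\<^sup>2 \<le> (4 * r / \<epsilon>)\<^sup>2 * indicator ?J z"
    proof (cases "fst z \<le> T - \<epsilon>")
     case True
     then show ?thesis using hp(5) by simp
    next
     case False
     then have "z \<in> ?J" using z sp by (cases z) (auto simp: QT_def)
     moreover have "(?h' (fst z))\<^sup>2 \<le> (4 * r / \<epsilon>)\<^sup>2" using hp(6)[of "fst z"] by (metis abs_ge_zero power2_abs power_mono)
     ultimately show ?thesis by simp
    qed
    then show ?thesis by simp
   qed
   finally have "ennreal ((norm (w (-1, z)))\<^sup>2 + (norm (w (1, z)))\<^sup>2) \<le> ennreal (((norm (v z))\<^sup>2 + (4 * r / \<epsilon>)\<^sup>2 * indicator ?J z) + ((norm (v z))\<^sup>2 + (4 * r / \<epsilon>)\<^sup>2 * indicator ?J z))"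
    by (intro ennreal_leI) (simp only: mult_2)
   also have "... = (ennreal ((norm (v z))\<^sup>2) + ennreal ((4 * r / \<epsilon>)\<^sup>2) * indicator ?J z) + (ennreal ((norm (v z))\<^sup>2) + ennreal ((4 * r / \<epsilon>)\<^sup>2) * indicator ?J z)"
   proof -
    have "ennreal ((norm (v z))\<^sup>2 + (4 * r / \<epsilon>)\<^sup>2 * indicator ?J z) = ennreal ((norm (v z))\<^sup>2) + ennreal ((4 * r / \<epsilon>)\<^sup>2) * indicator ?J z"
     by (cases "z \<in> ?J") simp_all
    then show ?thesis by (subst ennreal_plus) auto
   qed
   finally show "ennreal ((norm (w (-1, z)))\<^sup>2) + ennreal ((norm (w (1, z)))\<^sup>2) \<le> ..." by simp
  qed
  also have "... = (\<integral>\<^sup>+ z. ennreal ((norm (v z))\<^sup>2) + ennreal ((4 * r / \<epsilon>)\<^sup>2) * indicator ?J z \<partial>\<mu>)"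
   using vm Js by (subst nn_integral_add) (auto simp: half_double_ennreal)
  also have "... = (\<integral>\<^sup>+ z. ennreal ((norm (v z))\<^sup>2) \<partial>\<mu>) + ennreal ((4 * r / \<epsilon>)\<^sup>2) * emeasure \<mu> ?J"
   using vm Js by (subst nn_integral_add) (auto simp: nn_integral_cmult)
  also have "(\<integral>\<^sup>+ z. ennreal ((norm (v z))\<^sup>2) \<partial>\<mu>) = kin_energy \<mu> m (-T) T"
   unfolding kin_energy_def v_def using sp by (intro nn_integral_cong) (auto simp: QT_def)
  also have "ennreal ((4 * r / \<epsilon>)\<^sup>2) * emeasure \<mu> ?J = ennreal (16 * r\<^sup>2 / \<epsilon>)"
   using T by (subst time_strip_mass[OF \<mu> T(1,2)]) (auto simp: ennreal_mult[symmetric] power2_eq_square)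
  finally show ?thesis using m' by blast
 qed
 define \<sigma>' where "\<sigma>' t = avg2 (slice T \<mu> t) (?h t *\<^sub>R ?e)" for t
 have fb: "finite_borel (\<sigma>' t)" "measure (\<sigma>' t) UNIV = 1" if "t \<in> {-T..T}" for t
  unfolding \<sigma>'_def using finite_borel_avg2(1)[OF c(7)[OF that]] measure_avg2[OF c(7)[OF that], of UNIV] c(8)[OF that] by simp_all
 have hc: "continuous_on {-T..T} (%t. ?h t *\<^sub>R ?e)" by (intro continuous_intros continuous_on_subset[OF cont(1)]) auto
 have wc: "continuous_on {-T..T} (%t. LINT p|\<sigma>' t. f p)" if "L \<ge> 0" "lipschitz_fun L f" for L f
  unfolding \<sigma>'_def by (rule avg2_continuous[OF c(7,8) representative_continuous[OF c(5)] hc that])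
 have disint: "emeasure \<mu>' A = (\<integral>\<^sup>+ t. emeasure (\<sigma>' t) (Pair t -` A) \<partial>lborel_I T)" if A: "A \<in> sets (borel_QT T)" for A
 proof -
  have SA: "S s -` A \<inter> QT T \<in> sets (borel_QT T)" for s using measurable_sets[OF Sm A, of s] c(1) sp by simp
  have inner: "emeasure (\<sigma>' t) (Pair t -` A) = (emeasure (slice T \<mu> t) (Pair t -` (S (-1) -` A \<inter> QT T)) + emeasure (slice T \<mu> t) (Pair t -` (S 1 -` A \<inter> QT T))) / 2"
   if t: "t \<in> {-T<..<T}" for t
  proof -
   have B: "Pair t -` A \<in> sets borel"
    using measurable_sets[OF measurable_slice_QT[OF borel_measurable_indicator[OF A] t], of "{1::ennreal}"]
    by (simp add: vimage_def indicator_def)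
   have t': "t \<in> {-T..T}" using t by auto
   have "{p. tshift p (s *\<^sub>R ?h t *\<^sub>R ?e) \<in> Pair t -` A} = Pair t -` (S s -` A \<inter> QT T)" for s
    using t by (auto simp: S_def QT_def)
   from this[of "-1"] this[of 1] show ?thesis
    unfolding \<sigma>'_def finite_borel_avg2(2)[OF c(7)[OF t'] B] by simp
  qed
  have m: "(%t. emeasure (slice T \<mu> t) (Pair t -` (S s -` A \<inter> QT T))) \<in> borel_measurable (lborel_I T)" for s
   using c(6) sets_borel_QT_pair[OF SA] unfolding measurable_lborel_I_iff[symmetric]
   by (intro kernel_measurable[where M="restrict_space borel {-T<..<T}"]) (auto simp: is_disintegration_def space_restrict_space)
  have "emeasure \<mu>' A = (emeasure \<mu> (S (-1) -` A \<inter> QT T) + emeasure \<mu> (S 1 -` A \<inter> QT T)) / 2"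
   unfolding \<mu>'_def using signs_pair_emeasure_distr[OF c(2), of P "borel_QT T" A] Sm A by (simp add: Ps sp)
  also have "... = (\<integral>\<^sup>+ t. emeasure (slice T \<mu> t) (Pair t -` (S (-1) -` A \<inter> QT T)) + emeasure (slice T \<mu> t) (Pair t -` (S 1 -` A \<inter> QT T)) \<partial>lborel_I T) / 2"
   unfolding disintegration_emeasure[OF c(6,1) SA] using m by (subst nn_integral_add) auto
  also have "... = (\<integral>\<^sup>+ t. emeasure (\<sigma>' t) (Pair t -` A) \<partial>lborel_I T)"
   using m inner by (subst nn_integral_divide[symmetric]) (auto intro!: nn_integral_cong)
  finally show ?thesis .
 qed
 have in01: "t \<in> {-T..T}" if "t \<in> space (lborel_I T)" for t using that by auto
 have pa: "AE t in lborel_I T. purely_atomic (\<sigma>' t)"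
  using c(10) AE_space unfolding \<sigma>'_def by eventually_elim (intro purely_atomic_avg2 c(7) in01)
 obtain m1 where m1: "m1 \<in> fluxes T \<mu>'" using key c(3) by blast
 have comp: "\<mu>' \<in> competitors T" and sl: "\<And>t. t \<in> {-T..T} ==> slice T \<mu>' t = \<sigma>' t"
  and eqd: "AE t in lborel_I T. disintegration T \<mu>' t = \<sigma>' t"
  by (rule competitorI[OF fb wc s\<mu>' f\<mu>' m1 T(1) disint pa]; assumption)+
 let ?g = "%t. perimeter (disintegration T \<mu> t) * indicator {-T<..<T} t" and ?J = "{T - \<epsilon><..<T}"
 have "perim_energy T \<mu>' (-T) T \<le> (\<integral>\<^sup>+ t. ?g t + ?g t * indicator ?J t \<partial>lborel)"
  unfolding perim_energy_def
 proof (rule nn_integral_mono_AE)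
  show "AE t in lborel. perimeter (disintegration T \<mu>' t) * indicator {-T<..<T} t \<le> ?g t + ?g t * indicator ?J t"
   using eqd c(9) unfolding AE_lborel_I
  proof eventually_elim
   fix t assume a: "t \<in> {-T<..<T} \<longrightarrow> disintegration T \<mu>' t = \<sigma>' t" "t \<in> {-T<..<T} \<longrightarrow> disintegration T \<mu> t = slice T \<mu> t"
   show "perimeter (disintegration T \<mu>' t) * indicator {-T<..<T} t \<le> ?g t + ?g t * indicator ?J t"
   proof (cases "t \<in> {-T<..<T}")
    case True
    then have t: "t \<in> {-T..T}" by auto
    have eq: "disintegration T \<mu>' t = avg2 (slice T \<mu> t) (?h t *\<^sub>R ?e)" "disintegration T \<mu> t = slice T \<mu> t"
     using a True by (auto simp: \<sigma>'_def)
    show ?thesis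
    proof (cases "t \<in> ?J")
     case True
     then show ?thesis unfolding eq using perimeter_avg2(1)[OF c(7)[OF t]] \<open>t \<in> {-T<..<T}\<close> by (simp add: mult_2)
    next
     case False
     then have "?h t = 0" using True by (intro hp(4)) auto
     then show ?thesis unfolding eq using perimeter_avg2(2)[OF c(7)[OF t]] True by simp
    qed
   qed simp
  qed
 qed
 also have "... \<le> (\<integral>\<^sup>+ t. ?g t \<partial>lborel) + (\<integral>\<^sup>+ t. ?g t * indicator ?J t \<partial>lborel)"
  by (rule nn_integral_add_indicator_le) simp
 also have "(\<integral>\<^sup>+ t. ?g t * indicator ?J t \<partial>lborel) = perim_energy T \<mu> (T - \<epsilon>) T"
  unfolding perim_energy_def using T by (intro nn_integral_cong) (auto simp: indicator_def)
 also have "(\<integral>\<^sup>+ t. ?g t \<partial>lborel) = perim_energy T \<mu> (-T) T" by (simp add: perim_energy_def)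
 finally have pe: "perim_energy T \<mu>' (-T) T \<le> perim_energy T \<mu> (-T) T + irrigation_energy T \<mu> (T - \<epsilon>) T"
  using perim_energy_le[of T \<mu> "T - \<epsilon>" T] by (meson add_left_mono order_trans)
 define d where "d = irrigation_energy T \<mu> (T - \<epsilon>) T + ennreal (16 * r\<^sup>2 / \<epsilon>)"
 have each: "irrigation_energy T \<mu>' (-T) T \<le> d + (perim_energy T \<mu> (-T) T + kin_energy \<mu> m (-T) T)" if m: "m \<in> fluxes T \<mu>" for m
 proof -
  obtain m' where m': "m' \<in> fluxes T \<mu>'" "kin_energy \<mu>' m' (-T) T \<le> kin_energy \<mu> m (-T) T + ennreal (16 * r\<^sup>2 / \<epsilon>)"
   using key[OF m] by blast
  have "irrigation_energy T \<mu>' (-T) T \<le> perim_energy T \<mu>' (-T) T + kin_energy \<mu>' m' (-T) T"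
   unfolding irrigation_energy_alt by (rule INF_lower[OF m'(1)])
  also have "... \<le> (perim_energy T \<mu> (-T) T + irrigation_energy T \<mu> (T - \<epsilon>) T) + (kin_energy \<mu> m (-T) T + ennreal (16 * r\<^sup>2 / \<epsilon>))"
   by (rule add_mono[OF pe m'(2)])
  finally show ?thesis by (simp add: d_def add_ac)
 qed
 \<comment> \<open>The bound holds for each flux of \<open>\<mu>\<close>. A finite \<open>d\<close>
   is moved to the left before taking the infimum over fluxes.\<close>
 have "irrigation_energy T \<mu>' (-T) T \<le> d + irrigation_energy T \<mu> (-T) T"
 proof (cases "d = \<infinity>")
  case False
  then have dt: "d < top" by (simp add: less_top)
  have "irrigation_energy T \<mu>' (-T) T - d \<le> irrigation_energy T \<mu> (-T) T"
   unfolding irrigation_energy_alt[of T \<mu> "-T" T]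
   using each False by (intro INF_greatest) (simp add: ennreal_minus_le_iff)
  then show ?thesis by (simp add: ennreal_minus_le_iff)
 qed simp
 then have "irrigation_energy T \<mu>' (-T) T \<le> irrigation_energy T \<mu> (-T) T + irrigation_energy T \<mu> (T - \<epsilon>) T + ennreal (16 * r\<^sup>2 / \<epsilon>)"
  by (simp add: d_def add_ac)
 then show thesis using that comp sl unfolding \<sigma>'_def by blast
qed

section \<open>A competitor of finite energy\<close>

text \<open>A quadratic spline, \<open>2 x\<^sup>2\<close> up to one half and
  \<open>1 - 2 (1 - x)\<^sup>2\<close> from there to one. It is continuously differentiable with
  slope at most two, enough smoothness for particle trajectories.\<close>

definition step :: "real => real"
 where "step x = 2 * ((max 0 x)\<^sup>2 - 2 * (max 0 (x - 1 / 2))\<^sup>2 + (max 0 (x - 1))\<^sup>2)"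

definition step' :: "real => real"
 where "step' x = 4 * (max 0 x - 2 * max 0 (x - 1 / 2) + max 0 (x - 1))"

lemma step_props:
 "0 \<le> step x" "step x \<le> 1" "x \<le> 0 ==> step x = 0" "x \<ge> 1 ==> step x = 1"
 "\<bar>step' x\<bar> \<le> 2" "x \<le> 0 ==> step' x = 0" "x \<ge> 1 ==> step' x = 0"
proof -
 show z: "x \<le> 0 ==> step x = 0" "x \<le> 0 ==> step' x = 0" "x \<ge> 1 ==> step' x = 0" for x
  by (auto simp: step_def step'_def max_def)
 show o: "x \<ge> 1 ==> step x = 1" for x
  by (auto simp: step_def max_def power2_eq_square algebra_simps)
 have m1: "step x = 2 * x\<^sup>2" if "0 \<le> x" "x \<le> 1 / 2" for x using that by (auto simp: step_def max_def)
 have m2: "step x = 1 - 2 * (1 - x)\<^sup>2" if "1 / 2 \<le> x" "x \<le> 1" for x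
  using that by (auto simp: step_def max_def power2_eq_square algebra_simps)
 have sq: "y\<^sup>2 \<le> 1 / 4" if "0 \<le> y" "y \<le> 1 / 2" for y :: real
  using power_mono[OF that(2,1), of 2] by (simp add: power2_eq_square)
 consider "x \<le> 0" | "0 \<le> x" "x \<le> 1 / 2" | "1 / 2 \<le> x" "x \<le> 1" | "1 \<le> x" by linarith
 then show "0 \<le> step x" "step x \<le> 1"
  by (cases; use z(1)[of x] o[of x] m1[of x] m2[of x] sq[of x] sq[of "1 - x"] in force)+
 show "\<bar>step' x\<bar> \<le> 2" by (auto simp: step'_def max_def)
qed

lemma step_deriv: "(step has_real_derivative step' x) (at x)"
proof -
 have r: "((%x. (max 0 x)\<^sup>2) has_real_derivative 2 * max 0 x) (at x)" for x :: real
 proof (cases "x = 0")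
  case True
  have "((%h. max 0 h) \<longlongrightarrow> max 0 (0::real)) (at 0)" by (intro tendsto_intros)
  then have "((%h. max 0 h) \<longlongrightarrow> (0::real)) (at 0)" by simp
  then have "((%h. ((max 0 (0 + h))\<^sup>2 - (max 0 (0::real))\<^sup>2) / h) \<longlongrightarrow> 0) (at 0)"
   by (rule Lim_transform_eventually) (auto simp: eventually_at_filter max_def power2_eq_square)
  then show ?thesis unfolding True DERIV_def by simp
 next
  case False
  then consider "x > 0" | "x < 0" by linarith
  then show ?thesis
  proof cases
   case 1
   have "((%x. x\<^sup>2) has_real_derivative 2 * max 0 x) (at x)" using 1 by (auto intro!: derivative_eq_intros)
   then show ?thesis
    by (rule DERIV_cong_ev[THEN iffD1, OF refl _ refl, rotated])
     (use 1 in \<open>auto simp: eventually_nhds intro!: exI[of _ "{0<..}"]\<close>)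
  next
   case 2
   have "((%x. 0) has_real_derivative 2 * max 0 x) (at x)" using 2 by simp
   then show ?thesis
    by (rule DERIV_cong_ev[THEN iffD1, OF refl _ refl, rotated])
     (use 2 in \<open>auto simp: eventually_nhds intro!: exI[of _ "{..<0}"]\<close>)
  qed
 qed
 have s: "((%x. (max 0 (x - c))\<^sup>2) has_real_derivative 2 * max 0 (x - c)) (at x)" for c :: real
 proof -
  have "((%x. x - c) has_real_derivative 1) (at x)" by (auto intro!: derivative_eq_intros)
  from DERIV_chain2[where f = "%x. (max 0 x)\<^sup>2" and g = "%x. x - c", OF r this] show ?thesis by simp
 qed
 show ?thesis
  unfolding step_def step'_def
  by (rule DERIV_cong[OF DERIV_cmult[OF DERIV_add[OF DERIV_diff[OF r DERIV_cmult[OF s]] s]]]) simp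
qed

lemma continuous_step: "continuous_on UNIV step" "continuous_on UNIV step'"
 unfolding step_def step'_def by (intro continuous_intros)+

text \<open>Vanishes at both ends of the time interval and equals one in the middle, so one formula
  lets the tree branch towards \<open>-T\<close> and towards \<open>T\<close>.\<close>

definition remaining :: "real => real => real"
 where "remaining T t = 1 - (t / T)\<^sup>2"

text \<open>The affine argument is 0 when \<open>3 ^ n * remaining T t\<close> is
  \<open>1 / 3\<close> and 1 when it is \<open>1 / 9\<close>. The transition windows of successive
  generations thus meet only at their ends.\<close>

definition activation :: "real => nat => real => real"
 where "activation T n t = step (3 / 2 - 9 / 2 * 3 ^ n * remaining T t)"

definition activation' :: "real => nat => real => real"
 where "activation' T n t = step' (3 / 2 - 9 / 2 * 3 ^ n * remaining T t) * (9 * 3 ^ n * t / T\<^sup>2)"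

text \<open>Branches of generation \<open>n\<close> separate while \<open>remaining\<close> decreases from \<open>3\<^sup>-\<^sup>n\<^sup>-\<^sup>1\<close>
 to \<open>3\<^sup>-\<^sup>n\<^sup>-\<^sup>2\<close>. The ratio lies between \<open>1/4\<close> (finite kinetic energy) and \<open>1/2\<close> (finite
 perimeter).\<close>

definition branch :: "real => real => real => real"
 where "branch T t y = (\<Sum>n. activation T n t * digit n y / 2 ^ Suc n)"

definition branch' :: "real => real => real => real"
 where "branch' T t y = (\<Sum>n. activation' T n t * digit n y / 2 ^ Suc n)"

lemma activation_deriv:
 assumes "T \<noteq> 0"
 shows "(activation T n has_real_derivative activation' T n t) (at t)"
proof -
 have "((%t. 3 / 2 - 9 / 2 * 3 ^ n * remaining T t) has_real_derivative 9 * 3 ^ n * t / T\<^sup>2) (at t)"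
  unfolding remaining_def using assms by (auto intro!: derivative_eq_intros simp: power2_eq_square field_simps)
 from DERIV_chain2[OF step_deriv this] show ?thesis unfolding activation_def activation'_def .
qed

lemma continuous_activation: "continuous_on UNIV (activation T n)" "continuous_on UNIV (activation' T n)"
 unfolding activation_def activation'_def remaining_def divide_inverse
 by (intro continuous_intros continuous_on_compose2[OF continuous_step(1)] continuous_on_compose2[OF continuous_step(2)]; simp)+

lemma activation_inactive:
 assumes "1 / 3 \<le> 3 ^ N * remaining T t" "N \<le> n"
 shows "activation T n t = 0" "activation' T n t = 0"
proof -
 have "remaining T t > 0"
 proof (rule ccontr)
  assume "\<not> remaining T t > 0"
  then have "3 ^ N * remaining T t \<le> 0" by (intro mult_nonneg_nonpos) auto
  then show False using assms(1) by simp
 qed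
 then have "3 ^ N * remaining T t \<le> 3 ^ n * remaining T t" using assms(2) by (intro mult_right_mono power_increasing) auto
 then have "3 / 2 - 9 / 2 * 3 ^ n * remaining T t \<le> 0" using assms(1) unfolding mult.assoc by linarith
 then show "activation T n t = 0" "activation' T n t = 0"
  using step_props(3,6) unfolding activation_def activation'_def by simp_all
qed

lemma branch_finite:
 assumes "1 / 3 \<le> 3 ^ N * remaining T t"
 shows "branch T t y = (\<Sum>n<N. activation T n t * digit n y / 2 ^ Suc n)"
  "branch' T t y = (\<Sum>n<N. activation' T n t * digit n y / 2 ^ Suc n)"
proof -
 show "branch T t y = (\<Sum>n<N. activation T n t * digit n y / 2 ^ Suc n)"
  unfolding branch_def by (rule suminf_finite) (simp_all add: activation_inactive(1)[OF assms] not_less)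
 show "branch' T t y = (\<Sum>n<N. activation' T n t * digit n y / 2 ^ Suc n)"
  unfolding branch'_def by (rule suminf_finite) (simp_all add: activation_inactive(2)[OF assms] not_less)
qed

lemma digit_bounds: "0 \<le> digit n y" "digit n y \<le> 1"
 using digit_cases[of n y] by auto

lemma remaining_pos:
 assumes "T > 0" "t \<in> {-T<..<T}"
 shows "0 < remaining T t" "remaining T t \<le> 1"
proof -
 have "\<bar>t / T\<bar> < 1" using assms by (auto simp: abs_less_iff field_simps)
 then have "(t / T)\<^sup>2 < 1" by (simp add: abs_square_less_1)
 then show "0 < remaining T t" "remaining T t \<le> 1" by (simp_all add: remaining_def)
qed

lemma remaining_reach: "s > 0 ==> \<exists>N. 1 / 3 \<le> 3 ^ N * (s::real)"
proof -
 assume s: "s > 0"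
 obtain N where "1 / s < 3 ^ N" using real_arch_pow[of 3 "1 / s"] by auto
 then have "1 < 3 ^ N * s" using s by (simp add: field_simps)
 then show ?thesis by (intro exI[of _ N]) simp
qed

text \<open>A generation moves only while \<open>3 ^ n * remaining T t\<close> lies strictly between
  \<open>1 / 9\<close> and \<open>1 / 3\<close>, so at most one moves at a time. Slope 2 of
  \<open>step\<close>, inner derivative \<open>9 * 3 ^ n / T\<close> and displacement
  \<open>1 / 2 ^ Suc n\<close> give speed at most \<open>9 / T * (3 / 2) ^ n\<close>.\<close>

lemma branch'_bound:
 assumes T: "T > 0" "t \<in> {-T<..<T}"
 shows "ennreal ((branch' T t y)\<^sup>2) \<le> (\<Sum>n. ennreal (81 / T\<^sup>2 * (9 / 4) ^ n) * indicator {t. remaining T t \<le> 1 / 3 ^ n} t)"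
  (is "_ \<le> suminf ?f")
proof (cases "\<exists>n. activation' T n t \<noteq> 0")
 case True
 then obtain n where n: "activation' T n t \<noteq> 0" by blast
 have act: "1 / 9 < 3 ^ k * remaining T t \<and> 3 ^ k * remaining T t < 1 / 3" if "activation' T k t \<noteq> 0" for k
 proof -
  have "step' (3 / 2 - 9 / 2 * 3 ^ k * remaining T t) \<noteq> 0" using that by (auto simp: activation'_def)
  then have "0 < 3 / 2 - 9 / 2 * 3 ^ k * remaining T t" "3 / 2 - 9 / 2 * 3 ^ k * remaining T t < 1"
   using step_props(6,7) by (meson not_le)+
  then show ?thesis unfolding mult.assoc by linarith
 qed
 have other: "activation' T k t = 0" if "k \<noteq> n" for k
 proof (rule ccontr)
  assume k: "activation' T k t \<noteq> 0"
  have *: False if "i < j" "activation' T i t \<noteq> 0" "activation' T j t \<noteq> 0" for i j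
  proof -
   have "(3::real) ^ Suc i \<le> 3 ^ j" using that(1) by (intro power_increasing) auto
   then have "3 ^ Suc i * remaining T t \<le> 3 ^ j * remaining T t"
    using remaining_pos(1)[OF T] by (intro mult_right_mono) auto
   then show False using act[OF that(2)] act[OF that(3)] by simp
  qed
  show False using *[of k n] *[of n k] k n that by (meson nat_neq_iff)
 qed
 have "branch' T t y = (\<Sum>k\<in>{n}. activation' T k t * digit k y / 2 ^ Suc k)"
  unfolding branch'_def by (rule suminf_finite) (use other in auto)
 then have b: "branch' T t y = activation' T n t * digit n y / 2 ^ Suc n" by simp
 have "\<bar>activation' T n t\<bar> \<le> 2 * (9 * 3 ^ n / T)"
 proof -
  have "\<bar>9 * 3 ^ n * t / T\<^sup>2\<bar> \<le> 9 * 3 ^ n / T"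
   using T by (auto simp: abs_mult power2_eq_square field_simps)
  then show ?thesis unfolding activation'_def abs_mult using step_props(5) T by (intro mult_mono) auto
 qed
 then have "\<bar>branch' T t y\<bar> \<le> 2 * (9 * 3 ^ n / T) * 1 / 2 ^ Suc n"
  unfolding b abs_mult abs_divide using digit_bounds[of n y] T
  by (intro divide_mono mult_mono) (auto simp: abs_of_nonneg)
 also have "... = 9 / T * (3 / 2) ^ n" by (simp add: power_divide)
 finally have "(branch' T t y)\<^sup>2 \<le> (9 / T * (3 / 2) ^ n)\<^sup>2" by (metis abs_ge_zero power2_abs power_mono)
 also have "... = 81 / T\<^sup>2 * (9 / 4) ^ n"
 proof -
  have "((3 / 2 :: real) ^ n)\<^sup>2 = (9 / 4) ^ n" unfolding power2_eq_square power_mult_distrib[symmetric] by simp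
  then show ?thesis unfolding power_mult_distrib by (simp add: power_divide[of 9 T])
 qed
 finally have "ennreal ((branch' T t y)\<^sup>2) \<le> ennreal (81 / T\<^sup>2 * (9 / 4) ^ n)" by (rule ennreal_leI)
 also have "... = ?f n"
 proof -
  have "3 ^ n * remaining T t \<le> 1" using act[OF n] by simp
  then have "remaining T t \<le> 1 / 3 ^ n" by (simp add: field_simps)
  then show ?thesis by simp
 qed
 also have "... = sum ?f {n}" by (subst sum.insert) simp_all
 also have "... \<le> suminf ?f" by (rule sum_le_suminf) auto
 finally show ?thesis .
next
 case False
 then show ?thesis by (simp add: branch'_def)
qed

lemma remaining_level_set:
 assumes "T > 0" "0 < s" "s \<le> 1"
 shows "(\<integral>\<^sup>+t. indicator {t. remaining T t \<le> s} t \<partial>lborel_I T) \<le> ennreal (2 * T * s)"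
proof -
 let ?A = "{-T..- T * (1 - s)} \<union> {T * (1 - s)..T}"
 have "(\<integral>\<^sup>+t. indicator {t. remaining T t \<le> s} t \<partial>lborel_I T) \<le> (\<integral>\<^sup>+t. indicator ?A t \<partial>lborel)"
  unfolding nn_integral_restrict_space[of "{-T<..<T}" lborel, simplified]
 proof (intro nn_integral_mono)
  fix t
  have "t \<in> ?A" if t: "t \<in> {-T<..<T}" "remaining T t \<le> s"
  proof -
   \<comment> \<open>From \<open>(1 - s)\<^sup>2 \<le> 1 - s \<le> (t / T)\<^sup>2\<close> the time
     lies within \<open>T * s\<close> of one of the two ends.\<close>
   have "(1 - s)\<^sup>2 \<le> 1 - s" using assms by (simp add: power2_eq_square mult_left_le_one_le)
   also have "... \<le> \<bar>t / T\<bar>\<^sup>2" using t(2) by (simp add: remaining_def del: abs_divide)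
   finally have "1 - s \<le> \<bar>t / T\<bar>" by (rule power2_le_imp_le) simp
   then have "T * (1 - s) \<le> \<bar>t\<bar>" using assms(1) by (simp add: abs_divide field_simps)
   then show ?thesis using t(1) by (auto simp: abs_if split: if_splits)
  qed
  then show "indicator {t. remaining T t \<le> s} t * indicator {-T<..<T} t \<le> (indicator ?A t :: ennreal)"
   by (auto simp: indicator_def)
 qed
 also have "... = emeasure lborel ?A" by (rule nn_integral_indicator) auto
 also have "... \<le> emeasure lborel {-T..- T * (1 - s)} + emeasure lborel {T * (1 - s)..T}"
  by (rule emeasure_subadditive) auto
 also have "... = ennreal (2 * T * s)"
  using assms by (simp add: algebra_simps flip: ennreal_plus)
 finally show ?thesis .
qed

text \<open>The \<open>n\<close>-th level set has measure at most \<open>2 * T / 3 ^ n\<close>, so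
  the series is geometric with ratio \<open>q / 3\<close>. It is used with \<open>q = 9 / 4\<close>
  for the kinetic energy and \<open>q = 2\<close> for the perimeter.\<close>

lemma level_series_finite:
 assumes "T > 0" "0 \<le> c" "0 \<le> q" "q < 3"
 shows "(\<integral>\<^sup>+t. (\<Sum>n. ennreal (c * q ^ n) * indicator {t. remaining T t \<le> 1 / 3 ^ n} t) \<partial>lborel_I T) < \<infinity>"
proof -
 have cr: "continuous_on UNIV (remaining T)" unfolding remaining_def divide_inverse by (intro continuous_intros)
 have "{t. remaining T t \<le> s} \<in> sets borel" for s
  by (intro borel_closed closed_Collect_le cr continuous_intros)
 then have m: "(indicator {t. remaining T t \<le> s} :: real => ennreal) \<in> borel_measurable (lborel_I T)" for s
  by (intro measurable_restrict_space1) auto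
 have "(\<integral>\<^sup>+t. (\<Sum>n. ennreal (c * q ^ n) * indicator {t. remaining T t \<le> 1 / 3 ^ n} t) \<partial>lborel_I T)
   = (\<Sum>n. ennreal (c * q ^ n) * (\<integral>\<^sup>+t. indicator {t. remaining T t \<le> 1 / 3 ^ n} t \<partial>lborel_I T))"
  using m by (subst nn_integral_suminf) (auto simp: nn_integral_cmult intro!: borel_measurable_times_ennreal)
 also have "... \<le> (\<Sum>n. ennreal (2 * T * c * (q / 3) ^ n))"
 proof (rule suminf_le)
  fix n
  have "ennreal (c * q ^ n) * (\<integral>\<^sup>+t. indicator {t. remaining T t \<le> 1 / 3 ^ n} t \<partial>lborel_I T)
    \<le> ennreal (c * q ^ n) * ennreal (2 * T * (1 / 3 ^ n))"
   using assms(1) by (intro mult_left_mono remaining_level_set) auto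
  also have "... = ennreal (2 * T * c * (q / 3) ^ n)"
   using assms by (simp add: ennreal_mult[symmetric] power_divide mult_ac)
  finally show "ennreal (c * q ^ n) * (\<integral>\<^sup>+t. indicator {t. remaining T t \<le> 1 / 3 ^ n} t \<partial>lborel_I T) \<le> ennreal (2 * T * c * (q / 3) ^ n)" .
 qed auto
 also have "... = ennreal (2 * T * c * (1 / (1 - q / 3)))"
  using assms by (intro suminf_ennreal_eq sums_mult geometric_sums) auto
 finally show ?thesis by (rule order_le_less_trans) simp
qed

section \<open>Trajectories of the tree and the measures that it carries\<close>

definition unit_box :: "(real^2) measure"
 where "unit_box = restrict_space lborel (cbox 0 1)"

lemma unit_box_props: "prob_space unit_box" "space unit_box = cbox 0 1" "f \<in> borel_measurable borel ==> f \<in> borel_measurable unit_box"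
proof -
 show sp: "space unit_box = cbox 0 1" by (simp add: unit_box_def space_restrict_space)
 have "emeasure lborel (cbox 0 (1::real^2)) = 1"
  by (subst emeasure_lborel_cbox_eq) (auto simp: Basis_vec_def inner_axis prod.neutral)
 then show "prob_space unit_box"
  unfolding unit_box_def by (intro prob_spaceI) (simp add: emeasure_restrict_space space_restrict_space)
 show "f \<in> borel_measurable borel ==> f \<in> borel_measurable unit_box"
  unfolding unit_box_def by (intro measurable_restrict_space1) simp
qed

definition branch_pos :: "real => real => real^2 => real^2"
 where "branch_pos T t x = (\<chi> i. branch T t (x $ i))"

definition branch_vel :: "real => real => real^2 => real^2"
 where "branch_vel T t x = (\<chi> i. branch' T t (x $ i))"

lemma digit_measurable [measurable]: "digit n \<in> borel_measurable borel"
 unfolding digit_def by measurable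

lemma branch_pos_measurable:
 shows "(%z. branch_pos T (fst z) (snd z)) \<in> borel_measurable (borel \<Otimes>\<^sub>M borel)"
  "(%z. branch_vel T (fst z) (snd z)) \<in> borel_measurable (borel \<Otimes>\<^sub>M borel)"
proof -
 have [measurable]: "activation T n \<in> borel_measurable borel" "activation' T n \<in> borel_measurable borel" for n
  by (intro borel_measurable_continuous_onI continuous_activation)+
 have [measurable]: "(%x::real^2. x $ i) \<in> borel_measurable borel" for i
  by (intro borel_measurable_continuous_onI continuous_intros)
 have "(%z. branch T (fst z) (snd z $ i)) \<in> borel_measurable (borel \<Otimes>\<^sub>M (borel :: (real^2) measure))"
  "(%z. branch' T (fst z) (snd z $ i)) \<in> borel_measurable (borel \<Otimes>\<^sub>M (borel :: (real^2) measure))" for i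
  unfolding branch_def branch'_def by measurable
 then show "(%z. branch_pos T (fst z) (snd z)) \<in> borel_measurable (borel \<Otimes>\<^sub>M borel)"
  "(%z. branch_vel T (fst z) (snd z)) \<in> borel_measurable (borel \<Otimes>\<^sub>M borel)"
  unfolding branch_pos_def branch_vel_def
  by (subst borel_measurable_euclidean_space, auto simp: Basis_vec_def inner_axis)+
qed

lemma continuous_branch: "continuous_on UNIV (%t. branch T t y)"
proof (rule uniform_limit_theorem[OF always_eventually])
 let ?f = "%n t. activation T n t * digit n y / 2 ^ Suc n"
 show "\<forall>k. continuous_on UNIV (%t. \<Sum>n<k. ?f n t)" by (intro allI continuous_intros continuous_activation) auto
 show "uniform_limit UNIV (%k t. \<Sum>n<k. ?f n t) (%t. branch T t y) sequentially"
  unfolding branch_def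
 proof (rule Weierstrass_m_test)
  show "norm (?f n t) \<le> (1 / 2) ^ Suc n" for n t
   using step_props(1,2)[of "3 / 2 - 9 / 2 * 3 ^ n * remaining T t"] digit_bounds[of n y]
   by (simp add: activation_def power_divide divide_right_mono mult_le_one abs_of_nonneg)
  show "summable (%n. (1 / 2 :: real) ^ Suc n)" by (rule summable_Suc_iff[THEN iffD2, OF summable_geometric]) simp
 qed
qed simp

lemma activation_final: "T > 0 ==> t = T \<or> t = - T ==> activation T n t = 1"
 using step_props(4)[of "3 / 2"] by (auto simp: activation_def remaining_def)

text \<open>At the end times every activation is one and the position is the full binary expansion
  of the starting point.\<close>

lemma branch_final:
 assumes "T > 0" "t = T \<or> t = - T" "x \<in> cbox 0 1"
 shows "abs_torus (branch_pos T t x) = abs_torus x"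
 unfolding abs_torus_eq_iff
proof
 fix i
 have b: "branch T t y = (\<Sum>n. digit n y / 2 ^ Suc n)" for y
  unfolding branch_def using activation_final[OF assms(1,2)] by simp
 have x: "0 \<le> x $ i" "x $ i \<le> 1" using assms(3) by (auto simp: mem_box_cart)
 show "branch_pos T t x $ i - x $ i \<in> \<int>"
 proof (cases "x $ i < 1")
  case True
  then show ?thesis using sums_unique[OF digit_sums[OF x(1) True]] by (simp add: branch_pos_def b)
 next
  case False
  then have "x $ i = 1" using x by simp
  \<comment> \<open>For coordinate 1 all fractional digits vanish and the position is 0, which is
    the same point modulo integers.\<close>
  moreover have "digit n 1 = 0" for n
  proof -
   have "\<lfloor>2 ^ k * (1::real)\<rfloor> = 2 ^ k" for k by (metis floor_of_int mult_1_right of_int_numeral of_int_power)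
   then show ?thesis unfolding digit_def by simp
  qed
  ultimately show ?thesis by (simp add: branch_pos_def b)
 qed
qed

lemma branch_values:
 fixes T t :: real
 assumes "1 / 3 \<le> 3 ^ N * remaining T t"
 obtains F :: "torus set" where "finite F" "card F \<le> 4 ^ N" "\<And>x. abs_torus (branch_pos T t x) \<in> F"
proof -
 define g where "g d = (\<Sum>n<N. activation T n t * d n / 2 ^ Suc n)" for d :: "nat => real"
 define A where "A = g ` (PiE {..<N} (%_. {0, 1}))"
 have fA: "finite A" unfolding A_def by (intro finite_imageI finite_PiE) auto
 have "card A \<le> card (PiE {..<N} (%_. {0, 1 :: real}))"
  unfolding A_def by (intro card_image_le finite_PiE) auto
 then have cA: "card A \<le> 2 ^ N" by (simp add: card_PiE numeral_2_eq_2)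
 have bA: "branch T t y \<in> A" for y
 proof -
  have "branch T t y = g (restrict (%n. digit n y) {..<N})"
   unfolding branch_finite(1)[OF assms] g_def by (intro sum.cong) auto
  then show ?thesis unfolding A_def using digit_cases by (intro image_eqI[of _ _ "restrict (%n. digit n y) {..<N}"]) auto
 qed
 define F where "F = (%(a, b). abs_torus (\<chi> i. if i = 1 then a else b)) ` (A \<times> A)"
 have "finite F" unfolding F_def using fA by auto
 moreover have "card F \<le> 4 ^ N"
 proof -
  have "card F \<le> card (A \<times> A)" unfolding F_def by (intro card_image_le) (use fA in auto)
  also have "... \<le> 2 ^ N * 2 ^ N" using cA by (simp add: card_cartesian_product mult_le_mono)
  finally show ?thesis by (simp add: power_mult_distrib[symmetric])
 qed
 moreover have "abs_torus (branch_pos T t x) \<in> F" for x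
 proof -
  have "branch_pos T t x = (\<chi> i. if i = 1 then branch T t (x $ 1) else branch T t (x $ 2))"
   unfolding branch_pos_def vec_eq_iff forall_2 by simp
  then show ?thesis unfolding F_def using bA by (intro image_eqI[of _ _ "(branch T t (x $ 1), branch T t (x $ 2))"]) auto
 qed
 ultimately show thesis using that by blast
qed

text \<open>Cauchy--Schwarz for at most \<open>4 ^ N\<close> atoms of total mass at most one,
  written as the arithmetic-geometric inequality with weights \<open>2 ^ N\<close> and
  \<open>1 / 2 ^ N\<close>.\<close>

lemma perimeter_le_card:
 assumes "finite_borel \<sigma>" "measure \<sigma> UNIV = 1" "finite F" "card F \<le> 4 ^ N" "\<And>x. x \<notin> F ==> measure \<sigma> {x} = 0"
 shows "perimeter \<sigma> \<le> ennreal (2 ^ N)"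
proof -
 interpret finite_measure \<sigma> by (rule finite_borelD[OF assms(1)])
 note sb = finite_borelD(1,2)[OF assms(1)]
 have "(\<Sum>x\<in>F. measure \<sigma> {x}) = measure \<sigma> (\<Union>x\<in>F. {x})"
  using assms(3) sb by (intro measure_finite_Union[symmetric]) (auto simp: disjoint_family_on_def)
 also have "... \<le> 1" using finite_measure_mono[of "\<Union>x\<in>F. {x}" UNIV] sb assms(2) by auto
 finally have s1: "(\<Sum>x\<in>F. measure \<sigma> {x}) \<le> 1" .
 have pw: "sqrt a \<le> (2 ^ N * a + 1 / 2 ^ N) / 2" if "0 \<le> a" for a :: real
 proof -
  have "sqrt ((2 ^ N * a) * (1 / 2 ^ N)) \<le> (2 ^ N * a + 1 / 2 ^ N) / 2"
   using that by (intro arith_geo_mean_sqrt) auto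
  then show ?thesis by simp
 qed
 have "(\<Sum>x\<in>F. sqrt (measure \<sigma> {x})) \<le> (\<Sum>x\<in>F. (2 ^ N * measure \<sigma> {x} + 1 / 2 ^ N) / 2)"
  by (intro sum_mono pw) auto
 also have "... = (2 ^ N * (\<Sum>x\<in>F. measure \<sigma> {x}) + real (card F) / 2 ^ N) / 2"
  by (simp add: sum_divide_distrib[symmetric] sum.distrib sum_distrib_left)
 also have "... \<le> (2 ^ N * 1 + 4 ^ N / 2 ^ N) / 2"
 proof -
  have "real (card F) \<le> 4 ^ N" using assms(4) by (metis of_nat_le_iff of_nat_numeral of_nat_power)
  then show ?thesis using s1 by (intro divide_right_mono add_mono mult_left_mono) auto
 qed
 also have "... = 2 ^ N" by (simp add: power_divide[symmetric])
 finally have le: "(\<Sum>x\<in>F. sqrt (measure \<sigma> {x})) \<le> 2 ^ N" .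
 have "perimeter \<sigma> = (\<Sum>x\<in>F. ennreal (sqrt (measure \<sigma> {x})))"
  unfolding perimeter_nn_integral by (rule nn_integral_count_space') (use assms in auto)
 also have "... = ennreal (\<Sum>x\<in>F. sqrt (measure \<sigma> {x}))" by (rule sum_ennreal) auto
 finally show ?thesis using le by (simp add: ennreal_leI)
qed

lemma material_derivative:
 fixes X :: "real => real^2"
 assumes s: "smooth (lift_fun \<phi>)" and X: "(X has_vector_derivative v) (at t)"
 shows "((%t. \<phi> (t, abs_torus (X t))) has_vector_derivative
  time_deriv \<phi> (t, abs_torus (X t)) + space_grad \<phi> (t, abs_torus (X t)) \<bullet> v) (at t)"
proof -
 let ?D = "frechet_derivative (lift_fun \<phi>) (at (t, X t))"
 have D: "(lift_fun \<phi> has_derivative ?D) (at (t, X t))" by (rule cdiff_has_derivative'[OF s])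
 have lin: "linear ?D" by (rule has_derivative_linear[OF D])
 have v: "v = v $ 1 *\<^sub>R axis 1 1 + v $ 2 *\<^sub>R axis 2 1" by (simp add: vec_eq_iff forall_2 axis_def)
 have "(1, v) = (1, 0) + (v $ 1 *\<^sub>R (0, axis 1 1) + v $ 2 *\<^sub>R (0, axis 2 1))" by (subst v) simp
 then have "?D (1, v) = ?D ((1, 0) + (v $ 1 *\<^sub>R (0, axis 1 1) + v $ 2 *\<^sub>R (0, axis 2 1)))" by (rule arg_cong)
 also have "... = ?D (1, 0) + (v $ 1 * ?D (0, axis 1 1) + v $ 2 * ?D (0, axis 2 1))"
  by (simp only: linear_add[OF lin] linear_scale[OF lin] real_scaleR_def)
 also have "... = time_deriv \<phi> (t, abs_torus (X t)) + space_grad \<phi> (t, abs_torus (X t)) \<bullet> v"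
  by (simp add: time_deriv_abs[OF s] space_grad_abs[OF s] inner_vec_def sum_2 mult.commute)
 finally have e: "?D (1, v) = time_deriv \<phi> (t, abs_torus (X t)) + space_grad \<phi> (t, abs_torus (X t)) \<bullet> v" .
 have "((%t. (t, X t)) has_derivative (%h. (h, h *\<^sub>R v))) (at t)"
  using X unfolding has_vector_derivative_def by (auto intro!: derivative_eq_intros)
 from has_derivative_compose[where f = "%t. (t, X t)" and x = t, OF this D]
 have "((%t. \<phi> (t, abs_torus (X t))) has_derivative (%h. ?D (h, h *\<^sub>R v))) (at t)"
  by (simp add: lift_fun_def)
 moreover have "?D (h, h *\<^sub>R v) = h *\<^sub>R ?D (1, v)" for h using linear_scale[OF lin, of h "(1, v)"] by simp
 ultimately show ?thesis unfolding has_vector_derivative_def e[symmetric] by simp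
qed

text \<open>On the support of \<open>\<phi>\<close> only finitely many generations are active, so
  the trajectory there is a finite sum and continuously differentiable. The integrand is the
  derivative of \<open>\<phi>\<close> along the trajectory, and \<open>\<phi>\<close> vanishes at
  both ends.\<close>

lemma branch_weak_equation:
 assumes T: "T > 0" and \<phi>: "test_function T \<phi>"
 shows "(LINT t|lborel_I T. time_deriv \<phi> (t, abs_torus (branch_pos T t x)) +
  space_grad \<phi> (t, abs_torus (branch_pos T t x)) \<bullet> branch_vel T t x) = 0"
proof -
 have s: "smooth (lift_fun \<phi>)" using \<phi> by (simp add: test_function_def)
 obtain K where K: "compact K" "K \<subseteq> QT T" "\<And>z. z \<notin> K ==> \<phi> z = 0" using \<phi> by (auto simp: test_function_def)
 obtain c where c: "0 < c" "c < T" "\<And>t p. c \<le> \<bar>t\<bar> ==> (t, p) \<notin> K"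
 proof (cases "K = {}")
  case True
  then show ?thesis using that[of "T / 2"] T by simp
 next
  case False
  have "compact ((%z. \<bar>fst z\<bar>) ` K)" by (intro compact_continuous_image K(1) continuous_intros)
  then obtain z where z: "z \<in> K" "\<And>y. y \<in> K ==> \<bar>fst y\<bar> \<le> \<bar>fst z\<bar>"
   using compact_attains_sup[of "(%z. \<bar>fst z\<bar>) ` K"] False by auto
  have "\<bar>fst z\<bar> < T" using z(1) K(2) by (auto simp: QT_def abs_less_iff)
  moreover from this have "(t, p) \<notin> K" if "(\<bar>fst z\<bar> + T) / 2 \<le> \<bar>t\<bar>" for t p using z(2)[of "(t, p)"] that by auto
  ultimately show ?thesis using that[of "(\<bar>fst z\<bar> + T) / 2"] by simp
 qed
 have z0: "\<phi> (t, p) = 0" if "c \<le> \<bar>t\<bar>" for t p using c(3)[OF that] K(3) by blast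
 have d0: "time_deriv \<phi> (t, p) = 0 \<and> space_grad \<phi> (t, p) = 0" if t: "c < \<bar>t\<bar>" for t p
 proof (induction p rule: torus_induct)
  fix y
  let ?S = "{z :: real \<times> (real^2). c < \<bar>fst z\<bar>}"
  have "open ?S" by (intro open_Collect_less continuous_intros)
  moreover have "(t, y) \<in> ?S" using t by simp
  moreover have "0 = lift_fun \<phi> z" if "z \<in> ?S" for z using that z0 by (auto simp: lift_fun_def split: prod.splits)
  ultimately have "(lift_fun \<phi> has_derivative (%_. 0)) (at (t, y))"
   by (rule has_derivative_transform_within_open[OF has_derivative_const])
  from space_grad_I[OF s this] show "time_deriv \<phi> (t, abs_torus y) = 0 \<and> space_grad \<phi> (t, abs_torus y) = 0"
   by (simp add: vec_eq_iff)
 qed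
 have "0 < remaining T c" using remaining_pos(1)[OF T, of c] c by simp
 then obtain N where N: "1 / 3 \<le> 3 ^ N * remaining T c" using remaining_reach by blast
 have N': "1 / 3 \<le> 3 ^ N * remaining T t" if "t \<in> {-c..c}" for t
 proof -
  have "\<bar>t / T\<bar> \<le> \<bar>c / T\<bar>" using that T c(1) by (auto simp: abs_le_iff field_simps)
  then have "(t / T)\<^sup>2 \<le> (c / T)\<^sup>2" by (simp only: abs_le_square_iff)
  then have "3 ^ N * remaining T c \<le> 3 ^ N * remaining T t" by (intro mult_left_mono) (auto simp: remaining_def)
  then show ?thesis using N by linarith
 qed
 define X where "X t = (\<chi> i. \<Sum>n<N. activation T n t * digit n (x $ i) / 2 ^ Suc n)" for t
 define V where "V t = (\<chi> i. \<Sum>n<N. activation' T n t * digit n (x $ i) / 2 ^ Suc n)" for t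
 have eq: "branch_pos T t x = X t" "branch_vel T t x = V t" if "t \<in> {-c..c}" for t
  unfolding branch_pos_def branch_vel_def X_def V_def branch_finite[OF N'[OF that]] by simp_all
 have X: "(X has_vector_derivative V t) (at t)" for t
 proof -
  have "((%t. X t $ i) has_real_derivative V t $ i) (at t)" for i
   unfolding X_def V_def using T by (auto intro!: derivative_eq_intros activation_deriv)
  then have "((%t. X t $ i) has_derivative (%h. (h *\<^sub>R V t) $ i)) (at t)" for i
   by (simp add: has_field_derivative_def mult_commute_abs)
  then show ?thesis unfolding has_vector_derivative_def
   by (subst has_derivative_componentwise_within) (auto simp: Basis_vec_def inner_axis)
 qed
 have cX: "continuous_on A X" for A
  using X by (intro continuous_at_imp_continuous_on) (auto intro: has_vector_derivative_continuous)
 have cV: "continuous_on A V" for A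
  unfolding V_def by (intro continuous_intros continuous_on_subset[OF continuous_activation(2)]) auto
 let ?g = "%t. time_deriv \<phi> (t, abs_torus (X t)) + space_grad \<phi> (t, abs_torus (X t)) \<bullet> V t"
 have P: "continuous_on A (%t. (t, abs_torus (X t)))" for A
  by (intro continuous_intros continuous_on_compose2[OF continuous_abs_torus cX]) auto
 have cg: "continuous_on {-c..c} ?g"
  by (intro continuous_intros cV continuous_on_compose2[OF continuous_time_deriv[OF s] P]
    continuous_on_compose2[OF continuous_space_grad[OF s] P]) auto
 have "(\<integral>t. indicator {-c..c} t *\<^sub>R ?g t \<partial>lborel) = \<phi> (c, abs_torus (X c)) - \<phi> (-c, abs_torus (X (-c)))"
 proof (rule integral_FTC_Icc[where F = "%t. \<phi> (t, abs_torus (X t))", OF _ _ cg])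
  show "((%t. \<phi> (t, abs_torus (X t))) has_vector_derivative ?g t) (at t within {-c..c})" for t
   by (rule has_vector_derivative_at_within[OF material_derivative[OF s X]])
 qed (use c(1) in simp)
 also have "... = 0" using z0[of c] z0[of "-c"] c(1) by simp
 also have "(\<integral>t. indicator {-c..c} t *\<^sub>R ?g t \<partial>lborel) = (\<integral>t. indicator {-T<..<T} t *\<^sub>R
   (time_deriv \<phi> (t, abs_torus (branch_pos T t x)) + space_grad \<phi> (t, abs_torus (branch_pos T t x)) \<bullet> branch_vel T t x) \<partial>lborel)"
 proof (intro Bochner_Integration.integral_cong refl)
  fix t
  show "indicator {-c..c} t *\<^sub>R ?g t = indicator {-T<..<T} t *\<^sub>R
   (time_deriv \<phi> (t, abs_torus (branch_pos T t x)) + space_grad \<phi> (t, abs_torus (branch_pos T t x)) \<bullet> branch_vel T t x)"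
  proof (cases "t \<in> {-c..c}")
   case True
   then show ?thesis using c(2) eq[OF True] by auto
  next
   case False
   then have "c < \<bar>t\<bar>" by auto
   then show ?thesis using False d0[of t] by simp
  qed
 qed
 finally show ?thesis unfolding integrable_lborel_I_iff(2) .
qed

definition tree_measure :: "real => real => torus measure"
 where "tree_measure T t = distr unit_box borel (%x. abs_torus (branch_pos T t x))"

lemma tree_slice_measurable: "(%x. branch_pos T t x) \<in> borel_measurable unit_box" "(%x. abs_torus (branch_pos T t x)) \<in> borel_measurable unit_box"
proof -
 have "(%x. (t, x)) \<in> measurable borel (borel \<Otimes>\<^sub>M (borel :: (real^2) measure))" by measurable
 from measurable_compose[OF this branch_pos_measurable(1)]
 show *: "(%x. branch_pos T t x) \<in> borel_measurable unit_box" by (intro unit_box_props(3)) simp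
 show "(%x. abs_torus (branch_pos T t x)) \<in> borel_measurable unit_box"
  by (rule measurable_compose[OF * borel_measurable_continuous_onI[OF continuous_abs_torus]])
qed

lemma tree_measure_props:
 "finite_borel (tree_measure T t)" "measure (tree_measure T t) UNIV = 1" "emeasure (tree_measure T t) UNIV = 1"
proof -
 interpret prob_space unit_box by (rule unit_box_props(1))
 interpret p: prob_space "tree_measure T t" unfolding tree_measure_def by (rule prob_space_distr[OF tree_slice_measurable(2)])
 show "finite_borel (tree_measure T t)" using p.finite_measure_axioms by (simp add: finite_borel_def tree_measure_def)
 have "space (tree_measure T t) = UNIV" by (simp add: tree_measure_def)
 then show "measure (tree_measure T t) UNIV = 1" "emeasure (tree_measure T t) UNIV = 1"
  using p.prob_space p.emeasure_space_1 by simp_all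
qed

lemma tree_measure_continuous:
 assumes f: "continuous_on UNIV f"
 shows "continuous_on A (%t. LINT p|tree_measure T t. (f p :: real))"
proof -
 interpret prob_space unit_box by (rule unit_box_props(1))
 have fm: "f \<in> borel_measurable borel" by (rule borel_measurable_continuous_onI[OF f])
 obtain B where B: "\<And>p. norm (f p) \<le> B" using bounded_continuous_torus[OF f] by blast
 have "continuous_on UNIV (%t. LINT x|unit_box. f (abs_torus (branch_pos T t x)))"
 proof (rule continuous_at_imp_continuous_on, intro ballI, unfold continuous_at_sequentially comp_def, intro allI impI)
  fix t and u :: "nat => real" assume u: "u \<longlonglongrightarrow> t"
  show "(%n. LINT x|unit_box. f (abs_torus (branch_pos T (u n) x))) \<longlonglongrightarrow> (LINT x|unit_box. f (abs_torus (branch_pos T t x)))"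
  proof (rule integral_dominated_convergence[where w = "%_. B"])
   have "continuous_on UNIV (%t. f (abs_torus (branch_pos T t x)))" for x
    unfolding branch_pos_def
    by (intro continuous_on_compose2[OF f] continuous_on_compose2[OF continuous_abs_torus] continuous_on_vec_lambda continuous_branch) auto
   from continuous_on_tendsto_compose[OF this u]
   show "AE x in unit_box. (%n. f (abs_torus (branch_pos T (u n) x))) \<longlonglongrightarrow> f (abs_torus (branch_pos T t x))" by simp
  qed (use measurable_compose[OF tree_slice_measurable(2) fm] B in auto)
 qed
 then show ?thesis
  unfolding tree_measure_def integral_distr[OF tree_slice_measurable(2) fm] by (rule continuous_on_subset) simp
qed

lemma tree_measure_atoms:
 assumes "1 / 3 \<le> 3 ^ N * remaining T t"
 shows "purely_atomic (tree_measure T t)" "perimeter (tree_measure T t) \<le> ennreal (2 ^ N)"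
proof -
 obtain F :: "torus set" where F: "finite F" "card F \<le> 4 ^ N" "\<And>x. abs_torus (branch_pos T t x) \<in> F"
  using branch_values[OF assms] by metis
 have z: "emeasure (tree_measure T t) A = 0" if "A \<in> sets borel" "A \<inter> F = {}" for A
 proof -
  have "(%x. abs_torus (branch_pos T t x)) -` A \<inter> space unit_box = {}" using F(3) that(2) by auto
  then show ?thesis unfolding tree_measure_def using that(1) tree_slice_measurable(2) by (simp add: emeasure_distr)
 qed
 have "emeasure (tree_measure T t) (UNIV - F) = 0" using F(1) by (intro z) (auto intro: borel_closed finite_imp_closed)
 then show "purely_atomic (tree_measure T t)"
  unfolding purely_atomic_iff[OF tree_measure_props(1)] using F(1) by (blast intro: countable_finite)
 show "perimeter (tree_measure T t) \<le> ennreal (2 ^ N)"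
  by (rule perimeter_le_card[OF tree_measure_props(1,2) F(1,2)]) (simp add: measure_def z)
qed

text \<open>\<open>N\<close> is the first generation from which everything is still at rest, so
  there are at most \<open>4 ^ N\<close> atoms. Minimality gives
  \<open>remaining T t \<le> 1 / 3 ^ N\<close>, and the single term \<open>N\<close> of the series
  already dominates.\<close>

lemma tree_perimeter:
 assumes "T > 0" "t \<in> {-T<..<T}"
 shows "perimeter (tree_measure T t) \<le> (\<Sum>n. ennreal (1 * 2 ^ n) * indicator {t. remaining T t \<le> 1 / 3 ^ n} t)" (is "_ \<le> suminf ?f")
proof -
 define N where "N = (LEAST N. 1 / 3 \<le> 3 ^ N * remaining T t)"
 have N: "1 / 3 \<le> 3 ^ N * remaining T t"
  unfolding N_def using remaining_reach[OF remaining_pos(1)[OF assms]] by (rule LeastI_ex)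
 have "remaining T t \<le> 1 / 3 ^ N"
 proof (cases N)
  case 0
  then show ?thesis using remaining_pos(2)[OF assms] by simp
 next
  case (Suc n)
  then have "\<not> 1 / 3 \<le> 3 ^ n * remaining T t" using not_less_Least[of n "%N. 1 / 3 \<le> 3 ^ N * remaining T t"] by (simp add: N_def)
  then show ?thesis unfolding Suc by (simp add: field_simps)
 qed
 then have "ennreal (2 ^ N) = ?f N" by simp
 also have "... = sum ?f {N}" by (subst sum.insert) simp_all
 also have "... \<le> suminf ?f" by (rule sum_le_suminf) auto
 finally show ?thesis using tree_measure_atoms(2)[OF N] order_trans by blast
qed

lemma tree_measure_final: "T > 0 ==> t = T \<or> t = - T ==> tree_measure T t = torus_lebesgue"
 unfolding tree_measure_def torus_lebesgue_def unit_box_def[symmetric]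
 by (rule distr_cong) (auto simp: unit_box_props(2) branch_final)

text \<open>The particles are labelled by the unit square and carried by the tree. Both traces are
  Lebesgue measure, so the Sobolev terms vanish and only the two geometric series remain.\<close>

lemma finite_energy_competitor:
 assumes T: "T > 0"
 obtains \<mu> where "\<mu> \<in> competitors T" "energy lam T \<mu> < \<infinity>"
proof -
 let ?M = "lborel_I T \<Otimes>\<^sub>M unit_box"
 interpret ub: prob_space unit_box by (rule unit_box_props(1))
 interpret li: finite_measure "lborel_I T" by (rule finite_lborel_I)
 interpret pair: pair_sigma_finite "lborel_I T" unit_box ..
 have sU: "space (lborel_I T) = {-T<..<T}" by (simp add: space_restrict_space)
 have fM: "finite_measure ?M" by (intro finite_measure_pair_measure li.finite_measure_axioms ub.finite_measure_axioms)
 define P where "P z = (fst z, abs_torus (branch_pos T (fst z) (snd z)))" for z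
 define w where "w z = branch_vel T (fst z) (snd z)" for z
 have id: "(%z. (fst z, snd z)) \<in> measurable ?M (borel \<Otimes>\<^sub>M (borel :: (real^2) measure))"
 proof (rule measurable_Pair)
  have "(%t. t) \<in> measurable (lborel_I T) borel" "(%x. x) \<in> measurable unit_box borel"
   by (auto intro: measurable_restrict_space1 unit_box_props(3))
  then show "(%z. fst z) \<in> measurable ?M borel" "(%z. snd z) \<in> measurable ?M borel"
   using measurable_compose[OF measurable_fst] measurable_compose[OF measurable_snd] by blast+
 qed
 have w [measurable]: "w \<in> borel_measurable ?M" unfolding w_def using measurable_compose[OF id branch_pos_measurable(2)] by simp
 have Pb: "P \<in> measurable ?M borel"
  unfolding P_def borel_prod[symmetric]
  using measurable_compose[OF id branch_pos_measurable(1)] measurable_compose[OF id measurable_fst]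
  by (intro measurable_Pair measurable_compose[OF _ borel_measurable_continuous_onI[OF continuous_abs_torus]]) auto
 have P: "P \<in> measurable ?M (borel_QT T)"
  using Pb by (intro measurable_restrict_space2) (auto simp: P_def QT_def space_pair_measure sU)
 define S where "S t = (\<Sum>n. ennreal (81 / T\<^sup>2 * (9 / 4) ^ n) * indicator {t. remaining T t \<le> 1 / 3 ^ n} t)" for t
 have w2: "(\<integral>\<^sup>+z. ennreal ((norm (w z))\<^sup>2) \<partial>?M) < \<infinity>"
 proof -
  have pw: "ennreal ((norm (w z))\<^sup>2) \<le> 2 * S (fst z)" if "fst z \<in> {-T<..<T}" for z
  proof -
   have "(norm (w z))\<^sup>2 = (branch' T (fst z) (snd z $ 1))\<^sup>2 + (branch' T (fst z) (snd z $ 2))\<^sup>2"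
    by (simp add: w_def branch_vel_def power2_norm_eq_inner inner_vec_def sum_2 flip: power2_eq_square)
   then have "ennreal ((norm (w z))\<^sup>2) = ennreal ((branch' T (fst z) (snd z $ 1))\<^sup>2) + ennreal ((branch' T (fst z) (snd z $ 2))\<^sup>2)"
    by simp
   also have "... \<le> S (fst z) + S (fst z)" unfolding S_def using T that by (intro add_mono branch'_bound)
   finally show ?thesis by (simp add: mult_2)
  qed
  have "(\<integral>\<^sup>+z. ennreal ((norm (w z))\<^sup>2) \<partial>?M) = (\<integral>\<^sup>+t. (\<integral>\<^sup>+x. ennreal ((norm (w (t, x)))\<^sup>2) \<partial>unit_box) \<partial>lborel_I T)"
   by (rule ub.nn_integral_fst[symmetric]) measurable
  also have "... \<le> (\<integral>\<^sup>+t. 2 * S t \<partial>lborel_I T)"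
  proof (intro nn_integral_mono)
   fix t assume t: "t \<in> space (lborel_I T)"
   have "(\<integral>\<^sup>+x. ennreal ((norm (w (t, x)))\<^sup>2) \<partial>unit_box) \<le> (\<integral>\<^sup>+x. 2 * S t \<partial>unit_box)"
    using pw[of "(t, _)"] t sU by (intro nn_integral_mono) auto
   then show "(\<integral>\<^sup>+x. ennreal ((norm (w (t, x)))\<^sup>2) \<partial>unit_box) \<le> 2 * S t" by (simp add: ub.emeasure_space_1)
  qed
  also have "... \<le> 2 * (\<integral>\<^sup>+t. S t \<partial>lborel_I T)"
  proof -
   have cr: "continuous_on UNIV (remaining T)" unfolding remaining_def divide_inverse by (intro continuous_intros)
   have "{t. remaining T t \<le> s} \<in> sets borel" for s
    by (intro borel_closed closed_Collect_le cr continuous_intros)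
   then have "(indicator {t. remaining T t \<le> s} :: real => ennreal) \<in> borel_measurable (lborel_I T)" for s
    by (intro measurable_restrict_space1) auto
   then have "S \<in> borel_measurable (lborel_I T)" unfolding S_def by (intro borel_measurable_suminf_order borel_measurable_times_ennreal) auto
   then show ?thesis by (simp add: nn_integral_cmult)
  qed
  also have "... < \<infinity>" unfolding S_def using level_series_finite[of T "81 / T\<^sup>2" "9 / 4"] T
   by (auto simp: ennreal_mult_less_top)
  finally show ?thesis .
 qed
 have wi: "integrable ?M w"
 proof (rule integrableI_bounded[OF w])
  \<comment> \<open>On a finite measure space \<open>|w| \<le> 1 + |w|\<^sup>2\<close> turns finite
    kinetic energy into integrability.\<close>
  have "(\<integral>\<^sup>+z. ennreal (norm (w z)) \<partial>?M) \<le> (\<integral>\<^sup>+z. 1 + ennreal ((norm (w z))\<^sup>2) \<partial>?M)"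
  proof (intro nn_integral_mono)
   fix z
   have "0 \<le> (norm (w z) - 1)\<^sup>2" by simp
   then have "2 * norm (w z) \<le> 1 + (norm (w z))\<^sup>2" by (simp add: power2_eq_square algebra_simps)
   then have "norm (w z) \<le> 1 + (norm (w z))\<^sup>2" using norm_ge_zero[of "w z"] by linarith
   then show "ennreal (norm (w z)) \<le> 1 + ennreal ((norm (w z))\<^sup>2)" by (metis ennreal_1 ennreal_leI ennreal_plus zero_le_one zero_le_power2)
  qed
  also have "... = emeasure ?M (space ?M) + (\<integral>\<^sup>+z. ennreal ((norm (w z))\<^sup>2) \<partial>?M)" by (subst nn_integral_add) auto
  also have "... < \<infinity>" using w2 finite_measure.emeasure_finite[OF fM, of "space ?M"] by (simp add: less_top)
  finally show "(\<integral>\<^sup>+z. ennreal (norm (w z)) \<partial>?M) < \<infinity>" .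
 qed
 have weak: "(LINT z|?M. time_deriv \<phi> (P z)) + (LINT z|?M. space_grad \<phi> (P z) \<bullet> w z) = 0" if \<phi>: "test_function T \<phi>" for \<phi>
 proof -
  have s: "smooth (lift_fun \<phi>)" using \<phi> by (simp add: test_function_def)
  have PQ: "P z \<in> QT T" if "z \<in> space ?M" for z using measurable_space[OF P that] space_borel_QT by simp
  obtain B1 where B1: "\<And>z. z \<in> QT T ==> norm (time_deriv \<phi> z) \<le> B1" using continuous_bounded_QT[OF continuous_time_deriv[OF s]] by blast
  obtain B2 where B2: "\<And>z. z \<in> QT T ==> norm (space_grad \<phi> z) \<le> B2" using continuous_bounded_QT[OF continuous_space_grad[OF s]] by blast
  have m1 [measurable]: "(%z. time_deriv \<phi> (P z)) \<in> borel_measurable ?M"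
   by (rule measurable_compose[OF Pb borel_measurable_continuous_onI[OF continuous_time_deriv[OF s]]])
  have m2 [measurable]: "(%z. space_grad \<phi> (P z)) \<in> borel_measurable ?M"
   by (rule measurable_compose[OF Pb borel_measurable_continuous_onI[OF continuous_space_grad[OF s]]])
  have i1: "integrable ?M (%z. time_deriv \<phi> (P z))"
   by (rule finite_measure.integrable_const_bound[OF fM _ m1, of B1]) (use B1 PQ in auto)
  have i2: "integrable ?M (%z. space_grad \<phi> (P z) \<bullet> w z)"
  proof (rule Bochner_Integration.integrable_bound)
   show "integrable ?M (%z. \<bar>B2\<bar> * norm (w z))" using wi by auto
   show "AE z in ?M. norm (space_grad \<phi> (P z) \<bullet> w z) \<le> norm (\<bar>B2\<bar> * norm (w z))"
   proof (rule AE_I2)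
    fix z assume z: "z \<in> space ?M"
    have "norm (space_grad \<phi> (P z) \<bullet> w z) \<le> norm (space_grad \<phi> (P z)) * norm (w z)" by (simp add: Cauchy_Schwarz_ineq2)
    also have "... \<le> \<bar>B2\<bar> * norm (w z)" using B2[OF PQ[OF z]] by (intro mult_right_mono) auto
    finally show "norm (space_grad \<phi> (P z) \<bullet> w z) \<le> norm (\<bar>B2\<bar> * norm (w z))" by (simp add: abs_mult)
   qed
  qed measurable
  let ?h = "%t x. time_deriv \<phi> (P (t, x)) + space_grad \<phi> (P (t, x)) \<bullet> w (t, x)"
  have hz: "case_prod ?h = (%z. time_deriv \<phi> (P z) + space_grad \<phi> (P z) \<bullet> w z)" by auto
  have ih: "integrable ?M (case_prod ?h)" unfolding hz using i1 i2 by simp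
  have "(LINT z|?M. time_deriv \<phi> (P z)) + (LINT z|?M. space_grad \<phi> (P z) \<bullet> w z) = integral\<^sup>L ?M (case_prod ?h)"
   unfolding hz using i1 i2 by simp
  also have "... = (LINT x|unit_box. LINT t|lborel_I T. ?h t x)" by (rule pair.integral_snd[OF ih, symmetric])
  also have "... = 0" using branch_weak_equation[OF T \<phi>] by (simp add: P_def w_def)
  finally show ?thesis .
 qed
 define \<mu> where "\<mu> = distr ?M (borel_QT T) P"
 have s\<mu>: "sets \<mu> = sets (borel_QT T)" by (simp add: \<mu>_def)
 have f\<mu>: "finite_measure \<mu>" unfolding \<mu>_def by (rule finite_measure.finite_measure_distr[OF fM P])
 obtain m where m: "m \<in> fluxes T \<mu>" and le: "\<And>A. A \<in> sets (borel_QT T) ==>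
   (\<integral>\<^sup>+ x\<in>A. ennreal ((norm (vector_RN_deriv \<mu> m x))\<^sup>2) \<partial>\<mu>) \<le> (\<integral>\<^sup>+ z\<in>P -` A. ennreal ((norm (w z))\<^sup>2) \<partial>?M)"
  using flux_push_forward[OF fM P wi weak] unfolding \<mu>_def by blast
 have QTs: "{-T<..<T} \<times> (UNIV :: torus set) \<in> sets (borel_QT T)"
  unfolding sets_borel_QT using open_QT[of T] by (auto simp: QT_def)
 have "kin_energy \<mu> m (-T) T \<le> (\<integral>\<^sup>+ z\<in>P -` ({-T<..<T} \<times> UNIV). ennreal ((norm (w z))\<^sup>2) \<partial>?M)"
  unfolding kin_energy_def by (rule le[OF QTs])
 also have "... \<le> (\<integral>\<^sup>+ z. ennreal ((norm (w z))\<^sup>2) \<partial>?M)" by (intro nn_integral_mono) (auto simp: indicator_def)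
 finally have kin: "kin_energy \<mu> m (-T) T < \<infinity>" using w2 by (rule order_le_less_trans)
 have disint: "emeasure \<mu> A = (\<integral>\<^sup>+ t. emeasure (tree_measure T t) (Pair t -` A) \<partial>lborel_I T)" if A: "A \<in> sets (borel_QT T)" for A
 proof -
  have PA: "P -` A \<inter> space ?M \<in> sets ?M" by (rule measurable_sets[OF P A])
  have "emeasure \<mu> A = emeasure ?M (P -` A \<inter> space ?M)" unfolding \<mu>_def by (rule emeasure_distr[OF P A])
  also have "... = (\<integral>\<^sup>+ t. emeasure unit_box (Pair t -` (P -` A \<inter> space ?M)) \<partial>lborel_I T)"
   by (rule ub.emeasure_pair_measure_alt[OF PA])
  also have "... = (\<integral>\<^sup>+ t. emeasure (tree_measure T t) (Pair t -` A) \<partial>lborel_I T)"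
  proof (rule nn_integral_cong)
   fix t assume t: "t \<in> space (lborel_I T)"
   have B: "Pair t -` A \<in> sets borel"
    using measurable_sets[OF measurable_slice_QT[OF borel_measurable_indicator[OF A], of t], of "{1::ennreal}"] t sU
    by (simp add: vimage_def indicator_def)
   have "Pair t -` (P -` A \<inter> space ?M) = (%x. abs_torus (branch_pos T t x)) -` (Pair t -` A) \<inter> space unit_box"
    using t by (auto simp: P_def space_pair_measure)
   then show "emeasure unit_box (Pair t -` (P -` A \<inter> space ?M)) = emeasure (tree_measure T t) (Pair t -` A)"
    unfolding tree_measure_def using emeasure_distr[OF tree_slice_measurable(2) B] by simp
  qed
  finally show ?thesis .
 qed
 have pa: "AE t in lborel_I T. purely_atomic (tree_measure T t)"
 proof (rule AE_I2)
  fix t assume "t \<in> space (lborel_I T)"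
  then have "0 < remaining T t" using remaining_pos(1)[OF T, of t] sU by simp
  then obtain N where "1 / 3 \<le> 3 ^ N * remaining T t" using remaining_reach by blast
  then show "purely_atomic (tree_measure T t)" by (rule tree_measure_atoms(1))
 qed
 have comp: "\<mu> \<in> competitors T" and sl: "\<And>t. t \<in> {-T..T} ==> slice T \<mu> t = tree_measure T t"
  and eqd: "AE t in lborel_I T. disintegration T \<mu> t = tree_measure T t"
  by (rule competitorI[OF tree_measure_props(1,2) tree_measure_continuous[OF lipschitz_fun_continuous] s\<mu> f\<mu> m T disint pa]; assumption)+
 have sob: "sobolev_neg_diff_sq (1/2) (slice T \<mu> t) torus_lebesgue = 0" if "t = T \<or> t = - T" for t
 proof -
  have "t \<in> {-T..T}" using that T by auto
  then show ?thesis unfolding sobolev_neg_diff_sq_def sl[OF \<open>t \<in> {-T..T}\<close>] tree_measure_final[OF T that] by simp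
 qed
 have "perim_energy T \<mu> (-T) T = (\<integral>\<^sup>+ t. perimeter (disintegration T \<mu> t) \<partial>lborel_I T)"
  unfolding perim_energy_def by (simp add: nn_integral_restrict_space)
 also have "... \<le> (\<integral>\<^sup>+t. (\<Sum>n. ennreal (1 * 2 ^ n) * indicator {t. remaining T t \<le> 1 / 3 ^ n} t) \<partial>lborel_I T)"
 proof (rule nn_integral_mono_AE)
  show "AE t in lborel_I T. perimeter (disintegration T \<mu> t) \<le> (\<Sum>n. ennreal (1 * 2 ^ n) * indicator {t. remaining T t \<le> 1 / 3 ^ n} t)"
   using eqd AE_space
  proof eventually_elim
   case (elim t)
   then show ?case using tree_perimeter[OF T, of t] sU by simp
  qed
 qed
 also have "... < \<infinity>" using T by (intro level_series_finite) auto
 finally have per: "perim_energy T \<mu> (-T) T < \<infinity>" .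
 have "irrigation_energy T \<mu> (-T) T \<le> perim_energy T \<mu> (-T) T + kin_energy \<mu> m (-T) T"
  unfolding irrigation_energy_alt by (rule INF_lower[OF m])
 also have "... < \<infinity>" using per kin by simp
 finally have "energy lam T \<mu> < \<infinity>" unfolding energy_def by (simp add: sob)
 with comp show thesis by (rule that)
qed

section \<open>Fourier coefficients of the trace\<close>

definition char :: "int^2 => torus => complex"
 where "char k p = cis (- 2 * pi * (int_vec k \<bullet> rep_torus p))"

lemma char_abs: "char k (abs_torus x) = cis (- 2 * pi * (int_vec k \<bullet> x))"
proof -
 have "\<forall>i. rep_torus (abs_torus x) $ i - x $ i \<in> \<int>" using abs_torus_rep[of "abs_torus x"] unfolding abs_torus_eq_iff .
 then have "int_vec k \<bullet> (x - rep_torus (abs_torus x)) \<in> \<int>"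
  unfolding inner_vec_def int_vec_def by (auto intro!: Ints_sum Ints_mult) (metis Ints_minus minus_diff_eq)
 then have "cis (2 * pi * (int_vec k \<bullet> (x - rep_torus (abs_torus x)))) = 1" by (rule cis_multiple_2pi)
 moreover have "char k (abs_torus x) = cis (- 2 * pi * (int_vec k \<bullet> x)) * cis (2 * pi * (int_vec k \<bullet> (x - rep_torus (abs_torus x))))"
  unfolding char_def cis_mult by (simp add: inner_diff_right algebra_simps)
 ultimately show ?thesis by simp
qed

lemma continuous_char: "continuous_on UNIV (char k)"
 by (rule continuous_torusI) (auto simp: char_abs cis_conv_exp intro!: continuous_intros)

lemma char_tshift: "char k (tshift p v) = char k p * cis (- 2 * pi * (int_vec k \<bullet> v))"
 by (induction p rule: torus_induct) (simp add: tshift_abs char_abs cis_mult inner_add_right algebra_simps)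

lemma norm_char [simp]: "cmod (char k p) = 1"
 by (simp add: char_def)

lemma char_diff: "char j p * cnj (char l p) = char (j - l) p"
 by (simp add: char_def cis_cnj cis_mult int_vec_def inner_vec_def sum_2 algebra_simps)

lemma fourier_char: "fourier \<sigma> k = (LINT p|\<sigma>. char k p)"
 by (simp add: fourier_def char_def)

lemma fourier_0: "finite_borel \<sigma> ==> measure \<sigma> UNIV = 1 ==> fourier \<sigma> 0 = 1"
 using finite_borelD(2)[of \<sigma>] by (simp add: fourier_def int_vec_def inner_vec_def)

lemma fourier_avg2:
 assumes "finite_borel \<sigma>"
 shows "fourier (avg2 \<sigma> (c *\<^sub>R axis i 1)) k = cos (2 * pi * c * k $ i) * fourier \<sigma> k"
proof -
 let ?z = "cis (- 2 * pi * c * k $ i)"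
 have e: "int_vec k \<bullet> (c *\<^sub>R axis i 1) = c * k $ i" by (simp add: int_vec_def inner_axis)
 have "fourier (avg2 \<sigma> (c *\<^sub>R axis i 1)) k = (1 / 2) *\<^sub>R ((LINT p|\<sigma>. char k p * cnj ?z) + (LINT p|\<sigma>. char k p * ?z))"
  unfolding fourier_char integral_avg2[OF assms continuous_char] char_tshift inner_minus_right e
  by (simp add: cis_cnj mult.assoc)
 also have "... = (1 / 2) *\<^sub>R (fourier \<sigma> k * (cnj ?z + ?z))" by (simp add: fourier_char ring_distribs)
 also have "cnj ?z + ?z = of_real (2 * cos (2 * pi * c * k $ i))" by (simp add: complex_eq_iff)
 finally show ?thesis by (simp add: scaleR_conv_of_real)
qed

section \<open>Fourier coefficients of Lebesgue measure\<close>

lemma AE_coordinate_neq: "AE x in lborel. (x :: real^2) $ i \<noteq> c"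
proof -
 have "negligible {x :: real^2. x \<bullet> axis i 1 = c}" by (intro negligible_standard_hyperplane) (simp add: axis_in_Basis_iff)
 then have "{x :: real^2. x $ i = c} \<in> null_sets lebesgue" by (simp add: inner_axis negligible_iff_null_sets)
 moreover have "{x :: real^2. x $ i = c} \<in> sets lborel"
  unfolding sets_lborel by (intro borel_closed closed_Collect_eq continuous_intros)
 ultimately have "{x :: real^2. x $ i = c} \<in> null_sets lborel" by (simp add: null_sets_completion_iff)
 from AE_not_in[OF this] show ?thesis by simp
qed

text \<open>Translating by half a period of the character in a coordinate with
  \<open>k $ i \<noteq> 0\<close> preserves the integral over a period but multiplies it by
  \<open>-1\<close>.\<close>

lemma fourier_torus_lebesgue:
 assumes "k \<noteq> 0"
 shows "fourier torus_lebesgue k = 0"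
proof -
 obtain i where i: "k $ i \<noteq> 0" using assms by (auto simp: vec_eq_iff)
 define c where "c = 1 / (2 * \<bar>real_of_int (k $ i)\<bar>)"
 have "1 \<le> \<bar>real_of_int (k $ i)\<bar>" using i by linarith
 then have c: "0 \<le> c" "c \<le> 1" by (auto simp: c_def divide_simps)
 let ?e = "axis i 1 :: real^2" and ?g = "%x. char k (abs_torus x)"
 \<comment> \<open>Half-open in the distinguished coordinate, so that adjacent slabs are disjoint
   and the integrals \<open>F\<close> add up exactly.\<close>
 define A where "A a b = {x :: real^2. a \<le> x $ i \<and> x $ i < b \<and> (\<forall>j. j \<noteq> i \<longrightarrow> 0 \<le> x $ j \<and> x $ j \<le> 1)}" for a b
 have [measurable]: "(%x::real^2. x $ j) \<in> borel_measurable borel" for j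
  by (intro borel_measurable_continuous_onI continuous_intros)
 have As: "A a b \<in> sets lborel" for a b unfolding A_def sets_lborel by measurable
 have gm: "?g \<in> borel_measurable borel"
  by (intro borel_measurable_continuous_onI continuous_on_compose2[OF continuous_char continuous_abs_torus]) auto
 have gi: "set_integrable lborel (A a b) ?g" for a b
 proof -
  have "bounded (A a b)"
   by (rule bounded_subset[OF bounded_cbox[of "\<chi> j. min 0 a" "\<chi> j. max 1 b"]]) (auto simp: A_def mem_box_cart min_le_iff_disj le_max_iff_disj, (metis less_imp_le)+)
  then have "emeasure lborel (A a b) < \<infinity>" by (rule emeasure_bounded_finite)
  then have "integrable lborel (%x. indicator (A a b) x *\<^sub>R (1::real))" using As by simp
  then show ?thesis unfolding set_integrable_def
   by (rule Bochner_Integration.integrable_bound) (use As gm in \<open>auto intro!: borel_measurable_scaleR\<close>)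
 qed
 define F where "F a b = (LINT x:A a b|lborel. ?g x)" for a b
 have add: "F a d = F a b + F b d" if "a \<le> b" "b \<le> d" for a b d
 proof -
  have "A a d = A a b \<union> A b d" "A a b \<inter> A b d = {}" using that by (auto simp: A_def)
  then show ?thesis unfolding F_def using gi by (simp add: set_integral_Un)
 qed
 have shift: "F (a + s) (b + s) = cis (- 2 * pi * (s * k $ i)) * F a b" for a b s
 proof -
  have "F (a + s) (b + s) = (LINT x|distr lborel borel ((+) (s *\<^sub>R ?e)). indicator (A (a + s) (b + s)) x *\<^sub>R ?g x)"
   unfolding F_def set_lebesgue_integral_def by (simp add: lborel_distr_plus)
  also have "... = (LINT x|lborel. indicator (A (a + s) (b + s)) (s *\<^sub>R ?e + x) *\<^sub>R ?g (s *\<^sub>R ?e + x))"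
   using As gm by (intro integral_distr) (auto intro!: borel_measurable_scaleR)
  also have "... = (LINT x|lborel. cis (- 2 * pi * (s * k $ i)) * (indicator (A a b) x *\<^sub>R ?g x))"
  proof (rule Bochner_Integration.integral_cong[OF refl])
   fix x
   have "s *\<^sub>R ?e + x \<in> A (a + s) (b + s) \<longleftrightarrow> x \<in> A a b" by (auto simp: A_def axis_def)
   moreover have "?g (s *\<^sub>R ?e + x) = cis (- 2 * pi * (s * k $ i)) * ?g x"
    using char_tshift[of k "abs_torus x" "s *\<^sub>R ?e"] by (simp add: tshift_abs add.commute int_vec_def inner_axis)
   ultimately show "indicator (A (a + s) (b + s)) (s *\<^sub>R ?e + x) *\<^sub>R ?g (s *\<^sub>R ?e + x) = cis (- 2 * pi * (s * k $ i)) * (indicator (A a b) x *\<^sub>R ?g x)"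
    by (simp add: indicator_def)
  qed
  also have "... = cis (- 2 * pi * (s * k $ i)) * F a b" unfolding F_def set_lebesgue_integral_def by (rule integral_mult_right_zero)
  finally show ?thesis .
 qed
 have "cis (- 2 * pi * (1 * k $ i)) = 1" using cis_multiple_2pi[of "- real_of_int (k $ i)"] by simp
 then have "F 1 (1 + c) = F 0 c" using shift[of 0 1 c] by (simp add: add.commute)
 then have "F c (1 + c) = F 0 1" using add[of c 1 "1 + c"] add[of 0 c 1] c by simp
 moreover have "F c (1 + c) = cis (- 2 * pi * (c * k $ i)) * F 0 1" using shift[of 0 c 1] by simp
 moreover have "cis (- 2 * pi * (c * k $ i)) = -1"
 proof -
  have "- 2 * pi * (c * k $ i) = pi \<or> - 2 * pi * (c * k $ i) = - pi" using i by (auto simp: c_def abs_if field_simps)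
  moreover have "cis (- pi) = -1" by (simp add: complex_eq_iff)
  ultimately show ?thesis by (elim disjE) (simp_all only: cis_pi)
 qed
 ultimately have F0: "F 0 1 = 0" by simp
 have "fourier torus_lebesgue k = (LINT x|restrict_space lborel (cbox 0 1). ?g x)"
  unfolding fourier_char torus_lebesgue_def
  by (intro integral_distr measurable_restrict_space1 borel_measurable_continuous_onI continuous_char)
   (simp add: borel_measurable_continuous_onI[OF continuous_abs_torus])
 also have "... = (LINT x:cbox 0 1|lborel. ?g x)" unfolding set_lebesgue_integral_def by (rule integral_restrict_space) simp
 also have "... = F 0 1"
  unfolding F_def set_lebesgue_integral_def
 proof (rule integral_cong_AE)
  show "AE x in lborel. indicat_real (cbox 0 1) x *\<^sub>R ?g x = indicat_real (A 0 1) x *\<^sub>R ?g x"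
   using AE_coordinate_neq[of i 1]
  proof eventually_elim
   case (elim x)
   have "x \<in> cbox 0 1 \<longleftrightarrow> x \<in> A 0 1"
    unfolding A_def mem_box_cart mem_Collect_eq zero_index one_index using elim by (metis order.strict_iff_order)
   then show ?case by (simp add: indicator_def)
  qed
 qed (use As gm in \<open>auto intro!: borel_measurable_scaleR\<close>)
 finally show ?thesis using F0 by simp
qed

text \<open>The part of the \<open>k\<close>-th term of the squared \<open>H^(-1/2)\<close> norm
  that is lost when \<open>\<nu>\<close> is replaced by the average of its translates by
  \<open>\<rho>\<close> and \<open>-\<rho>\<close> along the axis \<open>i\<close>.\<close>

definition osc :: "torus measure => 2 => real => int^2 => real"
 where "osc \<nu> i \<rho> k = (if k = 0 then 0 else norm (int_vec k) powr (-1) * ((sin (2 * pi * \<rho> * k $ i))\<^sup>2 * (cmod (fourier \<nu> k))\<^sup>2))"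

text \<open>At frequency zero both coefficients equal one, and the infinite weight meets a zero.
  Elsewhere the coefficient of Lebesgue measure vanishes.\<close>

lemma sobolev_term:
 assumes "finite_borel \<nu>" "measure \<nu> UNIV = 1"
 shows "(if k = 0 then \<infinity> else ennreal (norm (int_vec k) powr (- 2 * (1 / 2)))) * ennreal ((cmod (fourier \<nu> k - fourier torus_lebesgue k))\<^sup>2)
  = (if k = 0 then 0 else ennreal (norm (int_vec k) powr (-1) * (cmod (fourier \<nu> k))\<^sup>2))"
proof (cases "k = 0")
 case True
 have "finite_borel torus_lebesgue" "measure torus_lebesgue UNIV = 1"
  using tree_measure_props(1,2)[of 1 1] tree_measure_final[of 1 1] by simp_all
 then show ?thesis using True fourier_0[OF assms] fourier_0[of torus_lebesgue] by simp
next
 case False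
 then show ?thesis using fourier_torus_lebesgue[OF False] by (simp add: ennreal_mult[symmetric])
qed

lemma sobolev_split:
 assumes "finite_borel \<nu>" "measure \<nu> UNIV = 1"
 shows "sobolev_neg_diff_sq (1 / 2) \<nu> torus_lebesgue =
  sobolev_neg_diff_sq (1 / 2) (avg2 \<nu> (\<rho> *\<^sub>R axis i 1)) torus_lebesgue + (\<integral>\<^sup>+k. ennreal (osc \<nu> i \<rho> k) \<partial>count_space UNIV)"
proof -
 have a: "finite_borel (avg2 \<nu> (\<rho> *\<^sub>R axis i 1))" "measure (avg2 \<nu> (\<rho> *\<^sub>R axis i 1)) UNIV = 1"
  using finite_borel_avg2(1)[OF assms(1)] measure_avg2[OF assms(1), of UNIV] assms(2) by simp_all
 show ?thesis
  unfolding sobolev_neg_diff_sq_def infsum_nn_integral sobolev_term[OF assms] sobolev_term[OF a]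
 proof (subst nn_integral_add[symmetric], simp, simp, rule nn_integral_cong)
  fix k :: "int^2"
  let ?w = "norm (int_vec k) powr (-1)" and ?f = "(cmod (fourier \<nu> k))\<^sup>2" and ?t = "2 * pi * \<rho> * k $ i"
  have "?w * ?f = ?w * ((cos ?t)\<^sup>2 * ?f) + ?w * ((sin ?t)\<^sup>2 * ?f)"
   unfolding distrib_left[symmetric] distrib_right[symmetric] by simp
  moreover have "(cmod (fourier (avg2 \<nu> (\<rho> *\<^sub>R axis i 1)) k))\<^sup>2 = (cos ?t)\<^sup>2 * ?f"
   unfolding fourier_avg2[OF assms(1)] norm_mult norm_of_real power_mult_distrib by simp
  ultimately show "(if k = 0 then 0 else ennreal (?w * ?f)) =
    (if k = 0 then 0 else ennreal (?w * (cmod (fourier (avg2 \<nu> (\<rho> *\<^sub>R axis i 1)) k))\<^sup>2)) + ennreal (osc \<nu> i \<rho> k)"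
   by (simp add: osc_def flip: ennreal_plus)
 qed
qed

lemma sobolev_avg2_0: "finite_borel \<sigma> ==> sobolev_neg_diff_sq \<gamma> (avg2 \<sigma> (0 *\<^sub>R axis i 1)) \<rho> = sobolev_neg_diff_sq \<gamma> \<sigma> \<rho>"
 unfolding sobolev_neg_diff_sq_def by (subst fourier_avg2) simp_all

lemma minimizer_energy_finite:
 assumes "is_minimizer lam T \<mu>" "T > 0"
 shows "energy lam T \<mu> < \<infinity>"
proof -
 obtain \<nu> where "\<nu> \<in> competitors T" "energy lam T \<nu> < \<infinity>" using finite_energy_competitor[OF assms(2)] by blast
 then show ?thesis using assms(1) unfolding is_minimizer_def by (meson order_le_less_trans)
qed

text \<open>Minimality against the shifted competitor. The trace at \<open>-T\<close> is unchanged
  because the hump vanishes there, and the common part of the two energies is finite, so it cancels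
  and leaves the lost oscillation against the added energy.\<close>

lemma minimizer_oscillation:
 assumes min: "is_minimizer lam T \<mu>" and "lam > 0" "T > 0" "0 < \<epsilon>" "\<epsilon> \<le> T" "0 \<le> r"
 shows "ennreal lam * (\<integral>\<^sup>+k. ennreal (osc (slice T \<mu> T) i (r * exp (-1)) k) \<partial>count_space UNIV)
  \<le> irrigation_energy T \<mu> (T - \<epsilon>) T + ennreal (16 * r\<^sup>2 / \<epsilon>)"
proof -
 have \<mu>: "\<mu> \<in> competitors T" using min by (simp add: is_minimizer_def)
 note c = competitor_slice[OF \<mu> assms(3)]
 obtain \<mu>' where \<mu>': "\<mu>' \<in> competitors T"
  "\<And>t. t \<in> {-T..T} ==> slice T \<mu>' t = avg2 (slice T \<mu> t) (hump \<epsilon> T r t *\<^sub>R axis i 1)"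
  "irrigation_energy T \<mu>' (-T) T \<le> irrigation_energy T \<mu> (-T) T + irrigation_energy T \<mu> (T - \<epsilon>) T + ennreal (16 * r\<^sup>2 / \<epsilon>)"
  using shift_competitor[OF \<mu> assms(3-6), of i] by blast
 have in01: "-T \<in> {-T..T}" "T \<in> {-T..T}" using assms(3) by auto
 have h: "hump \<epsilon> T r (-T) = 0" "hump \<epsilon> T r T = r * exp (-1)" using hump(4,7)[OF assms(4,6), where T=T] assms(3,5) by auto
 define I where "I = irrigation_energy T \<mu> (-T) T"
 define D where "D = irrigation_energy T \<mu> (T - \<epsilon>) T + ennreal (16 * r\<^sup>2 / \<epsilon>)"
 define S0 where "S0 = ennreal lam * sobolev_neg_diff_sq (1 / 2) (slice T \<mu> (-T)) torus_lebesgue"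
 define S1 where "S1 = ennreal lam * sobolev_neg_diff_sq (1 / 2) (slice T \<mu>' T) torus_lebesgue"
 define R where "R = ennreal lam * (\<integral>\<^sup>+k. ennreal (osc (slice T \<mu> T) i (r * exp (-1)) k) \<partial>count_space UNIV)"
 have e: "energy lam T \<mu> = I + S0 + (S1 + R)"
  unfolding energy_def I_def S0_def S1_def R_def \<mu>'(2)[OF in01(2)] h(2)
  by (subst sobolev_split[OF c(7,8)[OF in01(2)], of "r * exp (-1)" i]) (simp add: distrib_left)
 have "energy lam T \<mu> \<le> energy lam T \<mu>'" using min \<mu>'(1) by (simp add: is_minimizer_def)
 also have "... \<le> (I + D) + S0 + S1"
  unfolding energy_def S1_def S0_def \<mu>'(2)[OF in01(1)] h(1) sobolev_avg2_0[OF c(7)[OF in01(1)]] I_def D_def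
  using \<mu>'(3) by (intro add_mono) (auto simp: add.assoc)
 finally have "(I + S0 + S1) + R \<le> (I + S0 + S1) + D" unfolding e by (simp add: add_ac)
 moreover have "I + S0 + S1 < top"
 proof -
  have "I + S0 + S1 \<le> energy lam T \<mu>" unfolding e by (simp add: add.assoc[symmetric] le_iff_add)
  also have "... < \<infinity>" by (rule minimizer_energy_finite[OF min assms(3)])
  finally show ?thesis by simp
 qed
 ultimately show ?thesis unfolding R_def[symmetric] D_def[symmetric] by (auto simp: ennreal_add_left_cancel_le)
qed

section \<open>The lower dimension of the trace\<close>

lemma sum_osc_le:
 assumes "finite F" "(\<integral>\<^sup>+k. ennreal (osc \<nu> i \<rho> k) \<partial>count_space UNIV) \<le> ennreal b" "0 \<le> b"
 shows "(\<Sum>k\<in>F. osc \<nu> i \<rho> k) \<le> b"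
proof -
 have nn: "0 \<le> osc \<nu> i \<rho> k" for k by (simp add: osc_def)
 have "ennreal (\<Sum>k\<in>F. osc \<nu> i \<rho> k) = (\<Sum>k\<in>F. ennreal (osc \<nu> i \<rho> k))" by (simp add: nn sum_ennreal)
 also have "... = (\<integral>\<^sup>+k. ennreal (osc \<nu> i \<rho> k) \<partial>count_space F)" by (rule nn_integral_count_space_finite[OF assms(1), symmetric])
 also have "... \<le> (\<integral>\<^sup>+k. ennreal (osc \<nu> i \<rho> k) \<partial>count_space UNIV)"
  unfolding nn_integral_count_space_indicator[of F, simplified] by (intro nn_integral_mono) (simp add: indicator_def)
 also note assms(2)
 finally show ?thesis using assms(3) by simp
qed

text \<open>For small \<open>\<rho>\<close> the choice \<open>\<epsilon> = \<rho> powr q\<close>,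
  \<open>q = 2 / (1 + \<beta>)\<close>, gives \<open>\<epsilon>^\<beta>\<close> and
  \<open>\<rho>\<^sup>2 / \<epsilon>\<close> the same order. For larger \<open>\<rho>\<close> the
  oscillation is bounded by the full norm, finite by minimality.\<close>

lemma oscillation_decay:
 assumes min: "is_minimizer lam T \<mu>" and pos: "lam > 0" "T > 0" "0 < \<beta>" "\<delta> > 0" "C \<ge> 0"
  and I: "\<And>\<epsilon>. 0 < \<epsilon> ==> \<epsilon> < \<delta> ==> irrigation_energy T \<mu> (T - \<epsilon>) T \<le> ennreal (C * \<epsilon> powr \<beta>)"
 obtains K where "K \<ge> 0" "\<And>\<rho> i. \<rho> > 0 ==>
  (\<integral>\<^sup>+k. ennreal (osc (slice T \<mu> T) i \<rho> k) \<partial>count_space UNIV) \<le> ennreal (K * \<rho> powr (2 * \<beta> / (1 + \<beta>)))"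
proof -
 define q where "q = 2 / (1 + \<beta>)"
 define d where "d = min \<delta> T"
 have q: "q > 0" "q * \<beta> = 2 * \<beta> / (1 + \<beta>)" "2 - q = 2 * \<beta> / (1 + \<beta>)" using pos(3) by (auto simp: q_def field_simps)
 have d: "0 < d" "d \<le> \<delta>" "d \<le> T" using pos by (auto simp: d_def)
 let ?\<nu> = "slice T \<mu> T"
 let ?S = "sobolev_neg_diff_sq (1 / 2) ?\<nu> torus_lebesgue"
 let ?R = "%\<rho> i. \<integral>\<^sup>+k. ennreal (osc ?\<nu> i \<rho> k) \<partial>count_space UNIV"
 have \<mu>: "\<mu> \<in> competitors T" using min by (simp add: is_minimizer_def)
 note c = competitor_slice[OF \<mu> pos(2)]
 have TT: "T \<in> {-T..T}" using pos(2) by simp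
 have "ennreal lam * ?S \<le> energy lam T \<mu>" unfolding energy_def by (simp add: le_iff_add add.commute)
 then have "ennreal lam * ?S < top" using minimizer_energy_finite[OF min pos(2)] by (metis infinity_ennreal_def order_le_less_trans)
 then have "?S < top" using pos(1) by (auto simp: ennreal_mult_less_top)
 then obtain s where s: "?S = ennreal s" "0 \<le> s" by (metis ennreal_cases less_irrefl)
 define K where "K = (C + 16 * (exp 1)\<^sup>2) / lam + s / d powr \<beta>"
 have K1: "0 \<le> (C + 16 * (exp 1)\<^sup>2) / lam" "0 \<le> s / d powr \<beta>" using pos s by auto
 have "?R \<rho> i \<le> ennreal (K * \<rho> powr (2 * \<beta> / (1 + \<beta>)))" if \<rho>: "\<rho> > 0" for \<rho> i
 proof (cases "\<rho> powr q < d")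
  case True
  define \<epsilon> where "\<epsilon> = \<rho> powr q"
  have \<epsilon>: "0 < \<epsilon>" "\<epsilon> < \<delta>" "\<epsilon> \<le> T" using \<rho> True d by (auto simp: \<epsilon>_def)
  \<comment> \<open>Starting with amplitude \<open>\<rho> * exp 1\<close> makes the final shift of
    the hump exactly \<open>\<rho>\<close>.\<close>
  have e: "\<rho> * exp 1 * exp (-1) = \<rho>" by (simp add: mult.assoc exp_add[symmetric])
  have "ennreal lam * ?R \<rho> i \<le> irrigation_energy T \<mu> (T - \<epsilon>) T + ennreal (16 * (\<rho> * exp 1)\<^sup>2 / \<epsilon>)"
   using minimizer_oscillation[OF min pos(1,2) \<epsilon>(1,3), of "\<rho> * exp 1" i] \<rho> unfolding e by simp
  also have "... \<le> ennreal (C * \<epsilon> powr \<beta>) + ennreal (16 * (\<rho> * exp 1)\<^sup>2 / \<epsilon>)"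
   by (rule add_right_mono[OF I[OF \<epsilon>(1,2)]])
  also have "... = ennreal ((C + 16 * (exp 1)\<^sup>2) * \<rho> powr (2 * \<beta> / (1 + \<beta>)))"
  proof -
   have e1: "\<epsilon> powr \<beta> = \<rho> powr (2 * \<beta> / (1 + \<beta>))" by (simp add: \<epsilon>_def powr_powr q(2))
   have "\<rho>\<^sup>2 / \<epsilon> = \<rho> powr 2 / \<rho> powr q" using \<rho> by (simp add: \<epsilon>_def)
   also have "... = \<rho> powr (2 * \<beta> / (1 + \<beta>))" by (simp add: powr_diff[symmetric] q(3))
   finally have e2: "\<rho>\<^sup>2 / \<epsilon> = \<rho> powr (2 * \<beta> / (1 + \<beta>))" .
   have "16 * (\<rho> * exp 1)\<^sup>2 / \<epsilon> = 16 * (exp 1)\<^sup>2 * (\<rho>\<^sup>2 / \<epsilon>)" by (simp add: power_mult_distrib)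
   then show ?thesis unfolding e1 e2 using pos(5) by (simp add: distrib_right flip: ennreal_plus)
  qed
  finally have le: "ennreal lam * ?R \<rho> i \<le> ennreal ((C + 16 * (exp 1)\<^sup>2) * \<rho> powr (2 * \<beta> / (1 + \<beta>)))" .
  have "?R \<rho> i = ennreal (1 / lam) * (ennreal lam * ?R \<rho> i)"
   using pos(1) by (simp add: mult.assoc[symmetric] ennreal_mult[symmetric])
  also have "... \<le> ennreal (1 / lam) * ennreal ((C + 16 * (exp 1)\<^sup>2) * \<rho> powr (2 * \<beta> / (1 + \<beta>)))"
   by (rule mult_left_mono[OF le]) simp
  also have "... = ennreal ((C + 16 * (exp 1)\<^sup>2) / lam * \<rho> powr (2 * \<beta> / (1 + \<beta>)))"
   using pos(1,5) by (simp add: ennreal_mult[symmetric])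
  also have "... \<le> ennreal (K * \<rho> powr (2 * \<beta> / (1 + \<beta>)))"
   using K1 unfolding K_def by (intro ennreal_leI mult_right_mono) auto
  finally show ?thesis .
 next
  case False
  have "d powr \<beta> \<le> (\<rho> powr q) powr \<beta>" using False d pos(3) by (intro powr_mono2) auto
  then have le: "d powr \<beta> \<le> \<rho> powr (2 * \<beta> / (1 + \<beta>))" by (simp add: powr_powr q(2))
  have "?R \<rho> i \<le> ?S" unfolding sobolev_split[OF c(7,8)[OF TT], of \<rho> i] by (simp add: le_iff_add add.commute)
  also have "... = ennreal (s / d powr \<beta> * d powr \<beta>)" using d(1) by (simp add: s(1))
  also have "... \<le> ennreal (K * \<rho> powr (2 * \<beta> / (1 + \<beta>)))"
   using K1 le unfolding K_def by (intro ennreal_leI mult_mono) auto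
  finally show ?thesis .
 qed
 moreover have "K \<ge> 0" using K1 by (simp add: K_def)
 ultimately show thesis by (intro that)
qed

section \<open>Growth of the spectrum over dyadic boxes of frequencies\<close>

definition freq_box :: "int => int => (int^2) set"
 where "freq_box a b = {k. \<forall>i. a \<le> k $ i \<and> k $ i < b}"

lemma freq_box_eq: "freq_box a b = (%(m, n). \<chi> i. if i = 1 then m else n) ` ({a..<b} \<times> {a..<b})"
proof (intro equalityI subsetI)
 fix k assume k: "k \<in> freq_box a b"
 have "k = (\<chi> i. if i = 1 then k $ 1 else k $ 2)" by (simp add: vec_eq_iff forall_2)
 then show "k \<in> (%(m, n). \<chi> i. if i = 1 then m else n) ` ({a..<b} \<times> {a..<b})"
  using k by (intro image_eqI[of _ _ "(k $ 1, k $ 2)"]) (auto simp: freq_box_def)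
qed (auto simp: freq_box_def)

lemma finite_freq_box: "finite (freq_box a b)" by (simp add: freq_box_eq)

lemma square_powers: "((2::real) ^ n)\<^sup>2 = 4 ^ n" "((4::real) ^ n)\<^sup>2 = 16 ^ n"
 unfolding power2_eq_square power_mult_distrib[symmetric] by simp_all

lemma card_freq_box: "a \<le> b ==> real (card (freq_box a b)) = (b - a)\<^sup>2"
proof -
 assume ab: "a \<le> b"
 have "inj_on (%(m, n). (\<chi> i. if i = 1 then m else n) :: int^2) ({a..<b} \<times> {a..<b})"
  by (auto simp: inj_on_def vec_eq_iff forall_2)
 then have "card (freq_box a b) = card ({a..<b} \<times> {a..<b})" unfolding freq_box_eq by (rule card_image)
 also have "... = nat (b - a) * nat (b - a)" by (simp add: card_cartesian_product)
 finally show ?thesis using ab by (simp add: power2_eq_square)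
qed

lemma norm_int_vec_le: "norm (int_vec k) \<le> \<bar>k $ 1\<bar> + \<bar>k $ 2\<bar>"
 using norm_le_l1_cart[of "int_vec k"] by (simp add: sum_2 int_vec_def)

text \<open>The summation box contains all differences of two elements of
  \<open>freq_box 0 (2 ^ n)\<close>, the form in which it is needed for squared Dirichlet
  kernels.\<close>

abbreviation spectrum :: "torus measure => nat => real"
 where "spectrum \<nu> n \<equiv> (\<Sum>k\<in>freq_box (1 - 2 ^ n) (2 ^ n). (cmod (fourier \<nu> k))\<^sup>2)"

text \<open>On a dyadic shell in one coordinate a single \<open>\<rho>\<close> keeps the sine away
  from zero, so the shell sum is controlled by the oscillation. Two shells, one for each coordinate,
  lead from one box to the next.\<close>

lemma spectrum_growth:
 assumes \<nu>: "finite_borel \<nu>" "measure \<nu> UNIV = 1" and \<alpha>: "\<alpha> < 1" "0 \<le> \<alpha>" and K: "K \<ge> 0"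
  "\<And>\<rho> i. \<rho> > 0 ==> (\<integral>\<^sup>+k. ennreal (osc \<nu> i \<rho> k) \<partial>count_space UNIV) \<le> ennreal (K * \<rho> powr \<alpha>)"
 obtains D where "D \<ge> 0" "\<And>n. spectrum \<nu> n \<le> D * (2 powr (1 - \<alpha>)) ^ n"
proof -
 define q where "q = 2 powr (1 - \<alpha>)"
 have q: "q > 1" using \<alpha> by (simp add: q_def gr_one_powr)
 \<comment> \<open>The second bound is what closes the induction:
   \<open>D * q ^ n + 16 * K * q ^ n \<le> D * q ^ Suc n\<close>.\<close>
 define D where "D = max 1 (16 * K / (q - 1))"
 have D: "1 \<le> D" "16 * K \<le> D * (q - 1)" using q by (auto simp: D_def max_def field_simps)
 let ?f = "%k. (cmod (fourier \<nu> k))\<^sup>2"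
 define Sh where "Sh n i = {k \<in> freq_box (1 - 2 ^ Suc n) (2 ^ Suc n). 2 ^ n \<le> \<bar>k $ i\<bar>}" for n and i :: 2
 have fSh: "finite (Sh n i)" for n i unfolding Sh_def using finite_freq_box by simp
 have shell: "sum ?f (Sh n i) \<le> 8 * K * q ^ n" for n i
 proof -
  \<comment> \<open>For \<open>2 ^ n \<le> |k $ i| < 2 ^ Suc n\<close> the angle
    \<open>2 \<pi> \<rho> |k $ i|\<close> lies between \<open>\<pi> / 4\<close> and
    \<open>\<pi> / 2\<close>, hence the squared sine is at least one half.\<close>
  define \<rho> :: real where "\<rho> = 1 / (8 * 2 ^ n)"
  have \<rho>: "\<rho> > 0" "\<rho> \<le> 1 / 2 ^ n" by (auto simp: \<rho>_def field_simps)
  have "?f k \<le> 8 * 2 ^ n * osc \<nu> i \<rho> k" if k: "k \<in> Sh n i" for k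
  proof -
   have ki: "2 ^ n \<le> \<bar>k $ i\<bar>" and kb': "1 - 2 ^ Suc n \<le> k $ j \<and> k $ j < 2 ^ Suc n" for j
    using k by (auto simp: Sh_def freq_box_def)
   have kb: "\<bar>k $ j\<bar> < 2 ^ Suc n" for j using kb'[of j] by linarith
   have ri: "(2::real) ^ n \<le> \<bar>real_of_int (k $ i)\<bar>" using ki by (metis of_int_abs of_int_le_iff of_int_numeral of_int_power)
   have rb: "\<bar>real_of_int (k $ j)\<bar> < 2 * 2 ^ n" for j
    using kb[of j] by (metis of_int_abs of_int_less_iff of_int_numeral of_int_power power_Suc)
   have k0: "k \<noteq> 0" using ki by auto
   then have n0: "norm (int_vec k) > 0" by (auto simp: int_vec_def vec_eq_iff)
   have "norm (int_vec k) \<le> 4 * 2 ^ n" using norm_int_vec_le[of k] rb[of 1] rb[of 2] by linarith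
   then have w: "1 / (4 * 2 ^ n) \<le> norm (int_vec k) powr (-1)" using n0 by (simp add: powr_minus_divide frac_le)
   define \<theta> where "\<theta> = 2 * pi * \<rho> * \<bar>real_of_int (k $ i)\<bar>"
   have \<theta>e: "\<theta> = pi / 4 * (\<bar>real_of_int (k $ i)\<bar> / 2 ^ n)" by (simp add: \<theta>_def \<rho>_def)
   have "1 \<le> \<bar>real_of_int (k $ i)\<bar> / 2 ^ n" "\<bar>real_of_int (k $ i)\<bar> / 2 ^ n \<le> 2"
    using ri rb[of i] by (auto simp: field_simps)
   then have \<theta>: "pi / 4 \<le> \<theta>" "\<theta> \<le> pi / 2"
    unfolding \<theta>e using mult_left_mono[of 1 "\<bar>real_of_int (k $ i)\<bar> / 2 ^ n" "pi / 4"] mult_left_mono[of "\<bar>real_of_int (k $ i)\<bar> / 2 ^ n" 2 "pi / 4"] by simp_all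
   have "sin (pi / 4) \<le> sin \<theta>" using \<theta> pi_gt_zero by (intro sin_monotone_2pi_le) linarith+
   then have "(sqrt 2 / 2)\<^sup>2 \<le> (sin \<theta>)\<^sup>2" by (intro power_mono) (auto simp: sin_45)
   moreover have "(sin \<theta>)\<^sup>2 = (sin (2 * pi * \<rho> * k $ i))\<^sup>2"
    unfolding \<theta>_def by (cases "k $ i \<ge> 0") auto
   ultimately have sn: "1 / 2 \<le> (sin (2 * pi * \<rho> * k $ i))\<^sup>2" by (simp add: power_divide)
   have "1 / (4 * 2 ^ n) * (1 / 2 * ?f k) \<le> norm (int_vec k) powr (-1) * ((sin (2 * pi * \<rho> * k $ i))\<^sup>2 * ?f k)"
    by (intro mult_mono w mult_right_mono sn) auto
   then have "1 / (4 * 2 ^ n) * (1 / 2 * ?f k) \<le> osc \<nu> i \<rho> k" using k0 by (simp only: osc_def if_False)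
   then show ?thesis by (simp add: field_simps)
  qed
  then have "sum ?f (Sh n i) \<le> (\<Sum>k\<in>Sh n i. 8 * 2 ^ n * osc \<nu> i \<rho> k)" by (rule sum_mono)
  also have "... = 8 * 2 ^ n * (\<Sum>k\<in>Sh n i. osc \<nu> i \<rho> k)" by (simp add: sum_distrib_left)
  also have "... \<le> 8 * 2 ^ n * (K * \<rho> powr \<alpha>)"
   by (intro mult_left_mono sum_osc_le[OF fSh K(2)[OF \<rho>(1)]]) (use K(1) in auto)
  also have "... \<le> 8 * 2 ^ n * (K * (1 / 2 ^ n) powr \<alpha>)"
   using K(1) \<rho> \<alpha>(2) by (intro mult_left_mono powr_mono2) auto
  also have "... = 8 * K * (2 ^ n * (1 / 2 ^ n) powr \<alpha>)" by simp
  also have "2 ^ n * (1 / 2 ^ n) powr \<alpha> = q ^ n"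
  proof -
   have "2 ^ n * (1 / 2 ^ n) powr \<alpha> = 2 powr n * 2 powr (- (n * \<alpha>))"
    by (simp add: powr_divide powr_powr powr_realpow[symmetric] powr_minus_divide)
   also have "... = q powr n" unfolding powr_add[symmetric] q_def powr_powr by (simp add: algebra_simps)
   finally show ?thesis using q by (simp add: powr_realpow)
  qed
  finally show ?thesis .
 qed
 have "spectrum \<nu> n \<le> D * q ^ n" for n
 proof (induction n)
  case 0
  have "freq_box 0 1 = {0}" by (auto simp: freq_box_def vec_eq_iff) (smt (verit))
  then show ?case using D(1) fourier_0[OF \<nu>] by simp
 next
  case (Suc n)
  let ?B = "freq_box (1 - 2 ^ n) (2 ^ n)"
  have "freq_box (1 - 2 ^ Suc n) (2 ^ Suc n) \<subseteq> ?B \<union> (Sh n 1 \<union> Sh n 2)"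
  proof
   fix k assume k: "k \<in> freq_box (1 - 2 ^ Suc n) (2 ^ Suc n)"
   show "k \<in> ?B \<union> (Sh n 1 \<union> Sh n 2)"
   proof (rule ccontr)
    assume "k \<notin> ?B \<union> (Sh n 1 \<union> Sh n 2)"
    then have "k \<notin> ?B" "\<not> 2 ^ n \<le> \<bar>k $ 1\<bar>" "\<not> 2 ^ n \<le> \<bar>k $ 2\<bar>" using k by (auto simp: Sh_def)
    then show False by (auto simp: freq_box_def forall_2)
   qed
  qed
  then have "spectrum \<nu> (Suc n) \<le> sum ?f (?B \<union> (Sh n 1 \<union> Sh n 2))"
   using finite_freq_box fSh by (intro sum_mono2) auto
  also have "... \<le> sum ?f ?B + (sum ?f (Sh n 1) + sum ?f (Sh n 2))"
  proof -
   have un: "sum ?f (A \<union> B) \<le> sum ?f A + sum ?f B" if "finite A" "finite B" for A B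
    using sum.union_inter[OF that, of ?f] sum_nonneg[of "A \<inter> B" ?f] by simp
   show ?thesis using un[of ?B "Sh n 1 \<union> Sh n 2"] un[of "Sh n 1" "Sh n 2"] finite_freq_box fSh by force
  qed
  also have "... \<le> D * q ^ n + 16 * K * q ^ n" using Suc shell[of n 1] shell[of n 2] by linarith
  also have "... \<le> D * q ^ n + D * (q - 1) * q ^ n" using D(2) q by (intro add_left_mono mult_right_mono) auto
  also have "... = D * q ^ Suc n" by (simp add: algebra_simps)
  finally show ?case .
 qed
 then show thesis using that[of D] D(1) by (simp add: q_def)
qed

text \<open>The two-dimensional Dirichlet kernel on the frequencies
  \<open>0 \<le> k $ i < 2 ^ n\<close>; one-sided frequencies change only its phase.\<close>

definition kernel :: "nat => torus => torus => complex"
 where "kernel n x y = (\<Sum>j\<in>freq_box 0 (2 ^ n). char j x * cnj (char j y))"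

text \<open>Up to the scaling \<open>4 / 16 ^ n\<close> this dominates the mass of the ball of
  radius \<open>1 / (12 * 2 ^ n)\<close> around \<open>y\<close>, while its mean is computed by
  Fourier coefficients.\<close>

definition ball_bound :: "torus measure => nat => torus => real"
 where "ball_bound \<nu> n y = (LINT x|\<nu>. (cmod (kernel n x y))\<^sup>2)"

lemma kernel_square:
 "of_real ((cmod (kernel n x y))\<^sup>2) = (\<Sum>j\<in>freq_box 0 (2 ^ n). \<Sum>l\<in>freq_box 0 (2 ^ n). char (j - l) x * cnj (char (j - l) y))"
proof -
 have "of_real ((cmod (kernel n x y))\<^sup>2) = kernel n x y * cnj (kernel n x y)" by (rule complex_norm_square)
 also have "... = (\<Sum>j\<in>freq_box 0 (2 ^ n). \<Sum>l\<in>freq_box 0 (2 ^ n). (char j x * cnj (char l x)) * cnj (char j y * cnj (char l y)))"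
  unfolding kernel_def cnj_sum sum_product by (intro sum.cong refl) simp
 finally show ?thesis unfolding char_diff .
qed

lemma continuous_cnj_char: "continuous_on UNIV (%p. cnj (char k p))"
 by (intro continuous_on_cnj continuous_char)

lemma ball_bound_expand:
 assumes "finite_borel \<nu>"
 shows "of_real (ball_bound \<nu> n y) = (\<Sum>j\<in>freq_box 0 (2 ^ n). \<Sum>l\<in>freq_box 0 (2 ^ n). fourier \<nu> (j - l) * cnj (char (j - l) y))"
proof -
 have "of_real (ball_bound \<nu> n y) = (LINT x|\<nu>. (\<Sum>j\<in>freq_box 0 (2 ^ n). \<Sum>l\<in>freq_box 0 (2 ^ n). char (j - l) x * cnj (char (j - l) y)))"
  unfolding ball_bound_def kernel_square[symmetric] by (rule integral_complex_of_real[symmetric])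
 also have "... = (\<Sum>j\<in>freq_box 0 (2 ^ n). \<Sum>l\<in>freq_box 0 (2 ^ n). (LINT x|\<nu>. char (j - l) x * cnj (char (j - l) y)))"
  using integrable_continuous_torus[OF assms continuous_char] by (simp add: Bochner_Integration.integral_sum)
 finally show ?thesis by (simp add: fourier_char)
qed

lemma ball_bound_continuous:
 assumes "finite_borel \<nu>"
 shows "continuous_on UNIV (ball_bound \<nu> n)"
proof -
 have "continuous_on UNIV (%y. Re (of_real (ball_bound \<nu> n y)))"
  unfolding ball_bound_expand[OF assms] by (intro continuous_intros continuous_char)
 then show ?thesis by simp
qed

lemma ball_bound_nonneg: "0 \<le> ball_bound \<nu> n y"
 unfolding ball_bound_def by (intro Bochner_Integration.integral_nonneg) simp

text \<open>Expanding the squared kernel gives the double sum of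
  \<open>|\<nu>\<^sub>j\<^sub>-\<^sub>l|\<^sup>2\<close>. For each of the \<open>4 ^ n\<close>
  values of \<open>j\<close> the differences \<open>j - l\<close> are distinct and lie in the box of
  \<open>spectrum\<close>.\<close>

lemma ball_bound_integral:
 assumes "finite_borel \<nu>"
 shows "(LINT y|\<nu>. ball_bound \<nu> n y) \<le> 4 ^ n * spectrum \<nu> n"
proof -
 let ?J = "freq_box 0 (2 ^ n)" and ?f = "%k. (cmod (fourier \<nu> k))\<^sup>2"
 have "complex_of_real (LINT y|\<nu>. ball_bound \<nu> n y) = (LINT y|\<nu>. complex_of_real (ball_bound \<nu> n y))"
  by (rule integral_complex_of_real[symmetric])
 also have "... = (LINT y|\<nu>. (\<Sum>j\<in>?J. \<Sum>l\<in>?J. fourier \<nu> (j - l) * cnj (char (j - l) y)))"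
  unfolding ball_bound_expand[OF assms] ..
 also have "... = (\<Sum>j\<in>?J. \<Sum>l\<in>?J. fourier \<nu> (j - l) * (LINT y|\<nu>. cnj (char (j - l) y)))"
  using integrable_continuous_torus[OF assms continuous_cnj_char] by (simp add: Bochner_Integration.integral_sum)
 also have "... = (\<Sum>j\<in>?J. \<Sum>l\<in>?J. complex_of_real (?f (j - l)))"
  by (simp only: complex_norm_square) (simp add: fourier_char)
 also have "... = complex_of_real (\<Sum>j\<in>?J. \<Sum>l\<in>?J. ?f (j - l))" by simp
 finally have "(LINT y|\<nu>. ball_bound \<nu> n y) = (\<Sum>j\<in>?J. \<Sum>l\<in>?J. ?f (j - l))" by (simp only: of_real_eq_iff)
 also have "... \<le> (\<Sum>j\<in>?J. spectrum \<nu> n)"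
 proof (rule sum_mono)
  fix j assume j: "j \<in> ?J"
  have "(\<Sum>l\<in>?J. ?f (j - l)) = sum ?f ((%l. j - l) ` ?J)" by (subst sum.reindex) (auto simp: inj_on_def)
  also have "... \<le> spectrum \<nu> n"
  proof (rule sum_mono2)
   show "(%l. j - l) ` ?J \<subseteq> freq_box (1 - 2 ^ n) (2 ^ n)" using j unfolding freq_box_def
    by (smt (verit) image_iff mem_Collect_eq subsetI vector_minus_component)
  qed (auto simp: finite_freq_box)
  finally show "(\<Sum>l\<in>?J. ?f (j - l)) \<le> spectrum \<nu> n" .
 qed
 also have "... = 4 ^ n * spectrum \<nu> n"
  using card_freq_box[of 0 "2 ^ n"] by (simp add: square_powers)
 finally show ?thesis .
qed

text \<open>Frequencies have norm at most \<open>2 * 2 ^ n\<close>, so at this distance every phase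
  is at most \<open>\<pi> / 3\<close> and every one of the \<open>4 ^ n\<close> summands has real
  part at least one half.\<close>

lemma kernel_lower:
 assumes "dist x y \<le> 1 / (12 * 2 ^ n)"
 shows "4 ^ n / 2 \<le> cmod (kernel n x y)"
proof -
 obtain u where u: "x = abs_torus u" by (metis abs_torus_rep)
 obtain v where v: "abs_torus v = y" "dist u v = dist (abs_torus u) y" using torus_lift_near by blast
 have d: "norm (u - v) \<le> 1 / (12 * 2 ^ n)" using assms v(2) by (simp add: u dist_norm)
 have "1 / 2 \<le> Re (char j x * cnj (char j y))" if j: "j \<in> freq_box 0 (2 ^ n)" for j
 proof -
  have e: "Re (char j x * cnj (char j y)) = cos \<bar>2 * pi * (int_vec j \<bullet> (u - v))\<bar>"
   unfolding u v(1)[symmetric] char_abs cis_cnj cis_mult cis.simps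
   by (simp add: inner_diff_right algebra_simps) (metis cos_minus minus_diff_eq)
  have "0 \<le> j $ i" "j $ i < 2 ^ n" for i using j by (auto simp: freq_box_def)
  then have "real_of_int \<bar>j $ i\<bar> \<le> 2 ^ n" for i by (metis abs_of_nonneg less_imp_le of_int_le_iff of_int_numeral of_int_power)
  from this[of 1] this[of 2] have "norm (int_vec j) \<le> 2 * 2 ^ n" using norm_int_vec_le[of j] by simp
  then have "norm (int_vec j) * norm (u - v) \<le> (2 * 2 ^ n) * (1 / (12 * 2 ^ n))" using d by (intro mult_mono) auto
  then have "\<bar>int_vec j \<bullet> (u - v)\<bar> \<le> 1 / 6" using Cauchy_Schwarz_ineq2[of "int_vec j" "u - v"] by simp
  then have "\<bar>2 * pi * (int_vec j \<bullet> (u - v))\<bar> \<le> pi / 3" by (simp add: abs_mult)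
  then have "cos (pi / 3) \<le> cos \<bar>2 * pi * (int_vec j \<bullet> (u - v))\<bar>" by (intro cos_monotone_0_pi_le) auto
  then show ?thesis unfolding e by (simp add: cos_60)
 qed
 then have "(\<Sum>j\<in>freq_box 0 (2 ^ n). 1 / 2) \<le> (\<Sum>j\<in>freq_box 0 (2 ^ n). Re (char j x * cnj (char j y)))" by (rule sum_mono)
 also have "... = Re (kernel n x y)" by (simp add: kernel_def)
 also have "... \<le> cmod (kernel n x y)" by (rule complex_Re_le_cmod)
 finally show ?thesis using card_freq_box[of 0 "2 ^ n"] by (simp add: square_powers)
qed

lemma measure_ball_le:
 assumes "finite_borel \<nu>"
 shows "measure \<nu> (cball y (1 / (12 * 2 ^ n))) \<le> 4 * ball_bound \<nu> n y / 16 ^ n"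
proof -
 interpret finite_measure \<nu> by (rule finite_borelD[OF assms])
 let ?B = "cball y (1 / (12 * 2 ^ n))"
 have s: "?B \<in> sets \<nu>" using finite_borelD(1)[OF assms] by simp
 have "continuous_on UNIV (%x. (cmod (kernel n x y))\<^sup>2)" unfolding kernel_def by (intro continuous_intros continuous_char)
 then have ii: "integrable \<nu> (%x. (cmod (kernel n x y))\<^sup>2)" by (rule integrable_continuous_torus[OF assms])
 have "16 ^ n / 4 * measure \<nu> ?B = (LINT x|\<nu>. 16 ^ n / 4 * indicator ?B x)" using s by simp
 also have "... \<le> ball_bound \<nu> n y"
  unfolding ball_bound_def
 proof (rule Bochner_Integration.integral_mono[OF _ ii])
  show "integrable \<nu> (%x. (16::real) ^ n / 4 * indicator ?B x)" using s by (simp add: emeasure_eq_measure)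
  fix x
  have "16 ^ n / 4 \<le> (cmod (kernel n x y))\<^sup>2" if "x \<in> ?B"
  proof -
   have "(4 ^ n / 2)\<^sup>2 \<le> (cmod (kernel n x y))\<^sup>2" using that by (intro power_mono kernel_lower) (auto simp: dist_commute)
   moreover have "(4 ^ n / 2 :: real)\<^sup>2 = 16 ^ n / 4" by (simp add: power_divide square_powers)
   ultimately show ?thesis by simp
  qed
  then show "16 ^ n / 4 * indicator ?B x \<le> (cmod (kernel n x y))\<^sup>2" by (simp add: indicator_def)
 qed
 finally show ?thesis by (simp add: field_simps)
qed

text \<open>The mass distribution principle, with the growth condition required only at points of
  \<open>B\<close> and only at dyadic radii.\<close>

lemma frostman_null:
 fixes \<nu> :: "torus measure"
 assumes \<nu>: "finite_borel \<nu>" and s: "s > 0" and C: "C \<ge> 0"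
  and frost: "\<And>y n. y \<in> B ==> measure \<nu> (cball y (1 / (12 * 2 ^ n))) \<le> C * (2 powr (- s)) ^ n"
  and B: "B \<in> sets borel" "B \<subseteq> A" and null: "hausdorff_measure s A = 0"
 shows "measure \<nu> B = 0"
proof -
 interpret finite_measure \<nu> by (rule finite_borelD[OF \<nu>])
 note sb = finite_borelD(1)[OF \<nu>]
 let ?C = "C * 24 powr s"
 have C0: "0 \<le> ?C" using C by simp
 have q: "0 < 2 powr (- s)" "2 powr (- s) < 1" using s by (auto simp: powr_less_one)
 \<comment> \<open>A radius is compared with the dyadic one just above it, which satisfies
   \<open>1 / 2 ^ n < 24 * d\<close>; this is the factor \<open>24 powr s\<close>. Radius zero
   follows by letting \<open>n\<close> grow.\<close>
 have ball: "measure \<nu> (cball y d) \<le> ?C * d powr s" if y: "y \<in> B" and d: "0 \<le> d" "d \<le> 1 / 12" for y d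
 proof (cases "d = 0")
  case True
  have "measure \<nu> (cball y 0) \<le> C * (2 powr (- s)) ^ n" for n
   using frost[OF y, of n] finite_measure_mono[of "cball y 0" "cball y (1 / (12 * 2 ^ n))"] sb by fastforce
  moreover have "(%n. C * (2 powr (- s)) ^ n) \<longlonglongrightarrow> C * 0" using q by (intro tendsto_intros LIMSEQ_power_zero) auto
  ultimately have "measure \<nu> (cball y 0) \<le> 0" by (intro LIMSEQ_le_const) auto
  then show ?thesis using True s by simp
 next
  case False
  then have d0: "0 < d" using d by simp
  obtain m0 where "1 / (12 * d) < 2 ^ m0" using real_arch_pow[of 2 "1 / (12 * d)"] by auto
  then have ex: "1 / (12 * 2 ^ m0) < d" using d0 by (simp add: field_simps)
  define m where "m = (LEAST m. 1 / (12 * 2 ^ m) < d)"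
  have m: "1 / (12 * 2 ^ m) < d" unfolding m_def using ex by (rule LeastI)
  then obtain n where n: "m = Suc n" using d(2) by (cases m) auto
  have "d \<le> 1 / (12 * 2 ^ n)" using not_less_Least[of n "%m. 1 / (12 * 2 ^ m) < d"] n by (simp add: m_def)
  then have "measure \<nu> (cball y d) \<le> measure \<nu> (cball y (1 / (12 * 2 ^ n)))"
   using sb by (intro finite_measure_mono) auto
  also have "... \<le> C * (2 powr (- s)) ^ n" by (rule frost[OF y])
  also have "(2 powr (- s)) ^ n = (1 / 2 ^ n) powr s"
  proof -
   have "1 / 2 ^ n = 2 powr (- real n)" by (simp add: powr_minus_divide powr_realpow)
   then have "(1 / 2 ^ n) powr s = (2 powr (- s)) powr real n" by (simp add: powr_powr mult.commute)
   also have "... = (2 powr (- s)) ^ n" by (rule powr_realpow) simp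
   finally show ?thesis by simp
  qed
  also have "C * (1 / 2 ^ n) powr s \<le> C * (24 * d) powr s"
   using m n s C by (intro mult_left_mono powr_mono2) (auto simp: field_simps)
  finally show ?thesis using d by (simp add: powr_mult)
 qed
 have main: "measure \<nu> B \<le> ?C * e" if e: "e > 0" for e
 proof -
  have "hausdorff_premeasure s (1 / 12) A \<le> hausdorff_measure s A"
   unfolding hausdorff_measure_def by (rule SUP_upper) simp
  then have "hausdorff_premeasure s (1 / 12) A < ennreal e" using null e by simp
  then obtain U :: "nat => torus set" where U: "A \<subseteq> (\<Union>i. U i)" "\<And>i. bounded (U i)" "\<And>i. diameter (U i) \<le> 1 / 12"
   "(\<Sum>i. diam_weight s (U i)) < ennreal e"
   unfolding hausdorff_premeasure_def INF_less_iff by blast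
  \<comment> \<open>The growth condition is available only at points of \<open>B\<close>, so each
    covering set meeting \<open>B\<close> is replaced by a ball around one of its points in
    \<open>B\<close>, with radius the diameter.\<close>
  define y where "y i = (SOME y. y \<in> U i \<inter> B)" for i
  define V where "V i = (if U i \<inter> B = {} then {} else cball (y i) (diameter (U i)))" for i
  have y: "y i \<in> U i \<inter> B" if "U i \<inter> B \<noteq> {}" for i unfolding y_def by (rule someI_ex) (use that in blast)
  have Vs: "V i \<in> sets \<nu>" for i using sb by (simp add: V_def)
  have "B \<subseteq> (\<Union>i. V i)"
  proof
   fix x assume x: "x \<in> B"
   then obtain i where i: "x \<in> U i" using B(2) U(1) by blast
   then have "dist (y i) x \<le> diameter (U i)" using y[of i] x by (intro diameter_bounded_bound U(2)) auto
   then show "x \<in> (\<Union>i. V i)" using i x by (auto simp: V_def)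
  qed
  then have "emeasure \<nu> B \<le> emeasure \<nu> (\<Union>i. V i)" using Vs by (intro emeasure_mono) auto
  also have "... \<le> (\<Sum>i. emeasure \<nu> (V i))" using Vs by (intro emeasure_subadditive_countably) auto
  also have "... \<le> (\<Sum>i. ennreal ?C * diam_weight s (U i))"
  proof (rule suminf_le)
   fix i
   show "emeasure \<nu> (V i) \<le> ennreal ?C * diam_weight s (U i)"
   proof (cases "U i \<inter> B = {}")
    case False
    have "emeasure \<nu> (V i) = ennreal (measure \<nu> (cball (y i) (diameter (U i))))" using False by (simp add: V_def emeasure_eq_measure)
    also have "... \<le> ennreal (?C * diameter (U i) powr s)"
     using y[OF False] U(3)[of i] diameter_ge_0[OF U(2)] by (intro ennreal_leI ball) auto
    also have "... = ennreal ?C * diam_weight s (U i)" using False s C0 by (auto simp: diam_weight_def ennreal_mult)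
    finally show ?thesis .
   qed (simp add: V_def)
  qed auto
  also have "... = ennreal ?C * (\<Sum>i. diam_weight s (U i))" by simp
  also have "... \<le> ennreal ?C * ennreal e" using U(4) by (intro mult_left_mono) auto
  also have "... = ennreal (?C * e)" using C0 e by (simp add: ennreal_mult)
  finally show ?thesis using C0 e by (simp add: emeasure_eq_measure)
 qed
 show ?thesis
 proof (rule ccontr)
  assume "measure \<nu> B \<noteq> 0"
  then have b: "0 < measure \<nu> B" using zero_less_measure_iff by blast
  have "measure \<nu> B \<le> ?C * (measure \<nu> B / (2 * (?C + 1)))" by (rule main) (use b C0 in auto)
  also have "... = ?C / (?C + 1) * (measure \<nu> B / 2)" by simp
  also have "... \<le> 1 * (measure \<nu> B / 2)" using b C0 by (intro mult_right_mono) auto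
  also have "... < measure \<nu> B" using b by simp
  finally show False by simp
 qed
qed

text \<open>The function \<open>H\<close> sums all rescaled ball bounds. The spectral growth makes
  its integral a geometric series of ratio \<open>2 powr (s - 1 - \<alpha>) < 1\<close>, so
  \<open>H\<close> is finite almost everywhere, and the sets where \<open>H \<le> m\<close> exhaust
  \<open>A\<close> up to a null set.\<close>

lemma spectral_null:
 assumes \<nu>: "finite_borel \<nu>" and D: "D \<ge> 0" "\<And>n. spectrum \<nu> n \<le> D * (2 powr (1 - \<alpha>)) ^ n"
  and s: "0 < s" "s < 1 + \<alpha>" and A: "A \<in> sets borel" "hausdorff_measure s A = 0"
 shows "emeasure \<nu> A = 0"
proof -
 interpret finite_measure \<nu> by (rule finite_borelD[OF \<nu>])
 note sb = finite_borelD(1,2)[OF \<nu>]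
 define H where "H y = (\<Sum>n. ennreal ((2 powr s) ^ n * (4 * ball_bound \<nu> n y / 16 ^ n)))" for y
 have bc: "ball_bound \<nu> n \<in> borel_measurable borel" for n by (rule borel_measurable_continuous_onI[OF ball_bound_continuous[OF \<nu>]])
 have Hb: "H \<in> borel_measurable borel" unfolding H_def using bc by measurable
 have Hm: "H \<in> borel_measurable \<nu>" by (rule measurable_finite_borel[OF \<nu> Hb])
 have bm: "ball_bound \<nu> n \<in> borel_measurable \<nu>" for n by (rule measurable_finite_borel[OF \<nu> bc])
 have tm: "(%y. ennreal ((2 powr s) ^ n * (4 * ball_bound \<nu> n y / 16 ^ n))) \<in> borel_measurable \<nu>" for n
  by (intro measurable_compose[OF _ measurable_ennreal] borel_measurable_times borel_measurable_divide borel_measurable_const bm)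
 define x where "x = 2 powr (s - 1 - \<alpha>)"
 have x: "0 < x" "x < 1" using s by (auto simp: x_def powr_less_one)
 have "(\<integral>\<^sup>+y. H y \<partial>\<nu>) = (\<Sum>n. (\<integral>\<^sup>+y. ennreal ((2 powr s) ^ n * (4 * ball_bound \<nu> n y / 16 ^ n)) \<partial>\<nu>))"
  unfolding H_def by (rule nn_integral_suminf[OF tm])
 also have "... \<le> (\<Sum>n. ennreal (4 * D * x ^ n))"
 proof (rule suminf_le)
  fix n
  have ib: "integrable \<nu> (ball_bound \<nu> n)" by (rule integrable_continuous_torus[OF \<nu> ball_bound_continuous[OF \<nu>]])
  have "(\<integral>\<^sup>+y. ennreal ((2 powr s) ^ n * (4 * ball_bound \<nu> n y / 16 ^ n)) \<partial>\<nu>) = ennreal (LINT y|\<nu>. (2 powr s) ^ n * (4 * ball_bound \<nu> n y / 16 ^ n))"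
   using ib by (intro nn_integral_eq_integral) (auto simp: ball_bound_nonneg)
  also have "(LINT y|\<nu>. (2 powr s) ^ n * (4 * ball_bound \<nu> n y / 16 ^ n)) = (2 powr s) ^ n * 4 / 16 ^ n * (LINT y|\<nu>. ball_bound \<nu> n y)"
   by simp
  also have "... \<le> (2 powr s) ^ n * 4 / 16 ^ n * (4 ^ n * (D * (2 powr (1 - \<alpha>)) ^ n))"
   using ball_bound_integral[OF \<nu>, of n] D(2)[of n] by (intro mult_left_mono order_trans[OF ball_bound_integral[OF \<nu>]]) auto
  also have "... = 4 * D * x ^ n"
  proof -
   have "x * 4 = 2 powr (s - 1 - \<alpha>) * 2 powr 2" by (simp add: x_def)
   also have "... = 2 powr (s + (1 - \<alpha>))" unfolding powr_add[symmetric] by (simp add: algebra_simps)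
   also have "... = 2 powr s * 2 powr (1 - \<alpha>)" by (rule powr_add)
   finally have "x = (2 powr s * 2 powr (1 - \<alpha>)) * 4 / 16" by simp
   then have "x ^ n = (2 powr s) ^ n * (2 powr (1 - \<alpha>)) ^ n * 4 ^ n / 16 ^ n" by (simp only: power_mult_distrib power_divide)
   then show ?thesis by simp
  qed
  finally show "(\<integral>\<^sup>+y. ennreal ((2 powr s) ^ n * (4 * ball_bound \<nu> n y / 16 ^ n)) \<partial>\<nu>) \<le> ennreal (4 * D * x ^ n)"
   by (simp add: ennreal_leI)
 qed auto
 also have "... = ennreal (4 * D * (1 / (1 - x)))"
  using D(1) x by (intro suminf_ennreal_eq sums_mult geometric_sums) auto
 finally have "(\<integral>\<^sup>+y. H y \<partial>\<nu>) < top" by (rule order_le_less_trans) simp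
 then have fin: "AE y in \<nu>. H y \<noteq> top" using nn_integral_noteq_infinite[OF Hm] by (simp add: less_top)
 \<comment> \<open>Where \<open>H \<le> m\<close>, every single term is at most \<open>m\<close>,
   which is the growth condition of exponent \<open>s\<close> with constant
   \<open>m\<close>.\<close>
 define B where "B m = A \<inter> {y. H y \<le> ennreal (real m)}" for m :: nat
 have Bs: "B m \<in> sets borel" for m unfolding B_def using A(1) Hb by measurable
 have "measure \<nu> (B m) = 0" for m
 proof (rule frostman_null[OF \<nu> s(1) of_nat_0_le_iff[of m] _ Bs _ A(2)])
  fix y n assume y: "y \<in> B m"
  have "ennreal ((2 powr s) ^ n * (4 * ball_bound \<nu> n y / 16 ^ n)) = (\<Sum>k\<in>{n}. ennreal ((2 powr s) ^ k * (4 * ball_bound \<nu> k y / 16 ^ k)))" by (subst sum.insert) simp_all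
  also have "... \<le> H y" unfolding H_def by (rule sum_le_suminf) auto
  also have "... \<le> ennreal (real m)" using y by (simp add: B_def)
  finally have le: "(2 powr s) ^ n * (4 * ball_bound \<nu> n y / 16 ^ n) \<le> real m" by simp
  have "measure \<nu> (cball y (1 / (12 * 2 ^ n))) \<le> (2 powr (- s)) ^ n * ((2 powr s) ^ n * (4 * ball_bound \<nu> n y / 16 ^ n))"
   using measure_ball_le[OF \<nu>, of y n] unfolding mult.assoc[symmetric] power_mult_distrib[symmetric] by (simp add: powr_add[symmetric])
  also have "... \<le> (2 powr (- s)) ^ n * real m" by (intro mult_left_mono le) simp
  finally show "measure \<nu> (cball y (1 / (12 * 2 ^ n))) \<le> real m * (2 powr (- s)) ^ n" by (simp add: mult.commute)
 qed (auto simp: B_def)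
 then have "B m \<in> null_sets \<nu>" for m using Bs sb by (auto simp: null_sets_def emeasure_eq_measure)
 then have "(\<Union>m. B m) \<in> null_sets \<nu>" by (intro null_sets_UN) auto
 then have "AE y in \<nu>. y \<notin> (\<Union>m. B m)" by (rule AE_not_in)
 then have "AE y in \<nu>. y \<notin> A"
  using fin
 proof eventually_elim
  case (elim y)
  obtain h where "H y = ennreal h" using elim(2) by (metis ennreal_cases)
  moreover obtain m where "h \<le> real m" using real_arch_simple by blast
  ultimately have "H y \<le> ennreal (real m)" by (simp add: ennreal_leI)
  then show ?case using elim(1) by (auto simp: B_def)
 qed
 then show ?thesis using A(1) sb by (simp add: AE_iff_null_sets null_setsD1)
qed

lemma spectral_lower_dim:
 assumes "finite_borel \<nu>" "D \<ge> 0" "\<And>n. spectrum \<nu> n \<le> D * (2 powr (1 - \<alpha>)) ^ n" "\<alpha> > 0"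
 shows "ereal (1 + \<alpha>) \<le> lower_dim \<nu>"
 unfolding lower_dim_def hausdorff_dim_def
proof (intro INF_greatest Inf_greatest)
 fix A x assume "A \<in> {A \<in> sets borel. emeasure \<nu> A > 0}" and "x \<in> {ereal s |s. 0 \<le> s \<and> hausdorff_measure s A = 0}"
 then obtain s where A: "A \<in> sets borel" "emeasure \<nu> A > 0" and s: "x = ereal s" "0 \<le> s" "hausdorff_measure s A = 0" by blast
 \<comment> \<open>In dimension zero every nonempty covering set has weight one, so measure zero
   would force \<open>A\<close> to be empty.\<close>
 have "s \<noteq> 0"
 proof
  assume s0: "s = 0"
  have "hausdorff_premeasure s 1 A \<le> hausdorff_measure s A"
   unfolding hausdorff_measure_def by (rule SUP_upper) simp
  then have "hausdorff_premeasure s 1 A < 1" using s(3) by simp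
  then obtain U :: "nat => torus set" where U: "A \<subseteq> (\<Union>i. U i)" "(\<Sum>i. diam_weight s (U i)) < 1"
   unfolding hausdorff_premeasure_def INF_less_iff by blast
  have "U i = {}" for i
  proof (rule ccontr)
   assume "U i \<noteq> {}"
   then have "1 = (\<Sum>i\<in>{i}. diam_weight s (U i))" by (simp add: diam_weight_def s0)
   also have "... \<le> (\<Sum>i. diam_weight s (U i))" by (rule sum_le_suminf) auto
   finally show False using U(2) by simp
  qed
  then have "A = {}" using U(1) by auto
  then show False using A(2) by simp
 qed
 then have "\<not> s < 1 + \<alpha>" using spectral_null[OF assms(1-3) _ _ A(1), of s] s A(2) by auto
 then show "ereal (1 + \<alpha>) \<le> x" by (simp add: s(1))
qed

section \<open>The upper dimension of the trace\<close>

text \<open>A Lipschitz bound for the logarithm of \<open>f\<close>. The constant does not grow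
  under sums and is kept by inverses, and it adds up under products.\<close>

definition log_lip :: "real => (torus => real) => bool"
 where "log_lip L f \<longleftrightarrow> smooth_space f \<and> (\<forall>p. 0 < f p \<and> norm (tgrad f p) \<le> L * f p)"

lemma tgrad_eqI:
 assumes "smooth_space f" "((%x. f (abs_torus x)) has_derivative (%h. g \<bullet> h)) (at x)"
 shows "tgrad f (abs_torus x) = g"
proof -
 have "tgrad f (abs_torus x) \<bullet> h = g \<bullet> h" for h
  using has_derivative_unique[OF smooth_space_derivative[OF assms(1), of x] assms(2)] by (rule fun_cong)
 then show ?thesis by (metis vector_eq_rdot)
qed

lemma log_lip_const: "c > 0 ==> L \<ge> 0 ==> log_lip L (%_. c)"
 unfolding log_lip_def
proof (intro conjI allI)
 fix p assume "c > 0" "L \<ge> 0"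
 have "tgrad (%_. c) (abs_torus x) = 0" for x by (rule tgrad_eqI[OF smooth_space_const]) simp
 then have "tgrad (%_. c) p = 0" by (induction p rule: torus_induct) simp
 then show "norm (tgrad (%_. c) p) \<le> L * c" using \<open>c > 0\<close> \<open>L \<ge> 0\<close> by simp
qed (auto intro: smooth_space_const)

lemma log_lip_add:
 assumes "log_lip L f" "log_lip L g"
 shows "log_lip L (%p. f p + g p)"
proof -
 have s: "smooth_space f" "smooth_space g" using assms by (auto simp: log_lip_def)
 have "tgrad (%p. f p + g p) (abs_torus x) = tgrad f (abs_torus x) + tgrad g (abs_torus x)" for x
  by (rule tgrad_eqI[OF smooth_space_add[OF s]])
   (auto intro!: derivative_eq_intros smooth_space_derivative s simp: inner_add_left)
 then have "tgrad (%p. f p + g p) p = tgrad f p + tgrad g p" for p by (induction p rule: torus_induct)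
 then show ?thesis using assms unfolding log_lip_def
  by (auto intro!: smooth_space_add add_pos_pos norm_triangle_mono simp: distrib_left)
qed

lemma log_lip_mult:
 assumes "log_lip L f" "log_lip M g"
 shows "log_lip (L + M) (%p. f p * g p)"
proof -
 have s: "smooth_space f" "smooth_space g" using assms by (auto simp: log_lip_def)
 have "tgrad (%p. f p * g p) (abs_torus x) = f (abs_torus x) *\<^sub>R tgrad g (abs_torus x) + g (abs_torus x) *\<^sub>R tgrad f (abs_torus x)" for x
  by (rule tgrad_eqI[OF smooth_space_mult[OF s]])
   (auto intro!: derivative_eq_intros smooth_space_derivative s simp: inner_add_left)
 then have e: "tgrad (%p. f p * g p) p = f p *\<^sub>R tgrad g p + g p *\<^sub>R tgrad f p" for p by (induction p rule: torus_induct)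
 have "norm (tgrad (%p. f p * g p) p) \<le> (L + M) * (f p * g p)" for p
 proof -
  have fg: "0 < f p" "0 < g p" "norm (tgrad f p) \<le> L * f p" "norm (tgrad g p) \<le> M * g p" using assms by (auto simp: log_lip_def)
  then have "norm (f p *\<^sub>R tgrad g p) \<le> f p * (M * g p)" "norm (g p *\<^sub>R tgrad f p) \<le> g p * (L * f p)" by auto
  then show ?thesis unfolding e using norm_triangle_mono by (fastforce simp: algebra_simps)
 qed
 then show ?thesis using assms s by (auto simp: log_lip_def intro!: smooth_space_mult)
qed

lemma log_lip_inverse:
 assumes "log_lip L f"
 shows "log_lip L (%p. inverse (f p))"
proof -
 have s: "smooth_space f" and pos: "\<And>p. 0 < f p" using assms by (auto simp: log_lip_def)
 note si = smooth_space_inverse[OF s pos]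
 have "tgrad (%p. inverse (f p)) (abs_torus x) = - ((inverse (f (abs_torus x)))\<^sup>2 *\<^sub>R tgrad f (abs_torus x))" for x
  using pos[of "abs_torus x"]
  by (intro tgrad_eqI[OF si]) (auto intro!: derivative_eq_intros smooth_space_derivative s simp: power2_eq_square)
 then have e: "tgrad (%p. inverse (f p)) p = - ((inverse (f p))\<^sup>2 *\<^sub>R tgrad f p)" for p by (induction p rule: torus_induct)
 have "norm (tgrad (%p. inverse (f p)) p) \<le> L * inverse (f p)" for p
 proof -
  have "norm (tgrad f p) \<le> L * f p" using assms by (auto simp: log_lip_def)
  then have "(inverse (f p))\<^sup>2 * norm (tgrad f p) \<le> (inverse (f p))\<^sup>2 * (L * f p)" by (intro mult_left_mono) auto
  also have "... = L * inverse (f p)" using pos[of p] by (simp add: power2_eq_square field_simps)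
  finally show ?thesis by (simp add: e)
 qed
 then show ?thesis using si pos by (auto simp: log_lip_def)
qed

lemma log_lip_power: "log_lip L f ==> log_lip (real n * L) (%p. f p ^ n)"
proof (induction n)
 case (Suc n)
 from log_lip_mult[OF Suc.prems Suc.IH[OF Suc.prems]] show ?case by (simp add: distrib_right)
qed (simp add: log_lip_const)

lemma log_lip_sum:
 assumes "finite A" "A \<noteq> {}" "\<And>i. i \<in> A ==> log_lip L (f i)"
 shows "log_lip L (%p. \<Sum>i\<in>A. f i p)"
 using assms by (induction rule: finite_ne_induct) (auto intro: log_lip_add)

text \<open>With \<open>S = tdist2\<close> the gradient is at most
  \<open>2 \<pi> sqrt S / r\<^sup>2\<close>, and \<open>2 sqrt S / r \<le> 1 + S / r\<^sup>2\<close>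
  compares it with the function itself.\<close>

lemma log_lip_tdist2:
 assumes "r > 0"
 shows "log_lip (pi / r) (%p. 1 + tdist2 p q * (1 / r\<^sup>2))"
proof -
 obtain y where y: "q = abs_torus y" by (metis abs_torus_rep)
 have s: "smooth_space (%p. 1 + tdist2 p q * (1 / r\<^sup>2))"
  by (intro smooth_space_add smooth_space_mult smooth_space_const smooth_space_tdist2)
 have "norm (tgrad (%p. 1 + tdist2 p q * (1 / r\<^sup>2)) (abs_torus x)) \<le> pi / r * (1 + tdist2 (abs_torus x) q * (1 / r\<^sup>2))" for x
 proof -
  define S where "S = tdist2 (abs_torus x) q"
  let ?t = "%i. pi * (x $ i - y $ i)"
  define g :: "real^2" where "g = (\<chi> i. 2 * pi * (sin (?t i) * cos (?t i)))"
  have "((%x. 1 + (\<Sum>i\<in>UNIV. (sin (pi * (x $ i - y $ i)))\<^sup>2) * (1 / r\<^sup>2)) has_derivative (%h. ((1 / r\<^sup>2) *\<^sub>R g) \<bullet> h)) (at x)"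
   using assms by (auto intro!: derivative_eq_intros bounded_linear.has_derivative[OF bounded_linear_vec_nth]
     simp: fun_eq_iff g_def inner_vec_def sum_2 algebra_simps power2_eq_square)
  then have e: "tgrad (%p. 1 + tdist2 p q * (1 / r\<^sup>2)) (abs_torus x) = (1 / r\<^sup>2) *\<^sub>R g"
   by (intro tgrad_eqI[OF s]) (simp only: y tdist2_abs)
  have "(norm g)\<^sup>2 = (\<Sum>i\<in>UNIV. (2 * pi)\<^sup>2 * ((sin (?t i))\<^sup>2 * (cos (?t i))\<^sup>2))"
   unfolding power2_norm_eq_inner inner_vec_def g_def by (simp add: power2_eq_square mult_ac)
  also have "... \<le> (\<Sum>i\<in>UNIV. (2 * pi)\<^sup>2 * ((sin (?t i))\<^sup>2 * 1))"
   by (intro sum_mono mult_left_mono) (auto simp: abs_square_le_1)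
  also have "... = (2 * pi * sqrt S)\<^sup>2" by (simp add: S_def y tdist2_abs power_mult_distrib sum_distrib_left sum_nonneg)
  finally have "norm g \<le> 2 * pi * sqrt S" by (rule power2_le_imp_le) (simp add: S_def)
  then have "norm ((1 / r\<^sup>2) *\<^sub>R g) \<le> 1 / r\<^sup>2 * (2 * pi * sqrt S)" by (simp add: divide_right_mono)
  also have "... \<le> pi / r * (1 + S * (1 / r\<^sup>2))"
  proof -
   have "0 \<le> (1 - sqrt S / r)\<^sup>2" by simp
   also have "... = 1 + S * (1 / r\<^sup>2) - 2 * (sqrt S / r)" by (simp add: power2_diff power_divide S_def)
   finally have "2 * (sqrt S / r) \<le> 1 + S * (1 / r\<^sup>2)" by simp
   then have "pi / r * (2 * (sqrt S / r)) \<le> pi / r * (1 + S * (1 / r\<^sup>2))" using assms by (intro mult_left_mono) auto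
   then show ?thesis by (simp add: power2_eq_square field_simps)
  qed
  finally show ?thesis unfolding e S_def .
 qed
 then have "norm (tgrad (%p. 1 + tdist2 p q * (1 / r\<^sup>2)) p) \<le> pi / r * (1 + tdist2 p q * (1 / r\<^sup>2))" for p
  by (induction p rule: torus_induct)
 then show ?thesis using s by (auto simp: log_lip_def intro!: add_pos_nonneg)
qed

text \<open>A smooth function that is small at the points of \<open>X\<close>, close to one away from them, and whose
 gradient bound does not involve the number of points.\<close>

lemma cutoff_function:
 assumes X: "finite X" "X \<noteq> {}" and pos: "r > 0" "M > 0" "R > 0" and small: "M * real (card X) * (r / R) ^ (2 * q) \<le> 1"
 obtains \<phi> where "smooth_space \<phi>" "\<And>p. 0 \<le> \<phi> p" "\<And>p. \<phi> p \<le> 1" "\<And>p. norm (tgrad \<phi> p) \<le> real q * (pi / r)"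
  "\<And>p. p \<in> X ==> \<phi> p \<le> 1 / M" "\<And>p. (\<And>x. x \<in> X ==> R \<le> dist p x) ==> 1 / 2 \<le> \<phi> p"
proof -
 define u where "u x p = 1 + tdist2 p x * (1 / r\<^sup>2)" for x p
 \<comment> \<open>A bump around \<open>x\<close> equal to one at \<open>x\<close> and at most
   \<open>(r / R) ^ (2 * q)\<close> beyond distance \<open>R\<close>; a large \<open>q\<close> lets
   the decay beat the number of points.\<close>
 define h where "h x p = inverse (u x p) ^ q" for x p
 define F where "F p = (\<Sum>x\<in>X. h x p)" for p
 define \<phi> where "\<phi> p = inverse (1 + M * F p)" for p
 have u1: "1 \<le> u x p" for x p by (simp add: u_def)
 then have h0: "0 < h x p" for x p using order.strict_trans2[OF zero_less_one u1] by (auto simp: h_def)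
 have "log_lip (real q * (pi / r)) (h x)" for x
  unfolding h_def u_def by (intro log_lip_power log_lip_inverse log_lip_tdist2 pos)
 then have "log_lip (real q * (pi / r)) F" unfolding F_def by (intro log_lip_sum X)
 moreover have "log_lip 0 (%_. M)" using pos by (intro log_lip_const) auto
 ultimately have "log_lip (0 + real q * (pi / r)) (%p. M * F p)" by (intro log_lip_mult)
 then have ll: "log_lip (real q * (pi / r)) \<phi>"
  unfolding \<phi>_def using pos by (intro log_lip_inverse log_lip_add log_lip_const) auto
 have F0: "0 \<le> F p" for p unfolding F_def using h0 by (intro sum_nonneg less_imp_le)
 have "1 \<le> 1 + M * F p" for p using F0 pos by simp
 then have b: "0 \<le> \<phi> p" "\<phi> p \<le> 1" for p
  using order_trans[OF zero_le_one] by (auto simp: \<phi>_def inverse_le_1_iff)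
 show thesis
 proof (rule that[of \<phi>])
  show "smooth_space \<phi>" using ll by (simp add: log_lip_def)
  show "0 \<le> \<phi> p" "\<phi> p \<le> 1" for p by (rule b)+
  show "norm (tgrad \<phi> p) \<le> real q * (pi / r)" for p
  proof -
   have "norm (tgrad \<phi> p) \<le> real q * (pi / r) * \<phi> p" using ll by (simp add: log_lip_def)
   also have "... \<le> real q * (pi / r) * 1" using pos by (intro mult_left_mono b) auto
   finally show ?thesis by simp
  qed
  show "\<phi> p \<le> 1 / M" if "p \<in> X" for p
  proof -
   have "h p p \<le> F p" unfolding F_def using h0 X that by (intro member_le_sum) (auto intro: less_imp_le)
   then have "M * 1 \<le> M * F p" using pos by (intro mult_left_mono) (auto simp: h_def u_def)
   then have "M \<le> 1 + M * F p" by simp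
   then show ?thesis unfolding \<phi>_def using pos by (simp add: inverse_eq_divide frac_le)
  qed
  show "1 / 2 \<le> \<phi> p" if far: "\<And>x. x \<in> X ==> R \<le> dist p x" for p
  proof -
   have "h x p \<le> (r / R) ^ (2 * q)" if x: "x \<in> X" for x
   proof -
    have "R\<^sup>2 \<le> (dist p x)\<^sup>2" using far[OF x] pos by (intro power_mono) auto
    also have "... \<le> tdist2 p x" using dist_le_tdist2[of p x] zero_le_power2[of "dist p x"] by linarith
    finally have "R\<^sup>2 * (1 / r\<^sup>2) \<le> u x p" unfolding u_def using mult_right_mono[of "R\<^sup>2" "tdist2 p x" "1 / r\<^sup>2"] by simp
    then have "inverse (u x p) \<le> inverse (R\<^sup>2 * (1 / r\<^sup>2))" using pos by (intro le_imp_inverse_le) auto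
    also have "... = (r / R)\<^sup>2" by (simp add: power_divide)
    finally show ?thesis unfolding h_def power_mult using u1[of x p] by (intro power_mono) auto
   qed
   then have "F p \<le> (\<Sum>x\<in>X. (r / R) ^ (2 * q))" unfolding F_def by (rule sum_mono)
   then have "M * F p \<le> M * (real (card X) * (r / R) ^ (2 * q))" using pos by (intro mult_left_mono) auto
   then have "1 + M * F p \<le> 2" using small by (simp add: mult.assoc)
   moreover have "0 < 1 + M * F p" using F0[of p] pos by (simp add: add_pos_nonneg)
   ultimately show ?thesis unfolding \<phi>_def by (simp add: inverse_eq_divide frac_le)
  qed
 qed
qed

text \<open>One time in the strip has at most about average perimeter. Transport from there to
  \<open>T\<close> costs the gradient bound times the integral of \<open>|v|\<close> over the strip,
  which the kinetic energy and the mass \<open>\<epsilon>\<close> of the strip control.\<close>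

lemma good_slice:
 assumes \<mu>: "\<mu> \<in> competitors T" and T: "T > 0" "0 < \<epsilon>" "\<epsilon> < T" and C: "C \<ge> 0"
  and I: "irrigation_energy T \<mu> (T - \<epsilon>) T \<le> ennreal (C * \<epsilon> powr \<beta>)"
 obtains t where "t \<in> {-T..T}" "purely_atomic (slice T \<mu> t)" "perimeter (slice T \<mu> t) \<le> ennreal (2 * (C + 1) * \<epsilon> powr (\<beta> - 1))"
  "\<And>f L. smooth_space f ==> (\<And>p. norm (tgrad f p) \<le> L) ==>
   (LINT p|slice T \<mu> T. f p) \<le> (LINT p|slice T \<mu> t. f p) + L * ((C + 2) * \<epsilon> powr ((1 + \<beta>) / 2))"
proof -
 note c = competitor_slice[OF \<mu> T(1)]
 let ?J = "{T - \<epsilon><..<T}" and ?A = "{T - \<epsilon><..<T} \<times> (UNIV :: torus set)"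
 \<comment> \<open>The energy is an infimum over fluxes; replacing \<open>C\<close> by
   \<open>C + 1\<close> gives a strict inequality from which one flux can be extracted.\<close>
 define X where "X = (C + 1) * \<epsilon> powr \<beta>"
 have X0: "0 < X" "C * \<epsilon> powr \<beta> < X" using C T(2) by (simp_all add: X_def distrib_right add_nonneg_pos)
 from order_le_less_trans[OF I ennreal_lessI[OF X0]] obtain m where m: "m \<in> fluxes T \<mu>" "perim_energy T \<mu> (T - \<epsilon>) T + kin_energy \<mu> m (T - \<epsilon>) T < ennreal X"
  unfolding irrigation_energy_alt INF_less_iff by blast
 have per: "perim_energy T \<mu> (T - \<epsilon>) T \<le> ennreal X" by (rule order_trans[OF _ less_imp_le[OF m(2)]]) simp
 have kin: "kin_energy \<mu> m (T - \<epsilon>) T \<le> ennreal X" by (rule order_trans[OF _ less_imp_le[OF m(2)]]) simp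
 define Y where "Y = 2 * (C + 1) * \<epsilon> powr (\<beta> - 1)"
 have "Y * \<epsilon> = 2 * (C + 1) * (\<epsilon> * \<epsilon> powr (\<beta> - 1))" by (simp add: Y_def)
 then have YX: "Y * \<epsilon> = 2 * X" using T(2) powr_mult_base[of \<epsilon> "\<beta> - 1"] by (simp add: X_def)
 have XY: "0 < X" "0 < Y" using X0 T(2) C by (auto simp: Y_def)
 have "\<exists>t\<in>?J. purely_atomic (slice T \<mu> t) \<and> perimeter (slice T \<mu> t) \<le> ennreal Y"
 proof (rule ccontr)
  assume no: "\<not> ?thesis"
  \<comment> \<open>If the perimeter exceeded \<open>Y\<close> at almost every time of the strip,
    its integral would be at least \<open>Y * \<epsilon> = 2 * X\<close>, twice the available
    energy.\<close>
  have "ennreal (2 * X) = (\<integral>\<^sup>+t. ennreal Y * indicator ?J t \<partial>lborel)"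
   using T XY by (simp add: nn_integral_cmult_indicator ennreal_mult[symmetric] YX)
  also have "... \<le> perim_energy T \<mu> (T - \<epsilon>) T"
   unfolding perim_energy_def
  proof (rule nn_integral_mono_AE)
   show "AE t in lborel. ennreal Y * indicator ?J t \<le> perimeter (disintegration T \<mu> t) * indicator ?J t"
    using c(9,10) unfolding AE_lborel_I
   proof eventually_elim
    case (elim t)
    show ?case
    proof (cases "t \<in> ?J")
     case True
     then have "t \<in> {-T<..<T}" using T by auto
     then show ?thesis using True elim no by (auto simp: not_le less_imp_le)
    qed simp
   qed
  qed
  also note per
  finally show False using XY by simp
 qed
 then obtain t where t: "t \<in> ?J" "purely_atomic (slice T \<mu> t)" "perimeter (slice T \<mu> t) \<le> ennreal Y" by blast
 define b where "b = (1 + \<beta>) / 2"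
 define v where "v = vector_RN_deriv \<mu> m"
 have v: "integrable \<mu> v" unfolding v_def by (rule flux_integrable[OF m(1) c(2)])
 have sp: "space \<mu> = QT T" using sets_eq_imp_space_eq[OF c(1)] by simp
 have As: "?A \<in> sets \<mu>" using T unfolding c(1) sets_borel_QT by (auto simp: QT_def intro!: borel_open open_Times)
 have mA: "emeasure \<mu> ?A = ennreal \<epsilon>" using time_strip_mass[OF \<mu> T(1,2)] T by simp
 \<comment> \<open>The weight in \<open>|v| \<le> c0 + |v|\<^sup>2 / c0\<close>. This value gives
   both \<open>c0 * \<epsilon>\<close> and \<open>\<epsilon>^\<beta> / c0\<close> the order
   \<open>\<epsilon>^((1+\<beta>)/2)\<close>.\<close>
 define c0 where "c0 = \<epsilon> powr ((\<beta> - 1) / 2)"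
 have c0: "0 < c0" "c0 * \<epsilon> = \<epsilon> powr b" "X / c0 = (C + 1) * \<epsilon> powr b"
 proof -
  show "0 < c0" using T(2) by (simp add: c0_def)
  have b: "b = 1 + (\<beta> - 1) / 2" "b = \<beta> - (\<beta> - 1) / 2" by (simp_all add: b_def field_simps)
  show "c0 * \<epsilon> = \<epsilon> powr b" unfolding b(1) c0_def using powr_mult_base[of \<epsilon> "(\<beta> - 1) / 2"] T(2) by (simp add: mult.commute)
  show "X / c0 = (C + 1) * \<epsilon> powr b" unfolding b(2) c0_def X_def powr_diff by simp
 qed
 have iv: "integrable \<mu> (%z. indicator ?A z * norm (v z))" using integrable_mult_indicator[OF As integrable_norm[OF v]] by simp
 have v1: "(LINT z|\<mu>. indicator ?A z * norm (v z)) \<le> (C + 2) * \<epsilon> powr b"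
 proof -
  have "ennreal (LINT z|\<mu>. indicator ?A z * norm (v z)) = (\<integral>\<^sup>+z. ennreal (indicator ?A z * norm (v z)) \<partial>\<mu>)"
   by (rule nn_integral_eq_integral[symmetric, OF iv]) simp
  also have "... \<le> (\<integral>\<^sup>+z. ennreal c0 * indicator ?A z + ennreal (1 / c0) * (ennreal ((norm (v z))\<^sup>2) * indicator ?A z) \<partial>\<mu>)"
  proof (rule nn_integral_mono)
   fix z
   have "0 \<le> (c0 - norm (v z))\<^sup>2" by simp
   then have "2 * c0 * norm (v z) \<le> c0\<^sup>2 + (norm (v z))\<^sup>2" by (simp add: power2_diff)
   then have "2 * c0 * norm (v z) / c0 \<le> (c0\<^sup>2 + (norm (v z))\<^sup>2) / c0" using c0(1) by (intro divide_right_mono) auto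
   then have "2 * norm (v z) \<le> c0 + (norm (v z))\<^sup>2 / c0" using c0(1) by (simp add: add_divide_distrib power2_eq_square)
   then have "norm (v z) \<le> c0 + (norm (v z))\<^sup>2 / c0" using norm_ge_zero[of "v z"] by linarith
   then have "norm (v z) \<le> c0 + 1 / c0 * (norm (v z))\<^sup>2" by simp
   then have "ennreal (norm (v z)) \<le> ennreal c0 + ennreal (1 / c0) * ennreal ((norm (v z))\<^sup>2)"
    using c0(1) by (simp add: ennreal_leI flip: ennreal_mult ennreal_plus)
   then show "ennreal (indicator ?A z * norm (v z)) \<le> ennreal c0 * indicator ?A z + ennreal (1 / c0) * (ennreal ((norm (v z))\<^sup>2) * indicator ?A z)"
    by (cases "z \<in> ?A") auto
  qed
  also have "... = ennreal c0 * emeasure \<mu> ?A + ennreal (1 / c0) * kin_energy \<mu> m (T - \<epsilon>) T"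
   using As v unfolding kin_energy_def v_def[symmetric]
   by (subst nn_integral_add) (auto simp: nn_integral_cmult nn_integral_cmult_indicator)
  also have "... \<le> ennreal c0 * ennreal \<epsilon> + ennreal (1 / c0) * ennreal X" unfolding mA by (intro add_left_mono mult_left_mono kin) auto
  also have "... = ennreal ((C + 2) * \<epsilon> powr b)"
   using c0 X0 T(2) C by (simp add: distrib_right flip: ennreal_mult ennreal_plus)
  finally show ?thesis using C by simp
 qed
 have tt: "t \<in> {-T..T}" "T \<in> {-T..T}" using t(1) T by auto
 show thesis
 proof (rule that[OF tt(1) t(2)])
  show "perimeter (slice T \<mu> t) \<le> ennreal (2 * (C + 1) * \<epsilon> powr (\<beta> - 1))" using t(3) by (simp add: Y_def)
  fix f L assume f: "smooth_space f" "\<And>p. norm (tgrad f p) \<le> L"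
  have L0: "0 \<le> L" using f(2)[of undefined] norm_ge_zero order_trans by blast
  let ?k = "%z. tgrad f (snd z) \<bullet> v z"
  have ik: "integrable \<mu> ?k" unfolding v_def by (rule integrable_tgrad_flux[OF m(1) c(2,1) f(1)])
  have ms: "{z \<in> space \<mu>. fst z \<le> s} \<in> sets \<mu>" for s
  proof -
   have "{z :: real \<times> torus. fst z \<le> s} \<in> sets borel" by (intro borel_closed closed_Collect_le continuous_intros)
   then show ?thesis unfolding c(1) sp sets_borel_QT by (auto simp: Collect_conj_eq intro!: sets.Int[OF borel_open[OF open_QT]])
  qed
  have ind: "integrable \<mu> (%z. indicator {z. fst z \<le> s} z * ?k z)" for s
  proof -
   have "integrable \<mu> (%z. indicator {z \<in> space \<mu>. fst z \<le> s} z * ?k z)" using integrable_mult_indicator[OF ms ik] by simp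
   then show ?thesis by (rule Bochner_Integration.integrable_cong[THEN iffD1, rotated 2]) (auto simp: indicator_def)
  qed
  have "(LINT p|slice T \<mu> T. f p) - (LINT p|slice T \<mu> t. f p) = flow T \<mu> m f T - flow T \<mu> m f t"
   by (rule slice_transport[OF \<mu> T(1) m(1) f(1) tt])
  also have "... = (LINT z|\<mu>. indicator {z. fst z \<le> T} z * ?k z - indicator {z. fst z \<le> t} z * ?k z)"
   unfolding flow_def v_def[symmetric] by (rule Bochner_Integration.integral_diff[OF ind ind, symmetric])
  also have "... \<le> (LINT z|\<mu>. L * (indicator ?A z * norm (v z)))"
  proof (rule Bochner_Integration.integral_mono)
   show "integrable \<mu> (%z. indicator {z. fst z \<le> T} z * ?k z - indicator {z. fst z \<le> t} z * ?k z)" using ind by simp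
   show "integrable \<mu> (%z. L * (indicator ?A z * norm (v z)))" using iv by simp
   fix z assume z: "z \<in> space \<mu>"
   have "?k z \<le> norm (tgrad f (snd z)) * norm (v z)" by (rule norm_cauchy_schwarz)
   also have "... \<le> L * norm (v z)" by (intro mult_right_mono f) auto
   finally show "indicator {z. fst z \<le> T} z * ?k z - indicator {z. fst z \<le> t} z * ?k z \<le> L * (indicator ?A z * norm (v z))"
    using z t(1) L0 unfolding sp by (auto simp: indicator_def QT_def)
  qed
  also have "... \<le> L * ((C + 2) * \<epsilon> powr b)" using v1 L0 by (simp add: mult_left_mono)
  finally show "(LINT p|slice T \<mu> T. f p) \<le> (LINT p|slice T \<mu> t. f p) + L * ((C + 2) * \<epsilon> powr ((1 + \<beta>) / 2))"
   by (simp add: b_def)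
 qed
qed

text \<open>Atoms with square root of mass at least \<open>\<theta>\<close> number at most
  \<open>P / \<theta>\<close>. On the others the mass is at most \<open>\<theta>\<close> times its
  square root, and these sum to at most \<open>\<theta> * P\<close>.\<close>

lemma heavy_atoms:
 assumes \<sigma>: "finite_borel \<sigma>" "purely_atomic \<sigma>" and P: "perimeter \<sigma> \<le> ennreal P" "P \<ge> 0" and \<theta>: "\<theta> > 0"
 obtains X where "finite X" "real (card X) \<le> P / \<theta>" "measure \<sigma> (UNIV - X) \<le> \<theta> * P"
proof -
 interpret finite_measure \<sigma> by (rule finite_borelD[OF \<sigma>(1)])
 note sb = finite_borelD(1,2)[OF \<sigma>(1)]
 let ?s = "%x. sqrt (measure \<sigma> {x})"
 have fin: "sum ?s F \<le> P" if "finite F" for F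
 proof -
  have "ennreal (sum ?s F) = (\<integral>\<^sup>+x. ennreal (?s x) \<partial>count_space F)"
   using that by (simp add: nn_integral_count_space_finite sum_ennreal)
  also have "... \<le> perimeter \<sigma>"
   unfolding perimeter_nn_integral nn_integral_count_space_indicator[of F, simplified] by (intro nn_integral_mono) (simp add: indicator_def)
  also note P(1)
  finally show ?thesis using P(2) by simp
 qed
 define X where "X = {x. \<theta> \<le> ?s x}"
 have card: "real (card F) \<le> P / \<theta>" if "finite F" "F \<subseteq> X" for F
 proof -
  have "real (card F) * \<theta> \<le> sum ?s F" using sum_mono[of F "%_. \<theta>" ?s] that(2) by (auto simp: X_def)
  then show ?thesis using fin[OF that(1)] \<theta> by (simp add: pos_le_divide_eq)
 qed
 have fX: "finite X"
 proof (rule ccontr)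
  assume "infinite X"
  then obtain F where "F \<subseteq> X" "finite F" "card F = Suc (nat \<lceil>P / \<theta>\<rceil>)" using infinite_arbitrarily_large by blast
  then show False using card[of F] real_nat_ceiling_ge[of "P / \<theta>"] by linarith
 qed
 obtain Z where Z: "countable Z" "emeasure \<sigma> (UNIV - Z) = 0" using \<sigma> purely_atomic_iff by blast
 have Zs: "Z \<in> sets borel" by (rule sets.countable) (use Z in auto)
 have Xs: "X \<in> sets borel" using fX by (auto intro: borel_closed finite_imp_closed)
 have "emeasure \<sigma> (UNIV - X) \<le> emeasure \<sigma> ((Z - X) \<union> (UNIV - Z))"
  using sb Zs Xs by (intro emeasure_mono) auto
 also have "... \<le> emeasure \<sigma> (Z - X) + emeasure \<sigma> (UNIV - Z)"
  using sb Zs Xs by (intro emeasure_subadditive) auto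
 also have "... = (\<integral>\<^sup>+x. emeasure \<sigma> {x} \<partial>count_space (Z - X))"
  unfolding Z(2) add_0_right by (rule emeasure_countable_singleton) (use Z sb in auto)
 also have "... \<le> (\<integral>\<^sup>+x. ennreal \<theta> * ennreal (?s x) \<partial>count_space (Z - X))"
 proof (rule nn_integral_mono)
  fix x assume "x \<in> space (count_space (Z - X))"
  then have "?s x * ?s x \<le> \<theta> * ?s x" by (intro mult_right_mono) (auto simp: X_def)
  then show "emeasure \<sigma> {x} \<le> ennreal \<theta> * ennreal (?s x)"
   using \<theta> by (simp add: emeasure_eq_measure ennreal_leI flip: ennreal_mult)
 qed
 also have "... \<le> ennreal \<theta> * perimeter \<sigma>"
  unfolding perimeter_nn_integral nn_integral_count_space_indicator[of "Z - X", simplified]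
  by (subst nn_integral_cmult[symmetric]) (auto intro!: nn_integral_mono simp: indicator_def)
 also have "... \<le> ennreal (\<theta> * P)" using P \<theta> by (simp add: ennreal_mult mult_left_mono)
 finally have "measure \<sigma> (UNIV - X) \<le> \<theta> * P" using \<theta> P(2) by (simp add: emeasure_eq_measure)
 then show thesis using that[OF fX card[OF fX order_refl]] by blast
qed

text \<open>At time \<open>T - \<epsilon>\<close> most of the mass sits in few atoms, and it travels a distance of order
 \<open>\<epsilon>\<^sup>b\<close> up to time \<open>T\<close>.\<close>

lemma trace_concentration:
 assumes \<mu>: "\<mu> \<in> competitors T" and T: "T > 0" and C: "C \<ge> 0" and \<delta>: "\<delta> > 0" and \<beta>: "\<beta> < 1"
  and I: "\<And>\<epsilon>. 0 < \<epsilon> ==> \<epsilon> < \<delta> ==> irrigation_energy T \<mu> (T - \<epsilon>) T \<le> ennreal (C * \<epsilon> powr \<beta>)" and \<eta>: "\<eta> > 0"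
 obtains K \<epsilon>0 where "K \<ge> 0" "\<epsilon>0 > 0" "\<And>\<epsilon>. 0 < \<epsilon> ==> \<epsilon> < \<epsilon>0 ==> \<exists>X. finite X \<and> real (card X) \<le> K * \<epsilon> powr (- (2 * (1 - \<beta>) + \<eta>)) \<and>
   measure (slice T \<mu> T) (UNIV - (\<Union>x\<in>X. ball x (\<epsilon> powr ((1 + \<beta>) / 2 - 2 * \<eta>)))) \<le> K * \<epsilon> powr \<eta>"
proof -
 define a b where "a = 1 - \<beta>" and "b = (1 + \<beta>) / 2"
 have a: "a > 0" using \<beta> by (simp add: a_def)
 \<comment> \<open>Large enough that \<open>(r / R) ^ (2 * q)\<close> compensates the number of
   atoms and the factor \<open>M\<close> with a power \<open>2 * \<eta>\<close> of
   \<open>\<epsilon>\<close> to spare.\<close>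
 define q where "q = 2 + nat \<lceil>a / \<eta>\<rceil>"
 have q: "2 * a + 2 * \<eta> \<le> 2 * real q * \<eta> - 2 * \<eta>"
 proof -
  have "a / \<eta> \<le> real (nat \<lceil>a / \<eta>\<rceil>)" by (rule real_nat_ceiling_ge)
  then have "a \<le> real (nat \<lceil>a / \<eta>\<rceil>) * \<eta>" using \<eta> by (simp add: pos_divide_le_eq)
  then show ?thesis by (simp add: q_def algebra_simps)
 qed
 define K1 where "K1 = 2 * (C + 1)"
 have K1: "K1 \<ge> 1" using C by (simp add: K1_def)
 define K where "K = 2 * (K1 + 1 + real q * pi * (C + 2))"
 have K: "K \<ge> K1" "K \<ge> 0" using K1 C by (auto simp: K_def)
 \<comment> \<open>The last entry makes \<open>K1 * \<epsilon> powr (2 * \<eta>) \<le> 1\<close>, so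
   the spare power absorbs the constant.\<close>
 define \<epsilon>0 where "\<epsilon>0 = min (min \<delta> T) (min 1 ((1 / K1) powr (1 / (2 * \<eta>))))"
 have "\<epsilon>0 > 0" using \<delta> T K1 by (auto simp: \<epsilon>0_def)
 moreover have "\<exists>X. finite X \<and> real (card X) \<le> K * \<epsilon> powr (- (2 * a + \<eta>)) \<and>
   measure (slice T \<mu> T) (UNIV - (\<Union>x\<in>X. ball x (\<epsilon> powr (b - 2 * \<eta>)))) \<le> K * \<epsilon> powr \<eta>" if \<epsilon>: "0 < \<epsilon>" "\<epsilon> < \<epsilon>0" for \<epsilon>
 proof -
  have \<epsilon>': "\<epsilon> < \<delta>" "\<epsilon> < T" "\<epsilon> < 1" "\<epsilon> < (1 / K1) powr (1 / (2 * \<eta>))" using \<epsilon> by (auto simp: \<epsilon>0_def)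
  have small: "K1 * \<epsilon> powr (2 * \<eta>) \<le> 1"
  proof -
   have "\<epsilon> powr (2 * \<eta>) \<le> ((1 / K1) powr (1 / (2 * \<eta>))) powr (2 * \<eta>)" using \<epsilon> \<epsilon>'(4) \<eta> by (intro powr_mono2) auto
   also have "... = 1 / K1" using \<eta> K1 by (simp add: powr_powr)
   finally show ?thesis using K1 by (simp add: field_simps)
  qed
  obtain t where t: "t \<in> {-T..T}" "purely_atomic (slice T \<mu> t)" "perimeter (slice T \<mu> t) \<le> ennreal (K1 * \<epsilon> powr (- a))"
   and tr: "\<And>f L. smooth_space f ==> (\<And>p. norm (tgrad f p) \<le> L) ==>
    (LINT p|slice T \<mu> T. f p) \<le> (LINT p|slice T \<mu> t. f p) + L * ((C + 2) * \<epsilon> powr b)"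
   using good_slice[OF \<mu> T \<epsilon>(1) \<epsilon>'(2) C I[OF \<epsilon>(1) \<epsilon>'(1)]] unfolding K1_def a_def b_def minus_diff_eq by blast
  let ?\<sigma> = "slice T \<mu> t" and ?\<nu> = "slice T \<mu> T"
  have TT: "T \<in> {-T..T}" using T by simp
  note c = competitor_slice(7,8)[OF \<mu> T]
  interpret s: finite_measure ?\<sigma> by (rule finite_borelD[OF c(1)[OF t(1)]])
  interpret n: finite_measure ?\<nu> by (rule finite_borelD[OF c(1)[OF TT]])
  note ss = finite_borelD(1,2)[OF c(1)[OF t(1)]] and sn = finite_borelD(1,2)[OF c(1)[OF TT]]
  \<comment> \<open>The threshold \<open>\<epsilon> powr (a + \<eta>)\<close> loses a factor
    \<open>\<epsilon> powr (- \<eta>)\<close> in the number of atoms in order that the light atoms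
    carry mass of order \<open>\<epsilon> powr \<eta>\<close>.\<close>
  obtain X0 where X0: "finite X0" "real (card X0) \<le> K1 * \<epsilon> powr (- a) / \<epsilon> powr (a + \<eta>)"
   "measure ?\<sigma> (UNIV - X0) \<le> \<epsilon> powr (a + \<eta>) * (K1 * \<epsilon> powr (- a))"
   using heavy_atoms[OF c(1)[OF t(1)] t(2,3), of "\<epsilon> powr (a + \<eta>)"] K1 \<epsilon>(1) by auto
  have cX0: "real (card X0) \<le> K1 * \<epsilon> powr (- (2 * a + \<eta>))"
  proof -
   have "\<epsilon> powr (- a) / \<epsilon> powr (a + \<eta>) = \<epsilon> powr (- (2 * a + \<eta>))" unfolding powr_diff[symmetric] by (simp add: algebra_simps)
   then show ?thesis using X0(2) by (metis times_divide_eq_right)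
  qed
  have mX0: "measure ?\<sigma> (UNIV - X0) \<le> K1 * \<epsilon> powr \<eta>"
  proof -
   have "\<epsilon> powr (a + \<eta>) * \<epsilon> powr (- a) = \<epsilon> powr \<eta>" unfolding powr_add[symmetric] by simp
   then show ?thesis using X0(3) by (metis mult.left_commute)
  qed
  have pow1: "1 \<le> \<epsilon> powr (- (2 * a + \<eta>))" using \<epsilon>(1) \<epsilon>'(3) a \<eta> powr_mono'[of "- (2 * a + \<eta>)" 0 \<epsilon>] by simp
  \<comment> \<open>\<open>cutoff_function\<close> needs a nonempty set; an arbitrary extra point
    changes neither bound, since the bound for the number is at least one.\<close>
  define X where "X = (if X0 = {} then {undefined} else X0)"
  have X: "finite X" "X \<noteq> {}" "X0 \<subseteq> X" using X0(1) by (auto simp: X_def)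
  have "1 * 1 \<le> K1 * \<epsilon> powr (- (2 * a + \<eta>))" using K1 by (intro mult_mono pow1) auto
  then have cX: "real (card X) \<le> K1 * \<epsilon> powr (- (2 * a + \<eta>))"
   using cX0 by (auto simp: X_def)
  have "measure ?\<sigma> (UNIV - X) \<le> measure ?\<sigma> (UNIV - X0)"
   using X ss X0(1) by (intro s.finite_measure_mono) (auto intro: borel_closed[OF finite_imp_closed])
  then have mX: "measure ?\<sigma> (UNIV - X) \<le> K1 * \<epsilon> powr \<eta>" using mX0 by simp
  \<comment> \<open>All ratios are single powers: \<open>r / R\<close>, \<open>1 / M\<close> and
    \<open>\<epsilon> powr b / r\<close> equal \<open>\<epsilon> powr \<eta>\<close>, so the
    transport error and the values at the atoms have the same order as the light mass.\<close>
  define r R M where "r = \<epsilon> powr (b - \<eta>)" and "R = \<epsilon> powr (b - 2 * \<eta>)" and "M = \<epsilon> powr (- \<eta>)"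
  have pos: "r > 0" "M > 0" "R > 0" using \<epsilon>(1) by (auto simp: r_def R_def M_def)
  have "M * real (card X) * (r / R) ^ (2 * q) \<le> 1"
  proof -
   have "r / R = \<epsilon> powr \<eta>" unfolding r_def R_def powr_diff[symmetric] by simp
   then have "(r / R) ^ (2 * q) = \<epsilon> powr (2 * real q * \<eta>)"
    using \<epsilon>(1) by (simp add: powr_realpow[symmetric] powr_powr mult.commute)
   then have "M * real (card X) * (r / R) ^ (2 * q) \<le> M * (K1 * \<epsilon> powr (- (2 * a + \<eta>))) * \<epsilon> powr (2 * real q * \<eta>)"
    using cX pos by (simp add: mult_right_mono)
   also have "... = K1 * \<epsilon> powr (2 * real q * \<eta> - 2 * a - 2 * \<eta>)"
   proof -
    have "\<epsilon> powr (- \<eta>) * \<epsilon> powr (- (2 * a + \<eta>)) * \<epsilon> powr (2 * real q * \<eta>) = \<epsilon> powr (2 * real q * \<eta> - 2 * a - 2 * \<eta>)"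
     unfolding powr_add[symmetric] by (simp add: algebra_simps)
    then show ?thesis unfolding M_def by (metis mult.assoc mult.left_commute)
   qed
   also have "... \<le> K1 * \<epsilon> powr (2 * \<eta>)"
    using q K1 \<epsilon>(1) \<epsilon>'(3) by (intro mult_left_mono powr_mono') auto
   finally show ?thesis using small by simp
  qed
  then obtain \<phi> where \<phi>: "smooth_space \<phi>" "\<And>p. 0 \<le> \<phi> p" "\<And>p. \<phi> p \<le> 1" "\<And>p. norm (tgrad \<phi> p) \<le> real q * (pi / r)"
   "\<And>p. p \<in> X ==> \<phi> p \<le> 1 / M" "\<And>p. (\<And>x. x \<in> X ==> R \<le> dist p x) ==> 1 / 2 \<le> \<phi> p"
   using cutoff_function[OF X(1,2) pos] by metis
  note c\<phi> = continuous_smooth_space[OF \<phi>(1)]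
  let ?N = "UNIV - (\<Union>x\<in>X. ball x R)"
  have Xs: "UNIV - X \<in> sets ?\<sigma>" using ss X(1) by (auto intro: borel_closed[OF finite_imp_closed])
  have Ns: "?N \<in> sets ?\<nu>" unfolding sn(1) by (intro sets.Diff borel_open open_UN) auto
  have "(LINT p|?\<sigma>. \<phi> p) \<le> (LINT p|?\<sigma>. indicator (UNIV - X) p + 1 / M)"
  proof (rule Bochner_Integration.integral_mono)
   show "integrable ?\<sigma> \<phi>" by (rule integrable_continuous_torus[OF c(1)[OF t(1)] c\<phi>])
   show "integrable ?\<sigma> (%p. indicator (UNIV - X) p + 1 / M)" using Xs by (simp add: s.emeasure_eq_measure)
   show "\<phi> p \<le> indicator (UNIV - X) p + 1 / M" for p
    using \<phi>(3)[of p] \<phi>(5)[of p] pos by (cases "p \<in> X") (auto intro: order_trans)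
  qed
  also have "... = measure ?\<sigma> (UNIV - X) + 1 / M"
   using Xs c(2)[OF t(1)] ss by (simp add: s.emeasure_eq_measure)
  also have "... \<le> (K1 + 1) * \<epsilon> powr \<eta>" using mX by (simp add: M_def powr_minus_divide distrib_right)
  finally have i\<sigma>: "(LINT p|?\<sigma>. \<phi> p) \<le> (K1 + 1) * \<epsilon> powr \<eta>" .
  have "(1 / 2) * measure ?\<nu> ?N = (LINT p|?\<nu>. (1 / 2) * indicator ?N p)" using Ns by simp
  also have "... \<le> (LINT p|?\<nu>. \<phi> p)"
  proof (rule Bochner_Integration.integral_mono)
   show "integrable ?\<nu> \<phi>" by (rule integrable_continuous_torus[OF c(1)[OF TT] c\<phi>])
   show "integrable ?\<nu> (%p. (1 / 2) * indicator ?N p :: real)" using Ns by (simp add: n.emeasure_eq_measure)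
   show "(1 / 2) * indicator ?N p \<le> \<phi> p" for p
    using \<phi>(2)[of p] \<phi>(6)[of p] by (cases "p \<in> ?N") (auto simp: not_less dist_commute)
  qed
  also have "... \<le> (LINT p|?\<sigma>. \<phi> p) + real q * (pi / r) * ((C + 2) * \<epsilon> powr b)" by (rule tr[OF \<phi>(1,4)])
  also have "real q * (pi / r) * ((C + 2) * \<epsilon> powr b) = real q * pi * (C + 2) * \<epsilon> powr \<eta>"
  proof -
   have "\<epsilon> powr b / r = \<epsilon> powr \<eta>" unfolding r_def powr_diff[symmetric] by simp
   then show ?thesis by (metis (no_types, opaque_lifting) mult.assoc mult.commute times_divide_eq_left times_divide_eq_right)
  qed
  finally have "measure ?\<nu> ?N \<le> K * \<epsilon> powr \<eta>" using i\<sigma> by (simp add: K_def algebra_simps)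
  moreover have "real (card X) \<le> K * \<epsilon> powr (- (2 * a + \<eta>))"
   by (rule order_trans[OF cX mult_right_mono[OF K(1)]]) simp
  ultimately show ?thesis using X(1) unfolding R_def by blast
 qed
 ultimately show thesis using that[of K \<epsilon>0] K(2) unfolding a_def b_def by blast
qed

section \<open>Limsup sets and their Hausdorff measure\<close>

lemma premeasure_le_series:
 fixes V :: "nat => nat => 'a::metric_space set"
 assumes "A \<subseteq> (\<Union>j. \<Union>i. V j i)" "\<And>j i. bounded (V j i) \<and> diameter (V j i) \<le> \<delta>"
 shows "hausdorff_premeasure s \<delta> A \<le> (\<Sum>j. \<Sum>i. diam_weight s (V j i))"
proof -
 define U where "U k = case_prod V (prod_decode k)" for k
 have "A \<subseteq> (\<Union>k. U k)"
 proof
  fix x assume "x \<in> A"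
  then obtain j i where "x \<in> V j i" using assms(1) by blast
  then have "x \<in> U (prod_encode (j, i))" by (simp add: U_def)
  then show "x \<in> (\<Union>k. U k)" by blast
 qed
 moreover have "bounded (U k) \<and> diameter (U k) \<le> \<delta>" for k using assms(2) by (simp add: U_def split: prod.split)
 ultimately have "hausdorff_premeasure s \<delta> A \<le> (\<Sum>k. diam_weight s (U k))"
  unfolding hausdorff_premeasure_def by (intro INF_lower) blast
 also have "... = (\<Sum>j. \<Sum>i. diam_weight s (V j i))"
  unfolding U_def by (rule suminf_ennreal_2dimen[where f = "%z. diam_weight s (case_prod V z)"]) simp
 finally show ?thesis .
qed

text \<open>A point of the limsup set lies in a ball of some index beyond any given
  \<open>n\<close>, so the balls of the tail cover it. Summability makes the tail weight small and
  vanishing radii make the cover fine.\<close>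

lemma limsup_null:
 fixes X :: "nat => 'a::metric_space set"
 assumes X: "\<And>j. finite (X j)" and R: "\<And>j. R j \<ge> 0" "R \<longlonglongrightarrow> 0" and s: "s > 0"
  and sm: "summable (%j. real (card (X j)) * (2 * R j) powr s)"
 shows "hausdorff_measure s {y. \<exists>\<^sub>F j in sequentially. \<exists>x\<in>X j. y \<in> ball x (R j)} = 0" (is "hausdorff_measure s ?E = 0")
proof -
 let ?w = "%j. real (card (X j)) * (2 * R j) powr s"
 have "hausdorff_premeasure s \<delta> ?E \<le> 0" if \<delta>: "\<delta> > 0" for \<delta>
 proof (rule ennreal_le_epsilon)
  fix e :: real assume e: "e > 0"
  obtain n1 where n1: "\<And>n. n \<ge> n1 ==> norm (\<Sum>j. ?w (j + n)) < e" using suminf_exist_split[OF e sm] by blast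
  have "\<forall>\<^sub>F j in sequentially. R j < \<delta> / 2" using R(2) \<delta> by (intro order_tendstoD(2)) auto
  then obtain n2 where n2: "\<And>n. n \<ge> n2 ==> R n < \<delta> / 2" by (auto simp: eventually_sequentially)
  define n where "n = max n1 n2"
  have "\<exists>g. X j = g ` {..<card (X j)}" for j
   using ex_bij_betw_nat_finite[OF X[of j]] by (auto simp: bij_betw_def atLeast0LessThan)
  then obtain g where g: "\<And>j. X j = g j ` {..<card (X j)}" by metis
  define V where "V j i = (if i < card (X (j + n)) then ball (g (j + n) i) (R (j + n)) else {})" for j i
  have dm: "diameter (V j i) \<le> 2 * R (j + n)" for j i
  proof (cases "V j i = {}")
   case False
   have "dist x y \<le> 2 * R (j + n)" if "x \<in> V j i" "y \<in> V j i" for x y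
    using that dist_triangle2[of x y "g (j + n) i"] by (auto simp: V_def dist_commute split: if_splits)
   then show ?thesis using False by (auto simp: diameter_def intro!: cSUP_least)
  qed (simp add: R)
  have "hausdorff_premeasure s \<delta> ?E \<le> (\<Sum>j. \<Sum>i. diam_weight s (V j i))"
  proof (rule premeasure_le_series)
   show "?E \<subseteq> (\<Union>j. \<Union>i. V j i)"
   proof
    fix y assume "y \<in> ?E"
    then have "\<exists>k\<ge>n. \<exists>x\<in>X k. y \<in> ball x (R k)" by (simp add: frequently_sequentially)
    then obtain k x where k: "n \<le> k" "x \<in> X k" "y \<in> ball x (R k)" by blast
    then obtain i where "i < card (X k)" "x = g k i" using g[of k] by blast
    then have "y \<in> V (k - n) i" using k by (simp add: V_def)
    then show "y \<in> (\<Union>j. \<Union>i. V j i)" by blast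
   qed
   show "bounded (V j i) \<and> diameter (V j i) \<le> \<delta>" for j i
   proof -
    have "R (j + n) < \<delta> / 2" by (rule n2) (simp add: n_def)
    then show ?thesis using dm[of j i] by (simp add: V_def)
   qed
  qed
  also have "... \<le> (\<Sum>j. ennreal (?w (j + n)))"
  proof (rule suminf_le)
   fix j
   have "(\<Sum>i. diam_weight s (V j i)) = (\<Sum>i<card (X (j + n)). diam_weight s (V j i))"
    by (rule suminf_finite) (auto simp: V_def diam_weight_def)
   also have "... \<le> (\<Sum>i<card (X (j + n)). ennreal ((2 * R (j + n)) powr s))"
   proof (rule sum_mono)
    fix i
    have "diameter (V j i) powr s \<le> (2 * R (j + n)) powr s"
     using dm[of j i] s by (intro powr_mono2 diameter_ge_0) (auto simp: V_def)
    then show "diam_weight s (V j i) \<le> ennreal ((2 * R (j + n)) powr s)" using s by (simp add: diam_weight_def ennreal_leI)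
   qed
   also have "... = ennreal (?w (j + n))" by (simp add: ennreal_mult ennreal_of_nat_eq_real_of_nat)
   finally show "(\<Sum>i. diam_weight s (V j i)) \<le> ennreal (?w (j + n))" .
  qed auto
  also have "... = ennreal (\<Sum>j. ?w (j + n))" using sm by (intro suminf_ennreal2 summable_ignore_initial_segment) auto
  also have "... \<le> ennreal e" using n1[of n] by (intro ennreal_leI) (simp add: n_def)
  finally show "hausdorff_premeasure s \<delta> ?E \<le> 0 + ennreal e" by simp
 qed
 then show ?thesis unfolding hausdorff_measure_def by (intro antisym SUP_least) auto
qed

text \<open>Along \<open>\<epsilon> = 2^(-j)\<close> the masses missed by the balls are summable, so
  by Borel--Cantelli almost every point lies in all late unions. The covering sums with exponent
  \<open>s\<close> converge for \<open>s\<close> above \<open>2 a / b\<close>, which is the stated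
  bound.\<close>

lemma trace_upper_dim:
 assumes \<mu>: "\<mu> \<in> competitors T" and T: "T > 0" and C: "C \<ge> 0" and \<delta>: "\<delta> > 0" and \<beta>: "0 < \<beta>" "\<beta> < 1"
  and I: "\<And>\<epsilon>. 0 < \<epsilon> ==> \<epsilon> < \<delta> ==> irrigation_energy T \<mu> (T - \<epsilon>) T \<le> ennreal (C * \<epsilon> powr \<beta>)"
 shows "upper_dim (slice T \<mu> T) \<le> ereal (4 * (1 - \<beta>) / (1 + \<beta>))"
proof (rule dense_ge)
 fix z assume "ereal (4 * (1 - \<beta>) / (1 + \<beta>)) < z"
 then obtain s where s: "4 * (1 - \<beta>) / (1 + \<beta>) < s" "ereal s < z" using ereal_dense2 by (metis less_ereal.simps(1))
 define a b where "a = 1 - \<beta>" and "b = (1 + \<beta>) / 2"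
 have "0 \<le> 4 * (1 - \<beta>) / (1 + \<beta>)" using \<beta> by simp
 then have s0: "0 < s" using s(1) by linarith
 have sb: "2 * a < s * b" using s(1) \<beta> by (simp add: a_def b_def field_simps)
 \<comment> \<open>\<open>\<eta> * (1 + 2 * s)\<close> is half of the gap
   \<open>s * b - 2 * a\<close>, so the losses in the count and in the radius still leave
   \<open>2 * a + \<eta> < s * (b - 2 * \<eta>)\<close>.\<close>
 define \<eta> where "\<eta> = (s * b - 2 * a) / (2 * (1 + 2 * s))"
 have \<eta>: "\<eta> > 0" "\<eta> * (2 * (1 + 2 * s)) = s * b - 2 * a" using sb s0 by (auto simp: \<eta>_def)
 have g: "2 * a + \<eta> < s * (b - 2 * \<eta>)" using \<eta>(2) mult_pos_pos[OF \<eta>(1), of "1 + 2 * s"] s0 by (simp add: algebra_simps)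
 have "0 < s * (b - 2 * \<eta>)" using g \<eta>(1) \<beta> by (simp add: a_def)
 then have b\<eta>: "0 < b - 2 * \<eta>" using s0 by (simp add: zero_less_mult_iff)
 let ?\<nu> = "slice T \<mu> T"
 have TT: "T \<in> {-T..T}" using T by simp
 note fb = competitor_slice(7)[OF \<mu> T TT]
 interpret finite_measure ?\<nu> by (rule finite_borelD[OF fb])
 note sn = finite_borelD(1,2)[OF fb]
 obtain K \<epsilon>0 where K: "K \<ge> 0" "\<epsilon>0 > 0" and X: "\<And>\<epsilon>. 0 < \<epsilon> ==> \<epsilon> < \<epsilon>0 ==> \<exists>X. finite X \<and> real (card X) \<le> K * \<epsilon> powr (- (2 * a + \<eta>)) \<and>
   measure ?\<nu> (UNIV - (\<Union>x\<in>X. ball x (\<epsilon> powr (b - 2 * \<eta>)))) \<le> K * \<epsilon> powr \<eta>"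
  using trace_concentration[OF \<mu> T C \<delta> \<beta>(2) I \<eta>(1)] unfolding a_def b_def by metis
 obtain n where n: "(1 / 2) ^ n < \<epsilon>0" using real_arch_pow_inv[OF K(2), of "1 / 2"] by auto
 \<comment> \<open>The shift by \<open>n\<close> puts every scale below the threshold
   \<open>\<epsilon>0\<close>.\<close>
 define \<epsilon> where "\<epsilon> j = (1 / 2 :: real) ^ (j + n)" for j
 have le: "\<epsilon> j \<le> (1 / 2) ^ n" for j unfolding \<epsilon>_def by (intro power_decreasing) auto
 have \<epsilon>: "0 < \<epsilon> j" "\<epsilon> j < \<epsilon>0" for j using order_le_less_trans[OF le[of j] n] by (simp_all add: \<epsilon>_def)
 have \<epsilon>p: "\<epsilon> j powr c = (1 / 2) powr (c * n) * ((1 / 2) powr c) ^ j" for j c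
  by (simp add: \<epsilon>_def powr_realpow[symmetric] powr_powr powr_add[symmetric] algebra_simps)
 have half: "0 < (1 / 2 :: real) powr c" "(1 / 2 :: real) powr c < 1" if "c > 0" for c
  using that powr_less_mono'[of "1 / 2" 0 c] by auto
 have s\<epsilon>: "summable (%j. \<epsilon> j powr c)" if "c > 0" for c
  unfolding \<epsilon>p using half[OF that] by (intro summable_mult summable_geometric) simp
 have "\<exists>Y. \<forall>j. finite (Y j) \<and> real (card (Y j)) \<le> K * \<epsilon> j powr (- (2 * a + \<eta>)) \<and>
   measure ?\<nu> (UNIV - (\<Union>x\<in>Y j. ball x (\<epsilon> j powr (b - 2 * \<eta>)))) \<le> K * \<epsilon> j powr \<eta>"
  by (rule choice) (use X[OF \<epsilon>] in blast)
 then obtain Y where Y: "\<And>j. finite (Y j)" "\<And>j. real (card (Y j)) \<le> K * \<epsilon> j powr (- (2 * a + \<eta>))"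
  "\<And>j. measure ?\<nu> (UNIV - (\<Union>x\<in>Y j. ball x (\<epsilon> j powr (b - 2 * \<eta>)))) \<le> K * \<epsilon> j powr \<eta>" by blast
 define R where "R j = \<epsilon> j powr (b - 2 * \<eta>)" for j
 define N where "N j = (\<Union>x\<in>Y j. ball x (R j))" for j
 define E where "E = {y. \<exists>\<^sub>F j in sequentially. \<exists>x\<in>Y j. y \<in> ball x (R j)}"
 have No: "open (N j)" for j unfolding N_def by (intro open_UN ballI open_ball)
 have "E = (\<Inter>k. \<Union>j\<in>{k..}. N j)" by (simp add: E_def N_def frequently_sequentially set_eq_iff Bex_def)
 also have "... \<in> sets borel" using No by (intro sets.countable_INT sets.countable_UN) auto
 finally have Es: "E \<in> sets borel" .
 have "AE y in ?\<nu>. \<forall>\<^sub>F j in sequentially. y \<in> space ?\<nu> - (UNIV - N j)"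
 proof (rule borel_cantelli_AE1)
  show "UNIV - N j \<in> sets ?\<nu>" for j using No sn by auto
  have "summable (%j. measure ?\<nu> (UNIV - N j))"
   by (rule summable_comparison_test'[OF summable_mult[OF s\<epsilon>[OF \<eta>(1)], of K]]) (use Y(3) in \<open>simp add: N_def R_def\<close>)
  then show "summable (%j. measure ?\<nu> (UNIV - N j))" .
 qed (simp add: emeasure_eq_measure)
 then have "AE y in ?\<nu>. y \<in> E"
 proof eventually_elim
  case (elim y)
  then have "\<exists>\<^sub>F j in sequentially. y \<in> space ?\<nu> - (UNIV - N j)" by (rule eventually_frequently[OF sequentially_bot])
  then show ?case unfolding E_def by (auto elim!: frequently_elim1 simp: N_def)
 qed
 then have "emeasure ?\<nu> (UNIV - E) = 0" using Es sn by (subst (asm) AE_iff_measurable[of "UNIV - E"]) auto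
 moreover have "hausdorff_measure s E = 0"
  unfolding E_def
 proof (rule limsup_null[OF Y(1) _ _ s0])
  show "0 \<le> R j" for j by (simp add: R_def)
  show "R \<longlonglongrightarrow> 0" using summable_LIMSEQ_zero[OF s\<epsilon>[OF b\<eta>]] by (simp add: R_def[abs_def])
  have "norm (real (card (Y j)) * (2 * R j) powr s) \<le> K * 2 powr s * \<epsilon> j powr (s * (b - 2 * \<eta>) - (2 * a + \<eta>))" for j
  proof -
   have "(2 * R j) powr s = 2 powr s * \<epsilon> j powr (s * (b - 2 * \<eta>))" by (simp add: R_def powr_mult powr_powr mult.commute)
   then have "real (card (Y j)) * (2 * R j) powr s \<le> K * \<epsilon> j powr (- (2 * a + \<eta>)) * (2 powr s * \<epsilon> j powr (s * (b - 2 * \<eta>)))"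
    using Y(2)[of j] by (simp add: mult_right_mono)
   also have "... = K * 2 powr s * (\<epsilon> j powr (- (2 * a + \<eta>)) * \<epsilon> j powr (s * (b - 2 * \<eta>)))" by simp
   also have "\<epsilon> j powr (- (2 * a + \<eta>)) * \<epsilon> j powr (s * (b - 2 * \<eta>)) = \<epsilon> j powr (s * (b - 2 * \<eta>) - (2 * a + \<eta>))"
    unfolding powr_add[symmetric] by (simp add: algebra_simps)
   finally show ?thesis by simp
  qed
  then show "summable (%j. real (card (Y j)) * (2 * R j) powr s)"
   using g by (intro summable_comparison_test'[OF summable_mult[OF s\<epsilon>]]) auto
 qed
 ultimately have "upper_dim ?\<nu> \<le> ereal s"
  unfolding upper_dim_def hausdorff_dim_def using Es s0
  by (intro INF_lower2[of E] Inf_lower) (auto intro: less_imp_le)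
 then show "upper_dim ?\<nu> \<le> z" using s(2) by simp
qed

text \<open>A set carrying the whole mass of a probability measure has positive mass, so it competes
  in the infimum defining the lower dimension.\<close>

lemma lower_dim_le_upper_dim:
 assumes "finite_borel \<nu>" "measure \<nu> UNIV = 1"
 shows "lower_dim \<nu> \<le> upper_dim \<nu>"
 unfolding upper_dim_def
proof (rule INF_greatest)
 interpret finite_measure \<nu> by (rule finite_borelD[OF assms(1)])
 note sn = finite_borelD(1,2)[OF assms(1)]
 fix A assume "A \<in> {A \<in> sets borel. emeasure \<nu> (UNIV - A) = 0}"
 then have A: "A \<in> sets borel" "measure \<nu> (UNIV - A) = 0" by (auto simp: emeasure_eq_measure)
 then have "measure \<nu> A = 1" using finite_measure_compl[of A] sn assms(2) by simp
 then show "lower_dim \<nu> \<le> hausdorff_dim A"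
  unfolding lower_dim_def using A(1) by (intro INF_lower) (simp add: emeasure_eq_measure)
qed

theorem theorem1p1:
  fixes lam T \<beta> :: real and \<mu> :: "(real \<times> torus) measure"
  assumes "lam > 0" and "T > 0"
    and "is_minimizer lam T \<mu>" and "is_symmetric T \<mu>"
    and "0 < \<beta>" and "\<beta> < 1"
    and "Limsup (at_right 0)
           (\<lambda>\<epsilon>. irrigation_energy T \<mu> (T - \<epsilon>) T / ennreal (\<epsilon> powr \<beta>)) < \<infinity>"
  shows "ereal ((1 + 3 * \<beta>) / (1 + \<beta>)) \<le> lower_dim (slice T \<mu> T) \<and>
    lower_dim (slice T \<mu> T) \<le> upper_dim (slice T \<mu> T) \<and>
    upper_dim (slice T \<mu> T) \<le> ereal (4 * (1 - \<beta>) / (1 + \<beta>))"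
proof -
 have \<mu>: "\<mu> \<in> competitors T" using assms(3) by (simp add: is_minimizer_def)
 have "T \<in> {-T..T}" using assms(2) by simp
 note \<nu> = competitor_slice(7,8)[OF \<mu> assms(2) this]
 let ?f = "\<lambda>\<epsilon>. irrigation_energy T \<mu> (T - \<epsilon>) T / ennreal (\<epsilon> powr \<beta>)"
 \<comment> \<open>A finite real bound strictly above the limit superior turns it into an estimate
   for all small \<open>\<epsilon>\<close>.\<close>
 obtain C where C: "Limsup (at_right 0) ?f < ennreal C" "C \<ge> 0"
 proof -
  obtain c where c: "Limsup (at_right 0) ?f < c" "c < \<infinity>" using dense[OF assms(7)] by blast
  then show thesis using that by (cases c) auto
 qed
 have "\<forall>\<^sub>F \<epsilon> in at_right 0. ?f \<epsilon> < ennreal C" by (rule Limsup_lessD[OF C(1)])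
 then obtain \<delta> where \<delta>: "\<delta> > 0" "\<And>\<epsilon>. 0 < \<epsilon> \<Longrightarrow> \<epsilon> < \<delta> \<Longrightarrow> ?f \<epsilon> < ennreal C"
  unfolding eventually_at_right_field by blast
 have I: "irrigation_energy T \<mu> (T - \<epsilon>) T \<le> ennreal (C * \<epsilon> powr \<beta>)" if \<epsilon>: "0 < \<epsilon>" "\<epsilon> < \<delta>" for \<epsilon>
 proof -
  have p: "0 < ennreal (\<epsilon> powr \<beta>)" "ennreal (\<epsilon> powr \<beta>) < top" using \<epsilon> by auto
  have "irrigation_energy T \<mu> (T - \<epsilon>) T = ?f \<epsilon> * ennreal (\<epsilon> powr \<beta>)"
   using p by (simp add: ennreal_divide_times ennreal_times_divide[symmetric] ennreal_divide_self)
  also have "\<dots> \<le> ennreal C * ennreal (\<epsilon> powr \<beta>)" by (intro mult_right_mono less_imp_le[OF \<delta>(2)[OF \<epsilon>]]) simp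
  finally show ?thesis using C(2) by (simp add: ennreal_mult)
 qed
 \<comment> \<open>The decay exponent of the oscillation; \<open>\<beta> < 1\<close> is what keeps
   it below one, as the summation over shells requires.\<close>
 let ?\<alpha> = "2 * \<beta> / (1 + \<beta>)"
 have \<alpha>: "?\<alpha> < 1" "0 < ?\<alpha>" "0 \<le> ?\<alpha>" "1 + ?\<alpha> = (1 + 3 * \<beta>) / (1 + \<beta>)" using assms(5,6) by (auto simp: field_simps)
 obtain K where K: "K \<ge> 0" "\<And>\<rho> i. \<rho> > 0 \<Longrightarrow>
   (\<integral>\<^sup>+k. ennreal (osc (slice T \<mu> T) i \<rho> k) \<partial>count_space UNIV) \<le> ennreal (K * \<rho> powr ?\<alpha>)"
  using oscillation_decay[OF assms(3,1,2,5) \<delta>(1) C(2) I] by metis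
 obtain D where D: "D \<ge> 0" "\<And>n. spectrum (slice T \<mu> T) n \<le> D * (2 powr (1 - ?\<alpha>)) ^ n"
  using spectrum_growth[OF \<nu> \<alpha>(1,3) K] by metis
 show ?thesis
  using spectral_lower_dim[OF \<nu>(1) D \<alpha>(2)] lower_dim_le_upper_dim[OF \<nu>]
   trace_upper_dim[OF \<mu> assms(2) C(2) \<delta>(1) assms(5,6) I] unfolding \<alpha>(4) by blast
qed

end
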